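(* Let $k\ge 1$ be an integer, let $1\le p<\infty$, let $c_0\ge 1$, and let $\Omega\subset\mathbb{R}^n$ be a bounded domain with the $c_0$-ball separation property. Then, given $c\ge 1$, there exists $R_0=R_0(c_0,c,n)$, depending only on $c_0$, $c$ and $n$, such that for every $R\ge R_0$ the following holds: if $\Omega$ is $(c_0,c,R)$-radially hyperbolic, then $C^{\infty}(\Omega)\cap W^{k,\infty}(\Omega)$ is dense in $L^{k,p}(\Omega)$ (with respect to the homogeneous Sobolev seminorm).
   Context: A domain is a nonempty connected open set. For a domain $\Omega\subset\mathbb{R}^n$, $k\in\mathbb{N}$ and $p\in[1,\infty]$, the homogeneous Sobolev space is $L^{k,p}(\Omega)=\{u\in L^1_{loc}(\Omega): D^{\alpha}u\in L^p(\Omega)\text{ for all multi-indices } |\alpha|=k\}$ (distributional derivatives), equipped with the seminorm $\sum_{|\alpha|=k}\|D^{\alpha}u\|_{L^p(\Omega)}$. The space $W^{k,p}(\Omega)=\{u\in L^1_{loc}(\Omega): D^{\alpha}u\in L^p(\Omega)\text{ for all } |\alpha|\le k\}$ is equipped with the norm $\sum_{|\alpha|\le k}\|D^{\alpha}u\|_{L^p(\Omega)}$. Let $\Omega\subsetneq\mathbb{R}^n$ be a domain. Write $d_{\Omega}(z)=\mathrm{dist}(z,\partial\Omega)$ and $a\wedge b=\min\{a,b\}$. The intrinsic length metric $\lambda_{\Omega}(x,y)$ is the infimum of the Euclidean lengths of paths in $\Omega$ joining $x$ and $y$; the intrinsic diameter metric $\delta_{\Omega}(x,y)$ is the infimum of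 the Euclidean diameters of such paths; $l(\gamma)$ is the Euclidean length of a curve $\gamma$. Intrinsic balls are $B_{\Omega}(z,r)=\{y\in\Omega:\lambda_{\Omega}(z,y)<r\}$. For $x,y$ on a curve $\gamma$, $\gamma(x,y)$ is the subcurve of $\gamma$ between $x$ and $y$. Set $$\Delta_{\Omega}(x,y)=\log\Bigl(1+\frac{\delta_{\Omega}(x,y)}{d_{\Omega}(x)\wedge d_{\Omega}(y)}\Bigr),\qquad \Lambda_{\Omega}(x,y)=\log\Bigl(1+\frac{\lambda_{\Omega}(x,y)}{d_{\Omega}(x)\wedge d_{\Omega}(y)}\Bigr).$$ The quasihyperbolic distance is $k_{\Omega}(x,y)=\inf_{\gamma}\int_{\gamma}\frac{|dz|}{d_{\Omega}(z)}$, the infimum being over rectifiable curves in $\Omega$ joining $x$ and $y$; a quasihyperbolic geodesic is a curve attaining this infimum. Ball separation: a curve $\Gamma\subset\Omega$ satisfies the $c$-ball separation property ($c\ge1$) if for every $z\in\Gamma$ the intrinsic ball $B=B_{\Omega}(z,c\,d_{\Omega}(z))$ separates in $\Omega$ any $x,y\in\Gamma\setminus B$ with $z\in\Gamma(x,y)$ (that is, $x$ and $y$ lie in different components of $\Omega\setminus B$). The domain $\Omega$ has the $c$-ball separation property if every quasihyperbolic geodesic in $\Omega$ does. Local Gehring–Hayman properties: let $c\ge1$, $R\ge0$, $E\subset\Omega$. $E$ has the $(c,R)$-length Gehring–Hayman property if for all $x,y\in E$ with $\Lambda_{\Omega}(x,y)\le R$, each quasihyperbolic geodesic $\Gamma_{xy}$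 joining $x$ and $y$ in $\Omega$ satisfies $l(\Gamma_{xy})\le c\,\lambda_{\Omega}(x,y)$. $E$ has the $(c,R)$-diameter Gehring–Hayman property if for all $x,y\in E$ with $\Delta_{\Omega}(x,y)\le R$, each quasihyperbolic geodesic $\Gamma_{xy}$ joining $x$ and $y$ in $\Omega$ satisfies $\mathrm{diam}(\Gamma_{xy})\le c\,\delta_{\Omega}(x,y)$ (Euclidean diameter). Radial hyperbolicity: for $c_0,c\ge1$, $R\ge0$, the domain $\Omega\subsetneq\mathbb{R}^n$ is $(c_0,c,R)$-radially hyperbolic (with center $x_0$) if it has the $c_0$-ball separation property and there exists $x_0\in\Omega$ such that for every $x\in\Omega$, $x\ne x_0$, and every quasihyperbolic geodesic $\Gamma_x$ joining $x_0$ to $x$: (i) $\Gamma_x$ has the $(c,R)$-diameter Gehring–Hayman property; (ii) whenever $y\in\Omega$, $y\neq x_0$, and $\Gamma_y$ is a quasihyperbolic geodesic from $x_0$ to $y$ with $(\Gamma_x\cap\Gamma_y)\setminus\{x_0\}\ne\emptyset$, the set $\Gamma_x\cup\Gamma_y$ has either (a) the $(c,R)$-length Gehring–Hayman property, or (b) the $(c,R)$-diameter Gehring–Hayman property. *)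

theory Defs
  imports "HOL-Analysis.Analysis" "HOL-Probability.Essential_Supremum"
begin

definition domain_set :: "(real^'n) set \<Rightarrow> bool"
  where "domain_set \<Omega> \<longleftrightarrow> open \<Omega> \<and> connected \<Omega> \<and> \<Omega> \<noteq> {}"

definition partial_deriv :: "'n \<Rightarrow> (real^'n \<Rightarrow> real) \<Rightarrow> real^'n \<Rightarrow> real"
  where "partial_deriv i f x = frechet_derivative f (at x) (axis i 1)"

fun C_on :: "nat \<Rightarrow> (real^'n) set \<Rightarrow> (real^'n \<Rightarrow> real) \<Rightarrow> bool" where
  "C_on 0 \<Omega> f \<longleftrightarrow> continuous_on \<Omega> f"
| "C_on (Suc m) \<Omega> f \<longleftrightarrow>
     (\<forall>x\<in>\<Omega>. f differentiable (at x)) \<and> (\<forall>i. C_on m \<Omega> (partial_deriv i f))"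

text \<open>Only used for open sets; then the values of \<open>f\<close> off \<open>\<Omega>\<close> are irrelevant.\<close>

definition smooth_functions :: "(real^'n) set \<Rightarrow> (real^'n \<Rightarrow> real) set"
  where "smooth_functions \<Omega> = {f. \<forall>m. C_on m \<Omega> f}"

definition test_functions :: "(real^'n) set \<Rightarrow> (real^'n \<Rightarrow> real) set"
  where "test_functions \<Omega> = {\<phi> \<in> smooth_functions UNIV.
           compact (closure {x. \<phi> x \<noteq> 0}) \<and> closure {x. \<phi> x \<noteq> 0} \<subseteq> \<Omega>}"

text \<open>A multi-index is a function \<open>\<alpha> :: 'n \<Rightarrow> nat\<close> on the coordinates.\<close>

definition mi_order :: "('n::finite \<Rightarrow> nat) \<Rightarrow> nat"
  where "mi_order \<alpha> = (\<Sum>i\<in>UNIV. \<alpha> i)"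

lemma finite_mi_order_le: "finite {\<alpha>::'n::finite \<Rightarrow> nat. mi_order \<alpha> \<le> k}"
proof (rule finite_subset)
  show "{\<alpha>::'n \<Rightarrow> nat. mi_order \<alpha> \<le> k} \<subseteq> PiE UNIV (\<lambda>_. {..k})"
    by (auto simp: mi_order_def PiE_UNIV_domain intro: order_trans[OF member_le_sum[of _ UNIV]])
  show "finite (PiE (UNIV::'n set) (\<lambda>_. {..k}))"
    by (intro finite_PiE) auto
qed

text \<open>The iterated partial derivative of order \<open>\<alpha>\<close>, taken in some order of the coordinates. It is
  only applied to smooth functions, for which the order is immaterial.\<close>

definition mixed_partial :: "('n::finite \<Rightarrow> nat) \<Rightarrow> (real^'n \<Rightarrow> real) \<Rightarrow> real^'n \<Rightarrow> real"
  where "mixed_partial \<alpha> f = foldr partial_deriv (SOME is. \<forall>i. count_list is i = \<alpha> i) f"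

lemma ex_list_mi: "\<exists>is. \<forall>i::'n::finite. count_list is i = \<alpha> i"
proof -
  obtain xs where xs: "mset xs = Abs_multiset \<alpha>"
    using ex_mset by blast
  have "count (Abs_multiset \<alpha>) = \<alpha>"
    by (rule count_Abs_multiset) auto
  with xs show ?thesis
    by (metis count_mset)
qed

definition L1_loc :: "(real^'n) set \<Rightarrow> (real^'n \<Rightarrow> real) set"
  where "L1_loc \<Omega> = {u. \<forall>K. compact K \<and> K \<subseteq> \<Omega> \<longrightarrow> u absolutely_integrable_on K}"

definition has_weak_deriv ::
    "(real^'n) set \<Rightarrow> ('n \<Rightarrow> nat) \<Rightarrow> (real^'n \<Rightarrow> real) \<Rightarrow> (real^'n \<Rightarrow> real) \<Rightarrow> bool"
  where "has_weak_deriv \<Omega> \<alpha> u g \<longleftrightarrow> u \<in> L1_loc \<Omega> \<and> g \<in> L1_loc \<Omega> \<and>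
    (\<forall>\<phi> \<in> test_functions \<Omega>.
       (LINT x|lebesgue_on \<Omega>. u x * mixed_partial \<alpha> \<phi> x) =
       (-1) ^ mi_order \<alpha> * (LINT x|lebesgue_on \<Omega>. g x * \<phi> x))"

definition weak_deriv ::
    "(real^'n) set \<Rightarrow> ('n \<Rightarrow> nat) \<Rightarrow> (real^'n \<Rightarrow> real) \<Rightarrow> real^'n \<Rightarrow> real"
  where "weak_deriv \<Omega> \<alpha> u = (SOME g. has_weak_deriv \<Omega> \<alpha> u g)"

definition Lp_norm :: "ennreal \<Rightarrow> (real^'n) set \<Rightarrow> (real^'n \<Rightarrow> real) \<Rightarrow> ennreal"
  where "Lp_norm p \<Omega> f =
    (if p = \<infinity> then esssup (lebesgue_on \<Omega>) (\<lambda>x. ennreal \<bar>f x\<bar>)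
     else let I = (\<integral>\<^sup>+x. ennreal (\<bar>f x\<bar> powr enn2real p) \<partial>lebesgue_on \<Omega>)
          in if I = \<infinity> then \<infinity> else ennreal (enn2real I powr (1 / enn2real p)))"

definition Lp_space :: "ennreal \<Rightarrow> (real^'n) set \<Rightarrow> (real^'n \<Rightarrow> real) set"
  where "Lp_space p \<Omega> = {f \<in> borel_measurable (lebesgue_on \<Omega>). Lp_norm p \<Omega> f < \<infinity>}"

definition hom_sobolev :: "nat \<Rightarrow> ennreal \<Rightarrow> (real^'n) set \<Rightarrow> (real^'n \<Rightarrow> real) set"
  where "hom_sobolev k p \<Omega> = {u \<in> L1_loc \<Omega>.
    \<forall>\<alpha>. mi_order \<alpha> = k \<longrightarrow> (\<exists>g \<in> Lp_space p \<Omega>. has_weak_deriv \<Omega> \<alpha> u g)}"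

definition hom_sobolev_seminorm ::
    "nat \<Rightarrow> ennreal \<Rightarrow> (real^'n) set \<Rightarrow> (real^'n \<Rightarrow> real) \<Rightarrow> ennreal"
  where "hom_sobolev_seminorm k p \<Omega> u =
    (\<Sum>\<alpha> | mi_order \<alpha> = k. Lp_norm p \<Omega> (weak_deriv \<Omega> \<alpha> u))"

definition sobolev :: "nat \<Rightarrow> ennreal \<Rightarrow> (real^'n) set \<Rightarrow> (real^'n \<Rightarrow> real) set"
  where "sobolev k p \<Omega> = {u \<in> L1_loc \<Omega>.
    \<forall>\<alpha>. mi_order \<alpha> \<le> k \<longrightarrow> (\<exists>g \<in> Lp_space p \<Omega>. has_weak_deriv \<Omega> \<alpha> u g)}"

definition dense_wrt_seminorm ::
    "(('a \<Rightarrow> real) \<Rightarrow> ennreal) \<Rightarrow> ('a \<Rightarrow> real) set \<Rightarrow> ('a \<Rightarrow> real) set \<Rightarrow> bool"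
  where "dense_wrt_seminorm N A X \<longleftrightarrow>
    A \<subseteq> X \<and> (\<forall>u\<in>X. \<forall>\<epsilon>>0. \<exists>v\<in>A. N (\<lambda>x. u x - v x) < ennreal \<epsilon>)"

definition bdist :: "(real^'n) set \<Rightarrow> real^'n \<Rightarrow> real"
  where "bdist \<Omega> z = infdist z (frontier \<Omega>)"

definition curves :: "(real^'n) set \<Rightarrow> real^'n \<Rightarrow> real^'n \<Rightarrow> (real \<Rightarrow> real^'n) set"
  where "curves \<Omega> x y =
    {\<gamma>. path \<gamma> \<and> path_image \<gamma> \<subseteq> \<Omega> \<and> pathstart \<gamma> = x \<and> pathfinish \<gamma> = y}"

definition curve_length :: "(real \<Rightarrow> real^'n) \<Rightarrow> ennreal"
  where "curve_length \<gamma> = (SUP ts \<in> {ts. sorted ts \<and> set ts \<subseteq> {0..1}}.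
    \<Sum>i<length ts - 1. ennreal (dist (\<gamma> (ts ! i)) (\<gamma> (ts ! Suc i))))"

definition rect_curves :: "(real^'n) set \<Rightarrow> real^'n \<Rightarrow> real^'n \<Rightarrow> (real \<Rightarrow> real^'n) set"
  where "rect_curves \<Omega> x y = {\<gamma> \<in> curves \<Omega> x y. curve_length \<gamma> < \<infinity>}"

text \<open>On a domain the infimum is finite, since any two points are joined by a polygonal path.\<close>

definition length_metric :: "(real^'n) set \<Rightarrow> real^'n \<Rightarrow> real^'n \<Rightarrow> real"
  where "length_metric \<Omega> x y = enn2real (INF \<gamma> \<in> curves \<Omega> x y. curve_length \<gamma>)"

definition diam_metric :: "(real^'n) set \<Rightarrow> real^'n \<Rightarrow> real^'n \<Rightarrow> real"
  where "diam_metric \<Omega> x y = (INF \<gamma> \<in> curves \<Omega> x y. diameter (path_image \<gamma>))"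

definition intrinsic_ball :: "(real^'n) set \<Rightarrow> real^'n \<Rightarrow> real \<Rightarrow> (real^'n) set"
  where "intrinsic_ball \<Omega> z r = {y \<in> \<Omega>. length_metric \<Omega> z y < r}"

definition Delta_dist :: "(real^'n) set \<Rightarrow> real^'n \<Rightarrow> real^'n \<Rightarrow> real"
  where "Delta_dist \<Omega> x y = ln (1 + diam_metric \<Omega> x y / min (bdist \<Omega> x) (bdist \<Omega> y))"

definition Lambda_dist :: "(real^'n) set \<Rightarrow> real^'n \<Rightarrow> real^'n \<Rightarrow> real"
  where "Lambda_dist \<Omega> x y = ln (1 + length_metric \<Omega> x y / min (bdist \<Omega> x) (bdist \<Omega> y))"

text \<open>The arc-length parametrization of a rectifiable curve on \<open>{0..l}\<close>, \<open>l\<close> its length. The curve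
  is constant on the set of parameters with a given initial length, so the choice is immaterial.\<close>

definition arc_length_param :: "(real \<Rightarrow> real^'n) \<Rightarrow> real \<Rightarrow> real^'n"
  where "arc_length_param \<gamma> s =
    \<gamma> (SOME t. t \<in> {0..1} \<and> curve_length (subpath 0 t \<gamma>) = ennreal s)"

definition curve_integral :: "(real^'n \<Rightarrow> real) \<Rightarrow> (real \<Rightarrow> real^'n) \<Rightarrow> ennreal"
  where "curve_integral \<rho> \<gamma> =
    (\<integral>\<^sup>+s\<in>{0..enn2real (curve_length \<gamma>)}. ennreal (\<rho> (arc_length_param \<gamma> s)) \<partial>lborel)"

definition qh_length :: "(real^'n) set \<Rightarrow> (real \<Rightarrow> real^'n) \<Rightarrow> ennreal"
  where "qh_length \<Omega> \<gamma> = curve_integral (\<lambda>z. 1 / bdist \<Omega> z) \<gamma>"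

definition qh_dist :: "(real^'n) set \<Rightarrow> real^'n \<Rightarrow> real^'n \<Rightarrow> ennreal"
  where "qh_dist \<Omega> x y = (INF \<gamma> \<in> rect_curves \<Omega> x y. qh_length \<Omega> \<gamma>)"

definition qh_geodesic ::
    "(real^'n) set \<Rightarrow> real^'n \<Rightarrow> real^'n \<Rightarrow> (real \<Rightarrow> real^'n) \<Rightarrow> bool"
  where "qh_geodesic \<Omega> x y \<gamma> \<longleftrightarrow>
    \<gamma> \<in> rect_curves \<Omega> x y \<and> qh_length \<Omega> \<gamma> = qh_dist \<Omega> x y"

definition separates_in :: "(real^'n) set \<Rightarrow> (real^'n) set \<Rightarrow> real^'n \<Rightarrow> real^'n \<Rightarrow> bool"
  where "separates_in \<Omega> B x y \<longleftrightarrow> \<not> connected_component (\<Omega> - B) x y"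

text \<open>For \<open>x = \<gamma> s\<close>, \<open>y = \<gamma> t\<close> with \<open>s \<le> t\<close>, the subcurve between \<open>x\<close> and \<open>y\<close> is \<open>\<gamma>\<close> on
  \<open>{s..t}\<close>. Separation is symmetric in the two points, so \<open>s \<le> t\<close> is no restriction.\<close>

definition curve_ball_separation :: "real \<Rightarrow> (real^'n) set \<Rightarrow> (real \<Rightarrow> real^'n) \<Rightarrow> bool"
  where "curve_ball_separation c \<Omega> \<gamma> \<longleftrightarrow>
    (\<forall>r s t. 0 \<le> s \<and> s \<le> r \<and> r \<le> t \<and> t \<le> 1 \<longrightarrow>
      (let B = intrinsic_ball \<Omega> (\<gamma> r) (c * bdist \<Omega> (\<gamma> r)) in
        \<gamma> s \<notin> B \<longrightarrow> \<gamma> t \<notin> B \<longrightarrow> separates_in \<Omega> B (\<gamma> s) (\<gamma> t)))"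

definition ball_separation :: "real \<Rightarrow> (real^'n) set \<Rightarrow> bool"
  where "ball_separation c \<Omega> \<longleftrightarrow>
    (\<forall>x\<in>\<Omega>. \<forall>y\<in>\<Omega>. \<forall>\<gamma>. qh_geodesic \<Omega> x y \<gamma> \<longrightarrow> curve_ball_separation c \<Omega> \<gamma>)"

definition length_GH :: "real \<Rightarrow> real \<Rightarrow> (real^'n) set \<Rightarrow> (real^'n) set \<Rightarrow> bool"
  where "length_GH c R \<Omega> E \<longleftrightarrow>
    (\<forall>x\<in>E. \<forall>y\<in>E. Lambda_dist \<Omega> x y \<le> R \<longrightarrow>
      (\<forall>\<gamma>. qh_geodesic \<Omega> x y \<gamma> \<longrightarrow> curve_length \<gamma> \<le> ennreal (c * length_metric \<Omega> x y)))"

definition diam_GH :: "real \<Rightarrow> real \<Rightarrow> (real^'n) set \<Rightarrow> (real^'n) set \<Rightarrow> bool"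
  where "diam_GH c R \<Omega> E \<longleftrightarrow>
    (\<forall>x\<in>E. \<forall>y\<in>E. Delta_dist \<Omega> x y \<le> R \<longrightarrow>
      (\<forall>\<gamma>. qh_geodesic \<Omega> x y \<gamma> \<longrightarrow> diameter (path_image \<gamma>) \<le> c * diam_metric \<Omega> x y))"

definition radially_hyperbolic :: "real \<Rightarrow> real \<Rightarrow> real \<Rightarrow> (real^'n) set \<Rightarrow> bool"
  where "radially_hyperbolic c0 c R \<Omega> \<longleftrightarrow>
    ball_separation c0 \<Omega> \<and>
    (\<exists>x0\<in>\<Omega>. \<forall>x\<in>\<Omega>. x \<noteq> x0 \<longrightarrow> (\<forall>\<gamma>x. qh_geodesic \<Omega> x0 x \<gamma>x \<longrightarrow>
       diam_GH c R \<Omega> (path_image \<gamma>x) \<and>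
       (\<forall>y\<in>\<Omega>. \<forall>\<gamma>y. y \<noteq> x0 \<and> qh_geodesic \<Omega> x0 y \<gamma>y \<and>
            (path_image \<gamma>x \<inter> path_image \<gamma>y) - {x0} \<noteq> {} \<longrightarrow>
          length_GH c R \<Omega> (path_image \<gamma>x \<union> path_image \<gamma>y) \<or>
          diam_GH c R \<Omega> (path_image \<gamma>x \<union> path_image \<gamma>y))))"

end

theory Submission
  imports Defs "HOL-Complex_Analysis.Great_Picard" "HOL-Computational_Algebra.Polynomial"
begin

text \<open>
Write \<open>d\<close> for the distance to the boundary, \<open>x0\<close> for the centre and \<open>k\<close> for the order of the space. A
function \<open>u\<close> is replaced by its mollification at a small scale \<open>T\<close> in the part of the domain where
\<open>d\<close> is at least a fixed multiple of \<open>T\<close> and which is not cut off from the centre by a bottleneck of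
size \<open>T\<close>. In the remaining part near the boundary it is replaced by Taylor polynomials, of degree less than \<open>k\<close>, of
that mollification, based at finitely many points, the gates. A polynomial of degree less than \<open>k\<close>
has no derivatives of order \<open>k\<close>, and it is bounded with all its derivatives however complicated the
region on which it is used. What has to be controlled are the differences of two pieces where they
are glued together by a partition of unity of scale \<open>T\<close>. Such a difference is small of the order
required by the Leibniz rule if the two base points are joined by a connected set of size comparable
to \<open>T\<close> that keeps a distance comparable to \<open>T\<close> from the boundary (\<open>taylor_variation\<close>,
\<open>piece_difference\<close>). No length of this set enters: a connected set is covered by a bounded number of
small balls, and the image of a connected set on the line is an interval (\<open>connected_variation\<close>).

The geometry provides such gates (\<open>ex_gate_system\<close>). A point is a core point if some geodesic from
\<open>x0\<close> to it stays at distance at least \<open>T\<close> from the boundary. By ball separation, a ball of radius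
comparable to \<open>T\<close> around a core point at distance \<open>T\<close> separates from \<open>x0\<close> all points whose geodesics
run close to it, and a point that is behind none of finitely many such balls is itself a core point
(\<open>behind_some_gate\<close>). If only the balls with maximal regions behind them are kept, then two of these
regions meet only if the balls meet (\<open>behind_disjoint\<close>). It remains to link two core points \<open>m\<close>,
\<open>m'\<close> whose balls meet, and this is where radial hyperbolicity enters (\<open>core_points_linked\<close>). Let a point
\<open>p\<close> move along a short curve from \<open>m\<close> to \<open>m'\<close>, and cut the geodesics from \<open>x0\<close> to \<open>p\<close> at distance
\<open>t = T / (1 + c0)\<close> from the boundary. The exit points obtained in this way stay near the curve, as
otherwise a ball around one of them would violate ball separation (\<open>exit_near_curve\<close>). Any two exit
points of the same \<open>p\<close> lie on two geodesics with a common end point, so the Gehring--Hayman property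
makes the geodesic between them short, while ball separation keeps it away from the boundary
(\<open>exit_points_joined\<close>). As limits of exit points are exit points (\<open>exit_limit\<close>), the component that
contains the exit points does not change along the curve. The threshold \<open>R0\<close> is the bound on the
distances \<open>\<Delta>\<close> and \<open>\<Lambda>\<close> of the exit points that occur here.

Consequently the derivatives of order \<open>k\<close> of the patched function are bounded by a constant, which
does not depend on \<open>T\<close>, times an average of the weak derivatives of \<open>u\<close> over a ball of radius
comparable to \<open>T\<close> (\<open>pd_patched_le_average\<close>). Where \<open>d\<close> is at least \<open>2 s\<close>, with \<open>s\<close> large compared to \<open>T\<close>,
the patched function is the mollification of \<open>u\<close>, whose derivatives converge in \<open>L\<^sup>p\<close>. Where \<open>d\<close> is
smaller, both functions have derivatives of small norm, since by Jensen's inequality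
(\<open>convolution_power_bound\<close>) the averages contribute at most the norm of the weak derivatives over the
points with \<open>d\<close> less than \<open>3 s\<close>. Choosing \<open>s\<close> and then \<open>T\<close> small proves the density
(\<open>smooth_approximation\<close>).
\<close>

section \<open>Variation of a curve\<close>

fun chain_length :: "(real \<Rightarrow> 'a::metric_space) \<Rightarrow> real list \<Rightarrow> real" where
  "chain_length g (a # b # ts) = dist (g a) (g b) + chain_length g (b # ts)"
| "chain_length g _ = 0"

definition variation :: "(real \<Rightarrow> 'a::metric_space) \<Rightarrow> real \<Rightarrow> real \<Rightarrow> ennreal" where
  "variation g a b = (SUP ts \<in> {ts. sorted ts \<and> set ts \<subseteq> {a..b}}. ennreal (chain_length g ts))"

lemma chain_length_nonneg: "0 \<le> chain_length g ts"
  by (induction g ts rule: chain_length.induct) auto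

lemma chain_length_eq_sum:
  "(\<Sum>i<length ts - 1. ennreal (dist (g (ts ! i)) (g (ts ! Suc i)))) = ennreal (chain_length g ts)"
proof (induction g ts rule: chain_length.induct)
  case (1 g a b ts)
  have "(\<Sum>i<length (a # b # ts) - 1. ennreal (dist (g ((a # b # ts) ! i)) (g ((a # b # ts) ! Suc i))))
    = ennreal (dist (g a) (g b)) + (\<Sum>i<length (b # ts) - 1. ennreal (dist (g ((b # ts) ! i)) (g ((b # ts) ! Suc i))))"
    by (simp add: sum.lessThan_Suc_shift del: sum_ennreal sum.lessThan_Suc)
  then show ?case
    using 1 by (simp add: ennreal_plus chain_length_nonneg)
qed auto

lemma chain_length_map: "chain_length g (map \<phi> ts) = chain_length (\<lambda>t. g (\<phi> t)) ts"
  by (induction "\<lambda>t. g (\<phi> t)" ts rule: chain_length.induct) auto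

lemma chain_length_append:
  "xs \<noteq> [] \<Longrightarrow> ys \<noteq> [] \<Longrightarrow>
    chain_length g (xs @ ys) = chain_length g xs + dist (g (last xs)) (g (hd ys)) + chain_length g ys"
proof (induction g xs rule: chain_length.induct)
  case ("2_2" g v)
  then show ?case by (cases ys) auto
qed auto

lemma chain_length_rev: "chain_length g (rev ts) = chain_length g ts"
proof (induction g ts rule: chain_length.induct)
  case (1 g a b ts)
  then show ?case
    using chain_length_append[of "rev ts @ [b]" "[a]" g] by (simp add: dist_commute)
qed auto

lemma curve_length_eq_variation: "curve_length g = variation g 0 1"
  by (simp only: curve_length_def variation_def chain_length_eq_sum)

lemma variation_upper:
  "sorted ts \<Longrightarrow> set ts \<subseteq> {a..b} \<Longrightarrow> ennreal (chain_length g ts) \<le> variation g a b"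
  unfolding variation_def by (rule SUP_upper) auto

lemma variation_least:
  "(\<And>ts. sorted ts \<Longrightarrow> set ts \<subseteq> {a..b} \<Longrightarrow> ennreal (chain_length g ts) \<le> X) \<Longrightarrow> variation g a b \<le> X"
  unfolding variation_def by (rule SUP_least) auto

lemma chain_length_cong:
  "(\<And>t. t \<in> set ts \<Longrightarrow> g t = h t) \<Longrightarrow> chain_length g ts = chain_length h ts"
proof (induction ts)
  case (Cons a ts)
  then show ?case by (cases ts) auto
qed auto

text \<open>A partition of one interval is carried to a partition of the other one, with the same chain.\<close>

lemma variation_mono_reparam:
  assumes "mono_on {a..b} \<phi>" "\<And>t. t \<in> {a..b} \<Longrightarrow> \<phi> t \<in> {c..d} \<and> h t = g (\<phi> t)"
  shows "variation h a b \<le> variation g c d"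
proof (rule variation_least)
  fix ts assume ts: "sorted ts" "set ts \<subseteq> {a..b}"
  have "chain_length h ts = chain_length g (map \<phi> ts)"
    unfolding chain_length_map using ts assms by (intro chain_length_cong) auto
  moreover have "sorted (map \<phi> ts)"
    using ts assms(1) by (auto simp: sorted_map mono_on_def subset_iff intro!: sorted_wrt_mono_rel[of ts "(\<le>)"])
  moreover have "set (map \<phi> ts) \<subseteq> {c..d}" using ts assms(2) by auto
  ultimately show "ennreal (chain_length h ts) \<le> variation g c d"
    by (metis variation_upper)
qed

lemma variation_antimono_reparam:
  assumes "\<And>s t. s \<in> {a..b} \<Longrightarrow> t \<in> {a..b} \<Longrightarrow> s \<le> t \<Longrightarrow> \<phi> t \<le> \<phi> s"
    "\<And>t. t \<in> {a..b} \<Longrightarrow> \<phi> t \<in> {c..d} \<and> h t = g (\<phi> t)"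
  shows "variation h a b \<le> variation g c d"
proof (rule variation_least)
  fix ts assume ts: "sorted ts" "set ts \<subseteq> {a..b}"
  have "chain_length h ts = chain_length g (rev (map \<phi> ts))"
    unfolding chain_length_rev chain_length_map using ts assms by (intro chain_length_cong) auto
  moreover have "sorted (rev (map \<phi> ts))"
    using ts assms(1) by (auto simp: sorted_wrt_rev sorted_wrt_map subset_iff intro!: sorted_wrt_mono_rel[of ts "(\<le>)"])
  moreover have "set (rev (map \<phi> ts)) \<subseteq> {c..d}" using ts assms(2) by auto
  ultimately show "ennreal (chain_length h ts) \<le> variation g c d"
    by (metis variation_upper)
qed

lemma dist_le_variation:
  assumes "a \<le> b" shows "ennreal (dist (g a) (g b)) \<le> variation g a b"
  using variation_upper[of "[a,b]" a b g] assms by simp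

lemma variation_refl: "variation g a a = 0"
proof -
  have "chain_length g ts = 0" if "set ts \<subseteq> {a}" for ts
    using that by (induction g ts rule: chain_length.induct) auto
  then have "variation g a a \<le> 0"
    by (intro variation_least) simp
  then show ?thesis by simp
qed

text \<open>Inserting the cut point into a partition does not decrease its chain, and partitions of the two
  pieces can be concatenated.\<close>

lemma variation_additive:
  assumes "a \<le> b" "b \<le> c"
  shows "variation g a c = variation g a b + variation g b c"
proof (rule antisym)
  show "variation g a c \<le> variation g a b + variation g b c"
  proof (rule variation_least)
    fix ts assume ts: "sorted ts" "set ts \<subseteq> {a..c}"
    define xs where "xs = filter (\<lambda>t. t \<le> b) ts"
    define ys where "ys = filter (\<lambda>t. \<not> t \<le> b) ts"
    have split: "ts = xs @ ys"
      unfolding xs_def ys_def using ts(1)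
    proof (induction ts)
      case (Cons t ts)
      show ?case
      proof (cases "t \<le> b")
        case False
        then have "filter (\<lambda>t. t \<le> b) ts = []" using Cons.prems by (auto simp: filter_empty_conv)
        with False Cons show ?thesis by (auto intro!: filter_True[symmetric])
      qed (use Cons in auto)
    qed auto
    have "chain_length g ts \<le> chain_length g (xs @ [b]) + chain_length g (b # ys)"
    proof (cases "xs = [] \<or> ys = []")
      case True
      then show ?thesis
      proof
        assume "xs = []"
        then show ?thesis using split by (cases ys) auto
      next
        assume "ys = []"
        then show ?thesis using split chain_length_append[of xs "[b]" g] by (cases "xs = []") auto
      qed
    next
      case False
      then obtain y ys' where y: "ys = y # ys'" by (cases ys) auto
      have "dist (g (last xs)) (g y) \<le> dist (g (last xs)) (g b) + dist (g b) (g y)"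
        by (rule dist_triangle)
      then show ?thesis
        using False split chain_length_append[of xs ys g] chain_length_append[of xs "[b]" g] y
        by simp
    qed
    then have "ennreal (chain_length g ts) \<le> ennreal (chain_length g (xs @ [b])) + ennreal (chain_length g (b # ys))"
      by (simp flip: ennreal_plus add: chain_length_nonneg ennreal_leI)
    also have "\<dots> \<le> variation g a b + variation g b c"
    proof (intro add_mono variation_upper)
      show "sorted (xs @ [b])" "sorted (b # ys)"
        using ts(1) by (auto simp: xs_def ys_def sorted_append intro: sorted_filter[where f = id, simplified])
      show "set (xs @ [b]) \<subseteq> {a..b}" "set (b # ys) \<subseteq> {b..c}"
        using ts(2) assms by (auto simp: xs_def ys_def)
    qed
    finally show "ennreal (chain_length g ts) \<le> variation g a b + variation g b c" .
  qed
next
  let ?I = "\<lambda>a b. {ts. sorted ts \<and> set ts \<subseteq> {a..b::real}}"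
  have ne: "?I a b \<noteq> {}" for a b by (auto intro!: exI[of _ "[]"])
  have "variation g a b + variation g b c =
    (SUP ys\<in>?I b c. SUP xs\<in>?I a b. ennreal (chain_length g xs) + ennreal (chain_length g ys))"
    unfolding variation_def ennreal_SUP_add_left[OF ne, symmetric] ennreal_SUP_add_right[OF ne] ..
  also have "\<dots> \<le> variation g a c"
  proof (intro SUP_least)
    fix xs ys assume xs: "xs \<in> ?I a b" and ys: "ys \<in> ?I b c"
    have "chain_length g xs + chain_length g ys \<le> chain_length g (xs @ ys)"
      by (cases "xs = [] \<or> ys = []") (auto simp: chain_length_append)
    then have "ennreal (chain_length g xs) + ennreal (chain_length g ys) \<le> ennreal (chain_length g (xs @ ys))"
      by (simp flip: ennreal_plus add: chain_length_nonneg ennreal_leI)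
    also have "\<dots> \<le> variation g a c"
      using xs ys assms by (intro variation_upper) (force simp: sorted_append)+
    finally show "ennreal (chain_length g xs) + ennreal (chain_length g ys) \<le> variation g a c" .
  qed
  finally show "variation g a b + variation g b c \<le> variation g a c" .
qed

lemma variation_lipschitz:
  assumes "a \<le> b" "0 \<le> M" "\<And>s t. a \<le> s \<Longrightarrow> s \<le> t \<Longrightarrow> t \<le> b \<Longrightarrow> dist (g s) (g t) \<le> M * (t - s)"
  shows "variation g a b \<le> ennreal (M * (b - a))"
proof (rule variation_least, rule ennreal_leI)
  fix ts assume ts: "sorted ts" "set ts \<subseteq> {a..b}"
  have "chain_length g ts \<le> M * (b - hd ts)" if "ts \<noteq> []"
    using ts that
  proof (induction ts)
    case (Cons s ts)
    show ?case
    proof (cases ts)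
      case (Cons t us)
      then have "dist (g s) (g t) \<le> M * (t - s)" using Cons.prems by (intro assms(3)) auto
      then show ?thesis using Cons Cons.prems Cons.IH by (simp add: algebra_simps)
    qed (use Cons assms in auto)
  qed auto
  moreover have "M * (b - hd ts) \<le> M * (b - a)" if "ts \<noteq> []"
    using ts that assms(2) by (intro mult_left_mono) (cases ts, auto)
  ultimately show "chain_length g ts \<le> M * (b - a)"
    using assms by (cases "ts = []") auto
qed

lemma curve_length_subpath:
  assumes "a \<le> b" shows "curve_length (subpath a b g) = variation g a b"
proof (cases "a = b")
  case True
  then have "curve_length (subpath a b g) \<le> ennreal (0 * (1 - 0))"
    unfolding curve_length_eq_variation by (intro variation_lipschitz) (auto simp: subpath_def)
  then show ?thesis using True by (simp add: variation_refl)
next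
  case False
  then have ab: "a < b" using assms by simp
  show ?thesis unfolding curve_length_eq_variation
  proof (rule antisym)
    show "variation (subpath a b g) 0 1 \<le> variation g a b"
    proof (rule variation_mono_reparam[where \<phi> = "\<lambda>x. (b - a) * x + a"])
      show "mono_on {0..1} (\<lambda>x. (b - a) * x + a)" using ab by (auto simp: mono_on_def)
      fix t :: real assume "t \<in> {0..1}"
      then have "0 \<le> (b - a) * t" "(b - a) * t \<le> (b - a) * 1"
        using ab by (auto intro: mult_left_mono simp del: mult_1_right)
      then show "(b - a) * t + a \<in> {a..b} \<and> subpath a b g t = g ((b - a) * t + a)"
        by (auto simp: subpath_def)
    qed
    show "variation g a b \<le> variation (subpath a b g) 0 1"
    proof (rule variation_mono_reparam[where \<phi> = "\<lambda>x. (x - a) / (b - a)"])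
      show "mono_on {a..b} (\<lambda>x. (x - a) / (b - a))" using ab by (auto simp: mono_on_def divide_right_mono)
    qed (use ab in \<open>auto simp: subpath_def\<close>)
  qed
qed

lemma curve_length_reversepath: "curve_length (reversepath g) = curve_length g"
proof -
  have "curve_length (reversepath g) \<le> curve_length g" for g :: "real \<Rightarrow> real^'n"
    unfolding curve_length_eq_variation
    by (rule variation_antimono_reparam[where \<phi> = "\<lambda>x. 1 - x"]) (auto simp: reversepath_def)
  from this[of g] this[of "reversepath g"] show ?thesis by simp
qed

lemma curve_length_joinpaths:
  assumes "pathfinish g1 = pathstart g2"
  shows "curve_length (g1 +++ g2) \<le> curve_length g1 + curve_length g2"
proof -
  have "curve_length (g1 +++ g2) = variation (g1 +++ g2) 0 (1/2) + variation (g1 +++ g2) (1/2) 1"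
    unfolding curve_length_eq_variation by (rule variation_additive) auto
  also have "\<dots> \<le> variation g1 0 1 + variation g2 0 1"
  proof (rule add_mono)
    show "variation (g1 +++ g2) 0 (1/2) \<le> variation g1 0 1"
      by (rule variation_mono_reparam[where \<phi> = "\<lambda>x. 2 * x"]) (auto simp: joinpaths_def mono_on_def)
    show "variation (g1 +++ g2) (1/2) 1 \<le> variation g2 0 1"
      using assms
      by (intro variation_mono_reparam[where \<phi> = "\<lambda>x. 2 * x - 1"])
        (auto simp: joinpaths_def mono_on_def pathfinish_def pathstart_def mult.commute)
  qed
  finally show ?thesis by (simp add: curve_length_eq_variation)
qed

lemma curve_length_linepath: "curve_length (linepath x y) \<le> ennreal (dist x y)"
proof -
  have "curve_length (linepath x y) \<le> ennreal (dist x y * (1 - 0))"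
    unfolding curve_length_eq_variation
  proof (rule variation_lipschitz)
    fix s t :: real assume "s \<le> t"
    have "linepath x y s - linepath x y t = (t - s) *\<^sub>R (x - y)"
      by (simp add: linepath_def algebra_simps)
    then show "dist (linepath x y s) (linepath x y t) \<le> dist x y * (t - s)"
      using \<open>s \<le> t\<close> by (simp add: dist_norm mult.commute)
  qed auto
  then show ?thesis by simp
qed

section \<open>The arc length function of a rectifiable path\<close>

definition arc_upto :: "(real \<Rightarrow> real^'n) \<Rightarrow> real \<Rightarrow> real" where
  "arc_upto g t = enn2real (curve_length (subpath 0 t g))"

text \<open>The length of a subcurve is a supremum of sums that depend continuously on the end points,
  hence lower semicontinuous; as the lengths of the two pieces into which a parameter cuts the curve
  have a constant sum, both are upper semicontinuous as well.\<close>

lemma open_curve_length_superlevel: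
  fixes g :: "real \<Rightarrow> real^'n" and a b :: "real \<Rightarrow> real"
  assumes "continuous_on {0..1} g" "continuous_on {0..1} a" "continuous_on {0..1} b"
    "\<And>t. t \<in> {0..1} \<Longrightarrow> a t \<in> {0..1} \<and> b t \<in> {0..1}" "t0 \<in> {0..1}"
    "K < curve_length (subpath (a t0) (b t0) g)"
  shows "\<exists>e>0. \<forall>t\<in>{0..1}. \<bar>t - t0\<bar> < e \<longrightarrow> K < curve_length (subpath (a t) (b t) g)"
proof -
  obtain ts where ts: "sorted ts" "set ts \<subseteq> {0..1}" "K < ennreal (chain_length (subpath (a t0) (b t0) g) ts)"
    using assms(6) unfolding curve_length_eq_variation variation_def less_SUP_iff by auto
  have pt: "continuous_on {0..1} (\<lambda>t. g ((b t - a t) * s + a t))" if "s \<in> {0..1}" for s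
  proof (rule continuous_on_compose2[OF assms(1)])
    show "continuous_on {0..1} (\<lambda>t. (b t - a t) * s + a t)" by (intro continuous_intros assms)
    show "(\<lambda>t. (b t - a t) * s + a t) ` {0..1} \<subseteq> {0..1}"
    proof clarify
      fix t :: real assume "t \<in> {0..1}"
      then have "a t \<in> {0..1}" "b t \<in> {0..1}" using assms(4) by auto
      moreover have "convex {0..1::real}" by simp
      ultimately have "(1 - s) *\<^sub>R a t + s *\<^sub>R b t \<in> {0..1}"
        using that by (intro convexD_alt) auto
      then show "(b t - a t) * s + a t \<in> {0..1}" by (simp add: algebra_simps)
    qed
  qed
  have "continuous_on {0..1} (\<lambda>t. chain_length (subpath (a t) (b t) g) ts)"
    using ts(2)
  proof (induction ts)
    case (Cons u us)
    show ?case
    proof (cases us)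
      case (Cons v vs)
      show ?thesis unfolding Cons chain_length.simps subpath_def
        using Cons.IH Cons.prems Cons
        by (intro continuous_intros pt) (auto simp: subpath_def)
    qed simp
  qed simp
  moreover obtain k where k: "K = ennreal k" "0 \<le> k" "k < chain_length (subpath (a t0) (b t0) g) ts"
    using ts(3) by (cases K) (auto simp: ennreal_less_iff)
  ultimately obtain e where "e > 0" and e:
      "\<forall>t\<in>{0..1}. dist t t0 < e \<longrightarrow> dist (chain_length (subpath (a t) (b t) g) ts)
        (chain_length (subpath (a t0) (b t0) g) ts) < chain_length (subpath (a t0) (b t0) g) ts - k"
    using assms(5) unfolding continuous_on_iff
    by (metis diff_gt_0_iff_gt)
  show ?thesis
  proof (intro exI conjI ballI impI)
    fix t :: real assume t: "t \<in> {0..1}" "\<bar>t - t0\<bar> < e"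
    then have "k < chain_length (subpath (a t) (b t) g) ts"
      using e by (force simp: dist_real_def)
    then have "K < ennreal (chain_length (subpath (a t) (b t) g) ts)"
      using k by (simp add: ennreal_less_iff)
    also have "\<dots> \<le> curve_length (subpath (a t) (b t) g)"
      unfolding curve_length_eq_variation using ts by (intro variation_upper)
    finally show "K < curve_length (subpath (a t) (b t) g)" .
  qed fact
qed

locale rectifiable =
  fixes g :: "real \<Rightarrow> real^'n"
  assumes cont: "continuous_on {0..1} g" and fin: "curve_length g < \<infinity>"
begin

abbreviation "len \<equiv> enn2real (curve_length g)"

lemma variation_finite: "0 \<le> s \<Longrightarrow> s \<le> t \<Longrightarrow> t \<le> 1 \<Longrightarrow> variation g s t < \<infinity>"
  using variation_additive[of 0 s 1 g] variation_additive[of s t 1 g] fin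
  by (auto simp: curve_length_eq_variation top_unique less_top)

lemma arc_upto_diff:
  assumes "0 \<le> s" "s \<le> t" "t \<le> 1"
  shows "arc_upto g t - arc_upto g s = enn2real (variation g s t)"
proof -
  have "variation g 0 t = variation g 0 s + variation g s t"
    using assms by (intro variation_additive) auto
  then show ?thesis
    using assms variation_finite[of 0 s] variation_finite[of s t]
    by (simp add: arc_upto_def curve_length_subpath enn2real_plus less_top)
qed

lemma arc_upto_0: "arc_upto g 0 = 0" and arc_upto_1: "arc_upto g 1 = len"
  by (simp_all add: arc_upto_def curve_length_subpath variation_refl)

lemma arc_upto_mono: "0 \<le> s \<Longrightarrow> s \<le> t \<Longrightarrow> t \<le> 1 \<Longrightarrow> arc_upto g s \<le> arc_upto g t"
  using arc_upto_diff[of s t] enn2real_nonneg[of "variation g s t"] by linarith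

lemma dist_le_arc:
  assumes "0 \<le> s" "s \<le> t" "t \<le> 1"
  shows "dist (g s) (g t) \<le> arc_upto g t - arc_upto g s"
proof -
  have "dist (g s) (g t) = enn2real (ennreal (dist (g s) (g t)))" by simp
  also have "\<dots> \<le> enn2real (variation g s t)"
    using assms variation_finite by (intro enn2real_mono dist_le_variation) auto
  finally show ?thesis using arc_upto_diff assms by simp
qed

lemma arc_ennreal: "t \<in> {0..1} \<Longrightarrow> curve_length (subpath 0 t g) = ennreal (arc_upto g t)"
  using variation_finite[of 0 t] by (simp add: arc_upto_def curve_length_subpath less_top)

lemma arc_upto_continuous: "continuous_on {0..1} (arc_upto g)"
  unfolding continuous_on_iff
proof (intro ballI allI impI)
  fix t0 e :: real assume t0: "t0 \<in> {0..1}" and e: "e > 0"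
  have lower: "\<exists>d>0. \<forall>t\<in>{0..1}. \<bar>t - t0\<bar> < d \<longrightarrow> arc_upto g t0 - e < arc_upto g t"
  proof (cases "arc_upto g t0 < e")
    case True
    have "0 \<le> arc_upto g t" for t unfolding arc_upto_def by simp
    then show ?thesis using True by (intro exI[of _ 1]) (auto intro: less_le_trans[of _ 0])
  next
    case False
    have "ennreal (arc_upto g t0 - e) < curve_length (subpath 0 t0 g)"
      unfolding arc_ennreal[OF t0] using e False by (simp add: ennreal_less_iff)
    then obtain d where "d > 0" "\<forall>t\<in>{0..1}. \<bar>t - t0\<bar> < d \<longrightarrow> ennreal (arc_upto g t0 - e) < curve_length (subpath 0 t g)"
      using open_curve_length_superlevel[OF cont, of "\<lambda>_. 0" "\<lambda>t. t" t0] t0 by auto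
    then show ?thesis using False
      by (intro exI[of _ d]) (auto simp: arc_ennreal ennreal_less_iff)
  qed
  have rest: "curve_length (subpath t 1 g) = ennreal (len - arc_upto g t)" if "t \<in> {0..1}" for t
    using arc_upto_diff[of t 1] that variation_finite[of t 1]
    by (simp add: arc_upto_1 curve_length_subpath less_top)
  have upper: "\<exists>d>0. \<forall>t\<in>{0..1}. \<bar>t - t0\<bar> < d \<longrightarrow> arc_upto g t < arc_upto g t0 + e"
  proof (cases "len - arc_upto g t0 < e")
    case True
    have "arc_upto g t \<le> len" if "t \<in> {0..1}" for t
      using arc_upto_mono[of t 1] that arc_upto_1 by simp
    then show ?thesis using True by (intro exI[of _ 1]) force
  next
    case False
    have "ennreal (len - arc_upto g t0 - e) < curve_length (subpath t0 1 g)"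
      unfolding rest[OF t0] using e False by (simp add: ennreal_less_iff)
    then obtain d where "d > 0" "\<forall>t\<in>{0..1}. \<bar>t - t0\<bar> < d \<longrightarrow> ennreal (len - arc_upto g t0 - e) < curve_length (subpath t 1 g)"
      using open_curve_length_superlevel[OF cont, of "\<lambda>t. t" "\<lambda>_. 1" t0] t0 by auto
    then show ?thesis using False
      by (intro exI[of _ d]) (auto simp: rest ennreal_less_iff)
  qed
  obtain d1 d2 where "d1 > 0" "d2 > 0"
    "\<forall>t\<in>{0..1}. \<bar>t - t0\<bar> < d1 \<longrightarrow> arc_upto g t0 - e < arc_upto g t"
    "\<forall>t\<in>{0..1}. \<bar>t - t0\<bar> < d2 \<longrightarrow> arc_upto g t < arc_upto g t0 + e"
    using lower upper by blast
  then show "\<exists>d>0. \<forall>t\<in>{0..1}. dist t t0 < d \<longrightarrow> dist (arc_upto g t) (arc_upto g t0) < e"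
    by (intro exI[of _ "min d1 d2"]) (force simp: dist_real_def abs_less_iff)
qed

text \<open>Parameters with the same initial length bound a piece of length zero, on which the curve is
  constant; so the parameter chosen by the arc length parametrization does not matter.\<close>

lemma arc_length_param_arc:
  assumes "t \<in> {0..1}" shows "arc_length_param g (arc_upto g t) = g t"
proof -
  define t' where "t' = (SOME t'. t' \<in> {0..1} \<and> curve_length (subpath 0 t' g) = ennreal (arc_upto g t))"
  have "t' \<in> {0..1} \<and> curve_length (subpath 0 t' g) = ennreal (arc_upto g t)"
    unfolding t'_def by (rule someI[of _ t]) (use assms arc_ennreal in auto)
  then have t': "t' \<in> {0..1}" and "ennreal (arc_upto g t') = ennreal (arc_upto g t)"
    using arc_ennreal[of t'] by auto
  then have eq: "arc_upto g t' = arc_upto g t"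
    by (subst (asm) ennreal_inj) (simp_all add: arc_upto_def)
  have "dist (g t) (g t') \<le> 0"
  proof (cases "t \<le> t'")
    case True
    then show ?thesis using dist_le_arc[of t t'] assms t' eq by auto
  next
    case False
    then show ?thesis using dist_le_arc[of t' t] assms t' eq by (auto simp: dist_commute)
  qed
  then have "g t' = g t" by simp
  then show ?thesis unfolding arc_length_param_def t'_def .
qed

lemma arc_surj:
  assumes "s \<in> {0..len}" obtains t where "t \<in> {0..1}" "arc_upto g t = s"
  using IVT'[of "arc_upto g" 0 s 1] assms arc_upto_continuous by (auto simp: arc_upto_0 arc_upto_1)

lemma arc_length_param_lipschitz:
  assumes "s \<in> {0..len}" "s' \<in> {0..len}"
  shows "dist (arc_length_param g s) (arc_length_param g s') \<le> \<bar>s - s'\<bar>"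
proof -
  obtain t t' where t: "t \<in> {0..1}" "arc_upto g t = s" "t' \<in> {0..1}" "arc_upto g t' = s'"
    using arc_surj assms by metis
  then have "dist (g t) (g t') \<le> \<bar>s - s'\<bar>"
    using dist_le_arc[of t t'] dist_le_arc[of t' t] by (cases "t \<le> t'") (auto simp: dist_commute)
  then show ?thesis using arc_length_param_arc t by metis
qed

end

section \<open>The intrinsic metrics of a bounded domain\<close>

locale bounded_domain =
  fixes \<Omega> :: "(real^'n) set"
  assumes dom: "domain_set \<Omega>" and bdd: "bounded \<Omega>"
begin

abbreviation d :: "real^'n \<Rightarrow> real" where "d \<equiv> bdist \<Omega>"
abbreviation lm :: "real^'n \<Rightarrow> real^'n \<Rightarrow> real" where "lm \<equiv> length_metric \<Omega>"

lemma open_dom: "open \<Omega>" and conn_dom: "connected \<Omega>" and nonempty_dom: "\<Omega> \<noteq> {}"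
  using dom by (auto simp: domain_set_def)

lemma frontier_nonempty: "frontier \<Omega> \<noteq> {}"
  using bdd nonempty_dom frontier_not_empty[of \<Omega>] not_bounded_UNIV by fastforce

lemma d_lipschitz: "\<bar>d x - d y\<bar> \<le> dist x y"
  unfolding bdist_def by (rule infdist_triangle_abs)

lemma d_nonneg: "0 \<le> d x" by (simp add: bdist_def infdist_nonneg)

lemma d_continuous: "continuous_on S d"
  unfolding bdist_def by (intro continuous_intros)

lemma d_pos: "x \<in> \<Omega> \<Longrightarrow> 0 < d x"
  unfolding bdist_def using frontier_nonempty open_dom
  by (intro infdist_pos_not_in_closed) (auto simp: frontier_def interior_open)

lemma closure_d_pos: assumes "x \<in> closure \<Omega>" "0 < d x" shows "x \<in> \<Omega>"
proof (rule ccontr)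
  assume "x \<notin> \<Omega>"
  then have "x \<in> frontier \<Omega>" using assms(1) open_dom by (simp add: frontier_def interior_open)
  then show False using assms(2) by (simp add: bdist_def)
qed

lemma ball_d_subset: assumes "x \<in> \<Omega>" shows "ball x (d x) \<subseteq> \<Omega>"
proof (rule ccontr)
  assume "\<not> ball x (d x) \<subseteq> \<Omega>"
  moreover have "x \<in> ball x (d x) \<inter> \<Omega>" using assms d_pos by auto
  ultimately obtain z where "z \<in> ball x (d x)" "z \<in> frontier \<Omega>"
    using connected_Int_frontier[of "ball x (d x)" \<Omega>] by fastforce
  then show False using infdist_le[of z "frontier \<Omega>" x] by (auto simp: bdist_def)
qed

lemma d_bounded: "\<exists>D>0. \<forall>x\<in>\<Omega>. d x \<le> D"
proof -
  obtain z where z: "z \<in> frontier \<Omega>" using frontier_nonempty by auto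
  obtain B where B: "\<forall>x\<in>\<Omega>. dist z x \<le> B" using bdd by (metis bounded_any_center)
  have "d x \<le> max B 1" if "x \<in> \<Omega>" for x
    using infdist_le[OF z, of x] B that by (force simp: bdist_def dist_commute)
  then show ?thesis by (intro exI[of _ "max B 1"]) auto
qed

lemma curvesD: "\<gamma> \<in> curves \<Omega> x y \<Longrightarrow> path \<gamma> \<and> path_image \<gamma> \<subseteq> \<Omega> \<and> \<gamma> 0 = x \<and> \<gamma> 1 = y"
  by (auto simp: curves_def pathstart_def pathfinish_def)

lemma curves_endpoints: "\<gamma> \<in> curves \<Omega> x y \<Longrightarrow> x \<in> \<Omega> \<and> y \<in> \<Omega> \<and> x \<in> path_image \<gamma> \<and> y \<in> path_image \<gamma>"
  by (auto simp: curves_def)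

lemma ex_rectifiable:
  assumes "x \<in> \<Omega>" "y \<in> \<Omega>" shows "\<exists>\<gamma>. \<gamma> \<in> rect_curves \<Omega> x y"
proof -
  obtain g where g: "polynomial_function g" "path_image g \<subseteq> \<Omega>" "pathstart g = x" "pathfinish g = y"
    using connected_open_polynomial_connected[OF open_dom conn_dom assms] by auto
  obtain g' where g': "polynomial_function g'" "\<And>x. (g has_vector_derivative g' x) (at x)"
    using has_vector_derivative_polynomial_function[OF g(1)] by metis
  have "bounded (g' ` {0..1})"
    by (intro compact_imp_bounded compact_continuous_image continuous_on_polymonial_function g') auto
  then obtain B where B: "\<forall>t\<in>{0..1}. norm (g' t) \<le> B" by (auto simp: bounded_iff)
  have "dist (g s) (g t) \<le> B * (t - s)" if "0 \<le> s" "s \<le> t" "t \<le> 1" for s t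
  proof -
    have "norm (g t - g s) \<le> B * norm (t - s)"
    proof (rule differentiable_bound[of "{0..1}" g "\<lambda>x h. h *\<^sub>R g' x"])
      show "onorm (\<lambda>h. h *\<^sub>R g' u) \<le> B" if "u \<in> {0..1}" for u
        using B that by (intro onorm_bound) (auto simp: mult.commute[of B] intro: mult_left_mono order_trans[OF norm_ge_zero])
      show "(g has_derivative (\<lambda>h. h *\<^sub>R g' u)) (at u within {0..1})" for u
        using g'(2)[of u] unfolding has_vector_derivative_def by (rule has_derivative_at_withinI)
    qed (use that in auto)
    then show ?thesis using that by (simp add: dist_norm norm_minus_commute)
  qed
  moreover have "0 \<le> B" using B by (metis atLeastAtMost_iff norm_ge_zero order_refl order_trans zero_le_one)
  ultimately have "curve_length g \<le> ennreal (B * (1 - 0))"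
    unfolding curve_length_eq_variation by (intro variation_lipschitz) auto
  then show ?thesis
    using g by (intro exI[of _ g]) (auto simp: rect_curves_def curves_def path_def continuous_on_polymonial_function intro: le_less_trans)
qed

lemma INF_length_finite:
  assumes "x \<in> \<Omega>" "y \<in> \<Omega>" shows "(INF \<gamma> \<in> curves \<Omega> x y. curve_length \<gamma>) < \<infinity>"
  using ex_rectifiable[OF assms] by (auto simp: rect_curves_def INF_less_iff)

lemma lm_less_obtain:
  assumes "x \<in> \<Omega>" "y \<in> \<Omega>" "lm x y < r"
  obtains \<gamma> where "\<gamma> \<in> curves \<Omega> x y" "curve_length \<gamma> < ennreal r"
proof -
  have "(INF \<gamma> \<in> curves \<Omega> x y. curve_length \<gamma>) = ennreal (lm x y)"
    using INF_length_finite[OF assms(1,2)] by (simp add: length_metric_def less_top)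
  also have "\<dots> < ennreal r" using assms(3) by (simp add: ennreal_less_iff length_metric_def)
  finally show ?thesis using that by (auto simp: INF_less_iff)
qed

lemma lm_leI:
  assumes "\<gamma> \<in> curves \<Omega> x y" "curve_length \<gamma> \<le> ennreal r" "0 \<le> r"
  shows "lm x y \<le> r"
proof -
  have "(INF \<gamma> \<in> curves \<Omega> x y. curve_length \<gamma>) \<le> ennreal r"
    using assms by (metis INF_lower2)
  then show ?thesis using assms(3) unfolding length_metric_def by (intro enn2real_leI)
qed

lemma lm_lessI:
  assumes "\<gamma> \<in> curves \<Omega> x y" "curve_length \<gamma> < ennreal r"
  shows "lm x y < r"
proof -
  have "lm x y \<le> enn2real (curve_length \<gamma>)"
    using assms by (intro lm_leI) (auto simp: ennreal_enn2real_if)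
  also have "\<dots> < r" using assms(2) by (cases "curve_length \<gamma>") (auto simp: ennreal_less_iff)
  finally show ?thesis .
qed

lemma lm_nonneg: "0 \<le> lm x y" by (simp add: length_metric_def)

lemma curves_reverse: "\<gamma> \<in> curves \<Omega> x y \<Longrightarrow> reversepath \<gamma> \<in> curves \<Omega> y x"
  by (auto simp: curves_def)

lemma curves_join: "\<gamma>1 \<in> curves \<Omega> x y \<Longrightarrow> \<gamma>2 \<in> curves \<Omega> y z \<Longrightarrow> \<gamma>1 +++ \<gamma>2 \<in> curves \<Omega> x z"
  by (auto simp: curves_def path_image_join)

lemma curves_subpath:
  "\<gamma> \<in> curves \<Omega> x y \<Longrightarrow> s \<in> {0..1} \<Longrightarrow> t \<in> {0..1} \<Longrightarrow> subpath s t \<gamma> \<in> curves \<Omega> (\<gamma> s) (\<gamma> t)"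
  using path_image_subpath_subset[of s t \<gamma>] by (auto simp: curves_def)

lemma curves_linepath: "closed_segment x y \<subseteq> \<Omega> \<Longrightarrow> linepath x y \<in> curves \<Omega> x y"
  by (auto simp: curves_def)

lemma lm_commute: "lm x y = lm y x"
proof -
  have "(INF \<gamma> \<in> curves \<Omega> y x. curve_length \<gamma>) \<le> (INF \<gamma> \<in> curves \<Omega> x y. curve_length \<gamma>)" for x y
    by (intro INF_mono bexI[OF _ curves_reverse]) (auto simp: curve_length_reversepath)
  then show ?thesis unfolding length_metric_def by (metis antisym)
qed

lemma lm_triangle_less:
  assumes "x \<in> \<Omega>" "y \<in> \<Omega>" "z \<in> \<Omega>" "lm x y < a" "lm y z < b" shows "lm x z < a + b"
proof -
  obtain g1 where g1: "g1 \<in> curves \<Omega> x y" "curve_length g1 < ennreal a"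
    using lm_less_obtain assms by metis
  obtain g2 where g2: "g2 \<in> curves \<Omega> y z" "curve_length g2 < ennreal b"
    using lm_less_obtain assms by metis
  have "curve_length (g1 +++ g2) \<le> curve_length g1 + curve_length g2"
    using g1 g2 by (intro curve_length_joinpaths) (auto simp: curves_def)
  also have "\<dots> < ennreal a + ennreal b" using g1 g2 by (intro add_strict_mono)
  also have "\<dots> = ennreal (a + b)"
    using assms(4,5) lm_nonneg[of x y] lm_nonneg[of y z] by (simp add: ennreal_plus)
  finally show ?thesis using curves_join g1 g2 by (intro lm_lessI) auto
qed

lemma lm_triangle:
  assumes "x \<in> \<Omega>" "y \<in> \<Omega>" "z \<in> \<Omega>" shows "lm x z \<le> lm x y + lm y z"
proof (rule field_le_epsilon)
  fix e :: real assume "e > 0"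
  then show "lm x z \<le> lm x y + lm y z + e"
    using lm_triangle_less[OF assms, of "lm x y + e/2" "lm y z + e/2"] by simp
qed

lemma lm_segment: "closed_segment x y \<subseteq> \<Omega> \<Longrightarrow> lm x y \<le> dist x y"
  by (rule lm_leI[OF curves_linepath curve_length_linepath]) auto

lemma lm_refl: "x \<in> \<Omega> \<Longrightarrow> lm x x = 0"
  using lm_segment[of x x] lm_nonneg[of x x] by simp

lemma lm_ball: assumes "x \<in> \<Omega>" "dist x y < d x" shows "y \<in> \<Omega>" "lm x y \<le> dist x y"
proof -
  have "closed_segment x y \<subseteq> ball x (d x)"
    using assms d_pos by (intro closed_segment_subset) auto
  then show "y \<in> \<Omega>" "lm x y \<le> dist x y"
    using ball_d_subset[OF assms(1)] by (auto intro!: lm_segment)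
qed

text \<open>Initial pieces of a curve are not longer than the curve.\<close>

lemma lm_less_path:
  assumes "x \<in> \<Omega>" "y \<in> \<Omega>" "lm x y < r"
  obtains \<gamma> where "\<gamma> \<in> curves \<Omega> x y" "\<And>z. z \<in> path_image \<gamma> \<Longrightarrow> lm x z < r"
proof -
  obtain \<gamma> where g: "\<gamma> \<in> curves \<Omega> x y" "curve_length \<gamma> < ennreal r"
    using lm_less_obtain assms by metis
  have "lm x z < r" if z: "z \<in> path_image \<gamma>" for z
  proof -
    obtain t where t: "t \<in> {0..1}" "z = \<gamma> t" using z by (auto simp: path_image_def)
    have "curve_length (subpath 0 t \<gamma>) \<le> curve_length \<gamma>"
      using t variation_additive[of 0 t 1 \<gamma>] by (simp add: curve_length_subpath) (simp add: curve_length_eq_variation)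
    then show ?thesis
      using g t curves_subpath[OF g(1), of 0 t] curvesD[OF g(1)] by (intro lm_lessI[of "subpath 0 t \<gamma>"]) auto
  qed
  then show ?thesis using g that by blast
qed

lemma path_image_diameter_le_length:
  assumes "\<gamma> \<in> curves \<Omega> x y" "curve_length \<gamma> \<le> ennreal r" "0 \<le> r"
  shows "diameter (path_image \<gamma>) \<le> r"
proof (rule diameter_le)
  have *: "dist (\<gamma> s) (\<gamma> t) \<le> r" if "0 \<le> s" "s \<le> t" "t \<le> 1" for s t
  proof -
    have "variation \<gamma> s t \<le> variation \<gamma> 0 1"
      using variation_additive[of 0 s 1 \<gamma>] variation_additive[of s t 1 \<gamma>] that
      by (auto intro: add_increasing add_increasing2)
    then have "ennreal (dist (\<gamma> s) (\<gamma> t)) \<le> ennreal r"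
      using dist_le_variation[of s t \<gamma>] that assms(2) unfolding curve_length_eq_variation by (meson order_trans)
    then show ?thesis using assms(3) by simp
  qed
  fix z w assume "z \<in> path_image \<gamma>" "w \<in> path_image \<gamma>"
  then obtain s t where "s \<in> {0..1}" "t \<in> {0..1}" "z = \<gamma> s" "w = \<gamma> t" by (auto simp: path_image_def)
  then show "norm (z - w) \<le> r"
    using *[of s t] *[of t s] by (cases "s \<le> t") (auto simp: dist_norm norm_minus_commute)
qed (use assms in auto)

lemma dist_le_lm: assumes "x \<in> \<Omega>" "y \<in> \<Omega>" shows "dist x y \<le> lm x y"
proof (rule field_le_epsilon)
  fix e :: real assume "e > 0"
  then obtain g where g: "g \<in> curves \<Omega> x y" "curve_length g < ennreal (lm x y + e)"
    using lm_less_obtain[OF assms, of "lm x y + e"] by auto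
  then have "diameter (path_image g) \<le> lm x y + e"
    using \<open>e > 0\<close> lm_nonneg[of x y] by (intro path_image_diameter_le_length) auto
  moreover have "dist x y \<le> diameter (path_image g)"
    using g curves_endpoints[OF g(1)] by (intro diameter_bounded_bound) (auto simp: curves_def bounded_path_image)
  ultimately show "dist x y \<le> lm x y + e" by simp
qed

lemma diam_metric_le_lm: assumes "x \<in> \<Omega>" "y \<in> \<Omega>" shows "diam_metric \<Omega> x y \<le> lm x y"
proof (rule field_le_epsilon)
  fix e :: real assume "e > 0"
  then obtain g where g: "g \<in> curves \<Omega> x y" "curve_length g < ennreal (lm x y + e)"
    using lm_less_obtain[OF assms, of "lm x y + e"] by auto
  then have "diameter (path_image g) \<le> lm x y + e"
    using \<open>e > 0\<close> lm_nonneg[of x y] by (intro path_image_diameter_le_length) auto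
  moreover have "diam_metric \<Omega> x y \<le> diameter (path_image g)"
    unfolding diam_metric_def
    by (intro cINF_lower[OF _ g(1)] bdd_belowI[of _ 0])
      (auto intro!: diameter_ge_0 simp: curves_def bounded_path_image)
  ultimately show "diam_metric \<Omega> x y \<le> lm x y + e" by simp
qed

lemma d_le_lm: "x \<in> \<Omega> \<Longrightarrow> y \<in> \<Omega> \<Longrightarrow> \<bar>d x - d y\<bar> \<le> lm x y"
  using d_lipschitz dist_le_lm order_trans by blast

lemma intrinsic_ball_subset: "intrinsic_ball \<Omega> z r \<subseteq> \<Omega>"
  by (auto simp: intrinsic_ball_def)

lemma open_intrinsic_ball: assumes "z \<in> \<Omega>" shows "open (intrinsic_ball \<Omega> z r)"
  unfolding open_contains_ball
proof
  fix y assume y: "y \<in> intrinsic_ball \<Omega> z r"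
  then have yo: "y \<in> \<Omega>" "lm z y < r" by (auto simp: intrinsic_ball_def)
  let ?e = "min (d y) (r - lm z y)"
  have "ball y ?e \<subseteq> intrinsic_ball \<Omega> z r"
  proof
    fix w assume w: "w \<in> ball y ?e"
    then have "w \<in> \<Omega>" "lm y w \<le> dist y w" using lm_ball[OF yo(1), of w] by auto
    moreover from this have "lm z w \<le> lm z y + lm y w" using assms yo by (intro lm_triangle)
    ultimately show "w \<in> intrinsic_ball \<Omega> z r" using w by (auto simp: intrinsic_ball_def)
  qed
  then show "\<exists>e>0. ball y e \<subseteq> intrinsic_ball \<Omega> z r"
    using d_pos[OF yo(1)] yo(2) by (intro exI[of _ ?e]) auto
qed

lemma center_in_intrinsic_ball: "z \<in> \<Omega> \<Longrightarrow> 0 < r \<Longrightarrow> z \<in> intrinsic_ball \<Omega> z r"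
  by (simp add: intrinsic_ball_def lm_refl)

lemma connected_intrinsic_ball: assumes "z \<in> \<Omega>" shows "connected (intrinsic_ball \<Omega> z r)"
proof (cases "0 < r")
  case True
  have "connected_component (intrinsic_ball \<Omega> z r) z y" if "y \<in> intrinsic_ball \<Omega> z r" for y
  proof -
    have "y \<in> \<Omega>" "lm z y < r" using that by (auto simp: intrinsic_ball_def)
    then obtain g where g: "g \<in> curves \<Omega> z y" "\<And>w. w \<in> path_image g \<Longrightarrow> lm z w < r"
      using lm_less_path assms by metis
    then have "path_image g \<subseteq> intrinsic_ball \<Omega> z r" by (auto simp: intrinsic_ball_def curves_def)
    moreover have "connected (path_image g)" using g by (auto simp: curves_def)
    ultimately show ?thesis
      using curves_endpoints[OF g(1)] unfolding connected_component_def by blast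
  qed
  then show ?thesis
    using center_in_intrinsic_ball[OF assms True]
    by (metis connected_component_eq connected_component_eq_empty connected_connected_component
        connected_iff_connected_component connected_component_sym connected_component_trans)
next
  case False
  then have "intrinsic_ball \<Omega> z r = {}" using lm_nonneg by (auto simp: intrinsic_ball_def not_less intro: order_trans)
  then show ?thesis by simp
qed

end

section \<open>Quasihyperbolic geodesics\<close>

lemma set_nn_integral_continuous:
  fixes f :: "real \<Rightarrow> real"
  assumes "continuous_on {a..b} f" "\<And>x. x \<in> {a..b} \<Longrightarrow> 0 \<le> f x"
  shows "(\<integral>\<^sup>+x\<in>{a..b}. ennreal (f x) \<partial>lborel) = ennreal (integral {a..b} f)"
proof -
  have si: "set_integrable lborel {a..b} f"
    by (rule borel_integrable_atLeastAtMost'[OF assms(1)])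
  have "(\<integral>\<^sup>+x\<in>{a..b}. ennreal (f x) \<partial>lborel) = (\<integral>\<^sup>+x. ennreal (indicator {a..b} x *\<^sub>R f x) \<partial>lborel)"
    by (intro nn_integral_cong) (auto simp: indicator_def)
  also have "\<dots> = ennreal (\<integral>x. indicator {a..b} x *\<^sub>R f x \<partial>lborel)"
    using si assms(2) by (intro nn_integral_eq_integral) (auto simp: set_integrable_def indicator_def)
  also have "(\<integral>x. indicator {a..b} x *\<^sub>R f x \<partial>lborel) = integral {a..b} f"
    using set_borel_integral_eq_integral(2)[OF si] by (simp add: set_lebesgue_integral_def)
  finally show ?thesis .
qed

lemma lipschitz1_continuous_on:
  assumes "\<And>s t. s \<in> S \<Longrightarrow> t \<in> S \<Longrightarrow> dist (c s) (c t) \<le> \<bar>s - (t::real)\<bar>"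
  shows "continuous_on S c"
  by (rule lipschitz_on_continuous_on[of 1], rule lipschitz_onI) (use assms in \<open>auto simp: dist_real_def\<close>)

text \<open>Running through a curve at a speed of at most one does not decrease the integral of a
  nonnegative function along it.\<close>

lemma integral_lipschitz_reparam:
  fixes h m :: "real \<Rightarrow> real"
  assumes L: "0 \<le> L" and m0: "m 0 = 0"
    and mono: "\<And>s t. 0 \<le> s \<Longrightarrow> s \<le> t \<Longrightarrow> t \<le> L \<Longrightarrow> m s \<le> m t \<and> m t - m s \<le> t - s"
    and h: "continuous_on {0..m L} h" "\<And>x. x \<in> {0..m L} \<Longrightarrow> 0 \<le> h x"
  shows "integral {0..m L} h \<le> integral {0..L} (\<lambda>s. h (m s))"
proof (rule field_le_epsilon)
  fix e :: real assume e: "e > 0"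
  define e' where "e' = e / (L + 1)"
  have e': "e' > 0" "e' * L \<le> e" using e L by (auto simp: e'_def field_simps)
  have m_in: "m s \<in> {0..m L}" if "s \<in> {0..L}" for s
    using mono[of 0 s] mono[of s L] that m0 by auto
  have cm: "continuous_on {0..L} m"
    by (rule lipschitz1_continuous_on) (use mono in \<open>auto simp: dist_real_def abs_if\<close>, (smt (verit) mono)+)
  have cf: "continuous_on {0..L} (\<lambda>s. h (m s))"
    by (rule continuous_on_compose2[OF h(1) cm]) (use m_in in auto)
  then have "uniformly_continuous_on {0..L} (\<lambda>s. h (m s))"
    by (rule compact_uniformly_continuous) simp
  then obtain \<delta> where \<delta>: "\<delta> > 0" and
    \<delta>': "\<And>s t. s \<in> {0..L} \<Longrightarrow> t \<in> {0..L} \<Longrightarrow> dist t s < \<delta> \<Longrightarrow> dist (h (m t)) (h (m s)) < e' / 2"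
    unfolding uniformly_continuous_on_def using e' by (metis half_gt_zero)
  obtain N :: nat where "N > L / \<delta>" using reals_Archimedean2 by blast
  moreover have "0 \<le> L / \<delta>" using L \<delta> by simp
  ultimately have "real N > 0" "L < \<delta> * N" using \<delta> by (linarith, simp add: field_simps)
  then have N: "N > 0" "L / N < \<delta>" by (auto simp: field_simps)
  define \<eta> where "\<eta> = L / N"
  have \<eta>: "0 \<le> \<eta>" "\<eta> < \<delta>" "N * \<eta> = L" using N L by (auto simp: \<eta>_def)
  have le_L: "real i * \<eta> \<le> L" if "i \<le> N" for i
    using that \<eta> by (metis mult_right_mono of_nat_le_iff)
  have "integral {0..m (i * \<eta>)} h \<le> integral {0..i * \<eta>} (\<lambda>s. h (m s)) + e' * (i * \<eta>)" if "i \<le> N" for i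
    using that
  proof (induction i)
    case 0 then show ?case by (simp add: m0)
  next
    case (Suc i)
    define a b where "a = i * \<eta>" and "b = Suc i * \<eta>"
    have ab: "0 \<le> a" "a \<le> b" "b \<le> L" "b - a = \<eta>"
      using le_L[OF Suc.prems] \<eta> by (auto simp: a_def b_def algebra_simps)
    have mab: "0 \<le> m a" "m a \<le> m b" "m b \<le> m L" "m b - m a \<le> \<eta>"
      using mono[of a b] mono[of 0 a] mono[of b L] ab m0 by auto
    have near: "\<bar>h (m s) - h (m a)\<bar> < e' / 2" if "s \<in> {a..b}" for s
      using \<delta>'[of a s] that ab \<eta> by (auto simp: dist_real_def)
    have "integral {m a..m b} h \<le> integral {m a..m b} (\<lambda>_. h (m a) + e' / 2)"
    proof (rule integral_le)
      show "h integrable_on {m a..m b}"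
        by (rule integrable_continuous_real, rule continuous_on_subset[OF h(1)]) (use mab in auto)
      fix y assume "y \<in> {m a..m b}"
      moreover have "continuous_on {a..b} m" by (rule continuous_on_subset[OF cm]) (use ab in auto)
      ultimately obtain s where s: "s \<in> {a..b}" "m s = y" using IVT'[of m a y b] ab by auto
      then show "h y \<le> h (m a) + e' / 2" using near[OF s(1)] unfolding s(2)[symmetric] by linarith
    qed auto
    also have "\<dots> = (m b - m a) * (h (m a) + e' / 2)" using mab by simp
    also have "\<dots> \<le> \<eta> * (h (m a) + e' / 2)"
      using mab e' h(2)[of "m a"] by (intro mult_right_mono) auto
    also have "\<dots> = integral {a..b} (\<lambda>_. h (m a) - e' / 2) + e' * \<eta>"
      using ab by (simp add: algebra_simps)
    also have "integral {a..b} (\<lambda>_. h (m a) - e' / 2) \<le> integral {a..b} (\<lambda>s. h (m s))"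
    proof (rule integral_le)
      show "(\<lambda>s. h (m s)) integrable_on {a..b}"
        by (rule integrable_continuous_real, rule continuous_on_subset[OF cf]) (use ab in auto)
      show "h (m a) - e' / 2 \<le> h (m s)" if "s \<in> {a..b}" for s using near[OF that] by linarith
    qed auto
    finally have step: "integral {m a..m b} h \<le> integral {a..b} (\<lambda>s. h (m s)) + e' * \<eta>" by simp
    have "integral {0..m a} h + integral {m a..m b} h = integral {0..m b} h"
      by (rule Henstock_Kurzweil_Integration.integral_combine)
        (use mab in \<open>auto intro!: integrable_continuous_real continuous_on_subset[OF h(1)]\<close>)
    moreover have "integral {0..a} (\<lambda>s. h (m s)) + integral {a..b} (\<lambda>s. h (m s)) = integral {0..b} (\<lambda>s. h (m s))"
      by (rule Henstock_Kurzweil_Integration.integral_combine)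
        (use ab in \<open>auto intro!: integrable_continuous_real continuous_on_subset[OF cf]\<close>)
    moreover have "integral {0..m a} h \<le> integral {0..a} (\<lambda>s. h (m s)) + e' * a"
      using Suc unfolding a_def by simp
    moreover have "e' * b = e' * a + e' * \<eta>" by (simp add: a_def b_def algebra_simps)
    ultimately show ?case using step unfolding b_def[symmetric] by linarith
  qed
  from this[of N] show "integral {0..m L} h \<le> integral {0..L} (\<lambda>s. h (m s)) + e"
    using \<eta> e' by simp
qed

context bounded_domain
begin

text \<open>Paths of speed at most one on an interval of variable length. Unlike arc length parametrizations,
  they are closed under uniform limits; and since slowing down only increases the cost, minimizing over
  them gives the quasihyperbolic distance.\<close>

definition lip_path :: "real^'n \<Rightarrow> real^'n \<Rightarrow> (real \<Rightarrow> real^'n) \<Rightarrow> real \<Rightarrow> bool" where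
  "lip_path x y c L \<longleftrightarrow> 0 \<le> L \<and> (\<forall>s\<in>{0..L}. \<forall>t\<in>{0..L}. dist (c s) (c t) \<le> \<bar>s - t\<bar>) \<and>
     c 0 = x \<and> c L = y \<and> c ` {0..L} \<subseteq> \<Omega>"

definition qh_cost :: "(real \<Rightarrow> real^'n) \<Rightarrow> real \<Rightarrow> real" where
  "qh_cost c L = integral {0..L} (\<lambda>s. 1 / d (c s))"

definition minimal_path :: "real^'n \<Rightarrow> real^'n \<Rightarrow> (real \<Rightarrow> real^'n) \<Rightarrow> real \<Rightarrow> bool" where
  "minimal_path x y c L \<longleftrightarrow> lip_path x y c L \<and> (\<forall>c' L'. lip_path x y c' L' \<longrightarrow> qh_cost c L \<le> qh_cost c' L')"

lemma lip_pathD: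
  assumes "lip_path x y c L"
  shows "0 \<le> L" "\<And>s t. s \<in> {0..L} \<Longrightarrow> t \<in> {0..L} \<Longrightarrow> dist (c s) (c t) \<le> \<bar>s - t\<bar>" "c 0 = x" "c L = y"
    "\<And>s. s \<in> {0..L} \<Longrightarrow> c s \<in> \<Omega>" "\<And>s. s \<in> {0..L} \<Longrightarrow> 0 < d (c s)" "x \<in> \<Omega>" "y \<in> \<Omega>"
proof -
  show "\<And>s. s \<in> {0..L} \<Longrightarrow> c s \<in> \<Omega>" using assms by (auto simp: lip_path_def)
  then show "\<And>s. s \<in> {0..L} \<Longrightarrow> 0 < d (c s)" using d_pos by blast
qed (use assms in \<open>auto simp: lip_path_def\<close>)

lemma lip_path_continuous: "lip_path x y c L \<Longrightarrow> continuous_on {0..L} c"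
  by (rule lipschitz1_continuous_on) (use lip_pathD in blast)

lemma qh_cost_integrand_continuous:
  assumes "lip_path x y c L" shows "continuous_on {0..L} (\<lambda>s. 1 / d (c s))"
proof -
  have "continuous_on {0..L} (\<lambda>s. d (c s))"
    by (rule continuous_on_compose2[OF d_continuous lip_path_continuous[OF assms]]) auto
  then show ?thesis using lip_pathD(6)[OF assms] by (intro continuous_intros) force+
qed

lemma qh_cost_integrable: "lip_path x y c L \<Longrightarrow> (\<lambda>s. 1 / d (c s)) integrable_on {0..L}"
  by (intro integrable_continuous_real qh_cost_integrand_continuous)

lemma qh_cost_nonneg: "0 \<le> qh_cost c L"
proof (cases "(\<lambda>s. 1 / d (c s)) integrable_on {0..L}")
  case True
  then show ?thesis unfolding qh_cost_def by (intro Henstock_Kurzweil_Integration.integral_nonneg) (auto simp: d_nonneg)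
qed (simp add: qh_cost_def not_integrable_integral)

lemma rect_curve_lip_path:
  assumes "\<gamma> \<in> rect_curves \<Omega> x y"
  shows "lip_path x y (arc_length_param \<gamma>) (enn2real (curve_length \<gamma>))"
    "qh_length \<Omega> \<gamma> = ennreal (qh_cost (arc_length_param \<gamma>) (enn2real (curve_length \<gamma>)))"
proof -
  interpret rectifiable \<gamma>
    using assms by unfold_locales (auto simp: rect_curves_def curves_def path_def)
  let ?c = "arc_length_param \<gamma>"
  have g: "\<gamma> 0 = x" "\<gamma> 1 = y" "path_image \<gamma> \<subseteq> \<Omega>"
    using assms by (auto simp: rect_curves_def dest: curvesD)
  show lp: "lip_path x y ?c len"
    unfolding lip_path_def
  proof (intro conjI ballI)
    show "?c 0 = x" using arc_length_param_arc[of 0] arc_upto_0 g by simp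
    show "?c len = y" using arc_length_param_arc[of 1] arc_upto_1 g by simp
    show "?c ` {0..len} \<subseteq> \<Omega>"
    proof clarify
      fix s assume "s \<in> {0..len}"
      then obtain t where "t \<in> {0..1}" "arc_upto \<gamma> t = s" by (rule arc_surj)
      then show "?c s \<in> \<Omega>" using arc_length_param_arc[of t] g by (auto simp: path_image_def)
    qed
  qed (use arc_length_param_lipschitz in auto)
  show "qh_length \<Omega> \<gamma> = ennreal (qh_cost ?c len)"
    unfolding qh_length_def curve_integral_def qh_cost_def
    by (rule set_nn_integral_continuous[OF qh_cost_integrand_continuous[OF lp]]) (simp add: d_nonneg)
qed

text \<open>The curve may be shorter than \<open>L\<close>, since \<open>c\<close> may be slower than allowed; parametrized by arc
  length it costs less.\<close>

lemma lip_path_rect_curve: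
  assumes lp: "lip_path x y c L"
  defines "\<gamma> \<equiv> \<lambda>t. c (L * t)"
  shows "\<gamma> \<in> rect_curves \<Omega> x y" "qh_length \<Omega> \<gamma> \<le> ennreal (qh_cost c L)" "path_image \<gamma> = c ` {0..L}"
proof -
  note D = lip_pathD[OF lp]
  have in_L: "L * t \<in> {0..L}" if "t \<in> {0..1}" for t
    using that D(1) by (auto intro: mult_left_le)
  have lip: "dist (\<gamma> s) (\<gamma> t) \<le> L * (t - s)" if "0 \<le> s" "s \<le> t" "t \<le> 1" for s t
  proof -
    have "dist (\<gamma> s) (\<gamma> t) \<le> \<bar>L * s - L * t\<bar>"
      unfolding \<gamma>_def using that by (intro D(2) in_L) auto
    also have "\<dots> = L * (t - s)" using that D(1) mult_left_mono[of s t L]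
      by (simp add: abs_if algebra_simps)
    finally show ?thesis .
  qed
  have img: "(\<lambda>t. L * t) ` {0..1} = {0..L}"
    using image_mult_atLeastAtMost_if[of L 0 1] D(1) by (auto split: if_splits)
  show pi: "path_image \<gamma> = c ` {0..L}"
    unfolding path_image_def \<gamma>_def img[symmetric] by auto
  have var: "variation \<gamma> s t \<le> ennreal (L * (t - s))" if "0 \<le> s" "s \<le> t" "t \<le> 1" for s t
    using that lip D(1) by (intro variation_lipschitz) auto
  have "path \<gamma>" unfolding path_def \<gamma>_def
    by (rule continuous_on_compose2[OF lip_path_continuous[OF lp]]) (auto intro!: continuous_intros simp: img)
  moreover have "curve_length \<gamma> < \<infinity>"
    using var[of 0 1] by (auto simp: curve_length_eq_variation intro: le_less_trans)
  ultimately show rc: "\<gamma> \<in> rect_curves \<Omega> x y"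
    unfolding rect_curves_def curves_def using pi D(3-5) by (auto simp: pathstart_def pathfinish_def \<gamma>_def)
  interpret rectifiable \<gamma>
    using rc by unfold_locales (auto simp: rect_curves_def curves_def path_def)
  note lp' = rect_curve_lip_path[OF rc]
  show "qh_length \<Omega> \<gamma> \<le> ennreal (qh_cost c L)"
    unfolding lp'(2)
  proof (rule ennreal_leI)
    show "qh_cost (arc_length_param \<gamma>) len \<le> qh_cost c L"
    proof (cases "L = 0")
      case True
      then have "len = 0" using var[of 0 1] by (simp add: curve_length_eq_variation)
      then show ?thesis using True by (simp add: qh_cost_def)
    next
      case False
      then have L: "L > 0" using D(1) by simp
      define m where "m = (\<lambda>s. arc_upto \<gamma> (s / L))"
      have mL: "m L = len" using L by (simp add: m_def arc_upto_1)
      have "integral {0..m L} (\<lambda>s. 1 / d (arc_length_param \<gamma> s)) \<le>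
          integral {0..L} (\<lambda>s. 1 / d (arc_length_param \<gamma> (m s)))"
      proof (rule integral_lipschitz_reparam)
        show "m 0 = 0" by (simp add: m_def arc_upto_0)
        fix s t :: real assume st: "0 \<le> s" "s \<le> t" "t \<le> L"
        then have st': "0 \<le> s / L" "s / L \<le> t / L" "t / L \<le> 1" using L by (auto simp: divide_right_mono)
        have "enn2real (variation \<gamma> (s / L) (t / L)) \<le> L * (t / L - s / L)"
          using var[OF st'] st L by (intro enn2real_leI) (auto simp: divide_right_mono)
        then show "m s \<le> m t \<and> m t - m s \<le> t - s"
          using arc_upto_diff[OF st'] arc_upto_mono[OF st'] L by (simp add: m_def algebra_simps)
      qed (use D(1) qh_cost_integrand_continuous[OF lp'(1)] in \<open>auto simp: mL d_nonneg\<close>)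
      also have "\<dots> = integral {0..L} (\<lambda>s. 1 / d (c s))"
      proof (rule Henstock_Kurzweil_Integration.integral_cong)
        fix s assume "s \<in> {0..L}"
        then have "arc_length_param \<gamma> (m s) = \<gamma> (s / L)"
          unfolding m_def using L by (intro arc_length_param_arc) auto
        then show "1 / d (arc_length_param \<gamma> (m s)) = 1 / d (c s)" using L by (simp add: \<gamma>_def)
      qed
      finally show ?thesis by (simp add: qh_cost_def mL)
    qed
  qed
qed

lemma minimal_path_geodesic:
  assumes "minimal_path x y c L"
  shows "qh_geodesic \<Omega> x y (\<lambda>t. c (L * t))"
proof -
  note lp = lip_path_rect_curve[of x y c L]
  have *: "lip_path x y c L" using assms by (simp add: minimal_path_def)
  have "qh_dist \<Omega> x y = qh_length \<Omega> (\<lambda>t. c (L * t))"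
  proof (rule antisym)
    show "qh_dist \<Omega> x y \<le> qh_length \<Omega> (\<lambda>t. c (L * t))"
      unfolding qh_dist_def by (rule INF_lower[OF lp(1)[OF *]])
    show "qh_length \<Omega> (\<lambda>t. c (L * t)) \<le> qh_dist \<Omega> x y"
      unfolding qh_dist_def
    proof (rule INF_greatest)
      fix \<gamma> assume "\<gamma> \<in> rect_curves \<Omega> x y"
      note g = rect_curve_lip_path[OF this]
      have "qh_length \<Omega> (\<lambda>t. c (L * t)) \<le> ennreal (qh_cost c L)" by (rule lp(2)[OF *])
      also have "\<dots> \<le> qh_length \<Omega> \<gamma>"
        unfolding g(2) using assms g(1) by (intro ennreal_leI) (auto simp: minimal_path_def)
      finally show "qh_length \<Omega> (\<lambda>t. c (L * t)) \<le> qh_length \<Omega> \<gamma>" .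
    qed
  qed
  then show ?thesis using lp(1)[OF *] by (simp add: qh_geodesic_def)
qed

lemma ex_lip_path: "x \<in> \<Omega> \<Longrightarrow> y \<in> \<Omega> \<Longrightarrow> \<exists>c L. lip_path x y c L"
  using ex_rectifiable rect_curve_lip_path(1) by blast

lemma lip_path_join:
  assumes "lip_path x y c L" "lip_path y z c' L'"
  defines "c'' \<equiv> \<lambda>s. if s \<le> L then c s else c' (s - L)"
  shows "lip_path x z c'' (L + L')" "qh_cost c'' (L + L') = qh_cost c L + qh_cost c' L'"
proof -
  note D = lip_pathD[OF assms(1)] and D' = lip_pathD[OF assms(2)]
  have c''2: "c'' s = c' (s - L)" if "L \<le> s" for s
    using that D(4) D'(3) by (cases "s = L") (auto simp: c''_def)
  have dist_le: "dist (c'' s) (c'' t) \<le> \<bar>s - t\<bar>" if st: "0 \<le> s" "s \<le> t" "t \<le> L + L'" for s t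
  proof -
    consider "t \<le> L" | "L \<le> s" | "s \<le> L" "L \<le> t" by linarith
    then show ?thesis
    proof cases
      case 1 then show ?thesis using st D(2)[of s t] by (auto simp: c''_def)
    next
      case 2 then show ?thesis using st D'(2)[of "s - L" "t - L"] c''2 by auto
    next
      case 3
      have "dist (c'' s) (c'' t) \<le> dist (c s) (c L) + dist (c' 0) (c' (t - L))"
        using 3 c''2[of t] D(4) D'(3) dist_triangle by (auto simp: c''_def)
      also have "\<dots> \<le> \<bar>s - L\<bar> + \<bar>0 - (t - L)\<bar>"
        using 3 st D(1) D'(1) by (intro add_mono D(2) D'(2)) auto
      finally show ?thesis using 3 by simp
    qed
  qed
  have ends: "c'' 0 = x" "c'' (L + L') = z"
    using D D' c''2[of "L + L'"] by (auto simp: c''_def)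
  have inO: "c'' ` {0..L + L'} \<subseteq> \<Omega>"
    using D(5) D'(5) by (auto simp: c''_def)
  show lp: "lip_path x z c'' (L + L')"
    unfolding lip_path_def
  proof (intro conjI ballI ends inO)
    show "0 \<le> L + L'" using D(1) D'(1) by simp
    fix s t assume "s \<in> {0..L + L'}" "t \<in> {0..L + L'}"
    then show "dist (c'' s) (c'' t) \<le> \<bar>s - t\<bar>"
      using dist_le[of s t] dist_le[of t s] by (cases "s \<le> t") (auto simp: dist_commute)
  qed
  have "qh_cost c'' (L + L') = integral {0..L} (\<lambda>s. 1 / d (c'' s)) + integral {L..L + L'} (\<lambda>s. 1 / d (c'' s))"
    unfolding qh_cost_def using D(1) D'(1) qh_cost_integrable[OF lp]
    by (intro Henstock_Kurzweil_Integration.integral_combine[symmetric]) auto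
  also have "integral {0..L} (\<lambda>s. 1 / d (c'' s)) = qh_cost c L"
    unfolding qh_cost_def by (rule Henstock_Kurzweil_Integration.integral_cong) (simp add: c''_def)
  also have "integral {L..L + L'} (\<lambda>s. 1 / d (c'' s)) = integral {0..L'} (\<lambda>s. 1 / d (c'' (s + L)))"
    using integral_shift_real_ivl[of L L "L + L'" "\<lambda>s. 1 / d (c'' s)"] by simp
  also have "\<dots> = qh_cost c' L'"
    unfolding qh_cost_def by (rule Henstock_Kurzweil_Integration.integral_cong) (simp add: c''2)
  finally show "qh_cost c'' (L + L') = qh_cost c L + qh_cost c' L'" .
qed

lemma lip_path_split:
  assumes "lip_path x y c L" "s \<in> {0..L}"
  shows "lip_path x (c s) c s" "lip_path (c s) y (\<lambda>t. c (t + s)) (L - s)"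
    "qh_cost c L = qh_cost c s + qh_cost (\<lambda>t. c (t + s)) (L - s)"
proof -
  note D = lip_pathD[OF assms(1)]
  show "lip_path x (c s) c s"
    unfolding lip_path_def using assms(2) D by auto
  show "lip_path (c s) y (\<lambda>t. c (t + s)) (L - s)"
    unfolding lip_path_def
  proof (intro conjI ballI)
    fix a b assume "a \<in> {0..L - s}" "b \<in> {0..L - s}"
    then show "dist (c (a + s)) (c (b + s)) \<le> \<bar>a - b\<bar>"
      using D(2)[of "a + s" "b + s"] assms(2) by auto
  qed (use assms(2) D in auto)
  have "qh_cost c L = integral {0..s} (\<lambda>s. 1 / d (c s)) + integral {s..L} (\<lambda>s. 1 / d (c s))"
    unfolding qh_cost_def using assms(2) qh_cost_integrable[OF assms(1)]
    by (intro Henstock_Kurzweil_Integration.integral_combine[symmetric]) auto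
  then show "qh_cost c L = qh_cost c s + qh_cost (\<lambda>t. c (t + s)) (L - s)"
    unfolding qh_cost_def using integral_shift_real_ivl[of s s L "\<lambda>s. 1 / d (c s)"] by simp
qed

lemma minimal_path_initial:
  assumes "minimal_path x y c L" "s \<in> {0..L}" shows "minimal_path x (c s) c s"
proof -
  have lp: "lip_path x y c L" using assms(1) by (simp add: minimal_path_def)
  note S = lip_path_split[OF lp assms(2)]
  have "qh_cost c s \<le> qh_cost c' L'" if "lip_path x (c s) c' L'" for c' L'
  proof -
    note J = lip_path_join[OF that S(2)]
    have "qh_cost c L \<le> qh_cost c' L' + qh_cost (\<lambda>t. c (t + s)) (L - s)"
      using assms(1) J(1) unfolding J(2)[symmetric] minimal_path_def by blast
    then show ?thesis using S(3) by simp
  qed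
  then show ?thesis using S(1) by (simp add: minimal_path_def)
qed

lemma segment_lip_path:
  assumes "closed_segment x y \<subseteq> \<Omega>" "\<And>z. z \<in> closed_segment x y \<Longrightarrow> m \<le> d z" "0 < m"
  shows "\<exists>c L. lip_path x y c L \<and> qh_cost c L \<le> dist x y / m"
proof -
  define c where "c = (\<lambda>s. x + (s / dist x y) *\<^sub>R (y - x))"
  have seg: "c s \<in> closed_segment x y" if "s \<in> {0..dist x y}" for s
  proof -
    have "c s = (1 - s / dist x y) *\<^sub>R x + (s / dist x y) *\<^sub>R y" by (simp add: c_def algebra_simps)
    moreover have "s / dist x y \<le> 1" "0 \<le> s / dist x y"
      using that by (auto simp: divide_le_eq_1 zero_le_divide_iff)
    ultimately show ?thesis unfolding closed_segment_def by blast
  qed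
  have lp: "lip_path x y c (dist x y)"
    unfolding lip_path_def
  proof (intro conjI ballI)
    fix s t
    have "c s - c t = ((s - t) / dist x y) *\<^sub>R (y - x)" by (simp add: c_def algebra_simps diff_divide_distrib)
    then show "dist (c s) (c t) \<le> \<bar>s - t\<bar>"
      by (cases "x = y") (simp_all add: dist_norm norm_minus_commute)
  qed (use seg assms(1) in \<open>auto simp: c_def\<close>)
  have "qh_cost c (dist x y) \<le> integral {0..dist x y} (\<lambda>s. 1 / m)"
    unfolding qh_cost_def
    by (rule integral_le[OF qh_cost_integrable[OF lp]])
      (use seg assms in \<open>auto intro!: divide_left_mono intro: less_le_trans mult_pos_pos\<close>)
  then show ?thesis using lp by auto
qed

text \<open>As \<open>d\<close> grows at most at unit speed away from \<open>c s\<close>, the cost up to \<open>s\<close> is at least the logarithm of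
  \<open>d x / d (c s)\<close>.\<close>

lemma qh_cost_lower_bound:
  assumes "lip_path x y c L" "s \<in> {0..L}" shows "d x * exp (- qh_cost c L) \<le> d (c s)"
proof -
  note D = lip_pathD[OF assms(1)]
  define e where "e = d (c s)"
  have e: "e > 0" using D(6) assms(2) by (simp add: e_def)
  have "((\<lambda>u. 1 / (e + (s - u))) has_integral (- ln (e + (s - s)) - (- ln (e + (s - 0))))) {0..s}"
    by (rule fundamental_theorem_of_calculus)
      (use assms(2) e in \<open>auto simp flip: has_real_derivative_iff_has_vector_derivative intro!: derivative_eq_intros\<close>)
  then have int: "((\<lambda>u. 1 / (e + (s - u))) has_integral (ln (e + s) - ln e)) {0..s}" by simp
  have "ln (e + s) - ln e \<le> qh_cost c s"
    unfolding qh_cost_def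
  proof (rule has_integral_le[OF int integrable_integral])
    note S = lip_path_split(1)[OF assms]
    show "(\<lambda>s. 1 / d (c s)) integrable_on {0..s}" by (rule qh_cost_integrable[OF S])
    fix u assume u: "u \<in> {0..s}"
    have "d (c u) \<le> e + (s - u)"
      using d_lipschitz[of "c u" "c s"] D(2)[of u s] u assms(2) by (auto simp: e_def)
    moreover have "0 < d (c u)" using D(6) u assms(2) by auto
    ultimately show "1 / (e + (s - u)) \<le> 1 / d (c u)" by (intro divide_left_mono) auto
  qed
  also have "\<dots> \<le> qh_cost c L" using lip_path_split(3)[OF assms] qh_cost_nonneg[of "\<lambda>t. c (t + s)" "L - s"] by simp
  finally have "ln (e + s) \<le> ln e + qh_cost c L" by simp
  moreover have "d x \<le> e + s"
    using d_lipschitz[of "c 0" "c s"] D(2)[of 0 s] assms(2) D(3) by (auto simp: e_def)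
  moreover have "0 < d x" using D(7) d_pos by simp
  ultimately have "ln (d x) \<le> ln e + qh_cost c L" by (smt (verit) ln_le_cancel_iff)
  then have "exp (ln (d x)) \<le> exp (ln e + qh_cost c L)" by simp
  then have "d x \<le> e * exp (qh_cost c L)" using e \<open>0 < d x\<close> by (simp add: exp_add)
  then show ?thesis by (simp add: e_def exp_minus field_simps)
qed

lemma length_le_qh_cost:
  assumes "lip_path x y c L" "\<And>z. z \<in> \<Omega> \<Longrightarrow> d z \<le> D" shows "L \<le> D * qh_cost c L"
proof -
  note D = lip_pathD[OF assms(1)]
  have D0: "0 < D" using assms(2)[OF D(7)] d_pos[OF D(7)] by simp
  have "integral {0..L} (\<lambda>s. 1 / D) \<le> qh_cost c L"
    unfolding qh_cost_def
    by (rule integral_le[OF _ qh_cost_integrable[OF assms(1)]])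
      (use D(5,6) D0 assms(2) in \<open>auto intro!: divide_left_mono mult_pos_pos\<close>)
  then show ?thesis using D(1) D0 by (simp add: field_simps)
qed

end

section \<open>Existence and limits of minimal paths\<close>

context bounded_domain
begin

text \<open>Almost minimal paths with a common starting point and converging end points subconverge to a
  minimal path: their lengths are bounded, their quasihyperbolic lengths keep them away from the
  boundary, and Arzela--Ascoli applies to the paths extended by their end points.\<close>

lemma almost_minimal_limit:
  assumes x: "x \<in> \<Omega>" and p: "p \<in> \<Omega>"
    and lp: "\<And>n. lip_path x (P n) (C n) (l n)" and P: "P \<longlonglongrightarrow> p" and e: "e \<longlonglongrightarrow> 0"
    and almost: "\<And>n c' L'. lip_path x p c' L' \<Longrightarrow> qh_cost (C n) (l n) \<le> qh_cost c' L' + e n"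
  obtains r :: "nat \<Rightarrow> nat" and c L where "strict_mono r" "minimal_path x p c L" "(\<lambda>n. l (r n)) \<longlonglongrightarrow> L"
    "\<And>s \<sigma>. (\<And>n. 0 \<le> s n \<and> s n \<le> l (r n)) \<Longrightarrow> s \<longlonglongrightarrow> \<sigma> \<Longrightarrow> (\<lambda>n. C (r n) (s n)) \<longlonglongrightarrow> c \<sigma>"
proof -
  note D = lip_pathD[OF lp]
  obtain c1 L1 where lp1: "lip_path x p c1 L1" using ex_lip_path x p by blast
  obtain E where E: "\<And>n. e n \<le> E"
    using convergent_imp_bounded[OF e] by (metis bounded_iff rangeI real_norm_def abs_le_D1)
  define K where "K = qh_cost c1 L1 + E"
  have K: "qh_cost (C n) (l n) \<le> K" for n
    using almost[OF lp1, of n] E[of n] by (simp add: K_def)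
  have K0: "0 \<le> K" using K[of 0] qh_cost_nonneg[of "C 0" "l 0"] by linarith
  obtain Dm where Dm: "Dm > 0" "\<And>z. z \<in> \<Omega> \<Longrightarrow> d z \<le> Dm" using d_bounded by auto
  define M where "M = Dm * K"
  have lM: "l n \<le> M" for n
    using length_le_qh_cost[OF lp Dm(2)] mult_left_mono[OF K[of n], of Dm] Dm(1)
    by (smt (verit) M_def)
  have M0: "0 \<le> M" using K0 Dm by (simp add: M_def)
  \<comment> \<open>The paths rest at their end points, so as to be defined on a common interval.\<close>
  define F where "F n s = C n (min s (l n))" for n s
  have mem: "min s (l n) \<in> {0..l n}" if "s \<in> {0..M}" for s n using that D(1)[of n] by auto
  have FLip: "dist (F n s) (F n t) \<le> \<bar>s - t\<bar>" if "s \<in> {0..M}" "t \<in> {0..M}" for n s t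
    using D(2)[OF mem mem, of s t n] that unfolding F_def by (smt (verit) atLeastAtMost_iff)
  have Fin: "F n s \<in> \<Omega>" if "s \<in> {0..M}" for n s
    unfolding F_def by (rule D(5)[OF mem[OF that]])
  define d0 where "d0 = d x * exp (- K)"
  have d0: "d0 > 0" using d_pos[OF x] by (simp add: d0_def)
  have Fd: "d0 \<le> d (F n s)" if "s \<in> {0..M}" for n s
  proof -
    have "d0 \<le> d x * exp (- qh_cost (C n) (l n))"
      using K[of n] d_nonneg[of x] unfolding d0_def by (intro mult_left_mono) auto
    then show ?thesis using qh_cost_lower_bound[OF lp mem[OF that, of n]] by (simp add: F_def)
  qed
  have Fd': "d (F n s) \<noteq> 0" if "s \<in> {0..M}" for n s using Fd[OF that, of n] d0 by auto
  obtain B where B: "\<forall>z\<in>\<Omega>. norm z \<le> B" using bdd by (auto simp: bounded_iff)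
  obtain g and k :: "nat \<Rightarrow> nat" where g: "continuous_on {0..M} g" and k: "strict_mono k"
    and lim: "\<And>\<epsilon>. 0 < \<epsilon> \<Longrightarrow> \<exists>N. \<forall>n s. n \<ge> N \<and> s \<in> {0..M} \<longrightarrow> norm (F (k n) s - g s) < \<epsilon>"
  proof (rule Arzela_Ascoli[of "{0..M}" F B])
    show "norm (F n s) \<le> B" if "s \<in> {0..M}" for n s using B Fin[OF that] by blast
    show "\<exists>\<delta>>0. \<forall>n t. t \<in> {0..M} \<and> norm (s - t) < \<delta> \<longrightarrow> norm (F n s - F n t) < \<epsilon>"
      if "s \<in> {0..M}" "0 < \<epsilon>" for s \<epsilon>
      using FLip[OF that(1)] that(2) by (intro exI[of _ \<epsilon>]) (auto simp: dist_norm intro: le_less_trans)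
  qed (auto intro: that)
  have "bounded (range (l \<circ> k))" using lM D(1) by (auto simp: bounded_iff intro!: exI[of _ M])
  then obtain L and r2 :: "nat \<Rightarrow> nat" where r2: "strict_mono r2" and L: "((l \<circ> k) \<circ> r2) \<longlonglongrightarrow> L"
    using bounded_imp_convergent_subsequence[of "l \<circ> k"] by blast
  define r where "r = k \<circ> r2"
  have r: "strict_mono r" unfolding r_def by (rule strict_mono_o[OF k r2])
  have lL: "(\<lambda>n. l (r n)) \<longlonglongrightarrow> L" using L by (simp add: r_def o_def)
  have L0: "0 \<le> L" "L \<le> M"
    using LIMSEQ_le_const[OF lL, of 0] LIMSEQ_le_const2[OF lL, of M] D(1) lM by auto
  have ul: "\<exists>N. \<forall>n\<ge>N. \<forall>s\<in>{0..M}. dist (F (r n) s) (g s) < \<epsilon>" if \<epsilon>: "\<epsilon> > 0" for \<epsilon>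
  proof -
    obtain N where N: "\<forall>n s. n \<ge> N \<and> s \<in> {0..M} \<longrightarrow> norm (F (k n) s - g s) < \<epsilon>" using lim[OF \<epsilon>] by blast
    have "\<forall>n\<ge>N. N \<le> r2 n" using seq_suble[OF r2] by (meson order_trans)
    with N show ?thesis by (intro exI[of _ N]) (auto simp: r_def dist_norm)
  qed
  have conv: "(\<lambda>n. F (r n) (s n)) \<longlonglongrightarrow> g \<sigma>" if s: "\<And>n. s n \<in> {0..M}" "s \<longlonglongrightarrow> \<sigma>" for s \<sigma>
  proof -
    have \<sigma>: "\<sigma> \<in> {0..M}"
      using LIMSEQ_le_const[OF s(2), of 0] LIMSEQ_le_const2[OF s(2), of M] s(1) by auto
    have "(\<lambda>n. g (s n)) \<longlonglongrightarrow> g \<sigma>"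
      using continuous_on_tendsto_compose[OF g s(2) \<sigma>] s(1) by simp
    moreover have "(\<lambda>n. F (r n) (s n) - g (s n)) \<longlonglongrightarrow> 0"
      unfolding LIMSEQ_def using ul s(1) by (metis dist_norm diff_zero)
    ultimately show ?thesis using tendsto_add by fastforce
  qed
  have pt: "(\<lambda>n. F (r n) s) \<longlonglongrightarrow> g s" if "s \<in> {0..M}" for s using conv[of "\<lambda>_. s" s] that by simp
  have Pr: "(\<lambda>n. P (r n)) \<longlonglongrightarrow> p" using LIMSEQ_subseq_LIMSEQ[OF P r] by (simp add: o_def)
  have gd: "d0 \<le> d (g s)" if "s \<in> {0..M}" for s
  proof -
    have "(\<lambda>n. d (F (r n) s)) \<longlonglongrightarrow> d (g s)"
      using continuous_on_tendsto_compose[OF d_continuous[of UNIV] pt[OF that]] by simp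
    then show ?thesis using Fd[OF that] by (intro LIMSEQ_le_const) auto
  qed
  have gd': "d (g s) \<noteq> 0" if "s \<in> {0..M}" for s using gd[OF that] d0 by auto
  have gin: "g s \<in> \<Omega>" if "s \<in> {0..M}" for s
  proof (rule closure_d_pos)
    show "g s \<in> closure \<Omega>" unfolding closure_sequential using Fin[OF that] pt[OF that] by (intro exI[of _ "\<lambda>n. F (r n) s"]) auto
    show "0 < d (g s)" using gd[OF that] d0 by simp
  qed
  have gp: "g s = p" if "s \<in> {L..M}" for s
  proof -
    have lim0: "(\<lambda>n. \<bar>min s (l (r n)) - l (r n)\<bar>) \<longlonglongrightarrow> \<bar>min s L - L\<bar>"
      by (intro tendsto_intros lL)
    have "dist (F (r n) s) (P (r n)) \<le> \<bar>min s (l (r n)) - l (r n)\<bar>" for n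
      using D(2)[of "min s (l (r n))" "r n" "l (r n)"] D(1)[of "r n"] D(4)[of "r n"] that L0 by (simp add: F_def)
    moreover have "\<bar>min s L - L\<bar> = 0" using that by simp
    ultimately have "(\<lambda>n. dist (F (r n) s) (P (r n))) \<longlonglongrightarrow> 0"
      using lim0 by (intro tendsto_sandwich[OF _ _ tendsto_const lim0[unfolded \<open>\<bar>min s L - L\<bar> = 0\<close>]]) auto
    moreover have "(\<lambda>n. dist (F (r n) s) (P (r n))) \<longlonglongrightarrow> dist (g s) p"
      using that L0 by (intro tendsto_dist pt Pr) auto
    ultimately have "dist (g s) p = 0" using LIMSEQ_unique by blast
    then show ?thesis by simp
  qed
  have lpg: "lip_path x p g L"
    unfolding lip_path_def
  proof (intro conjI ballI)
    have "(\<lambda>n. F (r n) 0) = (\<lambda>_. x)" using D(1,3) by (auto simp: F_def min_def)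
    then show "g 0 = x" using pt[of 0] M0 LIMSEQ_unique[of "\<lambda>_. x" x] by auto
    fix s t assume st: "s \<in> {0..L}" "t \<in> {0..L}"
    then have st': "s \<in> {0..M}" "t \<in> {0..M}" using L0 by auto
    show "dist (g s) (g t) \<le> \<bar>s - t\<bar>"
      by (rule LIMSEQ_le_const2[OF tendsto_dist[OF pt[OF st'(1)] pt[OF st'(2)]]]) (use FLip st' in blast)
  qed (use L0 gp gin in auto)
  \<comment> \<open>The time spent at the end point contributes a known amount to the cost, so that the limit can be
    taken on a fixed interval.\<close>
  have cost_n: "qh_cost (C n) (l n) = integral {0..M} (\<lambda>s. 1 / d (F n s)) - (M - l n) / d (P n)" for n
  proof -
    have "(\<lambda>s. 1 / d (F n s)) integrable_on {0..M}"
    proof (rule integrable_continuous_real)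
      have "continuous_on {0..M} (F n)" by (rule lipschitz1_continuous_on) (use FLip in blast)
      then have "continuous_on {0..M} (\<lambda>s. d (F n s))"
        by (rule continuous_on_compose2[OF d_continuous[of UNIV]]) auto
      then show "continuous_on {0..M} (\<lambda>s. 1 / d (F n s))"
        using Fd' by (intro continuous_intros) auto
    qed
    then have "integral {0..l n} (\<lambda>s. 1 / d (F n s)) + integral {l n..M} (\<lambda>s. 1 / d (F n s)) =
        integral {0..M} (\<lambda>s. 1 / d (F n s))"
      by (intro Henstock_Kurzweil_Integration.integral_combine D(1) lM)
    moreover have "integral {0..l n} (\<lambda>s. 1 / d (F n s)) = qh_cost (C n) (l n)"
      unfolding qh_cost_def by (rule Henstock_Kurzweil_Integration.integral_cong) (simp add: F_def)
    moreover have "integral {l n..M} (\<lambda>s. 1 / d (F n s)) = integral {l n..M} (\<lambda>s. 1 / d (P n))"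
      by (rule Henstock_Kurzweil_Integration.integral_cong) (use D(4) in \<open>simp add: F_def\<close>)
    ultimately show ?thesis using lM[of n] by simp
  qed
  have cost_g: "qh_cost g L = integral {0..M} (\<lambda>s. 1 / d (g s)) - (M - L) / d p"
  proof -
    have "(\<lambda>s. 1 / d (g s)) integrable_on {0..M}"
    proof (rule integrable_continuous_real)
      have "continuous_on {0..M} (\<lambda>s. d (g s))"
        by (rule continuous_on_compose2[OF d_continuous[of UNIV] g]) auto
      then show "continuous_on {0..M} (\<lambda>s. 1 / d (g s))"
        using gd' by (intro continuous_intros) auto
    qed
    then have "integral {0..L} (\<lambda>s. 1 / d (g s)) + integral {L..M} (\<lambda>s. 1 / d (g s)) =
        integral {0..M} (\<lambda>s. 1 / d (g s))"
      using L0 by (intro Henstock_Kurzweil_Integration.integral_combine) auto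
    moreover have "integral {L..M} (\<lambda>s. 1 / d (g s)) = integral {L..M} (\<lambda>s. 1 / d p)"
      by (rule Henstock_Kurzweil_Integration.integral_cong) (simp add: gp)
    ultimately show ?thesis using L0 by (simp add: qh_cost_def)
  qed
  have "(\<lambda>n. integral {0..M} (\<lambda>s. 1 / d (F (r n) s))) \<longlonglongrightarrow> integral {0..M} (\<lambda>s. 1 / d (g s))"
  proof (rule dominated_convergence(2))
    show "(\<lambda>s. 1 / d (F (r n) s)) integrable_on {0..M}" for n
    proof (rule integrable_continuous_real)
      have "continuous_on {0..M} (F (r n))" by (rule lipschitz1_continuous_on) (use FLip in blast)
      then have "continuous_on {0..M} (\<lambda>s. d (F (r n) s))"
        by (rule continuous_on_compose2[OF d_continuous[of UNIV]]) auto
      then show "continuous_on {0..M} (\<lambda>s. 1 / d (F (r n) s))"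
        using Fd' by (intro continuous_intros) auto
    qed
    show "(\<lambda>s. 1 / d0) integrable_on {0..M}" by (rule integrable_const_ivl)
    show "norm (1 / d (F (r n) s)) \<le> 1 / d0" if "s \<in> {0..M}" for n s
      using Fd[OF that, of "r n"] d0 by (auto intro!: divide_left_mono simp: d_nonneg)
    show "(\<lambda>n. 1 / d (F (r n) s)) \<longlonglongrightarrow> 1 / d (g s)" if "s \<in> {0..M}" for s
      using gd[OF that] d0 continuous_on_tendsto_compose[OF d_continuous[of UNIV] pt[OF that]]
      by (intro tendsto_intros) auto
  qed
  moreover have "(\<lambda>n. d (P (r n))) \<longlonglongrightarrow> d p"
    using continuous_on_tendsto_compose[OF d_continuous[of UNIV] Pr] by simp
  ultimately have "(\<lambda>n. qh_cost (C (r n)) (l (r n))) \<longlonglongrightarrow> qh_cost g L"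
    unfolding cost_n cost_g using d_pos[OF p] by (intro tendsto_intros lL) auto
  moreover have "(\<lambda>n. e (r n)) \<longlonglongrightarrow> 0" using LIMSEQ_subseq_LIMSEQ[OF e r] by (simp add: o_def)
  ultimately have lim_cost: "(\<lambda>n. qh_cost (C (r n)) (l (r n)) - e (r n)) \<longlonglongrightarrow> qh_cost g L - 0"
    by (rule tendsto_diff)
  have "qh_cost g L \<le> qh_cost c' L'" if "lip_path x p c' L'" for c' L'
    using LIMSEQ_le_const2[OF lim_cost, of "qh_cost c' L'"] almost[OF that] by (simp add: algebra_simps)
  then have "minimal_path x p g L" using lpg by (simp add: minimal_path_def)
  moreover have "(\<lambda>n. C (r n) (s n)) \<longlonglongrightarrow> g \<sigma>" if "\<And>n. 0 \<le> s n \<and> s n \<le> l (r n)" "s \<longlonglongrightarrow> \<sigma>" for s \<sigma>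
  proof -
    have "s n \<in> {0..M}" for n using that(1)[of n] lM[of "r n"] by auto
    moreover have "F (r n) (s n) = C (r n) (s n)" for n using that(1)[of n] by (simp add: F_def min_def)
    ultimately show ?thesis using conv[of s \<sigma>] that(2) by simp
  qed
  ultimately show ?thesis using that r lL by blast
qed

lemma ex_minimal_path:
  assumes "x \<in> \<Omega>" "p \<in> \<Omega>" obtains c L where "minimal_path x p c L"
proof -
  define V where "V = Inf {qh_cost c L |c L. lip_path x p c L}"
  have ne: "{qh_cost c L |c L. lip_path x p c L} \<noteq> {}" using ex_lip_path assms by blast
  have bb: "bdd_below {qh_cost c L |c L. lip_path x p c L}"
    by (rule bdd_belowI[of _ 0]) (auto simp: qh_cost_nonneg)
  have "\<exists>c L. lip_path x p c L \<and> qh_cost c L < V + 1 / Suc n" for n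
    using cInf_lessD[OF ne, of "V + 1 / Suc n"] by (auto simp: V_def)
  then obtain C l where C: "\<And>n. lip_path x p (C n) (l n)" "\<And>n. qh_cost (C n) (l n) < V + 1 / Suc n" by metis
  have "qh_cost (C n) (l n) \<le> qh_cost c' L' + 1 / Suc n" if "lip_path x p c' L'" for n c' L'
  proof -
    have "V \<le> qh_cost c' L'" unfolding V_def by (rule cInf_lower[OF _ bb]) (use that in blast)
    then show ?thesis using C(2)[of n] by simp
  qed
  then show ?thesis
    by (rule almost_minimal_limit[OF assms C(1) tendsto_const LIMSEQ_inverse_real_of_nat[unfolded inverse_eq_divide]])
      (assumption, rule that)
qed

text \<open>Any path to \<open>p\<close>, continued by the segment from \<open>p\<close> to \<open>P n\<close>, competes with the minimal path to
  \<open>P n\<close>; hence the latter is almost minimal among the paths to \<open>p\<close>.\<close>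

lemma minimal_path_limit:
  assumes x: "x \<in> \<Omega>" and p: "p \<in> \<Omega>"
    and mp: "\<And>n. minimal_path x (P n) (C n) (l n)" and P: "P \<longlonglongrightarrow> p" and near: "\<And>n. dist (P n) p \<le> d p / 2"
  obtains r :: "nat \<Rightarrow> nat" and c L where "strict_mono r" "minimal_path x p c L" "(\<lambda>n. l (r n)) \<longlonglongrightarrow> L"
    "\<And>s \<sigma>. (\<And>n. 0 \<le> s n \<and> s n \<le> l (r n)) \<Longrightarrow> s \<longlonglongrightarrow> \<sigma> \<Longrightarrow> (\<lambda>n. C (r n) (s n)) \<longlonglongrightarrow> c \<sigma>"
proof (rule almost_minimal_limit[OF x p _ P])
  have lp: "\<And>n. lip_path x (P n) (C n) (l n)" using mp by (simp add: minimal_path_def)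
  show "lip_path x (P n) (C n) (l n)" for n by (rule lp)
  show "(\<lambda>n. dist p (P n) / (d p / 2)) \<longlonglongrightarrow> 0"
    using tendsto_divide[OF tendsto_dist[OF tendsto_const[of p] P] tendsto_const[of "d p / 2"]] d_pos[OF p] by simp
  fix n c' L' assume c': "lip_path x p c' L'"
  have seg: "d p / 2 \<le> d z" if "z \<in> closed_segment p (P n)" for z
  proof -
    have "dist p z \<le> d p / 2" using that near[of n]
      by (metis dist_in_closed_segment(1) dist_commute order_trans)
    then show ?thesis using d_lipschitz[of p z] by (simp add: abs_le_iff)
  qed
  have "closed_segment p (P n) \<subseteq> ball p (d p)"
    using near[of n] d_pos[OF p] by (intro closed_segment_subset) (auto simp: dist_commute)
  then have "closed_segment p (P n) \<subseteq> \<Omega>" using ball_d_subset[OF p] by blast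
  then obtain c2 L2 where c2: "lip_path p (P n) c2 L2" "qh_cost c2 L2 \<le> dist p (P n) / (d p / 2)"
    using segment_lip_path[OF _ seg] d_pos[OF p] by force
  note J = lip_path_join[OF c' c2(1)]
  have "qh_cost (C n) (l n) \<le> qh_cost c' L' + qh_cost c2 L2"
    using mp[of n] J(1) unfolding J(2)[symmetric] minimal_path_def by blast
  then show "qh_cost (C n) (l n) \<le> qh_cost c' L' + dist p (P n) / (d p / 2)" using c2(2) by simp
qed (use that in blast)

end

section \<open>Exit points of radial geodesics\<close>

text \<open>The bound on \<open>R\<close> makes the Gehring--Hayman properties available for two points at distance at least
  \<open>t\<close> from the boundary whose intrinsic distance is at most \<open>4 (c0 + 1)\<^sup>2 t + 2 c0 t\<close>.\<close>

locale radial_domain = bounded_domain \<Omega> for \<Omega> :: "(real^'n) set" +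
  fixes c0 c R :: real and x0 :: "real^'n"
  assumes c0: "1 \<le> c0" and c: "1 \<le> c" and x0: "x0 \<in> \<Omega>"
    and bs: "ball_separation c0 \<Omega>"
    and R: "ln (1 + (4 * (c0 + 1)^2 + 2 * c0)) \<le> R"
    and rad: "\<And>x y \<gamma>x \<gamma>y. x \<in> \<Omega> \<Longrightarrow> x \<noteq> x0 \<Longrightarrow> qh_geodesic \<Omega> x0 x \<gamma>x \<Longrightarrow>
      y \<in> \<Omega> \<Longrightarrow> y \<noteq> x0 \<Longrightarrow> qh_geodesic \<Omega> x0 y \<gamma>y \<Longrightarrow>
      (path_image \<gamma>x \<inter> path_image \<gamma>y) - {x0} \<noteq> {} \<Longrightarrow>
      length_GH c R \<Omega> (path_image \<gamma>x \<union> path_image \<gamma>y) \<or>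
      diam_GH c R \<Omega> (path_image \<gamma>x \<union> path_image \<gamma>y)"
begin

lemma minimal_path_separation:
  assumes "minimal_path x y g L" "s \<in> {0..L}"
    "A \<subseteq> \<Omega>" "connected A" "x \<in> A" "y \<in> A"
  shows "A \<inter> intrinsic_ball \<Omega> (g s) (c0 * d (g s)) \<noteq> {}"
proof
  assume disj: "A \<inter> intrinsic_ball \<Omega> (g s) (c0 * d (g s)) = {}"
  note D = lip_pathD[OF minimal_path_def[THEN iffD1, OF assms(1), THEN conjunct1]]
  have "curve_ball_separation c0 \<Omega> (\<lambda>u. g (L * u))"
    using bs minimal_path_geodesic[OF assms(1)] D(7,8) by (auto simp: ball_separation_def)
  moreover have "L * (s / L) = s" "0 \<le> s / L" "s / L \<le> 1"
    using assms(2) by (auto simp: divide_le_eq_1)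
  ultimately have "separates_in \<Omega> (intrinsic_ball \<Omega> (g s) (c0 * d (g s))) x y"
    unfolding curve_ball_separation_def Let_def
    using disj assms(5,6) D(3,4)
    by (elim allE[of _ "s / L"] allE[of _ 0] allE[of _ 1] impE) auto
  moreover have "connected_component (\<Omega> - intrinsic_ball \<Omega> (g s) (c0 * d (g s))) x y"
    unfolding connected_component_def using assms disj by blast
  ultimately show False by (simp add: separates_in_def)
qed

lemma d_less_intrinsic_ball:
  assumes "z \<in> \<Omega>" "w \<in> intrinsic_ball \<Omega> z (c0 * d z)" shows "d w < (1 + c0) * d z"
  using d_le_lm[OF assms(1), of w] assms(2) by (auto simp: intrinsic_ball_def algebra_simps)

text \<open>The separating ball around \<open>g s\<close> meets \<open>A\<close>, and its points are less than \<open>1 + c0\<close> times as far from the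
  boundary as \<open>g s\<close>.\<close>

lemma no_neck:
  assumes "minimal_path x y g L" "s \<in> {0..L}"
    "A \<subseteq> \<Omega>" "connected A" "x \<in> A" "y \<in> A" "\<And>z. z \<in> A \<Longrightarrow> h \<le> d z"
  shows "h / (1 + c0) \<le> d (g s)"
proof -
  obtain w where "w \<in> A" "w \<in> intrinsic_ball \<Omega> (g s) (c0 * d (g s))"
    using minimal_path_separation[OF assms(1-6)] by blast
  moreover have "g s \<in> \<Omega>" using assms(1,2) lip_pathD(5) by (auto simp: minimal_path_def)
  ultimately have "h < (1 + c0) * d (g s)"
    using assms(7) d_less_intrinsic_ball by (meson le_less_trans)
  then show ?thesis using c0 by (simp add: divide_le_eq mult.commute)
qed

lemma first_hit:
  fixes f :: "real \<Rightarrow> real"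
  assumes "continuous_on {0..L} f" "0 \<le> L" "h \<le> f 0" "\<not> (\<forall>s\<in>{0..L}. h < f s)"
  obtains s where "s \<in> {0..L}" "f s = (h::real)" "\<And>u. u \<in> {0..s} \<Longrightarrow> h \<le> f u"
proof -
  obtain b where b: "b \<in> {0..L}" "f b \<le> h" using assms(4) by (auto simp: not_less)
  have "closed {s \<in> {0..b}. f s = h}"
    by (rule continuous_closed_preimage_constant[OF continuous_on_subset[OF assms(1)]]) (use b in auto)
  moreover have "\<exists>s. 0 \<le> s \<and> s \<le> b \<and> f s = h"
    using b assms(3) by (intro IVT2') (auto intro: continuous_on_subset[OF assms(1)])
  then have ne: "{s \<in> {0..b}. f s = h} \<noteq> {}" by auto
  ultimately have "compact {s \<in> {0..b}. f s = h}"
    unfolding compact_eq_bounded_closed by (auto intro: bounded_subset[of "{0..b}"])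
  then obtain s where s: "s \<in> {0..b}" "f s = h" "\<And>u. u \<in> {0..b} \<Longrightarrow> f u = h \<Longrightarrow> s \<le> u"
    using compact_attains_inf[OF _ ne] by auto
  have "h \<le> f u" if u: "u \<in> {0..s}" for u
  proof (rule ccontr)
    assume "\<not> h \<le> f u"
    then have "\<exists>v. 0 \<le> v \<and> v \<le> u \<and> f v = h"
      using u s b assms(3) by (intro IVT2') (auto intro: continuous_on_subset[OF assms(1)])
    then obtain v where "0 \<le> v" "v \<le> u" "f v = h" by blast
    then have "v = s" using s u by force
    then show False using \<open>v \<le> u\<close> u \<open>\<not> h \<le> f u\<close> s by auto
  qed
  then show ?thesis using s b by (intro that[of s]) auto
qed

lemma diam_metric_nonneg: assumes "x \<in> \<Omega>" "y \<in> \<Omega>" shows "0 \<le> diam_metric \<Omega> x y"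
proof -
  have "curves \<Omega> x y \<noteq> {}" using ex_rectifiable[OF assms] by (auto simp: rect_curves_def)
  then show ?thesis unfolding diam_metric_def
    by (intro cINF_greatest) (auto intro!: diameter_ge_0 simp: curves_def bounded_path_image)
qed

end

locale radial_scale = radial_domain \<Omega> c0 c R x0
  for \<Omega> :: "(real^'n) set" and c0 c R x0 +
  fixes t :: real
  assumes t_pos: "0 < t"
    and small: "(1 + c0) * t + 4 * ((1 + c0)^2 * t) < d x0"
begin

text \<open>An intrinsic ball of radius \<open>c0 t\<close> around a point at distance \<open>t\<close> from the boundary contains only points
  at distance less than \<open>T\<close>. The same step leads from \<open>T\<close> to \<open>\<rho>\<close>, which equals \<open>T + c0 T\<close>: the ball of
  radius \<open>\<rho>\<close> around a point of a \<open>T\<close>-net of core points contains the separating balls of all nearby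
  core points at distance \<open>T\<close>. Linked core points are joined by a set at distance more than \<open>neck\<close> from
  the boundary that extends no further than \<open>reach\<close>.\<close>

definition "T = (1 + c0) * t"
definition "\<rho> = (1 + c0) * T"
definition "neck = t / (2 * (1 + c0))"
definition "reach = 2 * \<rho> + c0 * t + c * (4 * \<rho> + 2 * c0 * t)"

definition core :: "real^'n \<Rightarrow> bool" where
  "core m \<longleftrightarrow> (\<exists>g L. minimal_path x0 m g L \<and> (\<forall>s\<in>{0..L}. T \<le> d (g s)))"

text \<open>The point \<open>e\<close> need not be the first one at distance \<open>t\<close>; the conditions are chosen so as to be
  preserved by limits.\<close>

definition exit_point :: "real^'n \<Rightarrow> real^'n \<Rightarrow> bool" where
  "exit_point p e \<longleftrightarrow> (\<exists>g L s. minimal_path x0 p g L \<and> s \<in> {0..L} \<and> e = g s \<and>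
     (\<forall>u\<in>{0..s}. t \<le> d (g u)) \<and> (d e = t \<or> s = L))"

lemma scale_bounds: "0 < T" "t < T" "T \<le> \<rho>" "0 < \<rho>" "0 < neck" "neck < t / (1 + c0)" "neck < t" "T + 4 * \<rho> < d x0" "0 < c0 * t" "\<rho> = (1 + c0)^2 * t"
proof -
  show rho: "\<rho> = (1 + c0)^2 * t" by (simp add: \<rho>_def T_def power2_eq_square)
  show "0 < T" "t < T" "0 < neck" "neck < t / (1 + c0)" "0 < c0 * t" "neck < t"
    using t_pos c0 by (auto simp: T_def neck_def field_simps intro: add_pos_pos)
  show "0 < \<rho>" "T \<le> \<rho>" using t_pos c0 by (auto simp: \<rho>_def T_def intro: mult_right_mono[of 1, simplified])
  show "T + 4 * \<rho> < d x0" using small by (simp add: T_def rho)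
qed

lemma minimal_lip: "minimal_path x y g L \<Longrightarrow> lip_path x y g L"
  by (simp add: minimal_path_def)

lemma core_dom: "core m \<Longrightarrow> m \<in> \<Omega>"
  unfolding core_def using lip_pathD(8)[OF minimal_lip] by blast

lemma exit_dom: "exit_point p e \<Longrightarrow> e \<in> \<Omega>" and exit_d: "exit_point p e \<Longrightarrow> t \<le> d e"
  unfolding exit_point_def using lip_pathD(5)[OF minimal_lip] by force+

lemma ex_exit:
  assumes "p \<in> \<Omega>" shows "\<exists>e. exit_point p e"
proof -
  obtain g L where g: "minimal_path x0 p g L" using ex_minimal_path x0 assms by metis
  note D = lip_pathD[OF minimal_lip[OF g]]
  show ?thesis
  proof (cases "\<forall>s\<in>{0..L}. t < d (g s)")
    case True
    then have "exit_point p (g L)" unfolding exit_point_def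
      using g D(1) by (intro exI[of _ g] exI[of _ L] conjI) auto
    then show ?thesis by blast
  next
    case False
    have "continuous_on {0..L} (\<lambda>s. d (g s))"
      by (rule continuous_on_compose2[OF d_continuous[of UNIV] lip_path_continuous[OF minimal_lip[OF g]]]) auto
    moreover have "t \<le> d (g 0)" using D(3) scale_bounds by simp
    ultimately obtain s where s: "s \<in> {0..L}" "d (g s) = t" "\<And>u. u \<in> {0..s} \<Longrightarrow> t \<le> d (g u)"
      using first_hit[of L "\<lambda>s. d (g s)" t] D(1) False by metis
    then have "exit_point p (g s)" unfolding exit_point_def
      using g by (intro exI[of _ g] exI[of _ L] exI[of _ s] conjI) auto
    then show ?thesis by blast
  qed
qed

lemma core_exit: "core m \<Longrightarrow> exit_point m m"
  unfolding core_def exit_point_def using lip_pathD(1,4)[OF minimal_lip] scale_bounds(2) by fastforce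

text \<open>Otherwise the radial geodesic of the core point followed by the curve would join the centre to
  \<open>p\<close> outside a ball that has to separate them.\<close>

lemma exit_near_curve:
  assumes "core m" "\<gamma> \<in> curves \<Omega> m p" "exit_point p e"
  shows "\<exists>z\<in>path_image \<gamma>. lm e z < c0 * t"
proof -
  obtain g L s where g: "minimal_path x0 p g L" "s \<in> {0..L}" "e = g s" "d e = t \<or> s = L"
    using assms(3) by (auto simp: exit_point_def)
  show ?thesis
  proof (cases "d e = t")
    case False
    then have "e = p" using g lip_pathD(4)[OF minimal_lip[OF g(1)]] by auto
    then show ?thesis
      using curves_endpoints[OF assms(2)] lm_refl[of p] scale_bounds by (intro bexI[of _ p]) auto
  next
    case True
    obtain gm Lm where gm: "minimal_path x0 m gm Lm" "\<forall>s\<in>{0..Lm}. T \<le> d (gm s)"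
      using assms(1) by (auto simp: core_def)
    note D = lip_pathD[OF minimal_lip[OF gm(1)]]
    let ?A = "gm ` {0..Lm} \<union> path_image \<gamma>"
    have "m \<in> gm ` {0..Lm}" "x0 \<in> gm ` {0..Lm}" using D(1,3,4) by (auto intro: rev_image_eqI)
    moreover have "connected (gm ` {0..Lm})"
      by (intro connected_continuous_image lip_path_continuous[OF minimal_lip[OF gm(1)]]) auto
    ultimately have "connected ?A" "x0 \<in> ?A"
      using curves_endpoints[OF assms(2)] assms(2)
      by (auto intro!: connected_Un connected_path_image simp: curves_def)
    moreover have "?A \<subseteq> \<Omega>" "p \<in> ?A"
      using D(5) curvesD[OF assms(2)] curves_endpoints[OF assms(2)] by auto
    ultimately obtain w where w: "w \<in> ?A" "w \<in> intrinsic_ball \<Omega> e (c0 * d e)"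
      using minimal_path_separation[OF g(1,2), of ?A] g(3) by blast
    then have "d w < T" using d_less_intrinsic_ball[OF exit_dom[OF assms(3)] w(2)] True by (simp add: T_def)
    then have "w \<in> path_image \<gamma>" using w(1) gm(2) by force
    then show ?thesis using w(2) True by (auto simp: intrinsic_ball_def)
  qed
qed

text \<open>The two initial pieces form a connected set staying away from the boundary, so the geodesic
  between two exit points of the same point avoids the boundary; the Gehring--Hayman property keeps
  it short.\<close>

lemma exit_points_joined:
  assumes p: "p \<noteq> x0" and e: "exit_point p e" "exit_point p e'" and le: "lm e e' \<le> 4 * \<rho> + 2 * c0 * t"
  obtains A where "connected A" "e \<in> A" "e' \<in> A" "A \<subseteq> \<Omega>"
    "\<And>z. z \<in> A \<Longrightarrow> neck < d z \<and> dist e z \<le> c * (4 * \<rho> + 2 * c0 * t)"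
proof -
  obtain g L s where g: "minimal_path x0 p g L" "s \<in> {0..L}" "e = g s" "\<forall>u\<in>{0..s}. t \<le> d (g u)"
    using e(1) by (auto simp: exit_point_def)
  obtain g' L' s' where g': "minimal_path x0 p g' L'" "s' \<in> {0..L'}" "e' = g' s'" "\<forall>u\<in>{0..s'}. t \<le> d (g' u)"
    using e(2) by (auto simp: exit_point_def)
  note D = lip_pathD[OF minimal_lip[OF g(1)]] and D' = lip_pathD[OF minimal_lip[OF g'(1)]]
  obtain h M where h: "minimal_path e e' h M" using ex_minimal_path exit_dom e by metis
  note H = lip_pathD[OF minimal_lip[OF h]]
  let ?A = "g ` {0..s} \<union> g' ` {0..s'}"
  have "connected (g ` {0..s})" "connected (g' ` {0..s'})"
    using g(2) g'(2) lip_path_continuous[OF minimal_lip[OF g(1)]] lip_path_continuous[OF minimal_lip[OF g'(1)]]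
    by (auto intro!: connected_continuous_image elim: continuous_on_subset)
  moreover have "x0 \<in> g ` {0..s} \<inter> g' ` {0..s'}"
    using D(3) D'(3) g(2) g'(2) by (auto intro!: rev_image_eqI[of 0])
  ultimately have A: "connected ?A" by (intro connected_Un) auto
  have neck: "neck < d (h u)" if "u \<in> {0..M}" for u
  proof -
    have "t / (1 + c0) \<le> d (h u)"
      by (rule no_neck[OF h that _ A]) (use g g' D(5) D'(5) in \<open>auto intro: rev_image_eqI\<close>)
    then show ?thesis using scale_bounds(6) by simp
  qed
  let ?\<gamma> = "\<lambda>u. g (L * u)" and ?\<gamma>' = "\<lambda>u. g' (L' * u)" and ?h = "\<lambda>u. h (M * u)"
  note pi = lip_path_rect_curve(3)[OF minimal_lip[OF g(1)]] lip_path_rect_curve(3)[OF minimal_lip[OF g'(1)]]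
    lip_path_rect_curve(3)[OF minimal_lip[OF h]]
  have "p \<in> path_image ?\<gamma> \<inter> path_image ?\<gamma>'"
    unfolding pi using D(1,4) D'(1,4) by (auto intro: rev_image_eqI)
  then have GH: "length_GH c R \<Omega> (path_image ?\<gamma> \<union> path_image ?\<gamma>') \<or> diam_GH c R \<Omega> (path_image ?\<gamma> \<union> path_image ?\<gamma>')"
    using p by (intro rad[OF D(8) p minimal_path_geodesic[OF g(1)] D'(8) p minimal_path_geodesic[OF g'(1)]]) auto
  have eE: "e \<in> path_image ?\<gamma> \<union> path_image ?\<gamma>'" "e' \<in> path_image ?\<gamma> \<union> path_image ?\<gamma>'"
    unfolding pi using g g' by auto
  have mind: "t \<le> min (d e) (d e')" using exit_d e by simp
  have bound: "ln (1 + q / min (d e) (d e')) \<le> R" if "0 \<le> q" "q \<le> lm e e'" for q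
  proof -
    have "q / min (d e) (d e') \<le> (4 * \<rho> + 2 * c0 * t) / t"
      using that le mind t_pos by (intro frac_le) auto
    also have "\<dots> = 4 * (c0 + 1)^2 + 2 * c0" using t_pos scale_bounds(10) by (simp add: field_simps)
    finally have "ln (1 + q / min (d e) (d e')) \<le> ln (1 + (4 * (c0 + 1)^2 + 2 * c0))"
      using that(1) mind t_pos by (intro ln_mono) (auto intro!: add_pos_nonneg)
    then show ?thesis using R by simp
  qed
  have cl: "c * lm e e' \<le> c * (4 * \<rho> + 2 * c0 * t)" using le c by (intro mult_left_mono) auto
  have diam: "diameter (path_image ?h) \<le> c * (4 * \<rho> + 2 * c0 * t)"
    using GH
  proof
    assume "length_GH c R \<Omega> (path_image ?\<gamma> \<union> path_image ?\<gamma>')"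
    then have "curve_length ?h \<le> ennreal (c * lm e e')"
      using eE minimal_path_geodesic[OF h] bound[OF lm_nonneg order_refl]
      unfolding length_GH_def Lambda_dist_def by blast
    then have "diameter (path_image ?h) \<le> c * lm e e'"
      using lip_path_rect_curve(1)[OF minimal_lip[OF h]] c lm_nonneg[of e e']
      by (intro path_image_diameter_le_length) (auto simp: rect_curves_def)
    then show ?thesis using cl by simp
  next
    assume "diam_GH c R \<Omega> (path_image ?\<gamma> \<union> path_image ?\<gamma>')"
    then have "diameter (path_image ?h) \<le> c * diam_metric \<Omega> e e'"
      using eE minimal_path_geodesic[OF h] bound[OF diam_metric_nonneg diam_metric_le_lm] exit_dom e
      unfolding diam_GH_def Delta_dist_def by blast
    also have "\<dots> \<le> c * lm e e'" using c diam_metric_le_lm exit_dom e by (intro mult_left_mono) auto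
    finally show ?thesis using cl by simp
  qed
  show ?thesis
  proof (rule that[of "h ` {0..M}"])
    show "connected (h ` {0..M})"
      by (intro connected_continuous_image lip_path_continuous[OF minimal_lip[OF h]]) auto
    show "e \<in> h ` {0..M}" "e' \<in> h ` {0..M}" using H(1,3,4) by (auto intro: rev_image_eqI)
    show "h ` {0..M} \<subseteq> \<Omega>" using H(5) by auto
    fix z assume z: "z \<in> h ` {0..M}"
    have "bounded (path_image ?h)"
      using lip_path_rect_curve(1)[OF minimal_lip[OF h]] by (auto simp: rect_curves_def curves_def bounded_path_image)
    then have "dist e z \<le> diameter (path_image ?h)"
      using z H(1,3) pi(3) by (intro diameter_bounded_bound) (auto intro: rev_image_eqI)
    then show "neck < d z \<and> dist e z \<le> c * (4 * \<rho> + 2 * c0 * t)" using neck z diam by auto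
  qed
qed

text \<open>If the limit of the parameters lies before the end of the limit path, then the exit points are
  eventually at distance exactly \<open>t\<close>.\<close>

lemma exit_limit:
  assumes p: "p \<in> \<Omega>" and P: "P \<longlonglongrightarrow> p" "\<And>n. dist (P n) p \<le> d p / 2" and E: "\<And>n. exit_point (P n) (E n)"
  obtains r :: "nat \<Rightarrow> nat" and e where "strict_mono r" "(\<lambda>n. E (r n)) \<longlonglongrightarrow> e" "exit_point p e"
proof -
  have "\<exists>g L s. minimal_path x0 (P n) g L \<and> s \<in> {0..L} \<and> E n = g s \<and>
     (\<forall>u\<in>{0..s}. t \<le> d (g u)) \<and> (d (E n) = t \<or> s = L)" for n
    using E[of n] by (simp add: exit_point_def)
  then obtain C l s where C: "\<And>n. minimal_path x0 (P n) (C n) (l n)" "\<And>n. s n \<in> {0..l n}" "\<And>n. E n = C n (s n)"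
    "\<And>n u. u \<in> {0..s n} \<Longrightarrow> t \<le> d (C n u)" "\<And>n. d (E n) = t \<or> s n = l n"
    by metis
  obtain r1 :: "nat \<Rightarrow> nat" and L1 where r1: "strict_mono r1" "(\<lambda>n. l (r1 n)) \<longlonglongrightarrow> L1"
    by (rule minimal_path_limit[OF x0 p C(1) P])
  obtain B where "\<And>n. \<bar>l (r1 n)\<bar> \<le> B"
    using convergent_imp_bounded[OF r1(2)] by (auto simp: bounded_iff)
  moreover have "norm (s (r1 n)) \<le> \<bar>l (r1 n)\<bar>" for n using C(2)[of "r1 n"] by auto
  ultimately have "bounded (range (s \<circ> r1))" unfolding bounded_iff by (auto intro: order_trans)
  then obtain r2 :: "nat \<Rightarrow> nat" and \<sigma> where r2: "strict_mono r2" "((s \<circ> r1) \<circ> r2) \<longlonglongrightarrow> \<sigma>"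
    using bounded_imp_convergent_subsequence[of "s \<circ> r1"] by blast
  define q where "q = r1 \<circ> r2"
  have q: "strict_mono q" unfolding q_def by (rule strict_mono_o[OF r1(1) r2(1)])
  have Pq: "(\<lambda>n. P (q n)) \<longlonglongrightarrow> p" using LIMSEQ_subseq_LIMSEQ[OF P(1) q] by (simp add: o_def)
  have Cq: "minimal_path x0 (P (q n)) (C (q n)) (l (q n))" and Pq2: "dist (P (q n)) p \<le> d p / 2" for n
    by (rule C(1), rule P(2))
  obtain r3 :: "nat \<Rightarrow> nat" and g L where r3: "strict_mono r3" "minimal_path x0 p g L" "(\<lambda>n. l (q (r3 n))) \<longlonglongrightarrow> L"
    and lim: "\<And>s \<sigma>. (\<And>n. 0 \<le> s n \<and> s n \<le> l (q (r3 n))) \<Longrightarrow> s \<longlonglongrightarrow> \<sigma> \<Longrightarrow> (\<lambda>n. C (q (r3 n)) (s n)) \<longlonglongrightarrow> g \<sigma>"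
  proof (rule minimal_path_limit[OF x0 p Cq Pq Pq2], goal_cases)
    case (1 r c L)
    from 1(2-5) show ?case by (rule 1(1))
  qed
  define r where "r = q \<circ> r3"
  have r: "strict_mono r" unfolding r_def by (rule strict_mono_o[OF q r3(1)])
  have s\<sigma>: "(\<lambda>n. s (r n)) \<longlonglongrightarrow> \<sigma>"
    using LIMSEQ_subseq_LIMSEQ[OF r2(2) r3(1)] by (simp add: r_def q_def o_def)
  have lL: "(\<lambda>n. l (r n)) \<longlonglongrightarrow> L" using r3(3) by (simp add: r_def)
  have lim_u: "(\<lambda>n. C (r n) (min u (s (r n)))) \<longlonglongrightarrow> g (min u \<sigma>)" if "0 \<le> u" for u
    using lim[of "\<lambda>n. min u (s (r n))" "min u \<sigma>"] that C(2) tendsto_min[OF tendsto_const s\<sigma>]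
    by (auto simp: r_def min_le_iff_disj)
  have \<sigma>: "0 \<le> \<sigma>" "\<sigma> \<le> L"
    using LIMSEQ_le_const[OF s\<sigma>, of 0] LIMSEQ_le[OF s\<sigma> lL] C(2) by auto
  have lim_e: "(\<lambda>n. E (r n)) \<longlonglongrightarrow> g \<sigma>"
    using lim[of "\<lambda>n. s (r n)" \<sigma>] s\<sigma> C(2,3) by (simp add: r_def)
  have "d (g \<sigma>) = t \<or> \<sigma> = L"
  proof (cases "\<sigma> = L")
    case False
    then have "eventually (\<lambda>n. 0 < l (r n) - s (r n)) sequentially"
      using \<sigma> order_tendstoD(1)[OF tendsto_diff[OF lL s\<sigma>], of 0] by simp
    then have "eventually (\<lambda>n. d (E (r n)) = t) sequentially"
      by eventually_elim (metis C(5) diff_self less_irrefl)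
    moreover have "(\<lambda>n. d (E (r n))) \<longlonglongrightarrow> d (g \<sigma>)"
      using continuous_on_tendsto_compose[OF d_continuous[of UNIV] lim_e] by simp
    ultimately have "d (g \<sigma>) = t"
      by (metis LIMSEQ_unique tendsto_eventually)
    then show ?thesis by simp
  qed simp
  moreover have "t \<le> d (g u)" if u: "u \<in> {0..\<sigma>}" for u
  proof -
    have "(\<lambda>n. d (C (r n) (min u (s (r n))))) \<longlonglongrightarrow> d (g (min u \<sigma>))"
      using continuous_on_tendsto_compose[OF d_continuous[of UNIV] lim_u[of u]] u by simp
    then have "t \<le> d (g (min u \<sigma>))"
      by (rule LIMSEQ_le_const) (use C(2,4) u in auto)
    then show ?thesis using u by simp
  qed
  ultimately have "exit_point p (g \<sigma>)"
    unfolding exit_point_def using r3(2) \<sigma> by (intro exI[of _ g] exI[of _ L] exI[of _ \<sigma>]) auto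
  then show ?thesis using that r lim_e by blast
qed

text \<open>Along a short curve between two core points, the exit points of nearby points lie in the same
  component, because limits of exit points are exit points; hence the component never changes.\<close>

lemma core_points_linked:
  assumes m: "core m" "core m'" and lmm: "lm m m' < 2 * \<rho>" and dm: "d m + 2 * \<rho> < d x0"
  shows "connected_component {z \<in> \<Omega>. neck < d z \<and> dist m z < reach} m m'"
proof -
  define W where "W = {z \<in> \<Omega>. neck < d z \<and> dist m z < reach}"
  obtain \<beta> where \<beta>: "\<beta> \<in> curves \<Omega> m m'" "\<And>z. z \<in> path_image \<beta> \<Longrightarrow> lm m z < 2 * \<rho>"
    using lm_less_path[OF core_dom[OF m(1)] core_dom[OF m(2)] lmm] by metis
  have \<beta>dom: "p \<in> \<Omega>" if "p \<in> path_image \<beta>" for p using that \<beta>(1) by (auto simp: curves_def)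
  have not_x0: "p \<noteq> x0" if "p \<in> path_image \<beta>" for p
    using \<beta>(2)[OF that] d_le_lm[OF core_dom[OF m(1)] \<beta>dom[OF that]] dm by auto
  have exit_near: "lm m e < 2 * \<rho> + c0 * t" if p: "p \<in> path_image \<beta>" "exit_point p e" for p e
  proof -
    obtain v where v: "v \<in> {0..1}" "p = \<beta> v" using p by (auto simp: path_image_def)
    have sub: "subpath 0 v \<beta> \<in> curves \<Omega> m p"
      using curves_subpath[OF \<beta>(1), of 0 v] v curvesD[OF \<beta>(1)] by simp
    obtain z where z: "z \<in> path_image (subpath 0 v \<beta>)" "lm e z < c0 * t"
      using exit_near_curve[OF m(1) sub p(2)] by blast
    have "z \<in> path_image \<beta>" using z(1) path_image_subpath_subset[of 0 v \<beta>] v by auto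
    then show ?thesis
      using lm_triangle_less[OF core_dom[OF m(1)] \<beta>dom exit_dom[OF p(2)] \<beta>(2), of z "c0 * t"] z(2)
      by (simp add: lm_commute)
  qed
  have Y: "e \<in> W" if "p \<in> path_image \<beta>" "exit_point p e" for p e
  proof -
    have "dist m e < 2 * \<rho> + c0 * t"
      using exit_near[OF that] dist_le_lm[OF core_dom[OF m(1)] exit_dom[OF that(2)]] by simp
    moreover have "0 \<le> c * (4 * \<rho> + 2 * c0 * t)" using c scale_bounds by simp
    ultimately show ?thesis
      using exit_dom[OF that(2)] exit_d[OF that(2)] scale_bounds(7) by (auto simp: reach_def W_def)
  qed
  have same: "connected_component W e e'" if p: "p \<in> path_image \<beta>" "exit_point p e" "exit_point p e'" for p e e'
  proof -
    have "lm e e' < (2 * \<rho> + c0 * t) + (2 * \<rho> + c0 * t)"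
      using exit_near[OF p(1,2)] exit_near[OF p(1,3)]
      by (intro lm_triangle_less[OF exit_dom[OF p(2)] core_dom[OF m(1)] exit_dom[OF p(3)]]) (simp_all add: lm_commute)
    then obtain A where A: "connected A" "e \<in> A" "e' \<in> A" "A \<subseteq> \<Omega>"
        "\<And>z. z \<in> A \<Longrightarrow> neck < d z \<and> dist e z \<le> c * (4 * \<rho> + 2 * c0 * t)"
      using exit_points_joined[OF not_x0[OF p(1)] p(2,3)] by auto
    have "dist m e < 2 * \<rho> + c0 * t"
      using exit_near[OF p(1,2)] dist_le_lm[OF core_dom[OF m(1)] exit_dom[OF p(2)]] by simp
    then have "A \<subseteq> W"
      using A(4,5) dist_triangle_less_add[of m e "2 * \<rho> + c0 * t"] unfolding reach_def W_def
      by (smt (verit) dist_triangle mem_Collect_eq subset_iff)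
    then show ?thesis using A unfolding connected_component_def by blast
  qed
  have openY: "open W"
  proof -
    have "W = \<Omega> \<inter> {z. neck < d z} \<inter> ball m reach" by (auto simp: W_def)
    then show ?thesis
      using open_dom by (auto intro!: open_Int open_Collect_less continuous_intros d_continuous)
  qed
  \<comment> \<open>The points of the curve with an exit point in the component of \<open>m\<close>, and those with an exit point
    outside it. All exit points of one point lie in the same component, so that the two sets are
    disjoint.\<close>
  define In where "In = {p \<in> path_image \<beta>. \<exists>e. exit_point p e \<and> connected_component W m e}"
  define Out where "Out = {p \<in> path_image \<beta>. \<exists>e. exit_point p e \<and> \<not> connected_component W m e}"
  have seq: "\<exists>(r::nat\<Rightarrow>nat) e. strict_mono r \<and> exit_point p e \<and> p \<in> path_image \<beta> \<and>
      (\<exists>N. \<forall>n\<ge>N. connected_component W (E (r n)) e)"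
    if P: "\<And>n. P n \<in> path_image \<beta>" "P \<longlonglongrightarrow> p" "\<And>n. exit_point (P n) (E n)" for P E p
  proof -
    have "closed (path_image \<beta>)" using \<beta>(1) by (auto simp: curves_def closed_path_image)
    then have p: "p \<in> path_image \<beta>" using P closed_sequential_limits by blast
    then have po: "p \<in> \<Omega>" by (rule \<beta>dom)
    obtain N where N: "\<And>n. n \<ge> N \<Longrightarrow> dist (P n) p < d p / 2"
      using P(2) d_pos[OF po] unfolding LIMSEQ_def by (metis half_gt_zero)
    obtain r :: "nat \<Rightarrow> nat" and e where r: "strict_mono r" "(\<lambda>n. E (r n + N)) \<longlonglongrightarrow> e" "exit_point p e"
    proof (rule exit_limit[OF po, of "\<lambda>n. P (n + N)" "\<lambda>n. E (n + N)"])
      show "(\<lambda>n. P (n + N)) \<longlonglongrightarrow> p" using P(2) by (rule LIMSEQ_ignore_initial_segment)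
      show "dist (P (n + N)) p \<le> d p / 2" for n using N[of "n + N"] by simp
    qed (use P(3) that in auto)
    have eY: "e \<in> W" by (rule Y[OF p r(3)])
    have op: "open (connected_component_set W e)" by (rule open_connected_component[OF openY])
    have "e \<in> connected_component_set W e" by (rule CollectI, rule connected_component_refl[OF eY])
    then have "eventually (\<lambda>n. E (r n + N) \<in> connected_component_set W e) sequentially"
      using topological_tendstoD[OF r(2) op] by blast
    then obtain N' where "\<forall>n\<ge>N'. E (r n + N) \<in> connected_component_set W e"
      unfolding eventually_sequentially by blast
    then have "\<forall>n\<ge>N'. connected_component W (E (r n + N)) e"
      using connected_component_sym[of W e] by (simp only: mem_Collect_eq) blast
    moreover have "strict_mono (\<lambda>n. r n + N)" using r(1) by (simp add: strict_mono_def)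
    ultimately show ?thesis using r(3) p by blast
  qed
  have clIn: "closed In"
    unfolding closed_sequential_limits
  proof (intro allI impI)
    fix P p assume "(\<forall>n. P n \<in> In) \<and> P \<longlonglongrightarrow> p"
    then have Pb: "\<And>n. P n \<in> path_image \<beta>" and Pp: "P \<longlonglongrightarrow> p"
      and ex: "\<forall>n. \<exists>e. exit_point (P n) e \<and> connected_component W m e" unfolding In_def by blast+
    obtain E where E: "\<And>n. exit_point (P n) (E n)" "\<And>n. connected_component W m (E n)"
      using choice[OF ex] by blast
    obtain r :: "nat \<Rightarrow> nat" and e N where "exit_point p e" "p \<in> path_image \<beta>" "\<forall>n\<ge>N. connected_component W (E (r n)) e"
      using seq[OF Pb Pp E(1)] by blast
    moreover from this(3) have "connected_component W m e"
      using E(2)[of "r N"] connected_component_trans[of W m "E (r N)" e] by simp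
    ultimately show "p \<in> In" unfolding In_def by blast
  qed
  have clOut: "closed Out"
    unfolding closed_sequential_limits
  proof (intro allI impI)
    fix P p assume "(\<forall>n. P n \<in> Out) \<and> P \<longlonglongrightarrow> p"
    then have Pb: "\<And>n. P n \<in> path_image \<beta>" and Pp: "P \<longlonglongrightarrow> p"
      and ex: "\<forall>n. \<exists>e. exit_point (P n) e \<and> \<not> connected_component W m e" unfolding Out_def by blast+
    obtain E where E: "\<And>n. exit_point (P n) (E n)" "\<And>n. \<not> connected_component W m (E n)"
      using choice[OF ex] by blast
    obtain r :: "nat \<Rightarrow> nat" and e N where "exit_point p e" "p \<in> path_image \<beta>" "\<forall>n\<ge>N. connected_component W (E (r n)) e"
      using seq[OF Pb Pp E(1)] by blast
    moreover from this(3) have "\<not> connected_component W m e"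
      using E(2)[of "r N"] connected_component_trans[of W m e "E (r N)"] connected_component_sym[of W "E (r N)" e] by auto
    ultimately show "p \<in> Out" unfolding Out_def by blast
  qed
  have cov: "path_image \<beta> \<subseteq> In \<union> Out"
  proof
    fix p assume p: "p \<in> path_image \<beta>"
    then obtain e where "exit_point p e" using ex_exit \<beta>dom by blast
    then show "p \<in> In \<union> Out" using p unfolding In_def Out_def by blast
  qed
  have disj: "In \<inter> Out \<inter> path_image \<beta> = {}"
  proof (rule ccontr)
    assume "In \<inter> Out \<inter> path_image \<beta> \<noteq> {}"
    then obtain p e e' where "p \<in> path_image \<beta>" "exit_point p e" "connected_component W m e"
      "exit_point p e'" "\<not> connected_component W m e'" unfolding In_def Out_def by auto
    then show False using same connected_component_trans by metis
  qed
  have ends: "m \<in> path_image \<beta>" "m' \<in> path_image \<beta>" using curves_endpoints[OF \<beta>(1)] by auto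
  have "connected_component W m m"
    by (rule connected_component_refl[OF Y[OF ends(1) core_exit[OF m(1)]]])
  then have "m \<in> In" unfolding In_def using core_exit[OF m(1)] ends(1) by blast
  moreover have "connected (path_image \<beta>)" using \<beta>(1) by (auto simp: curves_def connected_path_image)
  ultimately have "Out \<inter> path_image \<beta> = {}"
    using connected_closedD[OF _ disj cov clIn clOut] ends by blast
  then have "connected_component W m m'" using core_exit[OF m(2)] ends(2) unfolding Out_def by blast
  then show ?thesis unfolding W_def .
qed

end

section \<open>Gates\<close>

context bounded_domain
begin

definition gate_of :: "(real^'n \<Rightarrow> (real^'n) option) \<Rightarrow> real^'n \<Rightarrow> real^'n" where
  "gate_of Z x = (case Z x of None \<Rightarrow> x | Some m \<Rightarrow> m)"

text \<open>The value \<open>None\<close> marks the points at which the mollification itself is going to be used, the value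
  \<open>Some m\<close> those at which its Taylor polynomial at the gate \<open>m\<close> is. In either case \<open>gate_of\<close> is the base
  point from which the function is developed, and the last condition links the base points that meet
  in a small connected set.\<close>

definition gate_system :: "real \<Rightarrow> real \<Rightarrow> real \<Rightarrow> real \<Rightarrow> (real^'n \<Rightarrow> (real^'n) option) \<Rightarrow> bool" where
  "gate_system a b s T Z \<longleftrightarrow> finite (range Z) \<and>
     (\<forall>x m. Z x = Some m \<longrightarrow> m \<in> \<Omega> \<and> T \<le> d m) \<and>
     (\<forall>x\<in>\<Omega>. Z x = None \<longrightarrow> T < d x) \<and>
     (\<forall>x\<in>\<Omega>. s \<le> d x \<longrightarrow> Z x = None) \<and>
     (\<forall>S x y. connected S \<and> S \<subseteq> \<Omega> \<and> (\<forall>u\<in>S. \<forall>v\<in>S. dist u v \<le> T / 2) \<and> x \<in> S \<and> y \<in> S \<and> Z x \<noteq> Z y \<longrightarrow>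
        connected_component {z \<in> \<Omega>. a * T < d z \<and> dist x z < b * T} (gate_of Z x) (gate_of Z y))"

text \<open>By compactness of the set of these points, finitely many curves, continued by short segments,
  suffice. Consequently a ball that stays close enough to the boundary does not separate any of them
  from the centre.\<close>

lemma connected_away_from_boundary:
  assumes x0: "x0 \<in> \<Omega>" and s: "0 < s"
  shows "\<exists>h>0. \<forall>x\<in>\<Omega>. s \<le> d x \<longrightarrow> (\<exists>A\<subseteq>\<Omega>. connected A \<and> x0 \<in> A \<and> x \<in> A \<and> (\<forall>z\<in>A. h \<le> d z))"
proof -
  define K where "K = {x \<in> \<Omega>. s \<le> d x}"
  have "K = closure \<Omega> \<inter> {x. s \<le> d x}"
    using closure_d_pos s closure_subset[of \<Omega>] by (force simp: K_def)
  moreover have "closed {x. s \<le> d x}"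
    by (intro closed_Collect_le continuous_intros d_continuous)
  ultimately have "compact K" using bdd by (simp add: compact_closure compact_Int_closed)
  have "\<exists>A h. A \<subseteq> \<Omega> \<and> connected A \<and> x0 \<in> A \<and> x \<in> A \<and> 0 < h \<and> (\<forall>z\<in>A. h \<le> d z)" if x: "x \<in> \<Omega>" for x
  proof -
    obtain \<gamma> where \<gamma>: "\<gamma> \<in> curves \<Omega> x0 x" using ex_rectifiable[OF x0 x] by (auto simp: rect_curves_def)
    have "compact (path_image \<gamma>)" "path_image \<gamma> \<noteq> {}" using \<gamma> by (auto simp: curves_def compact_path_image)
    then obtain w where w: "w \<in> path_image \<gamma>" "\<forall>z\<in>path_image \<gamma>. d w \<le> d z"
      using continuous_attains_inf[OF _ _ d_continuous] by metis
    have "path_image \<gamma> \<subseteq> \<Omega>" "connected (path_image \<gamma>)" using \<gamma> by (auto simp: curves_def connected_path_image)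
    then show ?thesis
      using w d_pos curves_endpoints[OF \<gamma>] by (intro exI[of _ "path_image \<gamma>"] exI[of _ "d w"]) auto
  qed
  then obtain A h where A: "\<And>x. x \<in> \<Omega> \<Longrightarrow> A x \<subseteq> \<Omega> \<and> connected (A x) \<and> x0 \<in> A x \<and> x \<in> A x \<and> 0 < h x \<and> (\<forall>z\<in>A x. h x \<le> d z)"
    by metis
  have "K \<subseteq> (\<Union>x\<in>K. ball x (s / 2))" using s by auto
  then obtain X where X: "X \<subseteq> K" "finite X" "K \<subseteq> (\<Union>x\<in>X. ball x (s / 2))"
    using compactE_image[OF \<open>compact K\<close>, of K "\<lambda>x. ball x (s / 2)"] by auto
  define h0 where "h0 = Min (insert (s / 2) (h ` X))"
  have h0: "h0 \<le> s / 2" "\<And>x. x \<in> X \<Longrightarrow> h0 \<le> h x"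
    unfolding h0_def by (rule Min_le; use X(2) in force)+
  have "0 < h0" unfolding h0_def using X s A by (subst Min_gr_iff) (auto simp: K_def)
  moreover have "\<exists>A\<subseteq>\<Omega>. connected A \<and> x0 \<in> A \<and> y \<in> A \<and> (\<forall>z\<in>A. h0 \<le> d z)" if y: "y \<in> \<Omega>" "s \<le> d y" for y
  proof -
    obtain x where x: "x \<in> X" "dist x y < s / 2" using X(3) y by (force simp: K_def)
    have xo: "x \<in> \<Omega>" "s \<le> d x" using x(1) X(1) by (auto simp: K_def)
    have seg: "dist x z \<le> s / 2" if "z \<in> closed_segment x y" for z
      using that x(2) by (metis dist_in_closed_segment(1) dist_commute less_eq_real_def order_trans)
    have "h0 \<le> d z" if "z \<in> A x \<union> closed_segment x y" for z
      using that A[OF xo(1)] h0(1) h0(2)[OF x(1)] seg[of z] xo(2) d_lipschitz[of x z] by fastforce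
    moreover have "closed_segment x y \<subseteq> ball x (d x)"
      using x(2) xo s by (intro closed_segment_subset) auto
    then have "A x \<union> closed_segment x y \<subseteq> \<Omega>" using A[OF xo(1)] ball_d_subset[OF xo(1)] by blast
    moreover have "connected (A x \<union> closed_segment x y)"
      using A[OF xo(1)] by (intro connected_Un) auto
    ultimately show ?thesis using A[OF xo(1)] by (intro exI[of _ "A x \<union> closed_segment x y"]) auto
  qed
  ultimately show ?thesis by blast
qed

end

text \<open>The value at \<open>x\<close> is the first set, in an arbitrary order, that contains \<open>x\<close>; so two points with
  different values cannot both lie in both sets.\<close>

lemma first_choice:
  assumes "finite G"
  obtains Z :: "'a \<Rightarrow> 'b option" where "\<And>x. Z x = None \<Longrightarrow> \<forall>m\<in>G. x \<notin> D m" "\<And>x m. Z x = Some m \<Longrightarrow> m \<in> G \<and> x \<in> D m"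
    "\<And>x y m m'. Z x = Some m \<Longrightarrow> Z y = Some m' \<Longrightarrow> x \<in> D m' \<Longrightarrow> y \<in> D m \<Longrightarrow> m = m'"
proof -
  obtain idx :: "'b \<Rightarrow> nat" where idx: "inj_on idx G"
    using finite_imp_inj_to_nat_seg[OF assms] by auto
  define Z where "Z x = (if \<exists>m\<in>G. x \<in> D m then Some (arg_min_on idx {m\<in>G. x \<in> D m}) else None)" for x
  have Z: "m \<in> G \<and> x \<in> D m \<and> (\<forall>m'\<in>G. x \<in> D m' \<longrightarrow> idx m \<le> idx m')" if "Z x = Some m" for x m
  proof -
    have ne: "{m\<in>G. x \<in> D m} \<noteq> {}" and m: "m = arg_min_on idx {m\<in>G. x \<in> D m}"
      using that by (auto simp: Z_def split: if_splits)
    show ?thesis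
      using arg_min_if_finite(1)[of "{m\<in>G. x \<in> D m}" idx] arg_min_least[of "{m\<in>G. x \<in> D m}" _ idx] ne assms
      unfolding m by auto
  qed
  show ?thesis
  proof (rule that[of Z])
    show "\<forall>m\<in>G. x \<notin> D m" if "Z x = None" for x using that by (auto simp: Z_def split: if_splits)
    show "m \<in> G \<and> x \<in> D m" if "Z x = Some m" for x m using Z[OF that] by simp
    show "m = m'" if "Z x = Some m" "Z y = Some m'" "x \<in> D m'" "y \<in> D m" for x y m m'
      using Z[OF that(1)] Z[OF that(2)] that(3,4) idx by (meson antisym inj_onD)
  qed
qed

context radial_scale
begin

definition behind :: "real^'n \<Rightarrow> (real^'n) set" where
  "behind m = \<Omega> - connected_component_set (\<Omega> - intrinsic_ball \<Omega> m \<rho>) x0"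

lemma centre_not_in_ball:
  assumes "m \<in> \<Omega>" "d m + r \<le> d x0" shows "x0 \<notin> intrinsic_ball \<Omega> m r"
  using d_le_lm[OF assms(1) x0] assms(2) by (auto simp: intrinsic_ball_def)

lemma behind_props:
  assumes m: "m \<in> \<Omega>" "d m = T"
  shows "open (behind m)" "connected (behind m)" "intrinsic_ball \<Omega> m \<rho> \<subseteq> behind m"
    "connected (\<Omega> - behind m)" "x0 \<in> \<Omega> - behind m"
proof -
  let ?B = "intrinsic_ball \<Omega> m \<rho>"
  have x0B: "x0 \<in> \<Omega> - ?B" using centre_not_in_ball[OF m(1), of \<rho>] m(2) scale_bounds x0 by auto
  have op: "open ?B" by (rule open_intrinsic_ball[OF m(1)])
  have "closedin (top_of_set (\<Omega> - ?B)) (connected_component_set (\<Omega> - ?B) x0)"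
    by (rule closedin_connected_component)
  moreover have "closedin (top_of_set \<Omega>) (\<Omega> - ?B)"
    using op open_dom by (intro closedin_diff) (auto simp: open_openin_trans intrinsic_ball_subset)
  ultimately have "closedin (top_of_set \<Omega>) (connected_component_set (\<Omega> - ?B) x0)"
    by (rule closedin_trans)
  then have "openin (top_of_set \<Omega>) (behind m)"
    unfolding behind_def by (intro openin_diff) auto
  then show "open (behind m)" using open_dom by (simp add: openin_open_eq)
  have "connected_component_set (\<Omega> - ?B) x0 \<in> components (\<Omega> - ?B)"
    using x0B by (rule componentsI)
  then show "connected (behind m)"
    unfolding behind_def using connected_intrinsic_ball[OF m(1)] conn_dom intrinsic_ball_subset
    by (intro component_diff_connected) auto
  show "?B \<subseteq> behind m"
    unfolding behind_def using connected_component_subset[of "\<Omega> - ?B" x0] intrinsic_ball_subset by auto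
  have eq: "\<Omega> - behind m = connected_component_set (\<Omega> - ?B) x0"
    unfolding behind_def using connected_component_subset[of "\<Omega> - ?B" x0] by auto
  show "connected (\<Omega> - behind m)" unfolding eq by simp
  show "x0 \<in> \<Omega> - behind m" unfolding eq using connected_component_refl[OF x0B] by simp
qed

lemma behind_subset: "behind m \<subseteq> \<Omega>" by (auto simp: behind_def)

lemma crossing_meets_ball:
  assumes "m \<in> \<Omega>" "d m = T" "connected S" "S \<subseteq> \<Omega>" "x \<in> S" "x \<in> behind m" "y \<in> S" "y \<notin> behind m"
  shows "S \<inter> intrinsic_ball \<Omega> m \<rho> \<noteq> {}"
proof
  assume disj: "S \<inter> intrinsic_ball \<Omega> m \<rho> = {}"
  have "connected_component (\<Omega> - intrinsic_ball \<Omega> m \<rho>) x0 y"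
    using assms(4,7,8) by (auto simp: behind_def)
  moreover have "connected_component (\<Omega> - intrinsic_ball \<Omega> m \<rho>) y x"
    unfolding connected_component_def using assms(3-5,7) disj by (intro exI[of _ S]) auto
  ultimately have "connected_component (\<Omega> - intrinsic_ball \<Omega> m \<rho>) x0 x"
    by (rule connected_component_trans)
  then show False using assms(6) by (simp add: behind_def)
qed

text \<open>A ball that meets the region behind another ball without meeting that ball lies in this region
  entirely, and then so does everything behind it. As neither region contains the other, neither ball meets the region behind the
  other one. If the two regions met, their connectedness would lead one of them across the other
  ball.\<close>

lemma behind_disjoint:
  assumes m: "m \<in> \<Omega>" "d m = T" and m': "m' \<in> \<Omega>" "d m' = T"
    and B: "intrinsic_ball \<Omega> m \<rho> \<inter> intrinsic_ball \<Omega> m' \<rho> = {}"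
    and max: "\<not> behind m \<subseteq> behind m'" "\<not> behind m' \<subseteq> behind m"
  shows "behind m \<inter> behind m' = {}"
proof -
  note P = behind_props[OF m] and P' = behind_props[OF m']
  have vis: "intrinsic_ball \<Omega> m2 \<rho> \<inter> behind m1 = {}"
    if m1: "m1 \<in> \<Omega>" "d m1 = T" and m2: "m2 \<in> \<Omega>" "d m2 = T"
      and disj: "intrinsic_ball \<Omega> m1 \<rho> \<inter> intrinsic_ball \<Omega> m2 \<rho> = {}" and n: "\<not> behind m2 \<subseteq> behind m1" for m1 m2
  proof (rule ccontr)
    assume "intrinsic_ball \<Omega> m2 \<rho> \<inter> behind m1 \<noteq> {}"
    then obtain x where x: "x \<in> intrinsic_ball \<Omega> m2 \<rho>" "x \<in> behind m1" by auto
    have sub: "intrinsic_ball \<Omega> m2 \<rho> \<subseteq> behind m1"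
    proof (rule ccontr)
      assume "\<not> intrinsic_ball \<Omega> m2 \<rho> \<subseteq> behind m1"
      then obtain y where y: "y \<in> intrinsic_ball \<Omega> m2 \<rho>" "y \<notin> behind m1" by auto
      show False
        using crossing_meets_ball[OF m1 connected_intrinsic_ball[OF m2(1)] intrinsic_ball_subset x y] disj by auto
    qed
    have "behind m2 \<subseteq> behind m1"
    proof
      fix z assume z: "z \<in> behind m2"
      show "z \<in> behind m1"
      proof (rule ccontr)
        assume nz: "z \<notin> behind m1"
        have "connected_component (\<Omega> - intrinsic_ball \<Omega> m2 \<rho>) x0 z"
          unfolding connected_component_def
          using behind_props(4,5)[OF m1] sub z nz behind_subset by (intro exI[of _ "\<Omega> - behind m1"]) auto
        then show False using z by (simp add: behind_def)
      qed
    qed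
    then show False using n by simp
  qed
  show ?thesis
  proof (rule ccontr)
    assume "behind m \<inter> behind m' \<noteq> {}"
    then obtain x where x: "x \<in> behind m" "x \<in> behind m'" by auto
    have c: "m \<in> intrinsic_ball \<Omega> m \<rho>" using m scale_bounds by (intro center_in_intrinsic_ball) auto
    then have "m \<notin> behind m'" using vis[OF m' m] B max by auto
    moreover have "m \<in> behind m" using c P(3) by auto
    ultimately have "behind m \<inter> intrinsic_ball \<Omega> m' \<rho> \<noteq> {}"
      using crossing_meets_ball[OF m' P(2) behind_subset x] by auto
    then show False using vis[OF m m' B max(2)] by auto
  qed
qed

lemma gate_net:
  obtains N where "finite N" "\<And>m. m \<in> N \<Longrightarrow> core m \<and> d m = T"
    "\<And>m. core m \<Longrightarrow> d m = T \<Longrightarrow> \<exists>m'\<in>N. dist m m' < T"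
proof -
  define S where "S = {m. core m \<and> d m = T}"
  have "bounded S" by (rule bounded_subset[OF bdd]) (auto simp: S_def core_dom)
  then have "compact (closure S)" by (simp add: compact_closure)
  moreover have "closure S \<subseteq> (\<Union>m\<in>S. ball m T)"
  proof
    fix x assume "x \<in> closure S"
    then obtain y where "y \<in> S" "dist y x < T" using scale_bounds(1) closure_approachable by blast
    then show "x \<in> (\<Union>m\<in>S. ball m T)" by auto
  qed
  ultimately obtain N where "N \<subseteq> S" "finite N" "closure S \<subseteq> (\<Union>m\<in>N. ball m T)"
    using compactE_image[of "closure S" S "\<lambda>m. ball m T"] by auto
  then show ?thesis
    using closure_subset[of S] by (intro that[of N]) (auto simp: S_def dist_commute subset_iff)
qed

text \<open>Otherwise the geodesic from \<open>x0\<close> to \<open>x\<close> comes down to distance \<open>T\<close> at a core point, whose separating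
  ball is contained in the ball of a point of the net; this ball then separates \<open>x\<close> from \<open>x0\<close>.\<close>

lemma behind_some_gate:
  assumes N: "\<And>m. m \<in> N \<Longrightarrow> core m \<and> d m = T" "\<And>m. core m \<Longrightarrow> d m = T \<Longrightarrow> \<exists>m'\<in>N. dist m m' < T"
    and x: "x \<in> \<Omega>" "\<And>m. m \<in> N \<Longrightarrow> x \<notin> behind m"
  shows "core x \<and> T < d x"
proof -
  obtain g L where g: "minimal_path x0 x g L" using ex_minimal_path x0 x(1) by metis
  note D = lip_pathD[OF minimal_lip[OF g]]
  have all: "\<forall>s\<in>{0..L}. T < d (g s)"
  proof (rule ccontr)
    assume n: "\<not> (\<forall>s\<in>{0..L}. T < d (g s))"
    have "continuous_on {0..L} (\<lambda>s. d (g s))"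
      by (rule continuous_on_compose2[OF d_continuous[of UNIV] lip_path_continuous[OF minimal_lip[OF g]]]) auto
    moreover have "T \<le> d (g 0)" using D(3) scale_bounds by simp
    ultimately obtain s where s: "s \<in> {0..L}" "d (g s) = T" "\<And>u. u \<in> {0..s} \<Longrightarrow> T \<le> d (g u)"
      using first_hit[of L "\<lambda>s. d (g s)" T] D(1) n by metis
    have "core (g s)" unfolding core_def using minimal_path_initial[OF g s(1)] s(3) by blast
    then obtain m where m: "m \<in> N" "dist (g s) m < T" using N(2) s(2) by blast
    have md: "m \<in> \<Omega>" "d m = T" using N(1)[OF m(1)] core_dom by auto
    have gs: "g s \<in> \<Omega>" by (rule D(5)[OF s(1)])
    have sub: "intrinsic_ball \<Omega> (g s) (c0 * d (g s)) \<subseteq> intrinsic_ball \<Omega> m \<rho>"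
    proof
      fix w assume w: "w \<in> intrinsic_ball \<Omega> (g s) (c0 * d (g s))"
      have "lm m (g s) < T" using lm_ball(2)[OF gs, of m] m(2) s(2) by (simp add: lm_commute)
      then have "lm m w < T + c0 * T"
        using w s(2) by (intro lm_triangle_less[OF md(1) gs]) (auto simp: intrinsic_ball_def)
      then show "w \<in> intrinsic_ball \<Omega> m \<rho>" using w by (auto simp: intrinsic_ball_def \<rho>_def algebra_simps)
    qed
    have "connected_component (\<Omega> - intrinsic_ball \<Omega> m \<rho>) x0 x"
      using x(1) x(2)[OF m(1)] by (simp add: behind_def)
    then obtain A where A: "connected A" "A \<subseteq> \<Omega> - intrinsic_ball \<Omega> m \<rho>" "x0 \<in> A" "x \<in> A"
      unfolding connected_component_def by blast
    then show False using minimal_path_separation[OF g s(1), of A] sub by blast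
  qed
  have "core x" unfolding core_def using g all by (force intro: less_imp_le)
  moreover have "T < d x" using all D(1,4) by force
  ultimately show ?thesis by simp
qed

lemma maximal_gates:
  obtains G where "finite G" "\<And>m. m \<in> G \<Longrightarrow> core m \<and> d m = T"
    "\<And>x. x \<in> \<Omega> \<Longrightarrow> \<forall>m\<in>G. x \<notin> behind m \<Longrightarrow> core x \<and> T < d x"
    "\<And>m m'. m \<in> G \<Longrightarrow> m' \<in> G \<Longrightarrow> behind m \<subseteq> behind m' \<Longrightarrow> m = m'"
proof -
  obtain N where N: "finite N" "\<And>m. m \<in> N \<Longrightarrow> core m \<and> d m = T"
    "\<And>m. core m \<Longrightarrow> d m = T \<Longrightarrow> \<exists>m'\<in>N. dist m m' < T" by (rule gate_net) (assumption | rule that)+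
  define X where "X = {D \<in> behind ` N. \<forall>D'\<in>behind ` N. D \<subseteq> D' \<longrightarrow> D = D'}"
  define G where "G = inv_into N behind ` X"
  have X: "inv_into N behind D \<in> N" "behind (inv_into N behind D) = D" if "D \<in> X" for D
    using that by (auto simp: X_def inv_into_into f_inv_into_f)
  show ?thesis
  proof (rule that[of G])
    show "finite G" using N(1) by (simp add: G_def X_def)
    show "core m \<and> d m = T" if "m \<in> G" for m using that X(1) N(2) by (auto simp: G_def)
    fix x assume x: "x \<in> \<Omega>" "\<forall>m\<in>G. x \<notin> behind m"
    have "x \<notin> behind m" if "m \<in> N" for m
    proof
      assume xm: "x \<in> behind m"
      obtain D where D: "D \<in> behind ` N" "behind m \<subseteq> D" "\<forall>D'\<in>behind ` N. D \<subseteq> D' \<longrightarrow> D = D'"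
        using finite_has_maximal2[of "behind ` N" "behind m"] N(1) \<open>m \<in> N\<close> by auto
      then have "D \<in> X" by (auto simp: X_def)
      then show False using x(2) X(2) xm D(2) by (auto simp: G_def)
    qed
    then show "core x \<and> T < d x" using behind_some_gate[OF N(2,3) x(1)] by blast
  next
    fix m m' assume mm: "m \<in> G" "m' \<in> G" "behind m \<subseteq> behind m'"
    then obtain D D' where DD: "D \<in> X" "m = inv_into N behind D" "D' \<in> X" "m' = inv_into N behind D'" by (auto simp: G_def)
    then have "D \<subseteq> D'" using mm(3) X(2) by simp
    then have "D = D'" using DD(1,3) by (auto simp: X_def)
    then show "m = m'" using DD by simp
  qed
qed

text \<open>A connected set of small diameter that meets the regions behind two gates either is covered by such
  regions, and then a chain of overlapping regions with linked gates leads from one to the other, or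
  it contains a point behind no gate, which is a core point and linked to both.\<close>

lemma gate_assignment:
  assumes far: "\<And>m x. m \<in> \<Omega> \<Longrightarrow> d m = T \<Longrightarrow> x \<in> \<Omega> \<Longrightarrow> s \<le> d x \<Longrightarrow> x \<notin> behind m"
  shows "\<exists>Z. gate_system (neck / T) ((reach + T + 3 * \<rho>) / T) s T Z"
proof -
  obtain G where G: "finite G" "\<And>m. m \<in> G \<Longrightarrow> core m \<and> d m = T"
    "\<And>x. x \<in> \<Omega> \<Longrightarrow> \<forall>m\<in>G. x \<notin> behind m \<Longrightarrow> core x \<and> T < d x"
    "\<And>m m'. m \<in> G \<Longrightarrow> m' \<in> G \<Longrightarrow> behind m \<subseteq> behind m' \<Longrightarrow> m = m'"
    by (rule maximal_gates) (assumption | rule that)+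
  have GO: "m \<in> \<Omega>" "d m = T" if "m \<in> G" for m using G(2)[OF that] core_dom by auto
  obtain Z :: "real^'n \<Rightarrow> (real^'n) option" where Z: "\<And>x. Z x = None \<Longrightarrow> \<forall>m\<in>G. x \<notin> behind m"
    "\<And>x m. Z x = Some m \<Longrightarrow> m \<in> G \<and> x \<in> behind m"
    "\<And>x y m m'. Z x = Some m \<Longrightarrow> Z y = Some m' \<Longrightarrow> x \<in> behind m' \<Longrightarrow> y \<in> behind m \<Longrightarrow> m = m'"
    by (rule first_choice[OF G(1), where D = behind]) (assumption | rule that)+
  have "range Z \<subseteq> insert None (Some ` G)" using Z(2) by (auto simp: image_iff) (metis not_None_eq)
  then have fin: "finite (range Z)" by (rule finite_subset) (use G(1) in auto)
  define b where "b = reach + T + 3 * \<rho>"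
  have main: "connected_component {z \<in> \<Omega>. neck < d z \<and> dist x z < b} (gate_of Z x) (gate_of Z y)"
    if S: "connected S" "S \<subseteq> \<Omega>" "\<And>u v. u \<in> S \<Longrightarrow> v \<in> S \<Longrightarrow> dist u v \<le> T / 2" "x \<in> S" "y \<in> S" "Z x \<noteq> Z y"
    for S x y
  proof -
    define W where "W = {z \<in> \<Omega>. neck < d z \<and> dist x z < b}"
    have link: "connected_component W m m'"
      if "core m" "core m'" "lm m m' < 2 * \<rho>" "d m = T" "dist x m \<le> T + 3 * \<rho>" for m m'
    proof -
      have "d m + 2 * \<rho> < d x0" using that(4) scale_bounds by simp
      then have "connected_component {z \<in> \<Omega>. neck < d z \<and> dist m z < reach} m m'"
        using core_points_linked that by blast
      moreover have "{z \<in> \<Omega>. neck < d z \<and> dist m z < reach} \<subseteq> W"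
        using that(5) unfolding W_def b_def by (auto intro: le_less_trans[OF dist_triangle[of _ _ m]])
      ultimately show ?thesis using connected_component_mono by blast
    qed
    have near: "dist x m < T / 2 + \<rho>" if m: "m \<in> G" "S \<inter> intrinsic_ball \<Omega> m \<rho> \<noteq> {}" for m
    proof -
      obtain z where z: "z \<in> S" "z \<in> \<Omega>" "lm m z < \<rho>" using m(2) by (auto simp: intrinsic_ball_def)
      then have "dist m z < \<rho>" using dist_le_lm[of m z] GO[OF m(1)] by simp
      then show ?thesis using S(3)[OF S(4) z(1)] dist_triangle[of x m z] by (simp add: dist_commute)
    qed
    have balls: "lm m m' < 2 * \<rho>" if m: "m \<in> G" "m' \<in> G" "intrinsic_ball \<Omega> m \<rho> \<inter> intrinsic_ball \<Omega> m' \<rho> \<noteq> {}" for m m'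
    proof -
      obtain z where "z \<in> \<Omega>" "lm m z < \<rho>" "lm m' z < \<rho>" using m(3) by (auto simp: intrinsic_ball_def)
      then show ?thesis using lm_triangle_less[of m z m' \<rho> \<rho>] GO m(1,2) by (simp add: lm_commute)
    qed
    have overlap: "lm m m' < 2 * \<rho>" if m: "m \<in> G" "m' \<in> G" "behind m \<inter> behind m' \<noteq> {}" for m m'
    proof (cases "m = m'")
      case True
      then show ?thesis using lm_refl GO m(1) scale_bounds by simp
    next
      case False
      then have "\<not> behind m \<subseteq> behind m'" "\<not> behind m' \<subseteq> behind m" using G(4) m(1,2) by blast+
      then have "intrinsic_ball \<Omega> m \<rho> \<inter> intrinsic_ball \<Omega> m' \<rho> \<noteq> {}"
        using behind_disjoint[of m m'] GO m by blast
      then show ?thesis using balls m(1,2) by blast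
    qed
    have core_case: "connected_component W w m" if w: "w \<in> S" "Z w = None" and m: "m \<in> G" "v \<in> S" "v \<in> behind m" for w m v
    proof -
      have cw: "core w" "T < d w" using G(3)[of w] Z(1)[OF w(2)] w(1) S(2) by auto
      have "w \<notin> behind m" using Z(1)[OF w(2)] m(1) by blast
      then have ne: "S \<inter> intrinsic_ball \<Omega> m \<rho> \<noteq> {}"
        using crossing_meets_ball[OF GO[OF m(1)] S(1,2) m(2,3) w(1)] by blast
      then obtain z where z: "z \<in> S" "z \<in> \<Omega>" "lm m z < \<rho>" by (auto simp: intrinsic_ball_def)
      have wO: "w \<in> \<Omega>" using w(1) S(2) by auto
      have "dist w z < d w" using S(3)[OF w(1) z(1)] cw scale_bounds(1) by simp
      then have "lm w z \<le> T / 2" using lm_ball(2)[OF wO] S(3)[OF w(1) z(1)] by fastforce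
      then have "lm z w < \<rho>" using scale_bounds by (simp add: lm_commute)
      then have "lm m w < \<rho> + \<rho>"
        using z GO[OF m(1)] wO by (intro lm_triangle_less[of m z w]) auto
      then have "lm m w < 2 * \<rho>" by simp
      then have "connected_component W m w"
        using near[OF m(1) ne] G(2)[OF m(1)] cw scale_bounds(1,4) by (intro link) auto
      then show ?thesis by (rule connected_component_sym)
    qed
    have cover_case: "connected_component W m m'"
      if cov: "\<And>w. w \<in> S \<Longrightarrow> Z w \<noteq> None" and m: "Z x = Some m" "Z y = Some m'" for m m'
    proof -
      have mG: "m \<in> G" "x \<in> behind m" "m' \<in> G" "y \<in> behind m'" using Z(2) m by auto
      have mm: "m \<noteq> m'" using m S(6) by auto
      \<comment> \<open>If the region behind \<open>m''\<close> contains all of \<open>S\<close>, it overlaps another region that \<open>S\<close> leaves: one of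
        \<open>m\<close>, \<open>m'\<close> has such a region, because both regions cannot contain both \<open>x\<close> and \<open>y\<close>.\<close>
      have near_m: "dist x m'' < T + 3 * \<rho>" if m'': "m'' \<in> G" "S \<inter> behind m'' \<noteq> {}" for m''
      proof (cases "S \<subseteq> behind m''")
        case False
        then have "S \<inter> intrinsic_ball \<Omega> m'' \<rho> \<noteq> {}"
          using crossing_meets_ball[OF GO[OF m''(1)] S(1,2)] m''(2) by blast
        then show ?thesis using near[OF m''(1)] scale_bounds by simp
      next
        case True
        obtain m1 where m1: "m1 \<in> G" "S \<inter> behind m1 \<noteq> {}" "\<not> S \<subseteq> behind m1"
        proof (cases "S \<subseteq> behind m")
          case True
          then have "\<not> S \<subseteq> behind m'" using Z(3)[OF m] mm S(4,5) by blast
          then show ?thesis using that[of m'] mG S(5) by blast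
        next
          case False then show ?thesis using that[of m] mG S(4) by blast
        qed
        then have "S \<inter> intrinsic_ball \<Omega> m1 \<rho> \<noteq> {}"
          using crossing_meets_ball[OF GO[OF m1(1)] S(1,2)] by blast
        then have "dist x m1 < T / 2 + \<rho>" using near m1(1) by blast
        moreover have "lm m1 m'' < 2 * \<rho>" using overlap[OF m1(1) m''(1)] True m1(2) by blast
        then have "dist m1 m'' < 2 * \<rho>" using dist_le_lm[of m1 m''] GO m1(1) m''(1) by force
        ultimately show ?thesis using dist_triangle[of x m'' m1] scale_bounds by simp
      qed
      \<comment> \<open>The regions behind the gates linked to \<open>m\<close>, and those behind the other gates. Overlapping regions
        have linked gates, so the two unions are disjoint; being open, they cannot disconnect \<open>S\<close>.\<close>
      define I where "I = (\<Union>m1\<in>{m1\<in>G. S \<inter> behind m1 \<noteq> {} \<and> connected_component W m m1}. behind m1)"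
      define J where "J = (\<Union>m1\<in>{m1\<in>G. S \<inter> behind m1 \<noteq> {} \<and> \<not> connected_component W m m1}. behind m1)"
      have step: "connected_component W m1 m2" if "m1 \<in> G" "m2 \<in> G" "S \<inter> behind m1 \<noteq> {}" "behind m1 \<inter> behind m2 \<noteq> {}" for m1 m2
        using that overlap[OF that(1,2,4)] near_m[OF that(1,3)] G(2) by (intro link) auto
      have mm1: "connected_component W m m" using step[of m m] mG S(4) by blast
      have "open I" "open J" unfolding I_def J_def using behind_props(1) GO by auto
      moreover have "S \<subseteq> I \<union> J"
      proof
        fix w assume w: "w \<in> S"
        then obtain m1 where m1: "Z w = Some m1" using cov by blast
        then have "m1 \<in> G" "w \<in> behind m1" using Z(2) by auto
        then show "w \<in> I \<union> J" using w unfolding I_def J_def by blast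
      qed
      moreover have "I \<inter> J \<inter> S = {}"
      proof (rule ccontr)
        assume "I \<inter> J \<inter> S \<noteq> {}"
        then obtain w m1 m2 where "m1 \<in> G" "S \<inter> behind m1 \<noteq> {}" "connected_component W m m1" "w \<in> behind m1"
          "m2 \<in> G" "\<not> connected_component W m m2" "w \<in> behind m2" unfolding I_def J_def by blast
        then show False using step[of m1 m2] connected_component_trans[of W m m1 m2] by blast
      qed
      moreover have "x \<in> I" unfolding I_def using mG mm1 S(4) by blast
      ultimately have "J \<inter> S = {}" using connectedD[OF S(1), of I J] S(4) by blast
      then have "m' \<notin> {m1\<in>G. S \<inter> behind m1 \<noteq> {} \<and> \<not> connected_component W m m1}"
        using S(5) mG(4) unfolding J_def by blast
      then show ?thesis using mG S(5) by blast
    qed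
    have "connected_component W (gate_of Z x) (gate_of Z y)"
    proof (cases "\<exists>w\<in>S. Z w = None")
      case True
      then obtain w where w: "w \<in> S" "Z w = None" by blast
      have some: "connected_component W w m" if "v \<in> S" "Z v = Some m" for v m
        using core_case[OF w, of m v] Z(2)[OF that(2)] that(1) by blast
      show ?thesis
      proof (cases "Z x")
        case None
        then obtain m' where m': "Z y = Some m'" using S(6) by (cases "Z y") auto
        have "connected_component W x m'"
          using core_case[OF S(4) None, of m' y] Z(2)[OF m'] S(5) by blast
        then show ?thesis using None m' by (simp add: gate_of_def)
      next
        case (Some m)
        show ?thesis
        proof (cases "Z y")
          case None
          have "connected_component W y m"
            using core_case[OF S(5) None, of m x] Z(2)[OF Some] S(4) by blast
          then show ?thesis using None Some connected_component_sym by (simp add: gate_of_def)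
        next
          case (Some m')
          then show ?thesis using \<open>Z x = Some m\<close> some[OF S(4) \<open>Z x = Some m\<close>] some[OF S(5) Some]
              connected_component_sym[of W w m] connected_component_trans[of W m w m'] by (simp add: gate_of_def)
        qed
      qed
    next
      case False
      then have "Z x \<noteq> None" "Z y \<noteq> None" using S(4,5) by metis+
      then obtain m m' where "Z x = Some m" "Z y = Some m'" by auto
      then show ?thesis using cover_case False by (auto simp: gate_of_def)
    qed
    then show ?thesis by (simp add: W_def)
  qed
  have "gate_system (neck / T) (b / T) s T Z"
    unfolding gate_system_def
  proof (intro conjI fin)
    show "\<forall>x m. Z x = Some m \<longrightarrow> m \<in> \<Omega> \<and> T \<le> d m" using Z(2) GO by fastforce
    show "\<forall>x\<in>\<Omega>. Z x = None \<longrightarrow> T < d x" using Z(1) G(3) by blast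
    show "\<forall>x\<in>\<Omega>. s \<le> d x \<longrightarrow> Z x = None"
    proof (intro ballI impI)
      fix x assume "x \<in> \<Omega>" "s \<le> d x"
      then show "Z x = None" using Z(2)[of x] far GO by (cases "Z x") auto
    qed
    have e: "neck / T * T = neck" "b / T * T = b" using scale_bounds(1) by auto
    show "\<forall>S x y. connected S \<and> S \<subseteq> \<Omega> \<and> (\<forall>u\<in>S. \<forall>v\<in>S. dist u v \<le> T / 2) \<and> x \<in> S \<and> y \<in> S \<and> Z x \<noteq> Z y \<longrightarrow>
        connected_component {z \<in> \<Omega>. neck / T * T < d z \<and> dist x z < b / T * T} (gate_of Z x) (gate_of Z y)"
      unfolding e using main by blast
  qed
  then show ?thesis unfolding b_def by blast
qed

end

context radial_domain
begin

text \<open>All lengths of the construction are multiples of \<open>T\<close>. Only the requirement that points at distance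
  at least \<open>s\<close> from the boundary are behind no gate needs \<open>T\<close> to be small.\<close>

lemma ex_gate_system:
  "\<exists>a b. 0 < a \<and> a \<le> 1 \<and> 0 < b \<and> (\<forall>s>0. \<exists>T0>0. \<forall>T. 0 < T \<and> T < T0 \<longrightarrow> (\<exists>Z. gate_system a b s T Z))"
proof -
  define q where "q = 1 + c0"
  have q: "2 \<le> q" using c0 by (simp add: q_def)
  define a where "a = 1 / (2 * q^2)"
  define b where "b = (2 * q + c0 / q + c * (4 * q + 2 * c0 / q)) + 1 + 3 * q"
  have "1 \<le> q^2" using q by (intro one_le_power) simp
  then have "a \<le> 1" by (simp add: a_def divide_le_eq)
  moreover have "a > 0" using q by (simp add: a_def)
  moreover have "b > 0" using q c c0 unfolding b_def by (intro add_pos_pos mult_pos_pos divide_pos_pos) auto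
  moreover have "\<exists>T0>0. \<forall>T. 0 < T \<and> T < T0 \<longrightarrow> (\<exists>Z. gate_system a b s T Z)" if s: "s > 0" for s
  proof -
    obtain h where h: "h > 0" and away: "\<And>x. x \<in> \<Omega> \<Longrightarrow> s \<le> d x \<Longrightarrow>
        \<exists>A\<subseteq>\<Omega>. connected A \<and> x0 \<in> A \<and> x \<in> A \<and> (\<forall>z\<in>A. h \<le> d z)"
      using connected_away_from_boundary[OF x0 s] by blast
    define T0 where "T0 = min h (d x0) / (1 + 4 * q)"
    have "T0 > 0" using h d_pos[OF x0] q by (simp add: T0_def)
    moreover have "\<exists>Z. gate_system a b s T Z" if T: "0 < T" "T < T0" for T
    proof -
      define t where "t = T / q"
      have Tq: "T * (1 + 4 * q) < min h (d x0)" using T q by (simp add: T0_def field_simps)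
      have tT: "(1 + c0) * t = T" using q by (simp add: t_def q_def)
      have sm: "(1 + c0) * t + 4 * ((1 + c0)^2 * t) = T * (1 + 4 * q)"
        unfolding power2_eq_square mult.assoc tT by (simp add: q_def algebra_simps)
      interpret S: radial_scale \<Omega> c0 c R x0 t
        by unfold_locales (use T q Tq sm in \<open>auto simp: t_def\<close>)
      have ST: "S.T = T" and S\<rho>: "S.\<rho> = q * T" by (simp_all add: S.T_def S.\<rho>_def tT q_def)
      have nk: "S.neck = T / q / (2 * q)" unfolding S.neck_def by (simp add: t_def q_def)
      have "S.neck / S.T = a" unfolding ST nk a_def using T q by (simp add: field_simps power2_eq_square)
      moreover have "(S.reach + S.T + 3 * S.\<rho>) / S.T = b"
        unfolding S.reach_def S\<rho> ST b_def unfolding t_def using T q by (simp add: field_simps)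
      moreover have "x \<notin> S.behind m" if m: "m \<in> \<Omega>" "d m = S.T" and x: "x \<in> \<Omega>" "s \<le> d x" for m x
      proof -
        obtain A where A: "A \<subseteq> \<Omega>" "connected A" "x0 \<in> A" "x \<in> A" "\<forall>z\<in>A. h \<le> d z" using away[OF x] by blast
        have "A \<inter> intrinsic_ball \<Omega> m S.\<rho> = {}"
        proof (rule ccontr)
          assume "A \<inter> intrinsic_ball \<Omega> m S.\<rho> \<noteq> {}"
          then obtain z where z: "z \<in> A" "z \<in> \<Omega>" "lm m z < q * T" by (auto simp: intrinsic_ball_def S\<rho>)
          then have "d z < T + q * T" using d_le_lm[OF m(1) z(2)] m(2) by (simp add: ST)
          moreover have "0 \<le> q * T" using q T by simp
          ultimately show False using A(5) z(1) Tq by (force simp: algebra_simps)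
        qed
        then have "connected_component (\<Omega> - intrinsic_ball \<Omega> m S.\<rho>) x0 x"
          unfolding connected_component_def using A by blast
        then show ?thesis by (simp add: S.behind_def)
      qed
      ultimately show ?thesis using S.gate_assignment[of s] by (simp add: ST)
    qed
    ultimately show ?thesis by blast
  qed
  ultimately show ?thesis by blast
qed

end

section \<open>Calculus of iterated partial derivatives\<close>

abbreviation pd_list :: "'n list \<Rightarrow> (real^'n \<Rightarrow> real) \<Rightarrow> real^'n \<Rightarrow> real" where
  "pd_list xs f \<equiv> foldr partial_deriv xs f"

lemma partial_deriv_eqI: "(f has_derivative F) (at x) \<Longrightarrow> partial_deriv i f x = F (axis i 1)"
  unfolding partial_deriv_def by (metis frechet_derivative_at)

lemma has_derivative_partials:
  fixes f :: "real^'n \<Rightarrow> real"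
  assumes "f differentiable (at x)"
  shows "(f has_derivative (\<lambda>h. \<Sum>i\<in>UNIV. h $ i * partial_deriv i f x)) (at x)"
proof -
  let ?F = "frechet_derivative f (at x)"
  have F: "(f has_derivative ?F) (at x)" using assms frechet_derivative_works by blast
  then have lin: "linear ?F" by (rule has_derivative_linear)
  have "?F h = (\<Sum>i\<in>UNIV. h $ i * partial_deriv i f x)" for h
  proof -
    have "?F h = ?F (\<Sum>i\<in>UNIV. h $ i *\<^sub>R axis i 1)"
      using basis_expansion[of h] by (simp add: scalar_mult_eq_scaleR)
    also have "\<dots> = (\<Sum>i\<in>UNIV. h $ i * ?F (axis i 1))"
      using lin by (simp add: linear_sum linear_scale)
    finally show ?thesis by (simp add: partial_deriv_def)
  qed
  then have "?F = (\<lambda>h. \<Sum>i\<in>UNIV. h $ i * partial_deriv i f x)" by (rule ext)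
  then show ?thesis using F by (simp only:)
qed

lemma partial_deriv_cong:
  assumes "open S" "x \<in> S" "\<And>y. y \<in> S \<Longrightarrow> f y = g y"
  shows "partial_deriv i f x = partial_deriv i g x"
proof -
  have "(f has_derivative F) (at x) \<longleftrightarrow> (g has_derivative F) (at x)" for F
    using assms has_derivative_transform_within_open by metis
  then show ?thesis by (simp add: partial_deriv_def frechet_derivative_def)
qed

lemma pd_list_cong:
  assumes "open S" "x \<in> S" "\<And>y. y \<in> S \<Longrightarrow> f y = g y"
  shows "pd_list xs f x = pd_list xs g x"
  using assms(2)
proof (induction xs arbitrary: x)
  case (Cons i xs)
  then show ?case using partial_deriv_cong[OF assms(1) Cons.prems, of "pd_list xs f" "pd_list xs g" i] by simp
qed (use assms in auto)

lemma C_on_cong: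
  assumes "open S" "\<And>y. y \<in> S \<Longrightarrow> f y = g y"
  shows "C_on m S f \<longleftrightarrow> C_on m S g"
  using assms(2)
proof (induction m arbitrary: f g)
  case 0
  then show ?case by (simp cong: continuous_on_cong)
next
  case (Suc m)
  have "f differentiable (at x) \<longleftrightarrow> g differentiable (at x)" if "x \<in> S" for x
    unfolding differentiable_def using has_derivative_transform_within_open[OF _ assms(1) that] Suc.prems by metis
  moreover have "C_on m S (partial_deriv i f) \<longleftrightarrow> C_on m S (partial_deriv i g)" for i
    using partial_deriv_cong[OF assms(1)] Suc.prems by (intro Suc.IH) metis
  ultimately show ?case by simp
qed

lemma C_on_Suc_imp: "open S \<Longrightarrow> C_on (Suc m) S f \<Longrightarrow> C_on m S f"
proof (induction m arbitrary: f)
  case 0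
  then show ?case by (auto intro!: continuous_at_imp_continuous_on differentiable_imp_continuous_within)
qed auto

lemma C_on_subset: "T \<subseteq> S \<Longrightarrow> C_on m S f \<Longrightarrow> C_on m T f"
  by (induction m arbitrary: f) (auto intro: continuous_on_subset)

lemma C_on_local:
  assumes "\<And>x. x \<in> S \<Longrightarrow> \<exists>U. open U \<and> x \<in> U \<and> C_on m U f"
  shows "C_on m S f"
  using assms
proof (induction m arbitrary: f)
  case 0
  then show ?case by (auto intro!: continuous_at_imp_continuous_on simp: continuous_on_eq_continuous_at) (metis continuous_on_eq_continuous_at)
next
  case (Suc m)
  have "f differentiable (at x)" if "x \<in> S" for x using Suc.prems[OF that] by auto
  moreover have "C_on m S (partial_deriv i f)" for i
    using Suc.prems by (intro Suc.IH) fastforce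
  ultimately show ?case by simp
qed

lemma partial_deriv_const: "partial_deriv i (\<lambda>x. c) x = 0"
  by (subst partial_deriv_eqI[of _ "\<lambda>_. 0"]) auto

lemma C_on_const: "C_on m (S :: (real^'n) set) (\<lambda>x. c)"
proof (induction m arbitrary: c)
  case (Suc m)
  have "partial_deriv i (\<lambda>x::real^'n. c) = (\<lambda>x. 0)" for i by (rule ext) (rule partial_deriv_const)
  then show ?case using Suc by simp
qed simp

lemma partial_deriv_add:
  assumes "f differentiable (at x)" "g differentiable (at x)"
  shows "partial_deriv i (\<lambda>x. f x + g x) x = partial_deriv i f x + partial_deriv i g x"
proof -
  have "((\<lambda>x. f x + g x) has_derivative (\<lambda>h. frechet_derivative f (at x) h + frechet_derivative g (at x) h)) (at x)"
    using assms by (intro has_derivative_add) (auto simp: frechet_derivative_works[symmetric])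
  from partial_deriv_eqI[OF this] show ?thesis by (simp add: partial_deriv_def)
qed

lemma partial_deriv_mult:
  assumes "f differentiable (at x)" "g differentiable (at x)"
  shows "partial_deriv i (\<lambda>x. f x * g x) x = partial_deriv i f x * g x + f x * partial_deriv i g x"
proof -
  have "((\<lambda>x. f x * g x) has_derivative (\<lambda>h. f x * frechet_derivative g (at x) h + frechet_derivative f (at x) h * g x)) (at x)"
    using assms by (intro has_derivative_mult) (auto simp: frechet_derivative_works[symmetric])
  from partial_deriv_eqI[OF this] show ?thesis by (simp add: partial_deriv_def)
qed

lemma C_on_add:
  assumes "open S" shows "C_on m S f \<Longrightarrow> C_on m S g \<Longrightarrow> C_on m S (\<lambda>x. f x + g x)"
proof (induction m arbitrary: f g)
  case (Suc m)
  have "C_on m S (partial_deriv i (\<lambda>x. f x + g x))" for i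
  proof (subst C_on_cong[OF assms])
    show "partial_deriv i (\<lambda>x. f x + g x) y = partial_deriv i f y + partial_deriv i g y" if "y \<in> S" for y
      using Suc.prems that by (intro partial_deriv_add) auto
  qed (use Suc in auto)
  then show ?case using Suc.prems by auto
qed (auto intro: continuous_intros)

lemma C_on_mult:
  assumes "open S" shows "C_on m S f \<Longrightarrow> C_on m S g \<Longrightarrow> C_on m S (\<lambda>x. f x * g x)"
proof (induction m arbitrary: f g)
  case (Suc m)
  have fg: "C_on m S f" "C_on m S g" using Suc.prems C_on_Suc_imp[OF assms] by blast+
  have "C_on m S (partial_deriv i (\<lambda>x. f x * g x))" for i
  proof (subst C_on_cong[OF assms])
    show "partial_deriv i (\<lambda>x. f x * g x) y = partial_deriv i f y * g y + f y * partial_deriv i g y" if "y \<in> S" for y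
      using Suc.prems that by (intro partial_deriv_mult) auto
  qed (use Suc fg in \<open>auto intro!: C_on_add[OF assms]\<close>)
  then show ?case using Suc.prems by auto
qed (auto intro: continuous_intros)

lemma smooth_C_on: "f \<in> smooth_functions S \<Longrightarrow> C_on m S f"
  by (simp add: smooth_functions_def)

lemma smooth_cong: "open S \<Longrightarrow> (\<And>y. y \<in> S \<Longrightarrow> f y = g y) \<Longrightarrow> f \<in> smooth_functions S \<Longrightarrow> g \<in> smooth_functions S"
  unfolding smooth_functions_def mem_Collect_eq using C_on_cong by metis

lemma smooth_subset: "T \<subseteq> S \<Longrightarrow> f \<in> smooth_functions S \<Longrightarrow> f \<in> smooth_functions T"
  unfolding smooth_functions_def mem_Collect_eq using C_on_subset by metis

lemma smooth_local: "(\<And>x. x \<in> S \<Longrightarrow> \<exists>U. open U \<and> x \<in> U \<and> f \<in> smooth_functions U) \<Longrightarrow> f \<in> smooth_functions S"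
  unfolding smooth_functions_def mem_Collect_eq by (intro allI C_on_local) blast

lemma smooth_const: "(\<lambda>x. c) \<in> smooth_functions S"
  by (simp add: smooth_functions_def C_on_const)

lemma smooth_add: "open S \<Longrightarrow> f \<in> smooth_functions S \<Longrightarrow> g \<in> smooth_functions S \<Longrightarrow> (\<lambda>x. f x + g x) \<in> smooth_functions S"
  by (simp add: smooth_functions_def C_on_add)

lemma smooth_mult: "open S \<Longrightarrow> f \<in> smooth_functions S \<Longrightarrow> g \<in> smooth_functions S \<Longrightarrow> (\<lambda>x. f x * g x) \<in> smooth_functions S"
  by (simp add: smooth_functions_def C_on_mult)

lemma smooth_diff: "open S \<Longrightarrow> f \<in> smooth_functions S \<Longrightarrow> g \<in> smooth_functions S \<Longrightarrow> (\<lambda>x. f x - g x) \<in> smooth_functions S"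
  using smooth_add[of S f "\<lambda>x. (-1) * g x", OF _ _ smooth_mult[of S "\<lambda>x. -1" g, OF _ smooth_const]] by simp

lemma smooth_sum: "open S \<Longrightarrow> (\<And>j. j \<in> J \<Longrightarrow> f j \<in> smooth_functions S) \<Longrightarrow> (\<lambda>x. \<Sum>j\<in>J. f j x) \<in> smooth_functions S"
  by (induction J rule: infinite_finite_induct) (auto intro: smooth_const smooth_add)

lemma smooth_partial_deriv: "f \<in> smooth_functions S \<Longrightarrow> partial_deriv i f \<in> smooth_functions S"
  unfolding smooth_functions_def mem_Collect_eq using C_on.simps(2) by blast

lemma smooth_pd_list: "f \<in> smooth_functions S \<Longrightarrow> pd_list xs f \<in> smooth_functions S"
  by (induction xs) (auto intro: smooth_partial_deriv)

lemma smooth_differentiable: "f \<in> smooth_functions S \<Longrightarrow> x \<in> S \<Longrightarrow> f differentiable (at x)"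
  using smooth_C_on[of f S "Suc 0"] by simp

lemma smooth_continuous_on: "f \<in> smooth_functions S \<Longrightarrow> continuous_on S f"
  using smooth_C_on[of f S 0] by simp

lemma pd_list_add:
  assumes "open S" "f \<in> smooth_functions S" "g \<in> smooth_functions S" "x \<in> S"
  shows "pd_list xs (\<lambda>x. f x + g x) x = pd_list xs f x + pd_list xs g x"
  using assms(4)
proof (induction xs arbitrary: x)
  case (Cons i xs)
  have "partial_deriv i (pd_list xs (\<lambda>x. f x + g x)) x = partial_deriv i (\<lambda>x. pd_list xs f x + pd_list xs g x) x"
    by (rule partial_deriv_cong[OF assms(1) Cons.prems Cons.IH])
  then show ?case
    using partial_deriv_add[of "pd_list xs f" x "pd_list xs g" i] smooth_differentiable[OF smooth_pd_list Cons.prems] assms(2,3)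
    by simp
qed simp

lemma pd_list_zero: "pd_list xs (\<lambda>x. 0) (x :: real^'n) = 0"
proof -
  have "pd_list xs (\<lambda>x::real^'n. 0) = (\<lambda>x. 0)"
    by (induction xs) (auto simp: partial_deriv_const)
  then show ?thesis by simp
qed

lemma pd_list_sum:
  assumes "open S" "\<And>j. j \<in> J \<Longrightarrow> f j \<in> smooth_functions S" "x \<in> S"
  shows "pd_list xs (\<lambda>x. \<Sum>j\<in>J. f j x) x = (\<Sum>j\<in>J. pd_list xs (f j) x)"
  using assms(2)
proof (induction J rule: infinite_finite_induct)
  case (insert j J)
  then show ?case using pd_list_add[OF assms(1) _ smooth_sum[OF assms(1)] assms(3), of "f j" J f] by simp
qed (auto simp: pd_list_zero)

lemma partial_deriv_cmult:
  assumes "g differentiable (at x)" shows "partial_deriv i (\<lambda>x. c * g x) x = c * partial_deriv i g x"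
  using partial_deriv_mult[of "\<lambda>x. c" x g i] assms by (simp add: partial_deriv_const)

lemma pd_list_cmult:
  assumes "open S" "f \<in> smooth_functions S" "x \<in> S"
  shows "pd_list xs (\<lambda>x. c * f x) x = c * pd_list xs f x"
  using assms(3)
proof (induction xs arbitrary: x)
  case (Cons i xs)
  have "partial_deriv i (pd_list xs (\<lambda>x. c * f x)) x = partial_deriv i (\<lambda>x. c * pd_list xs f x) x"
    by (rule partial_deriv_cong[OF assms(1) Cons.prems Cons.IH])
  then show ?case
    using partial_deriv_cmult[of "pd_list xs f" x i c] smooth_differentiable[OF smooth_pd_list Cons.prems] assms(2) by simp
qed simp

lemma pd_list_diff:
  assumes "open S" "f \<in> smooth_functions S" "g \<in> smooth_functions S" "x \<in> S"
  shows "pd_list xs (\<lambda>x. f x - g x) x = pd_list xs f x - pd_list xs g x"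
  using pd_list_add[OF assms(1,2) smooth_mult[OF assms(1) smooth_const assms(3)] assms(4), of xs "-1"]
    pd_list_cmult[OF assms(1,3,4), of xs "-1"] by simp

text \<open>The Leibniz rule, in the form of a bound that is homogeneous in a length scale \<open>1 / q\<close>. The
  induction peels off the innermost derivative, because that one acts on the product itself.\<close>

lemma pd_list_mult_bound:
  assumes "open S" "x \<in> S" "0 \<le> A" "0 \<le> B" "0 \<le> q"
  shows "f \<in> smooth_functions S \<Longrightarrow> g \<in> smooth_functions S \<Longrightarrow>
    (\<And>js. length js \<le> length xs \<Longrightarrow> \<bar>pd_list js f x\<bar> \<le> A * q ^ length js) \<Longrightarrow>
    (\<And>js. length js \<le> length xs \<Longrightarrow> \<bar>pd_list js g x\<bar> \<le> B * q ^ length js) \<Longrightarrow>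
    \<bar>pd_list xs (\<lambda>x. f x * g x) x\<bar> \<le> 2 ^ length xs * (A * B) * q ^ length xs"
  using assms(3,4)
proof (induction xs arbitrary: f g A B rule: rev_induct)
  case Nil
  from Nil(3)[of "[]"] Nil(4)[of "[]"] Nil(5,6) show ?case by (simp add: abs_mult mult_mono)
next
  case (snoc i xs)
  let ?n = "length xs"
  note sm = snoc.prems(1,2)
  have "pd_list (xs @ [i]) (\<lambda>x. f x * g x) x = pd_list xs (partial_deriv i (\<lambda>x. f x * g x)) x" by simp
  also have "\<dots> = pd_list xs (\<lambda>x. partial_deriv i f x * g x + f x * partial_deriv i g x) x"
    using sm by (intro pd_list_cong[OF assms(1,2)] partial_deriv_mult) (auto intro: smooth_differentiable)
  also have "\<dots> = pd_list xs (\<lambda>x. partial_deriv i f x * g x) x + pd_list xs (\<lambda>x. f x * partial_deriv i g x) x"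
    using sm by (intro pd_list_add[OF assms(1) _ _ assms(2)] smooth_mult[OF assms(1)] smooth_partial_deriv) auto
  finally have eq: "pd_list (xs @ [i]) (\<lambda>x. f x * g x) x = \<dots>" .
  have "\<bar>pd_list js (partial_deriv i f) x\<bar> \<le> (A * q) * q ^ length js" if "length js \<le> ?n" for js
    using snoc.prems(3)[of "js @ [i]"] that by (simp add: mult_ac)
  moreover have "\<bar>pd_list js g x\<bar> \<le> B * q ^ length js" if "length js \<le> ?n" for js
    using snoc.prems(4)[of js] that by simp
  ultimately have 1: "\<bar>pd_list xs (\<lambda>x. partial_deriv i f x * g x) x\<bar> \<le> 2 ^ ?n * (A * q * B) * q ^ ?n"
    using snoc.prems(5,6) assms(5) sm by (intro snoc.IH smooth_partial_deriv) auto
  have "\<bar>pd_list js (partial_deriv i g) x\<bar> \<le> (B * q) * q ^ length js" if "length js \<le> ?n" for js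
    using snoc.prems(4)[of "js @ [i]"] that by (simp add: mult_ac)
  moreover have "\<bar>pd_list js f x\<bar> \<le> A * q ^ length js" if "length js \<le> ?n" for js
    using snoc.prems(3)[of js] that by simp
  ultimately have 2: "\<bar>pd_list xs (\<lambda>x. f x * partial_deriv i g x) x\<bar> \<le> 2 ^ ?n * (A * (B * q)) * q ^ ?n"
    using snoc.prems(5,6) assms(5) sm by (intro snoc.IH smooth_partial_deriv) auto
  show ?case unfolding eq using 1 2 by (simp add: algebra_simps)
qed

subsection \<open>Families of derivatives\<close>

definition inc :: "'n \<Rightarrow> ('n \<Rightarrow> nat) \<Rightarrow> 'n \<Rightarrow> nat" where
  "inc i \<beta> = \<beta>(i := Suc (\<beta> i))"

text \<open>All iterated derivatives of a function at once. Indexing them by multi-indices encodes that the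
  order of differentiation does not matter, which thus holds for the functions used here by
  construction.\<close>

definition deriv_family :: "(('n \<Rightarrow> nat) \<Rightarrow> real^'n \<Rightarrow> real) \<Rightarrow> bool" where
  "deriv_family F \<longleftrightarrow> (\<forall>\<beta> x. (F \<beta> has_derivative (\<lambda>h. \<Sum>i\<in>UNIV. h $ i * F (inc i \<beta>) x)) (at x))"

lemma mi_order_inc: "mi_order (inc i \<beta>) = Suc (mi_order (\<beta> :: 'n::finite \<Rightarrow> nat))"
proof -
  have "mi_order (inc i \<beta>) = Suc (\<beta> i) + (\<Sum>j\<in>UNIV - {i}. \<beta> j)"
    unfolding mi_order_def inc_def by (subst sum.remove[of UNIV i]) (auto intro!: sum.cong)
  also have "\<dots> = Suc (mi_order \<beta>)"
    unfolding mi_order_def using sum.remove[of UNIV i \<beta>] by simp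
  finally show ?thesis .
qed

lemma mi_order_zero: "mi_order (\<lambda>_. 0) = 0"
  by (simp add: mi_order_def)

lemma mi_order_count_list: "mi_order (count_list xs) = length (xs :: 'n::finite list)"
proof (induction xs)
  case (Cons i xs)
  have e: "count_list (i # xs) = inc i (count_list xs)" by (rule ext) (simp add: inc_def)
  show ?case unfolding e mi_order_inc using Cons by simp
qed (simp add: mi_order_def)

lemma deriv_family_partial:
  assumes "deriv_family F" shows "partial_deriv i (F \<beta>) = F (inc i \<beta>)"
proof
  fix x
  have "partial_deriv i (F \<beta>) x = (\<Sum>j\<in>UNIV. axis i 1 $ j * F (inc j \<beta>) x)"
    using assms unfolding deriv_family_def by (intro partial_deriv_eqI) blast
  also have "\<dots> = (\<Sum>j\<in>UNIV. if j = i then F (inc j \<beta>) x else 0)"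
    by (intro sum.cong) (auto simp: axis_def)
  also have "\<dots> = F (inc i \<beta>) x" by simp
  finally show "partial_deriv i (F \<beta>) x = F (inc i \<beta>) x" .
qed

lemma deriv_family_smooth: "deriv_family F \<Longrightarrow> F \<beta> \<in> smooth_functions S"
proof -
  assume F: "deriv_family F"
  have "C_on m S (F \<beta>)" for m
  proof (induction m arbitrary: \<beta>)
    case 0
    have "F \<beta> differentiable (at x)" for x using F unfolding deriv_family_def differentiable_def by blast
    then show ?case by (auto intro!: continuous_at_imp_continuous_on differentiable_imp_continuous_within)
  next
    case (Suc m)
    then show ?case using F by (auto simp: deriv_family_partial[OF F] deriv_family_def differentiable_def)
  qed
  then show ?thesis by (simp add: smooth_functions_def)
qed

lemma deriv_family_pd_list:
  assumes "deriv_family F" shows "pd_list xs (F \<beta>) = F (\<lambda>i. \<beta> i + count_list xs i)"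
proof (induction xs)
  case (Cons i xs)
  have "inc i (\<lambda>j. \<beta> j + count_list xs j) = (\<lambda>j. \<beta> j + count_list (i # xs) j)" by (auto simp: inc_def)
  then show ?case using Cons deriv_family_partial[OF assms] by simp
qed simp

lemma deriv_family_mixed_partial:
  assumes "deriv_family F" shows "mixed_partial \<alpha> (F (\<lambda>_. 0)) = F \<alpha>"
proof -
  have "\<forall>i. count_list (SOME xs. \<forall>i. count_list xs i = \<alpha> i) i = \<alpha> i"
    by (rule someI_ex[OF ex_list_mi])
  then show ?thesis unfolding mixed_partial_def deriv_family_pd_list[OF assms] by simp
qed

section \<open>A smooth partition of unity\<close>

subsection \<open>A smooth bump on the line\<close>

definition exp_poly :: "real poly \<Rightarrow> real \<Rightarrow> real" where
  "exp_poly p t = (if 0 < t then poly p (1 / t) * exp (- (1 / t)) else 0)"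

lemma poly_times_exp_neg_tendsto: "((\<lambda>s. s ^ k * poly p s * exp (- s)) \<longlongrightarrow> (0::real)) at_top"
proof (induction p arbitrary: k)
  case (pCons a p)
  have "((\<lambda>s. a * (s ^ k / exp s) + s ^ Suc k * poly p s * exp (- s)) \<longlongrightarrow> a * 0 + (0::real)) at_top"
    by (intro tendsto_add tendsto_mult tendsto_const tendsto_power_div_exp_0 pCons)
  then show ?case by (simp add: algebra_simps exp_minus divide_inverse)
qed simp

text \<open>These functions are closed under differentiation, with vanishing derivative at zero because the
  exponential beats every polynomial.\<close>

lemma exp_poly_deriv:
  "(exp_poly p has_real_derivative exp_poly ([:0, 0, 1:] * (p - pderiv p)) t) (at t)"
proof -
  consider "t > 0" | "t < 0" | "t = 0" by linarith
  then show ?thesis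
  proof cases
    case 1
    have "((\<lambda>t. poly p (1 / t) * exp (- (1 / t))) has_real_derivative
        exp_poly ([:0, 0, 1:] * (p - pderiv p)) t) (at t)"
      using 1 by (auto intro!: derivative_eq_intros simp: exp_poly_def field_simps power2_eq_square)
    then show ?thesis
      by (rule has_field_derivative_transform_within_open[of _ _ _ "{0<..}"]) (use 1 in \<open>auto simp: exp_poly_def\<close>)
  next
    case 2
    have "((\<lambda>_. 0) has_real_derivative exp_poly ([:0, 0, 1:] * (p - pderiv p)) t) (at t)"
      using 2 by (auto simp: exp_poly_def)
    then show ?thesis
      by (rule has_field_derivative_transform_within_open[of _ _ _ "{..<0}"]) (use 2 in \<open>auto simp: exp_poly_def\<close>)
  next
    case 3
    have "((\<lambda>h. (exp_poly p (0 + h) - exp_poly p 0) / h) \<longlongrightarrow> 0) (at 0)"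
    proof (rule filterlim_split_at)
      show "((\<lambda>h. (exp_poly p (0 + h) - exp_poly p 0) / h) \<longlongrightarrow> 0) (at_left 0)"
        by (rule tendsto_eventually) (auto simp: eventually_at_filter exp_poly_def)
      have "((\<lambda>h. inverse h ^ 1 * poly p (inverse h) * exp (- inverse h)) \<longlongrightarrow> 0) (at_right (0::real))"
        by (rule filterlim_compose[OF poly_times_exp_neg_tendsto filterlim_inverse_at_top_right])
      then show "((\<lambda>h. (exp_poly p (0 + h) - exp_poly p 0) / h) \<longlongrightarrow> 0) (at_right 0)"
        by (rule Lim_transform_eventually) (auto simp: eventually_at_filter exp_poly_def field_simps)
    qed
    then show ?thesis using 3 by (simp add: DERIV_def exp_poly_def)
  qed
qed

lemma exp_poly_reflect_deriv:
  "((\<lambda>t. exp_poly p (1 - t)) has_real_derivative (-1) * exp_poly ([:0, 0, 1:] * (p - pderiv p)) (1 - t)) (at t)"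
proof -
  have "((\<lambda>t. 1 - t) has_real_derivative -1) (at t)" by (auto intro!: derivative_eq_intros)
  from DERIV_chain2[where f = "exp_poly p" and g = "\<lambda>t. 1 - t", OF exp_poly_deriv this]
  show ?thesis by (simp only: mult.commute)
qed

definition step_denominator :: "real \<Rightarrow> real" where
  "step_denominator t = exp_poly 1 t + exp_poly 1 (1 - t)"

lemma exp_poly_1: "0 \<le> exp_poly 1 t" "0 < t \<Longrightarrow> 0 < exp_poly 1 t" "t \<le> 0 \<Longrightarrow> exp_poly 1 t = 0"
  by (auto simp: exp_poly_def)

lemma step_denominator_pos: "0 < step_denominator t"
  using exp_poly_1[of t] exp_poly_1[of "1 - t"] by (cases "0 < t") (auto simp: step_denominator_def intro: add_pos_nonneg add_nonneg_pos)

text \<open>An algebra of functions closed under differentiation that contains the smooth step.\<close>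

inductive_set step_algebra :: "(real \<Rightarrow> real) set" where
  "exp_poly p \<in> step_algebra"
| "(\<lambda>t. exp_poly p (1 - t)) \<in> step_algebra"
| "(\<lambda>t. 1 / step_denominator t) \<in> step_algebra"
| "(\<lambda>t. c) \<in> step_algebra"
| "f \<in> step_algebra \<Longrightarrow> g \<in> step_algebra \<Longrightarrow> (\<lambda>t. f t + g t) \<in> step_algebra"
| "f \<in> step_algebra \<Longrightarrow> g \<in> step_algebra \<Longrightarrow> (\<lambda>t. f t * g t) \<in> step_algebra"

lemma step_algebra_deriv:
  "f \<in> step_algebra \<Longrightarrow> \<exists>g\<in>step_algebra. \<forall>t. (f has_real_derivative g t) (at t)"
proof (induction rule: step_algebra.induct)
  case (1 p)
  then show ?case using exp_poly_deriv step_algebra.intros(1) by blast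
next
  case (2 p)
  let ?p = "[:0, 0, 1:] * (p - pderiv p)"
  have "((\<lambda>t. exp_poly p (1 - t)) has_real_derivative (-1) * exp_poly ?p (1 - t)) (at t)" for t
    by (rule exp_poly_reflect_deriv)
  moreover have "(\<lambda>t. (-1) * exp_poly ?p (1 - t)) \<in> step_algebra" by (intro step_algebra.intros)
  ultimately show ?case by (intro bexI[of _ "\<lambda>t. (-1) * exp_poly ?p (1 - t)"]) auto
next
  case 3
  let ?p = "[:0, 0, 1:] * (1 - pderiv 1) :: real poly"
  let ?g = "\<lambda>t. (-1) * ((exp_poly ?p t + (-1) * exp_poly ?p (1 - t)) * ((1 / step_denominator t) * (1 / step_denominator t)))"
  have "((\<lambda>t. 1 / step_denominator t) has_real_derivative ?g t) (at t)" for t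
  proof -
    have "((\<lambda>t. exp_poly 1 (1 - t)) has_real_derivative (-1) * exp_poly ?p (1 - t)) (at t)"
      by (rule exp_poly_reflect_deriv)
    then have "(step_denominator has_real_derivative (exp_poly ?p t + (-1) * exp_poly ?p (1 - t))) (at t)"
      unfolding step_denominator_def by (intro DERIV_add exp_poly_deriv)
    then show ?thesis
      using step_denominator_pos[of t] by (auto intro!: derivative_eq_intros simp: field_simps power2_eq_square)
  qed
  moreover have "?g \<in> step_algebra" by (intro step_algebra.intros)
  ultimately show ?case by (intro bexI[of _ ?g]) auto
next
  case (4 c)
  show ?case by (intro bexI[of _ "\<lambda>_. 0"] step_algebra.intros) auto
next
  case (5 f g)
  then obtain f' g' where "f' \<in> step_algebra" "\<forall>t. (f has_real_derivative f' t) (at t)"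
    "g' \<in> step_algebra" "\<forall>t. (g has_real_derivative g' t) (at t)" by blast
  then show ?case
    by (intro bexI[of _ "\<lambda>t. f' t + g' t"] step_algebra.intros) (auto intro!: derivative_eq_intros)
next
  case (6 f g)
  then obtain f' g' where fg: "f' \<in> step_algebra" "\<forall>t. (f has_real_derivative f' t) (at t)"
    "g' \<in> step_algebra" "\<forall>t. (g has_real_derivative g' t) (at t)" by blast
  then have "((\<lambda>t. f t * g t) has_real_derivative f' t * g t + f t * g' t) (at t)" for t
    by (auto intro!: derivative_eq_intros)
  then show ?case
    using fg 6 by (intro bexI[of _ "\<lambda>t. f' t * g t + f t * g' t"] step_algebra.intros) auto
qed

text \<open>The function \<open>\<theta> n\<close> is the derivative of order \<open>n\<close> of a bump whose integer translates sum to one.\<close>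

definition is_bump :: "(nat \<Rightarrow> real \<Rightarrow> real) \<Rightarrow> bool" where
  "is_bump \<theta> \<longleftrightarrow> (\<forall>n t. (\<theta> n has_real_derivative \<theta> (Suc n) t) (at t)) \<and> (\<forall>n t. 1 < \<bar>t\<bar> \<longrightarrow> \<theta> n t = 0) \<and>
     (\<forall>t. 0 \<le> \<theta> 0 t) \<and> \<theta> 0 0 = 1 \<and>
     (\<forall>a b t. of_int a \<le> t - 1 \<and> t + 1 \<le> of_int b \<longrightarrow> (\<Sum>l\<in>{a..b}. \<theta> 0 (t - of_int l)) = 1)"

text \<open>Differences of translates of a smooth step form a partition of unity by telescoping.\<close>

lemma ex_bump: "\<exists>\<theta>. is_bump \<theta>"
proof -
  define s where "s t = exp_poly 1 t * (1 / step_denominator t)" for t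
  have s_mem: "s \<in> step_algebra" unfolding s_def by (intro step_algebra.intros)
  define der where "der f = (SOME g. g \<in> step_algebra \<and> (\<forall>t. (f has_real_derivative g t) (at t)))" for f
  have der: "der f \<in> step_algebra \<and> (\<forall>t. (f has_real_derivative der f t) (at t))" if "f \<in> step_algebra" for f
    unfolding der_def using someI_ex[of "\<lambda>g. g \<in> step_algebra \<and> (\<forall>t. (f has_real_derivative g t) (at t))"]
      step_algebra_deriv[OF that] by blast
  define S where "S n = (der ^^ n) s" for n
  have S_mem: "S n \<in> step_algebra" for n
    by (induction n) (auto simp: S_def s_mem der)
  have S: "(S n has_real_derivative S (Suc n) t) (at t)" for n t
    using der[OF S_mem[of n]] by (simp add: S_def)
  have S0: "S 0 t = 0" if "t \<le> 0" for t using exp_poly_1(3)[OF that] by (simp add: S_def s_def)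
  have S1: "S 0 t = 1" if "1 \<le> t" for t
    using exp_poly_1(3)[of "1 - t"] exp_poly_1(2)[of t] that by (simp add: S_def s_def step_denominator_def)
  have Sb: "0 \<le> S 0 t" "S 0 t \<le> 1" for t
    using exp_poly_1(1)[of t] exp_poly_1(1)[of "1 - t"] step_denominator_pos[of t]
    by (auto simp: S_def s_def step_denominator_def divide_le_eq)
  define \<theta> where "\<theta> n t = S n (t + 1) - S n t" for n t
  have d\<theta>: "(\<theta> n has_real_derivative \<theta> (Suc n) t) (at t)" for n t
    unfolding \<theta>_def using DERIV_shift[of "S n" "S (Suc n) (t + 1)" t 1] S by (intro DERIV_diff) auto
  have out: "\<theta> n t = 0" if "1 < \<bar>t\<bar>" for n t
    using that
  proof (induction n arbitrary: t)
    case 0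
    then show ?case by (cases "0 < t") (auto simp: \<theta>_def S0 S1)
  next
    case (Suc n)
    have "((\<lambda>_. 0) has_real_derivative \<theta> (Suc n) t) (at t)"
      by (rule has_field_derivative_transform_within_open[OF d\<theta>[of n t], of "{t. 1 < \<bar>t\<bar>}"])
        (use Suc in \<open>auto intro!: open_Collect_less continuous_intros\<close>)
    then show ?case using DERIV_unique DERIV_const by blast
  qed
  have nonneg: "0 \<le> \<theta> 0 t" for t
  proof -
    consider "t \<le> 0" | "0 \<le> t" by linarith
    then show ?thesis
    proof cases
      case 1 then show ?thesis using S0[OF 1] Sb(1)[of "t + 1"] by (simp add: \<theta>_def)
    next
      case 2 then show ?thesis using S1[of "t + 1"] Sb(2)[of t] by (simp add: \<theta>_def)
    qed
  qed
  have tele: "(\<Sum>l\<in>{a..b}. \<theta> 0 (t - of_int l)) = S 0 (t - of_int a + 1) - S 0 (t - of_int b)" if "a \<le> b" for a b t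
    using that
  proof (induction b rule: int_ge_induct)
    case base
    then show ?case by (simp add: \<theta>_def)
  next
    case (step b)
    have "{a..b + 1} = insert (b + 1) {a..b}" using step by auto
    then show ?case using step by (simp add: \<theta>_def algebra_simps)
  qed
  have "(\<Sum>l\<in>{a..b}. \<theta> 0 (t - of_int l)) = 1" if "of_int a \<le> t - 1" "t + 1 \<le> of_int b" for a b t
  proof -
    have "real_of_int a \<le> of_int b" using that by linarith
    then show ?thesis using tele[of a b t] S1[of "t - of_int a + 1"] S0[of "t - of_int b"] that by simp
  qed
  then have "is_bump \<theta>" unfolding is_bump_def
    using d\<theta> out nonneg S0[of 0] S1[of 1] by (auto simp: \<theta>_def)
  then show ?thesis by blast
qed

definition bump :: "nat \<Rightarrow> real \<Rightarrow> real" where "bump = (SOME \<theta>. is_bump \<theta>)"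

lemma bump: "is_bump bump"
  unfolding bump_def by (rule someI_ex[OF ex_bump])

lemma bump_deriv: "(bump n has_real_derivative bump (Suc n) t) (at t)"
  and bump_support: "1 < \<bar>t\<bar> \<Longrightarrow> bump n t = 0"
  and bump_nonneg: "0 \<le> bump 0 t" and bump_at_0: "bump 0 0 = 1"
  and bump_sum: "of_int a \<le> t - 1 \<Longrightarrow> t + 1 \<le> of_int b \<Longrightarrow> (\<Sum>l\<in>{a..b}. bump 0 (t - of_int l)) = 1"
  using bump by (auto simp: is_bump_def)

lemma bump_bounded: "\<exists>B. \<forall>t. \<bar>bump n t\<bar> \<le> B"
proof -
  have "continuous_on {-1..1} (bump n)"
    by (intro continuous_at_imp_continuous_on ballI DERIV_isCont[OF bump_deriv])
  then have "bounded (bump n ` {-1..1})" by (intro compact_imp_bounded compact_continuous_image) auto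
  then obtain B where B: "\<forall>t\<in>{-1..1}. \<bar>bump n t\<bar> \<le> B" by (auto simp: bounded_iff)
  have "\<bar>bump n t\<bar> \<le> max B 0" for t
  proof (cases "1 < \<bar>t\<bar>")
    case False
    then have "t \<in> {-1..1}" by auto
    then show ?thesis using B by fastforce
  qed (simp add: bump_support)
  then show ?thesis by blast
qed

subsection \<open>Tensor products of bumps\<close>

definition tensor_bump :: "('n::finite \<Rightarrow> nat) \<Rightarrow> real^'n \<Rightarrow> real" where
  "tensor_bump \<beta> z = (\<Prod>i\<in>UNIV. bump (\<beta> i) (z $ i))"

lemma deriv_family_tensor_bump: "deriv_family tensor_bump"
  unfolding deriv_family_def
proof (intro allI)
  fix \<beta> :: "'n::finite \<Rightarrow> nat" and z
  have "((\<lambda>z. \<Prod>i\<in>UNIV. bump (\<beta> i) (z $ i)) has_derivative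
      (\<lambda>h. \<Sum>i\<in>UNIV. (bump (Suc (\<beta> i)) (z $ i) * h $ i) * (\<Prod>j\<in>UNIV - {i}. bump (\<beta> j) (z $ j)))) (at z)"
  proof (rule has_derivative_prod)
    fix i :: 'n
    have "((\<lambda>z. z $ i) has_derivative (\<lambda>h. h $ i)) (at z)"
      by (rule bounded_linear.has_derivative[OF bounded_linear_vec_nth has_derivative_ident])
    then show "((\<lambda>z. bump (\<beta> i) (z $ i)) has_derivative (\<lambda>h. bump (Suc (\<beta> i)) (z $ i) * h $ i)) (at z)"
      by (rule has_derivative_compose[where g = "bump (\<beta> i)"]) (rule bump_deriv[unfolded has_field_derivative_def])
  qed
  moreover have "bump (Suc (\<beta> i)) (z $ i) * (\<Prod>j\<in>UNIV - {i}. bump (\<beta> j) (z $ j)) = tensor_bump (inc i \<beta>) z" for i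
    unfolding tensor_bump_def inc_def by (subst prod.remove[of UNIV i]) (auto intro!: prod.cong)
  ultimately show "(tensor_bump \<beta> has_derivative (\<lambda>h. \<Sum>i\<in>UNIV. h $ i * tensor_bump (inc i \<beta>) z)) (at z)"
    unfolding tensor_bump_def[abs_def] by (auto simp: mult_ac elim!: has_derivative_eq_rhs intro!: sum.cong)
qed

lemma tensor_bump_component: "tensor_bump \<beta> z \<noteq> 0 \<Longrightarrow> \<bar>z $ i\<bar> \<le> 1"
  unfolding tensor_bump_def using bump_support[of "z $ i" "\<beta> i"] by (force simp: prod_zero_iff)

lemma tensor_bump_support: "tensor_bump \<beta> z \<noteq> 0 \<Longrightarrow> norm z \<le> real CARD('n)" for z :: "real^'n"
proof -
  assume "tensor_bump \<beta> z \<noteq> 0"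
  then have "(\<Sum>i\<in>UNIV. \<bar>z $ i\<bar>) \<le> (\<Sum>i\<in>(UNIV::'n set). 1)" by (intro sum_mono tensor_bump_component)
  then show ?thesis using norm_le_l1_cart[of z] by simp
qed

lemma tensor_bump_nonneg: "0 \<le> tensor_bump (\<lambda>_. 0) z"
  unfolding tensor_bump_def by (intro prod_nonneg ballI bump_nonneg)

lemma tensor_bump_at_0: "tensor_bump (\<lambda>_. 0) 0 = 1"
  by (simp add: tensor_bump_def bump_at_0)

lemma tensor_bump_bounded: "\<exists>M>0. \<forall>\<beta>::'n::finite \<Rightarrow> nat. mi_order \<beta> \<le> k \<longrightarrow> (\<forall>z. \<bar>tensor_bump \<beta> z\<bar> \<le> M)"
proof -
  obtain B where B: "\<And>n t. \<bar>bump n t\<bar> \<le> B n" using bump_bounded by metis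
  let ?I = "{\<beta>::'n \<Rightarrow> nat. mi_order \<beta> \<le> k}"
  let ?b = "\<lambda>\<beta>::'n \<Rightarrow> nat. \<Prod>i\<in>UNIV. B (\<beta> i)"
  have b: "\<bar>tensor_bump \<beta> z\<bar> \<le> ?b \<beta>" for \<beta> z
    unfolding tensor_bump_def abs_prod by (intro prod_mono) (auto simp: B)
  define M where "M = Max (insert 1 (?b ` ?I))"
  have "?b \<beta> \<le> M" if "mi_order \<beta> \<le> k" for \<beta>
    unfolding M_def using that finite_mi_order_le by (intro Max_ge) auto
  moreover have "1 \<le> M" unfolding M_def using finite_mi_order_le by (intro Max_ge) auto
  ultimately show ?thesis using b by (intro exI[of _ M]) (auto intro: order_trans)
qed

abbreviation lattice_point :: "('n::finite \<Rightarrow> int) \<Rightarrow> real^'n" where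
  "lattice_point j \<equiv> (\<chi> i. real_of_int (j i))"

lemma
  fixes x :: "real^'n"
  shows finite_lattice_near: "finite {j::'n \<Rightarrow> int. \<forall>i. \<bar>x $ i - of_int (j i)\<bar> < 2}"
  and card_lattice_near: "card {j::'n \<Rightarrow> int. \<forall>i. \<bar>x $ i - of_int (j i)\<bar> < 2} \<le> 6 ^ CARD('n)"
proof -
  let ?P = "PiE (UNIV::'n set) (\<lambda>i. {\<lfloor>x $ i\<rfloor> - 2..\<lfloor>x $ i\<rfloor> + 3})"
  have sub: "{j::'n \<Rightarrow> int. \<forall>i. \<bar>x $ i - of_int (j i)\<bar> < 2} \<subseteq> ?P"
  proof
    fix j :: "'n \<Rightarrow> int" assume j: "j \<in> {j. \<forall>i. \<bar>x $ i - of_int (j i)\<bar> < 2}"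
    have "j i \<in> {\<lfloor>x $ i\<rfloor> - 2..\<lfloor>x $ i\<rfloor> + 3}" for i
    proof -
      have "\<bar>x $ i - of_int (j i)\<bar> < 2" using j by auto
      then show ?thesis by (auto simp: abs_less_iff) linarith+
    qed
    then show "j \<in> ?P" by (simp add: PiE_UNIV_domain)
  qed
  show "finite {j::'n \<Rightarrow> int. \<forall>i. \<bar>x $ i - of_int (j i)\<bar> < 2}"
    by (rule finite_subset[OF sub]) (intro finite_PiE, auto)
  have "card {j::'n \<Rightarrow> int. \<forall>i. \<bar>x $ i - of_int (j i)\<bar> < 2} \<le> card ?P"
    by (rule card_mono[OF _ sub]) (intro finite_PiE, auto)
  also have "\<dots> = 6 ^ CARD('n)" by (simp add: card_PiE)
  finally show "card {j::'n \<Rightarrow> int. \<forall>i. \<bar>x $ i - of_int (j i)\<bar> < 2} \<le> 6 ^ CARD('n)" .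
qed

lemma tensor_bump_partition:
  fixes x :: "real^'n"
  assumes "finite J" "\<And>j. (\<And>i. \<bar>x $ i - of_int (j i)\<bar> < 2) \<Longrightarrow> j \<in> J"
  shows "(\<Sum>j\<in>J. tensor_bump (\<lambda>_. 0) (x - lattice_point j)) = 1"
proof -
  let ?P = "PiE (UNIV::'n set) (\<lambda>i. {\<lfloor>x $ i\<rfloor> - 1..\<lfloor>x $ i\<rfloor> + 2})"
  let ?f = "\<lambda>j. tensor_bump (\<lambda>_. 0) (x - lattice_point j)"
  have supp: "\<bar>x $ i - of_int (j i)\<bar> \<le> 1" if "?f j \<noteq> 0" for j i
    using tensor_bump_component[OF that, of i] by simp
  have "(\<Sum>j\<in>J. ?f j) = (\<Sum>j\<in>J \<inter> ?P. ?f j)"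
  proof (rule sum.mono_neutral_right[OF assms(1)])
    show "\<forall>j\<in>J - J \<inter> ?P. ?f j = 0"
    proof (rule ballI, rule ccontr)
      fix j assume j: "j \<in> J - J \<inter> ?P" "?f j \<noteq> 0"
      have "j i \<in> {\<lfloor>x $ i\<rfloor> - 1..\<lfloor>x $ i\<rfloor> + 2}" for i
        using supp[OF j(2), of i] by (auto simp: abs_le_iff) linarith+
      then show False using j(1) by (simp add: PiE_UNIV_domain)
    qed
  qed auto
  also have "\<dots> = (\<Sum>j\<in>?P. ?f j)"
  proof (rule sum.mono_neutral_left)
    show "finite ?P" by (intro finite_PiE) auto
    show "\<forall>j\<in>?P - J \<inter> ?P. ?f j = 0"
    proof (rule ballI, rule ccontr)
      fix j assume j: "j \<in> ?P - J \<inter> ?P" "?f j \<noteq> 0"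
      have "j \<in> J" by (rule assms(2), rule le_less_trans[OF supp[OF j(2)]]) simp
      then show False using j(1) by simp
    qed
  qed auto
  also have "\<dots> = (\<Prod>i\<in>UNIV. \<Sum>l\<in>{\<lfloor>x $ i\<rfloor> - 1..\<lfloor>x $ i\<rfloor> + 2}. bump 0 (x $ i - of_int l))"
    by (subst prod_sum_PiE) (auto simp: tensor_bump_def)
  also have "\<dots> = 1"
    by (rule prod.neutral, rule ballI, rule bump_sum; linarith)
  finally show ?thesis .
qed

subsection \<open>Remainder estimates\<close>

lemma abs_sum_components_le:
  fixes h :: "real^'n"
  assumes "\<And>i. \<bar>c i\<bar> \<le> M"
  shows "\<bar>\<Sum>i\<in>UNIV. h $ i * c i\<bar> \<le> real CARD('n) * M * norm h"
proof -
  have "\<bar>\<Sum>i\<in>UNIV. h $ i * c i\<bar> \<le> (\<Sum>i\<in>UNIV. \<bar>h $ i * c i\<bar>)" by (rule sum_abs)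
  also have "\<dots> \<le> (\<Sum>i\<in>(UNIV::'n set). norm h * M)"
    unfolding abs_mult using assms by (intro sum_mono mult_mono component_le_norm_cart) auto
  finally show ?thesis by (simp add: mult_ac)
qed

lemma partials_mean_value:
  fixes P :: "real^'n \<Rightarrow> real"
  assumes "convex S" "x \<in> S" "y \<in> S"
    "\<And>z. z \<in> S \<Longrightarrow> (P has_derivative (\<lambda>h. \<Sum>i\<in>UNIV. h $ i * c i z)) (at z)" "\<And>z i. z \<in> S \<Longrightarrow> \<bar>c i z\<bar> \<le> M"
  shows "\<bar>P x - P y\<bar> \<le> real CARD('n) * M * dist x y"
proof -
  have "norm (P x - P y) \<le> (real CARD('n) * M) * norm (x - y)"
  proof (rule differentiable_bound[OF assms(1) _ _ assms(2,3)])
    show "(P has_derivative (\<lambda>h. \<Sum>i\<in>UNIV. h $ i * c i z)) (at z within S)" if "z \<in> S" for z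
      using assms(4)[OF that] by (rule has_derivative_at_withinI)
    show "onorm (\<lambda>h. \<Sum>i\<in>UNIV. h $ i * c i z) \<le> real CARD('n) * M" if "z \<in> S" for z
      using abs_sum_components_le[of "\<lambda>i. c i z" M] assms(5)[OF that] by (intro onorm_le) auto
  qed
  then show ?thesis by (simp add: dist_norm)
qed

text \<open>The remainder is bounded uniformly in \<open>z\<close>, which permits differentiation under an integral.\<close>

lemma deriv_family_second_order:
  fixes F :: "('n::finite \<Rightarrow> nat) \<Rightarrow> real^'n \<Rightarrow> real"
  assumes F: "deriv_family F" and M: "\<And>i j z. \<bar>F (inc j (inc i \<beta>)) z\<bar> \<le> M"
  shows "\<bar>F \<beta> (z + h) - F \<beta> z - (\<Sum>i\<in>UNIV. h $ i * F (inc i \<beta>) z)\<bar> \<le> real CARD('n) * (real CARD('n) * M) * (norm h)\<^sup>2"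
proof -
  note dF = F[unfolded deriv_family_def, rule_format]
  have first: "\<bar>F (inc i \<beta>) w - F (inc i \<beta>) z\<bar> \<le> real CARD('n) * M * dist w z" for i w
    by (rule partials_mean_value[of UNIV w z "F (inc i \<beta>)" "\<lambda>j. F (inc j (inc i \<beta>))" M, OF _ _ _ dF M]) auto
  let ?P = "\<lambda>w. F \<beta> w - (\<Sum>i\<in>UNIV. w $ i * F (inc i \<beta>) z)"
  have M0: "0 \<le> M" using M abs_ge_zero order_trans by blast
  have "\<bar>?P (z + h) - ?P z\<bar> \<le> real CARD('n) * (real CARD('n) * M * norm h) * dist (z + h) z"
  proof (rule partials_mean_value[of "cball z (norm h)" _ _ _ "\<lambda>i w. F (inc i \<beta>) w - F (inc i \<beta>) z"])
    fix w assume w: "w \<in> cball z (norm h)"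
    have "((\<lambda>w. \<Sum>i\<in>UNIV. w $ i * F (inc i \<beta>) z) has_derivative (\<lambda>h. \<Sum>i\<in>UNIV. h $ i * F (inc i \<beta>) z)) (at w)"
      by (intro bounded_linear.has_derivative[OF _ has_derivative_ident] bounded_linear_sum bounded_linear_mult_const bounded_linear_vec_nth)
    from has_derivative_diff[OF dF[of \<beta> w] this]
    show "(?P has_derivative (\<lambda>h. \<Sum>i\<in>UNIV. h $ i * (F (inc i \<beta>) w - F (inc i \<beta>) z))) (at w)"
      by (simp add: algebra_simps sum_subtractf)
    fix i
    have "real CARD('n) * M * dist w z \<le> real CARD('n) * M * norm h"
      using w M0 by (intro mult_left_mono) (auto simp: dist_commute)
    then show "\<bar>F (inc i \<beta>) w - F (inc i \<beta>) z\<bar> \<le> real CARD('n) * M * norm h"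
      by (rule order_trans[OF first[of i w]])
  qed (auto simp: dist_norm)
  moreover have "?P (z + h) - ?P z = F \<beta> (z + h) - F \<beta> z - (\<Sum>i\<in>UNIV. h $ i * F (inc i \<beta>) z)"
    by (simp add: algebra_simps sum.distrib)
  ultimately show ?thesis by (simp add: dist_norm power2_eq_square mult_ac)
qed

section \<open>Convolution and mollification\<close>

lemma nn_integral_lborel_affine:
  fixes f :: "'a::euclidean_space \<Rightarrow> ennreal"
  assumes [measurable]: "f \<in> borel_measurable borel" and "c \<noteq> 0"
  shows "(\<integral>\<^sup>+x. f x \<partial>lborel) = ennreal (\<bar>c\<bar> ^ DIM('a)) * (\<integral>\<^sup>+x. f (t + c *\<^sub>R x) \<partial>lborel)"
  by (subst lborel_affine[OF assms(2), of t]) (simp add: nn_integral_density nn_integral_distr nn_integral_cmult)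

lemma nn_integral_translate:
  fixes f :: "'a::euclidean_space \<Rightarrow> ennreal"
  assumes "f \<in> borel_measurable borel"
  shows "(\<integral>\<^sup>+x. f (x - y) \<partial>lborel) = (\<integral>\<^sup>+x. f x \<partial>lborel)" "(\<integral>\<^sup>+x. f (y - x) \<partial>lborel) = (\<integral>\<^sup>+x. f x \<partial>lborel)"
  using nn_integral_lborel_affine[OF assms, of 1 "- y"] nn_integral_lborel_affine[OF assms, of "-1" y] by simp_all

lemma integral_translate:
  fixes f :: "'a::euclidean_space \<Rightarrow> real"
  assumes "f \<in> borel_measurable borel"
  shows "(\<integral>x. f (x + y) \<partial>lborel) = (\<integral>x. f x \<partial>lborel)"
  using integral_distr[of "(+) y" lborel borel f] assms by (simp add: lborel_distr_plus add.commute)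

lemma borel_imp_lebesgue_measurable:
  "f \<in> borel_measurable borel \<Longrightarrow> f \<in> borel_measurable (lebesgue :: 'a::euclidean_space measure)"
  by (rule measurable_completion) simp

subsection \<open>Power integrals\<close>

text \<open>The power function lies above its tangent at \<open>a\<close>.\<close>

lemma power_tangent:
  fixes p a t :: real
  assumes "1 \<le> p" "0 \<le> a" "0 \<le> t"
  shows "p * a powr (p - 1) * t \<le> t powr p + (p - 1) * a powr p"
proof (cases "a = 0 \<or> t = 0")
  case False
  then have at: "a > 0" "t > 0" using assms by auto
  have "((t / a) powr p) powr (1 / p) * 1 powr (1 - 1 / p) \<le> 1 / p * (t / a) powr p + (1 - 1 / p) * 1"
    using assms at by (intro Youngs_inequality_0) auto
  then have "t / a \<le> 1 / p * (t / a) powr p + (1 - 1 / p)"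
    using assms at by (simp add: powr_powr)
  then have "p * (t / a) \<le> p * (1 / p * (t / a) powr p + (1 - 1 / p))"
    using assms by (intro mult_left_mono) auto
  then have "p * (t / a) \<le> (t / a) powr p + (p - 1)" using assms by (simp add: algebra_simps)
  then have "a powr p * (p * (t / a)) \<le> a powr p * ((t / a) powr p + (p - 1))"
    by (intro mult_left_mono) auto
  moreover have "a powr p * (p * (t / a)) = p * a powr (p - 1) * t"
    using at by (simp add: powr_diff field_simps)
  moreover have "a powr p * (t / a) powr p = t powr p" using at by (simp add: powr_mult[symmetric])
  ultimately show ?thesis by (simp add: algebra_simps)
qed (use assms in auto)

text \<open>Jensen's inequality for a measure of mass at most one: integrate the tangent inequality at the mean
  of \<open>\<bar>f\<bar>\<close>.\<close>

lemma jensen_kernel: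
  fixes f k :: "'a \<Rightarrow> real"
  assumes p: "1 \<le> p" and [measurable]: "f \<in> borel_measurable M" "k \<in> borel_measurable M"
    and k: "\<And>y. 0 \<le> k y" "(\<integral>\<^sup>+y. ennreal (k y) \<partial>M) \<le> 1" and fk: "integrable M (\<lambda>y. f y * k y)"
  shows "ennreal (\<bar>\<integral>y. f y * k y \<partial>M\<bar> powr p) \<le> (\<integral>\<^sup>+y. ennreal (\<bar>f y\<bar> powr p * k y) \<partial>M)"
proof -
  define a where "a = (\<integral>y. \<bar>f y\<bar> * k y \<partial>M)"
  have ia: "integrable M (\<lambda>y. \<bar>f y\<bar> * k y)"
    using integrable_norm[OF fk] k(1) by (simp add: abs_mult)
  have a0: "0 \<le> a" unfolding a_def using k(1) by (intro Bochner_Integration.integral_nonneg) auto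
  have "\<bar>\<integral>y. f y * k y \<partial>M\<bar> \<le> a"
    unfolding a_def using integral_norm_bound[of M "\<lambda>y. f y * k y"] k(1) by (simp add: abs_mult)
  then have le: "\<bar>\<integral>y. f y * k y \<partial>M\<bar> powr p \<le> a powr p" using p by (intro powr_mono2) auto
  have nna: "(\<integral>\<^sup>+y. ennreal (\<bar>f y\<bar> * k y) \<partial>M) = ennreal a"
    unfolding a_def using ia k(1) by (intro nn_integral_eq_integral) auto
  have "ennreal (p * a powr p) = ennreal (p * a powr (p - 1)) * ennreal a"
    using p a0 by (cases "a = 0") (auto simp flip: ennreal_mult simp: powr_diff)
  also have "\<dots> = (\<integral>\<^sup>+y. ennreal (p * a powr (p - 1)) * ennreal (\<bar>f y\<bar> * k y) \<partial>M)"
    unfolding nna[symmetric] by (rule nn_integral_cmult[symmetric]) simp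
  also have "\<dots> \<le> (\<integral>\<^sup>+y. ennreal (\<bar>f y\<bar> powr p * k y) + ennreal ((p - 1) * a powr p) * ennreal (k y) \<partial>M)"
  proof (rule nn_integral_mono)
    fix y
    have "p * a powr (p - 1) * \<bar>f y\<bar> * k y \<le> (\<bar>f y\<bar> powr p + (p - 1) * a powr p) * k y"
      using power_tangent[OF p a0, of "\<bar>f y\<bar>"] k(1) by (intro mult_right_mono) auto
    then have "ennreal (p * a powr (p - 1) * \<bar>f y\<bar> * k y) \<le> ennreal (\<bar>f y\<bar> powr p * k y + ((p - 1) * a powr p) * k y)"
      by (intro ennreal_leI) (simp only: distrib_right)
    moreover have "ennreal (p * a powr (p - 1)) * ennreal (\<bar>f y\<bar> * k y) = ennreal (p * a powr (p - 1) * \<bar>f y\<bar> * k y)"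
      using p k(1)[of y] by (simp flip: ennreal_mult add: mult.assoc)
    moreover have "ennreal (\<bar>f y\<bar> powr p * k y) + ennreal ((p - 1) * a powr p) * ennreal (k y) =
        ennreal (\<bar>f y\<bar> powr p * k y + ((p - 1) * a powr p) * k y)"
      using p k(1)[of y] by (simp add: ennreal_plus ennreal_mult)
    ultimately show "ennreal (p * a powr (p - 1)) * ennreal (\<bar>f y\<bar> * k y) \<le>
        ennreal (\<bar>f y\<bar> powr p * k y) + ennreal ((p - 1) * a powr p) * ennreal (k y)" by simp
  qed
  also have "\<dots> = (\<integral>\<^sup>+y. ennreal (\<bar>f y\<bar> powr p * k y) \<partial>M) + ennreal ((p - 1) * a powr p) * (\<integral>\<^sup>+y. ennreal (k y) \<partial>M)"
    by (simp add: nn_integral_add nn_integral_cmult)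
  also have "\<dots> \<le> (\<integral>\<^sup>+y. ennreal (\<bar>f y\<bar> powr p * k y) \<partial>M) + ennreal ((p - 1) * a powr p) * 1"
    by (intro add_left_mono mult_left_mono k) auto
  finally have *: "ennreal (p * a powr p) \<le> (\<integral>\<^sup>+y. ennreal (\<bar>f y\<bar> powr p * k y) \<partial>M) + ennreal ((p - 1) * a powr p)" by simp
  have "ennreal (a powr p) \<le> (\<integral>\<^sup>+y. ennreal (\<bar>f y\<bar> powr p * k y) \<partial>M)"
  proof (cases "\<integral>\<^sup>+y. ennreal (\<bar>f y\<bar> powr p * k y) \<partial>M")
    case (real X)
    then have "ennreal (p * a powr p) \<le> ennreal (X + (p - 1) * a powr p)"
      using * p by (simp add: ennreal_plus)
    then have "p * a powr p \<le> X + (p - 1) * a powr p" using real p by (subst (asm) ennreal_le_iff) auto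
    then show ?thesis using real by (simp add: algebra_simps ennreal_leI)
  qed simp
  then show ?thesis using le by (meson ennreal_leI order_trans)
qed

text \<open>Jensen's inequality is integrated over \<open>x\<close> and the integrals are exchanged. The sets \<open>A\<close> and \<open>B\<close>
  localize the estimate, as a kernel of small support sees \<open>f\<close> near \<open>A\<close> only.\<close>

lemma convolution_power_bound:
  fixes f \<eta> :: "'a::euclidean_space \<Rightarrow> real"
  assumes p: "1 \<le> p" and [measurable]: "f \<in> borel_measurable borel" "\<eta> \<in> borel_measurable borel"
    and \<eta>: "\<And>z. 0 \<le> \<eta> z" "(\<integral>\<^sup>+z. ennreal (\<eta> z) \<partial>lborel) \<le> 1"
    and int: "\<And>x. integrable lborel (\<lambda>y. f y * \<eta> (x - y))"
    and [measurable]: "A \<in> sets borel" and AB: "\<And>x y. x \<in> A \<Longrightarrow> \<eta> (x - y) \<noteq> 0 \<Longrightarrow> y \<in> B" and [measurable]: "B \<in> sets borel"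
  shows "(\<integral>\<^sup>+x\<in>A. ennreal (\<bar>\<integral>y. f y * \<eta> (x - y) \<partial>lborel\<bar> powr p) \<partial>lborel) \<le> (\<integral>\<^sup>+y\<in>B. ennreal (\<bar>f y\<bar> powr p) \<partial>lborel)"
proof -
  have "(\<integral>\<^sup>+x\<in>A. ennreal (\<bar>\<integral>y. f y * \<eta> (x - y) \<partial>lborel\<bar> powr p) \<partial>lborel) \<le>
      (\<integral>\<^sup>+x. \<integral>\<^sup>+y. ennreal (\<bar>f y\<bar> powr p * \<eta> (x - y)) * indicator B y \<partial>lborel \<partial>lborel)"
  proof (rule nn_integral_mono)
    fix x :: 'a
    show "ennreal (\<bar>\<integral>y. f y * \<eta> (x - y) \<partial>lborel\<bar> powr p) * indicator A x \<le>
        (\<integral>\<^sup>+y. ennreal (\<bar>f y\<bar> powr p * \<eta> (x - y)) * indicator B y \<partial>lborel)"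
    proof (cases "x \<in> A")
      case True
      have "ennreal (\<bar>\<integral>y. f y * \<eta> (x - y) \<partial>lborel\<bar> powr p) \<le> (\<integral>\<^sup>+y. ennreal (\<bar>f y\<bar> powr p * \<eta> (x - y)) \<partial>lborel)"
        using \<eta> by (intro jensen_kernel p int) (auto simp: nn_integral_translate(2)[of "\<lambda>z. ennreal (\<eta> z)" x])
      also have "\<dots> = (\<integral>\<^sup>+y. ennreal (\<bar>f y\<bar> powr p * \<eta> (x - y)) * indicator B y \<partial>lborel)"
      proof (rule nn_integral_cong)
        fix y
        have "y \<in> B \<or> \<eta> (x - y) = 0" using AB[OF True] by blast
        then show "ennreal (\<bar>f y\<bar> powr p * \<eta> (x - y)) = ennreal (\<bar>f y\<bar> powr p * \<eta> (x - y)) * indicator B y" by auto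
      qed
      finally show ?thesis using True by simp
    qed simp
  qed
  also have "\<dots> = (\<integral>\<^sup>+y. \<integral>\<^sup>+x. ennreal (\<bar>f y\<bar> powr p * \<eta> (x - y)) * indicator B y \<partial>lborel \<partial>lborel)"
    by (rule lborel_pair.Fubini'[symmetric]) (simp add: case_prod_beta)
  also have "\<dots> \<le> (\<integral>\<^sup>+y\<in>B. ennreal (\<bar>f y\<bar> powr p) \<partial>lborel)"
  proof (rule nn_integral_mono)
    fix y :: 'a
    have "(\<integral>\<^sup>+x. ennreal (\<bar>f y\<bar> powr p * \<eta> (x - y)) * indicator B y \<partial>lborel) =
        (\<integral>\<^sup>+x. (ennreal (\<bar>f y\<bar> powr p) * indicator B y) * ennreal (\<eta> (x - y)) \<partial>lborel)"
      using \<eta>(1) by (intro nn_integral_cong) (simp add: ennreal_mult mult_ac)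
    also have "\<dots> = (ennreal (\<bar>f y\<bar> powr p) * indicator B y) * (\<integral>\<^sup>+x. ennreal (\<eta> (x - y)) \<partial>lborel)"
      by (rule nn_integral_cmult) simp
    also have "\<dots> \<le> (ennreal (\<bar>f y\<bar> powr p) * indicator B y) * 1"
      using \<eta>(2) nn_integral_translate(1)[of "\<lambda>z. ennreal (\<eta> z)" y] by (intro mult_left_mono) auto
    finally show "(\<integral>\<^sup>+x. ennreal (\<bar>f y\<bar> powr p * \<eta> (x - y)) * indicator B y \<partial>lborel) \<le> ennreal (\<bar>f y\<bar> powr p) * indicator B y" by simp
  qed
  finally show ?thesis .
qed

lemma powr_add_le:
  fixes a b p :: real
  assumes "0 \<le> p" shows "\<bar>a + b\<bar> powr p \<le> 2 powr p * (\<bar>a\<bar> powr p + \<bar>b\<bar> powr p)"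
proof -
  have "\<bar>a + b\<bar> powr p \<le> (2 * max \<bar>a\<bar> \<bar>b\<bar>) powr p" using assms by (intro powr_mono2) auto
  also have "\<dots> = 2 powr p * max \<bar>a\<bar> \<bar>b\<bar> powr p" by (simp add: powr_mult)
  also have "\<dots> \<le> 2 powr p * (\<bar>a\<bar> powr p + \<bar>b\<bar> powr p)" by (intro mult_left_mono) (auto simp: max_def)
  finally show ?thesis .
qed

lemma power_integral_add:
  assumes "0 \<le> p" and [measurable]: "f \<in> borel_measurable M" "g \<in> borel_measurable M"
  shows "(\<integral>\<^sup>+x. ennreal (\<bar>f x + g x\<bar> powr p) \<partial>M) \<le>
    ennreal (2 powr p) * ((\<integral>\<^sup>+x. ennreal (\<bar>f x\<bar> powr p) \<partial>M) + (\<integral>\<^sup>+x. ennreal (\<bar>g x\<bar> powr p) \<partial>M))"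
proof -
  have "(\<integral>\<^sup>+x. ennreal (\<bar>f x + g x\<bar> powr p) \<partial>M) \<le>
      (\<integral>\<^sup>+x. ennreal (2 powr p) * (ennreal (\<bar>f x\<bar> powr p) + ennreal (\<bar>g x\<bar> powr p)) \<partial>M)"
    using powr_add_le[OF assms(1)] by (intro nn_integral_mono) (simp flip: ennreal_mult ennreal_plus add: ennreal_leI)
  also have "\<dots> = ennreal (2 powr p) * ((\<integral>\<^sup>+x. ennreal (\<bar>f x\<bar> powr p) \<partial>M) + (\<integral>\<^sup>+x. ennreal (\<bar>g x\<bar> powr p) \<partial>M))"
    by (simp add: nn_integral_cmult nn_integral_add)
  finally show ?thesis .
qed

text \<open>A measurable function is a limit almost everywhere of continuous functions; truncating these in
  value and in space makes the convergence dominated.\<close>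

lemma bounded_continuous_approx:
  fixes f :: "'a::euclidean_space \<Rightarrow> real"
  assumes p: "1 \<le> p" and f: "f \<in> borel_measurable borel" and B: "\<And>x. \<bar>f x\<bar> \<le> N" "\<And>x. N < norm x \<Longrightarrow> f x = 0" and e: "0 < e"
  shows "\<exists>h r. continuous_on UNIV h \<and> (\<forall>x. r < norm x \<longrightarrow> h x = 0) \<and> (\<integral>\<^sup>+x. ennreal (\<bar>f x - h x\<bar> powr p) \<partial>lborel) < ennreal e"
proof -
  have N0: "0 \<le> N" using B(1)[of 0] by linarith
  have "f measurable_on UNIV"
    using borel_imp_lebesgue_measurable[OF f] by (simp add: measurable_on_iff_borel_measurable lebesgue_on_UNIV_eq)
  then obtain Z g where Z: "negligible Z" and g: "\<And>n. continuous_on UNIV (g n)"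
    and lim: "\<And>x. x \<notin> Z \<Longrightarrow> (\<lambda>n. g n x) \<longlonglongrightarrow> f x"
    by (auto simp: measurable_on_def)
  define cut where "cut x = max 0 (min 1 (N + 1 - norm x))" for x :: 'a
  define h where "h n x = max (- N) (min N (g n x)) * cut x" for n x
  have cut: "0 \<le> cut x" "cut x \<le> 1" "norm x \<le> N \<Longrightarrow> cut x = 1" "N + 1 < norm x \<Longrightarrow> cut x = 0" for x
    by (auto simp: cut_def)
  have hc: "continuous_on UNIV (h n)" for n
    unfolding h_def cut_def by (intro continuous_intros g)
  have hb: "\<bar>h n x\<bar> \<le> N" for n x
  proof -
    have "\<bar>max (- N) (min N (g n x))\<bar> * cut x \<le> N * 1" using N0 cut[of x] by (intro mult_mono) auto
    then show ?thesis using cut(1) by (simp add: h_def abs_mult)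
  qed
  have "(\<lambda>n. \<integral>\<^sup>+x. ennreal (\<bar>f x - h n x\<bar> powr p) \<partial>lebesgue) \<longlonglongrightarrow> (\<integral>\<^sup>+x. 0 \<partial>(lebesgue :: 'a measure))"
  proof (rule nn_integral_dominated_convergence[where w = "\<lambda>x. ennreal ((2 * N) powr p) * indicator (cball 0 (N + 1)) x"])
    show "(\<lambda>x. ennreal (\<bar>f x - h n x\<bar> powr p)) \<in> borel_measurable lebesgue" for n
    proof -
      have "h n \<in> borel_measurable borel" using hc by (rule borel_measurable_continuous_onI)
      then have "(\<lambda>x. ennreal (\<bar>f x - h n x\<bar> powr p)) \<in> borel_measurable borel" using f by measurable
      then show ?thesis by (rule borel_imp_lebesgue_measurable)
    qed
    have "(\<lambda>x. ennreal ((2 * N) powr p) * indicator (cball (0::'a) (N + 1)) x) \<in> borel_measurable borel"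
      by (intro borel_measurable_times_ennreal borel_measurable_const borel_measurable_indicator) auto
    then show "(\<lambda>x. ennreal ((2 * N) powr p) * indicator (cball (0::'a) (N + 1)) x) \<in> borel_measurable lebesgue"
      by (rule borel_imp_lebesgue_measurable)
    show "AE x in lebesgue. ennreal (\<bar>f x - h n x\<bar> powr p) \<le> ennreal ((2 * N) powr p) * indicator (cball 0 (N + 1)) x" for n
    proof (rule AE_I2)
      fix x
      have "\<bar>f x - h n x\<bar> \<le> 2 * N" using B(1)[of x] hb[of n x] by linarith
      then have "\<bar>f x - h n x\<bar> powr p \<le> (2 * N) powr p" using p by (intro powr_mono2) auto
      moreover have "f x - h n x = 0" if "N + 1 < norm x"
        using that B(2)[of x] cut(4)[of x] by (simp add: h_def)
      ultimately show "ennreal (\<bar>f x - h n x\<bar> powr p) \<le> ennreal ((2 * N) powr p) * indicator (cball 0 (N + 1)) x"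
        by (cases "N + 1 < norm x") (auto simp: indicator_def ennreal_leI)
    qed
    have "emeasure lborel (cball (0::'a) (N + 1)) < \<infinity>"
      by (rule emeasure_lborel_cball_finite)
    then show "(\<integral>\<^sup>+x. ennreal ((2 * N) powr p) * indicator (cball (0::'a) (N + 1)) x \<partial>lebesgue) < \<infinity>"
      unfolding nn_integral_completion by (subst nn_integral_cmult_indicator) (simp_all add: ennreal_mult_less_top)
    have "AE x in lebesgue. x \<notin> Z" using Z by (simp add: AE_not_in negligible_iff_null_sets)
    then show "AE x in lebesgue. (\<lambda>n. ennreal (\<bar>f x - h n x\<bar> powr p)) \<longlonglongrightarrow> 0"
    proof eventually_elim
      case (elim x)
      have "(\<lambda>n. h n x) \<longlonglongrightarrow> max (- N) (min N (f x)) * cut x"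
        unfolding h_def by (intro tendsto_intros lim elim)
      moreover have "max (- N) (min N (f x)) * cut x = f x"
        using B(1)[of x] B(2)[of x] cut(3)[of x] by (cases "N < norm x") (auto simp: max_def min_def)
      ultimately have "(\<lambda>n. \<bar>f x - h n x\<bar>) \<longlonglongrightarrow> \<bar>f x - f x\<bar>" by (intro tendsto_intros) auto
      then have "(\<lambda>n. \<bar>f x - h n x\<bar> powr p) \<longlonglongrightarrow> 0 powr p"
        using p by (intro tendsto_powr2) auto
      then show ?case using p by (simp add: tendsto_ennrealI[of _ 0, simplified])
    qed
  qed simp
  then have "eventually (\<lambda>n. (\<integral>\<^sup>+x. ennreal (\<bar>f x - h n x\<bar> powr p) \<partial>lebesgue) < ennreal e) sequentially"
    using e by (intro order_tendstoD(2)) (auto simp: ennreal_zero_less_mult_iff)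
  then obtain n where "(\<integral>\<^sup>+x. ennreal (\<bar>f x - h n x\<bar> powr p) \<partial>lborel) < ennreal e"
    unfolding nn_integral_completion eventually_sequentially by blast
  moreover have "\<forall>x. N + 1 < norm x \<longrightarrow> h n x = 0" using cut(4) by (simp add: h_def)
  ultimately show ?thesis using hc by blast
qed

lemma Lp_continuous_approx:
  fixes f :: "'a::euclidean_space \<Rightarrow> real"
  assumes p: "1 \<le> p" and [measurable]: "f \<in> borel_measurable borel"
    and fin: "(\<integral>\<^sup>+x. ennreal (\<bar>f x\<bar> powr p) \<partial>lborel) < \<infinity>" and e: "0 < e"
  shows "\<exists>h r. continuous_on UNIV h \<and> (\<forall>x. r < norm x \<longrightarrow> h x = 0) \<and> (\<integral>\<^sup>+x. ennreal (\<bar>f x - h x\<bar> powr p) \<partial>lborel) < ennreal e"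
proof -
  define g where "g n x = (if norm x \<le> real n then max (- real n) (min (real n) (f x)) else 0)" for n :: nat and x
  have [measurable]: "g n \<in> borel_measurable borel" for n unfolding g_def by measurable
  have lim: "(\<lambda>n. \<integral>\<^sup>+x. ennreal (\<bar>f x - g n x\<bar> powr p) \<partial>lborel) \<longlonglongrightarrow> (\<integral>\<^sup>+x. 0 \<partial>(lborel :: 'a measure))"
  proof (rule nn_integral_dominated_convergence[where w = "\<lambda>x. ennreal (\<bar>f x\<bar> powr p)"])
    show "AE x in lborel. ennreal (\<bar>f x - g n x\<bar> powr p) \<le> ennreal (\<bar>f x\<bar> powr p)" for n
      using p by (intro AE_I2 ennreal_leI powr_mono2) (auto simp: g_def max_def min_def)
    show "AE x in lborel. (\<lambda>n. ennreal (\<bar>f x - g n x\<bar> powr p)) \<longlonglongrightarrow> 0"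
    proof (rule AE_I2)
      fix x
      obtain N :: nat where "max \<bar>f x\<bar> (norm x) \<le> real N" using real_arch_simple by blast
      then have N: "\<bar>f x\<bar> \<le> real N" "norm x \<le> real N" by auto
      have "ennreal (\<bar>f x - g n x\<bar> powr p) = 0" if "N \<le> n" for n
      proof -
        have "\<bar>f x\<bar> \<le> real n" "norm x \<le> real n" using N that by linarith+
        then have "g n x = f x" by (auto simp: g_def max_def min_def)
        then show ?thesis using p by simp
      qed
      then show "(\<lambda>n. ennreal (\<bar>f x - g n x\<bar> powr p)) \<longlonglongrightarrow> 0"
        by (intro tendsto_eventually) (auto simp: eventually_sequentially)
    qed
  qed (use fin in auto)
  define e' where "e' = e / (2 * 2 powr p)"
  have e': "e' > 0" "2 powr p * (e' + e') = e" using e by (auto simp: e'_def field_simps)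
  obtain n where n: "(\<integral>\<^sup>+x. ennreal (\<bar>f x - g n x\<bar> powr p) \<partial>lborel) < ennreal e'"
    using order_tendstoD(2)[OF lim, of "ennreal e'"] e'
    by (auto simp: eventually_sequentially)
  have "\<exists>h r. continuous_on UNIV h \<and> (\<forall>x. r < norm x \<longrightarrow> h x = 0) \<and> (\<integral>\<^sup>+x. ennreal (\<bar>g n x - h x\<bar> powr p) \<partial>lborel) < ennreal e'"
    by (rule bounded_continuous_approx[OF p _ _ _ e'(1), where N = "real n"]) (auto simp: g_def)
  then obtain h r where h: "continuous_on UNIV h" "\<forall>x. r < norm x \<longrightarrow> h x = 0"
    "(\<integral>\<^sup>+x. ennreal (\<bar>g n x - h x\<bar> powr p) \<partial>lborel) < ennreal e'" by blast
  have [measurable]: "h \<in> borel_measurable borel" using h(1) by (rule borel_measurable_continuous_onI)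
  have "(\<integral>\<^sup>+x. ennreal (\<bar>f x - h x\<bar> powr p) \<partial>lborel) = (\<integral>\<^sup>+x. ennreal (\<bar>(f x - g n x) + (g n x - h x)\<bar> powr p) \<partial>lborel)"
    by simp
  also have "\<dots> \<le> ennreal (2 powr p) * ((\<integral>\<^sup>+x. ennreal (\<bar>f x - g n x\<bar> powr p) \<partial>lborel) + (\<integral>\<^sup>+x. ennreal (\<bar>g n x - h x\<bar> powr p) \<partial>lborel))"
    using p by (intro power_integral_add) auto
  also have "\<dots> < ennreal (2 powr p) * (ennreal e' + ennreal e')"
    by (intro ennreal_mult_strict_left_mono add_strict_mono n h) auto
  also have "\<dots> = ennreal e" using e' by (simp flip: ennreal_plus ennreal_mult)
  finally show ?thesis using h by blast
qed

lemma integrable_continuous_bounded_support: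
  fixes g :: "'a::euclidean_space \<Rightarrow> real"
  assumes "continuous_on UNIV g" "\<And>x. r < norm x \<Longrightarrow> g x = 0"
  shows "integrable lborel g"
proof -
  have "(\<lambda>z. indicator (cball 0 r) z *\<^sub>R g z) = g"
    using assms(2) by (auto simp: indicator_def fun_eq_iff not_le[symmetric])
  moreover have "integrable lborel (\<lambda>z. indicator (cball 0 r) z *\<^sub>R g z)"
    by (rule borel_integrable_compact) (auto intro: continuous_on_subset[OF assms(1)])
  ultimately show ?thesis by simp
qed

subsection \<open>The mollifier\<close>

definition bump_mass :: "'n::finite itself \<Rightarrow> real" where
  "bump_mass _ = (\<integral>z. tensor_bump (\<lambda>_. 0) (z :: real^'n) \<partial>lborel)"

definition mollifier :: "real \<Rightarrow> real^'n \<Rightarrow> real" where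
  "mollifier \<rho> z = tensor_bump (\<lambda>_. 0) ((1 / \<rho>) *\<^sub>R z) / (bump_mass TYPE('n) * \<rho> ^ CARD('n))"

lemma tensor_bump_continuous: "continuous_on S (tensor_bump \<beta>)"
  using smooth_continuous_on[OF deriv_family_smooth[OF deriv_family_tensor_bump, of _ UNIV]] continuous_on_subset by blast

lemma tensor_bump_measurable [measurable]: "tensor_bump \<beta> \<in> borel_measurable borel"
  by (rule borel_measurable_continuous_onI[OF tensor_bump_continuous])

lemma tensor_bump_integrable: "integrable lborel (tensor_bump \<beta> :: real^'n \<Rightarrow> real)"
  by (rule integrable_continuous_bounded_support[OF tensor_bump_continuous, of "real CARD('n)"])
    (use tensor_bump_support in \<open>force simp: not_le[symmetric]\<close>)

lemma bump_mass_pos: "0 < bump_mass TYPE('n::finite)"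
proof -
  let ?f = "tensor_bump (\<lambda>_. 0) :: real^'n \<Rightarrow> real"
  have "isCont ?f 0" using tensor_bump_continuous[of UNIV "\<lambda>_::'n. 0"] by (simp add: continuous_on_eq_continuous_at)
  then obtain \<delta> where \<delta>: "\<delta> > 0" "\<And>z. dist z 0 < \<delta> \<Longrightarrow> dist (?f z) (?f 0) < 1 / 2"
    unfolding continuous_at by (metis Lim_at continuous_at continuous_at_eps_delta half_gt_zero zero_less_one)
  have "0 < measure lborel (ball (0::real^'n) \<delta>) * (1 / 2)"
    using content_ball_pos[OF \<delta>(1), of "0::real^'n"] by simp
  also have "\<dots> = (\<integral>z. indicator (ball (0::real^'n) \<delta>) z * (1 / 2) \<partial>lborel)" by simp
  also have "\<dots> \<le> (\<integral>z. ?f z \<partial>lborel)"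
  proof (rule integral_mono)
    show "integrable lborel (\<lambda>z. indicator (ball (0::real^'n) \<delta>) z * (1 / 2 :: real))"
      using emeasure_lborel_ball_finite[of "0::real^'n" \<delta>] by (intro integrable_mult_left integrable_real_indicator) auto
    show "integrable lborel ?f" by (rule tensor_bump_integrable)
    fix z
    show "indicator (ball 0 \<delta>) z * (1 / 2) \<le> ?f z"
    proof (cases "dist z 0 < \<delta>")
      case True
      have "- (?f z - 1) < 1 / 2"
        by (rule le_less_trans[OF abs_ge_minus_self])
          (use \<delta>(2)[OF True] in \<open>simp add: tensor_bump_at_0 dist_real_def\<close>)
      then show ?thesis by (simp add: indicator_def)
    qed (simp add: tensor_bump_nonneg indicator_def dist_commute)
  qed
  finally show ?thesis by (simp add: bump_mass_def)
qed

lemma mollifier_nonneg: "0 < \<rho> \<Longrightarrow> 0 \<le> mollifier \<rho> (z :: real^'n)"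
  unfolding mollifier_def using bump_mass_pos[where 'n = 'n]
  by (intro divide_nonneg_nonneg tensor_bump_nonneg mult_nonneg_nonneg) auto

lemma mollifier_measurable [measurable]: "mollifier \<rho> \<in> borel_measurable borel"
  unfolding mollifier_def by measurable

lemma mollifier_mass:
  assumes "0 < \<rho>" shows "(\<integral>\<^sup>+z. ennreal (mollifier \<rho> (z :: real^'n)) \<partial>lborel) = 1"
proof -
  let ?m = "bump_mass TYPE('n)"
  have nn: "(\<integral>\<^sup>+z. ennreal (tensor_bump (\<lambda>_. 0) (z :: real^'n)) \<partial>lborel) = ennreal ?m"
    unfolding bump_mass_def by (rule nn_integral_eq_integral[OF tensor_bump_integrable]) (simp add: tensor_bump_nonneg)
  have "(\<integral>\<^sup>+z. ennreal (mollifier \<rho> (z :: real^'n)) \<partial>lborel) =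
      ennreal (\<bar>\<rho>\<bar> ^ CARD('n)) * (\<integral>\<^sup>+z. ennreal (mollifier \<rho> (0 + \<rho> *\<^sub>R (z :: real^'n))) \<partial>lborel)"
    using assms nn_integral_lborel_affine[of "\<lambda>z. ennreal (mollifier \<rho> (z::real^'n))" \<rho> 0] by simp
  also have "(\<integral>\<^sup>+z. ennreal (mollifier \<rho> (0 + \<rho> *\<^sub>R (z :: real^'n))) \<partial>lborel) =
      (\<integral>\<^sup>+z. ennreal (1 / (?m * \<rho> ^ CARD('n))) * ennreal (tensor_bump (\<lambda>_. 0) (z :: real^'n)) \<partial>lborel)"
    using assms bump_mass_pos[where 'n = 'n]
    by (intro nn_integral_cong) (simp flip: ennreal_mult add: mollifier_def tensor_bump_nonneg)
  also have "\<dots> = ennreal (1 / (?m * \<rho> ^ CARD('n))) * ennreal ?m"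
    by (simp add: nn_integral_cmult nn)
  finally show ?thesis using assms bump_mass_pos[where 'n = 'n] by (simp flip: ennreal_mult)
qed

lemma mollifier_integral: "0 < \<rho> \<Longrightarrow> (\<integral>y. mollifier \<rho> (x - y) \<partial>lborel) = 1" for x :: "real^'n"
  using mollifier_mass[of \<rho>] mollifier_nonneg[of \<rho>] nn_integral_translate(2)[of "\<lambda>z. ennreal (mollifier \<rho> z)" x]
  by (subst integral_eq_nn_integral) auto

lemma mollifier_support: "0 < \<rho> \<Longrightarrow> mollifier \<rho> z \<noteq> 0 \<Longrightarrow> norm z \<le> real CARD('n) * \<rho>" for z :: "real^'n"
proof -
  assume "0 < \<rho>" "mollifier \<rho> z \<noteq> 0"
  then have "norm ((1 / \<rho>) *\<^sub>R z) \<le> real CARD('n)" by (intro tensor_bump_support) (auto simp: mollifier_def)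
  then show ?thesis using \<open>0 < \<rho>\<close> by (simp add: field_simps)
qed

lemma mollifier_bounded: assumes "0 < \<rho>" obtains M where "\<And>z::real^'n. \<bar>mollifier \<rho> z\<bar> \<le> M"
proof -
  obtain B where B: "\<And>z::real^'n. \<bar>tensor_bump (\<lambda>_. 0) z\<bar> \<le> B"
    using tensor_bump_bounded[where 'n = 'n, of 0] by (metis mi_order_zero order_refl)
  show ?thesis
  proof (rule that)
    fix z :: "real^'n"
    show "\<bar>mollifier \<rho> z\<bar> \<le> B / (bump_mass TYPE('n) * \<rho> ^ CARD('n))"
      unfolding mollifier_def abs_divide using assms bump_mass_pos[where 'n = 'n] B
      by (simp add: divide_right_mono abs_mult)
  qed
qed

lemma integrable_times_mollifier:
  fixes f :: "real^'n \<Rightarrow> real"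
  assumes "integrable lborel f" "0 < \<rho>" shows "integrable lborel (\<lambda>y. f y * mollifier \<rho> (x - y))"
proof -
  obtain M where M: "\<And>z::real^'n. \<bar>mollifier \<rho> z\<bar> \<le> M" using mollifier_bounded[OF assms(2)] by blast
  have "integrable lborel (\<lambda>y. M * f y)" using assms(1) by simp
  then show ?thesis
  proof (rule Bochner_Integration.integrable_bound)
    show "(\<lambda>y. f y * mollifier \<rho> (x - y)) \<in> borel_measurable lborel" using assms(1) by simp
    show "AE y in lborel. norm (f y * mollifier \<rho> (x - y)) \<le> norm (M * f y)"
    proof (rule AE_I2)
      fix y
      have "\<bar>f y\<bar> * \<bar>mollifier \<rho> (x - y)\<bar> \<le> \<bar>f y\<bar> * \<bar>M\<bar>"
        using M[of "x - y"] by (intro mult_left_mono) auto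
      then show "norm (f y * mollifier \<rho> (x - y)) \<le> norm (M * f y)" by (simp add: abs_mult mult.commute)
    qed
  qed
qed

lemma mollify_continuous_close:
  fixes h :: "real^'n \<Rightarrow> real"
  assumes p: "1 \<le> p" and h: "continuous_on UNIV h" "\<And>x. r < norm x \<Longrightarrow> h x = 0" and e: "0 < e"
  shows "\<exists>\<rho>0>0. \<forall>\<rho>. 0 < \<rho> \<and> \<rho> < \<rho>0 \<longrightarrow>
    (\<integral>\<^sup>+x. ennreal (\<bar>h x - (\<integral>y. h y * mollifier \<rho> (x - y) \<partial>lborel)\<bar> powr p) \<partial>lborel) < ennreal e"
proof -
  let ?n = "real CARD('n)"
  define V where "V = measure lborel (cball (0::real^'n) (r + 1))"
  define \<epsilon> where "\<epsilon> = (e / (2 * (V + 1))) powr (1 / p)"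
  have V0: "0 \<le> V" by (simp add: V_def)
  have \<epsilon>: "\<epsilon> > 0" "\<epsilon> powr p * V < e"
  proof -
    show "\<epsilon> > 0" using e V0 by (simp add: \<epsilon>_def)
    have "\<epsilon> powr p = e / (2 * (V + 1))" using e V0 p by (simp add: \<epsilon>_def powr_powr)
    then show "\<epsilon> powr p * V < e" using e V0 
      using mult_strict_left_mono[of V "2 * (V + 1)" e] by (simp add: divide_less_eq)
  qed
  have hint: "integrable lborel h" by (rule integrable_continuous_bounded_support[OF h(1,2)])
  have "uniformly_continuous_on (cball 0 (r + 2)) h"
    by (intro compact_uniformly_continuous continuous_on_subset[OF h(1)]) auto
  then obtain \<delta> where \<delta>: "\<delta> > 0" "\<And>x y. x \<in> cball 0 (r + 2) \<Longrightarrow> y \<in> cball 0 (r + 2) \<Longrightarrow> dist y x < \<delta> \<Longrightarrow> dist (h y) (h x) < \<epsilon>"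
    unfolding uniformly_continuous_on_def using \<epsilon>(1) by metis
  define \<rho>0 where "\<rho>0 = min \<delta> 1 / ?n"
  have \<rho>0: "\<rho>0 > 0" using \<delta>(1) by (simp add: \<rho>0_def)
  have "(\<integral>\<^sup>+x. ennreal (\<bar>h x - (\<integral>y. h y * mollifier \<rho> (x - y) \<partial>lborel)\<bar> powr p) \<partial>lborel) < ennreal e"
    if \<rho>: "0 < \<rho>" "\<rho> < \<rho>0" for \<rho>
  proof -
    have n\<rho>: "?n * \<rho> < \<delta>" "?n * \<rho> < 1" using \<rho> by (auto simp: \<rho>0_def field_simps)
    have diff: "\<bar>h x - (\<integral>y. h y * mollifier \<rho> (x - y) \<partial>lborel)\<bar> \<le> \<epsilon> * indicator (cball 0 (r + 1)) x" for x
    proof (cases "r + 1 < norm x")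
      case True
      have "h y * mollifier \<rho> (x - y) = 0" for y
      proof (rule ccontr)
        assume "h y * mollifier \<rho> (x - y) \<noteq> 0"
        then have "norm y \<le> r" "norm (x - y) < 1"
          using h(2)[of y] mollifier_support[OF \<rho>(1), of "x - y"] n\<rho> by (force, force)
        then show False using True norm_triangle_sub[of x y] by linarith
      qed
      then have "(\<lambda>y. h y * mollifier \<rho> (x - y)) = (\<lambda>_. 0)" by (rule ext)
      then have "(\<integral>y. h y * mollifier \<rho> (x - y) \<partial>lborel) = 0" by (simp only: integral_zero)
      then show ?thesis using True h(2)[of x] by (simp add: indicator_def)
    next
      case False
      have mint: "integrable lborel (\<lambda>y. mollifier \<rho> (x - y))"
        using mollifier_integral[OF \<rho>(1), of x] not_integrable_integral_eq by fastforce
      have "h x - (\<integral>y. h y * mollifier \<rho> (x - y) \<partial>lborel) = (\<integral>y. (h x - h y) * mollifier \<rho> (x - y) \<partial>lborel)"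
        using mint integrable_times_mollifier[OF hint \<rho>(1), of x] mollifier_integral[OF \<rho>(1), of x]
        by (simp add: left_diff_distrib)
      also have "\<bar>\<dots>\<bar> \<le> (\<integral>y. \<bar>(h x - h y) * mollifier \<rho> (x - y)\<bar> \<partial>lborel)" by (rule integral_abs_bound)
      also have "\<dots> \<le> (\<integral>y. \<epsilon> * mollifier \<rho> (x - y) \<partial>lborel)"
      proof (rule integral_mono')
        show "integrable lborel (\<lambda>y. \<epsilon> * mollifier \<rho> (x - y))" using mint by simp
        show "\<bar>(h x - h y) * mollifier \<rho> (x - y)\<bar> \<le> \<epsilon> * mollifier \<rho> (x - y)" for y
        proof (cases "mollifier \<rho> (x - y) = 0")
          case nz: False
          have d: "dist x y \<le> ?n * \<rho>" using mollifier_support[OF \<rho>(1) nz] by (simp add: dist_norm)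
          then have "norm y \<le> r + 2" using False n\<rho> norm_triangle_sub[of y x] by (simp add: dist_norm norm_minus_commute)
          then have "dist (h y) (h x) < \<epsilon>" using \<delta>(2)[of x y] d n\<rho> False by (auto simp: dist_commute)
          then show ?thesis using mollifier_nonneg[OF \<rho>(1), of "x - y"]
            by (simp add: abs_mult dist_real_def abs_minus_commute mult_right_mono)
        qed simp
        show "0 \<le> \<epsilon> * mollifier \<rho> (x - y)" for y using \<epsilon>(1) mollifier_nonneg[OF \<rho>(1), of "x - y"] by simp
      qed
      also have "\<dots> = \<epsilon>" using mollifier_integral[OF \<rho>(1), of x] by simp
      finally show ?thesis using False by (simp add: indicator_def)
    qed
    have "(\<integral>\<^sup>+x. ennreal (\<bar>h x - (\<integral>y. h y * mollifier \<rho> (x - y) \<partial>lborel)\<bar> powr p) \<partial>lborel) \<le>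
        (\<integral>\<^sup>+x. ennreal (\<epsilon> powr p) * indicator (cball (0::real^'n) (r + 1)) x \<partial>lborel)"
    proof (rule nn_integral_mono)
      fix x :: "real^'n"
      have "\<bar>h x - (\<integral>y. h y * mollifier \<rho> (x - y) \<partial>lborel)\<bar> powr p \<le> (\<epsilon> * indicator (cball 0 (r + 1)) x) powr p"
        using diff p by (intro powr_mono2) auto
      then show "ennreal (\<bar>h x - (\<integral>y. h y * mollifier \<rho> (x - y) \<partial>lborel)\<bar> powr p) \<le> ennreal (\<epsilon> powr p) * indicator (cball 0 (r + 1)) x"
        using p by (auto simp: indicator_def ennreal_leI split: if_splits)
    qed
    also have "\<dots> = ennreal (\<epsilon> powr p) * ennreal V"
      using emeasure_lborel_cball_finite[of "0::real^'n" "r + 1"]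
      by (subst nn_integral_cmult_indicator) (simp_all add: V_def emeasure_eq_ennreal_measure less_top)
    also have "\<dots> < ennreal e" using \<epsilon> V0 by (simp flip: ennreal_mult add: ennreal_less_iff)
    finally show ?thesis .
  qed
  then show ?thesis using \<rho>0 by blast
qed

text \<open>This holds for a continuous function of bounded support by uniform continuity. In general, the
  difference between \<open>f\<close> and such a function is small, and so is its mollification.\<close>

proposition mollify_Lp:
  fixes f :: "real^'n \<Rightarrow> real"
  assumes p: "1 \<le> p" and f: "integrable lborel f"
    and fin: "(\<integral>\<^sup>+x. ennreal (\<bar>f x\<bar> powr p) \<partial>lborel) < \<infinity>" and e: "0 < e"
  shows "\<exists>\<rho>0>0. \<forall>\<rho>. 0 < \<rho> \<and> \<rho> < \<rho>0 \<longrightarrow>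
    (\<integral>\<^sup>+x. ennreal (\<bar>f x - (\<integral>y. f y * mollifier \<rho> (x - y) \<partial>lborel)\<bar> powr p) \<partial>lborel) < ennreal e"
proof -
  have [measurable]: "f \<in> borel_measurable borel" using f by simp
  define q where "q = (2::real) powr p"
  have q: "q > 0" by (simp add: q_def)
  define e' where "e' = e / (q * (1 + 2 * q))"
  have e': "e' > 0" using e q by (simp add: e'_def)
  have "q * (e' + q * (e' + e')) = (q * (1 + 2 * q)) * e'" by (simp add: algebra_simps)
  also have "\<dots> = e" using q by (simp add: e'_def)
  finally have e'_sum: "q * (e' + q * (e' + e')) = e" .
  obtain h r where h: "continuous_on UNIV h" "\<And>x. r < norm x \<Longrightarrow> h x = 0"
    and fh: "(\<integral>\<^sup>+x. ennreal (\<bar>f x - h x\<bar> powr p) \<partial>lborel) < ennreal e'"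
    using Lp_continuous_approx[OF p _ fin e'] by auto
  have hint: "integrable lborel h" by (rule integrable_continuous_bounded_support[OF h(1,2)])
  then have [measurable]: "h \<in> borel_measurable borel" by simp
  obtain \<rho>0 where \<rho>0: "\<rho>0 > 0" and hm: "\<And>\<rho>. 0 < \<rho> \<and> \<rho> < \<rho>0 \<Longrightarrow>
    (\<integral>\<^sup>+x. ennreal (\<bar>h x - (\<integral>y. h y * mollifier \<rho> (x - y) \<partial>lborel)\<bar> powr p) \<partial>lborel) < ennreal e'"
    using mollify_continuous_close[OF p h e'] by blast
  have "(\<integral>\<^sup>+x. ennreal (\<bar>f x - (\<integral>y. f y * mollifier \<rho> (x - y) \<partial>lborel)\<bar> powr p) \<partial>lborel) < ennreal e"
    if \<rho>: "0 < \<rho>" "\<rho> < \<rho>0" for \<rho>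
  proof -
    let ?A = "\<lambda>f x. \<integral>y. f y * mollifier \<rho> (x - y) \<partial>lborel"
    have ma: "?A g \<in> borel_measurable borel" if [measurable]: "g \<in> borel_measurable borel" for g :: "real^'n \<Rightarrow> real" by measurable
    have lin: "?A f x = ?A h x + ?A (\<lambda>y. f y - h y) x" for x
      using integrable_times_mollifier[OF f \<rho>(1), of x] integrable_times_mollifier[OF hint \<rho>(1), of x]
      by (simp add: left_diff_distrib)
    have A: "(\<integral>\<^sup>+x. ennreal (\<bar>- ?A (\<lambda>y. f y - h y) x\<bar> powr p) \<partial>lborel) \<le> (\<integral>\<^sup>+x. ennreal (\<bar>f x - h x\<bar> powr p) \<partial>lborel)"
      using convolution_power_bound[OF p, of "\<lambda>y. f y - h y" "mollifier \<rho>" UNIV UNIV]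
        mollifier_nonneg[OF \<rho>(1), where 'n = 'n] mollifier_mass[OF \<rho>(1), where 'n = 'n]
        integrable_times_mollifier[OF Bochner_Integration.integrable_diff[OF f hint] \<rho>(1)] by simp
    have "(\<integral>\<^sup>+x. ennreal (\<bar>f x - ?A f x\<bar> powr p) \<partial>lborel) =
        (\<integral>\<^sup>+x. ennreal (\<bar>(f x - h x) + ((h x - ?A h x) + - ?A (\<lambda>y. f y - h y) x)\<bar> powr p) \<partial>lborel)"
      unfolding lin by (intro nn_integral_cong) (simp add: algebra_simps)
    also have "\<dots> \<le> ennreal q * ((\<integral>\<^sup>+x. ennreal (\<bar>f x - h x\<bar> powr p) \<partial>lborel) +
        (\<integral>\<^sup>+x. ennreal (\<bar>(h x - ?A h x) + - ?A (\<lambda>y. f y - h y) x\<bar> powr p) \<partial>lborel))"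
      unfolding q_def using p by (intro power_integral_add) auto
    also have "\<dots> \<le> ennreal q * ((\<integral>\<^sup>+x. ennreal (\<bar>f x - h x\<bar> powr p) \<partial>lborel) +
        ennreal q * ((\<integral>\<^sup>+x. ennreal (\<bar>h x - ?A h x\<bar> powr p) \<partial>lborel) + (\<integral>\<^sup>+x. ennreal (\<bar>- ?A (\<lambda>y. f y - h y) x\<bar> powr p) \<partial>lborel)))"
      unfolding q_def using p by (intro mult_left_mono add_left_mono power_integral_add) auto
    also have "\<dots> < ennreal q * (ennreal e' + ennreal q * (ennreal e' + ennreal e'))"
      using q by (intro ennreal_mult_strict_left_mono add_strict_mono fh hm le_less_trans[OF A]) (use \<rho> in auto)
    also have "\<dots> = ennreal e" using e' e'_sum q by (simp flip: ennreal_plus ennreal_mult)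
    finally show ?thesis .
  qed
  then show ?thesis using \<rho>0 by blast
qed

section \<open>Weak derivatives\<close>

lemma deriv_family_affine:
  fixes F :: "('n::finite \<Rightarrow> nat) \<Rightarrow> real^'n \<Rightarrow> real"
  assumes "deriv_family F"
  shows "deriv_family (\<lambda>\<beta> y. C * c ^ mi_order \<beta> * F \<beta> (a + c *\<^sub>R y))"
  unfolding deriv_family_def
proof (intro allI)
  fix \<beta> :: "'n \<Rightarrow> nat" and y :: "real^'n"
  have 1: "((\<lambda>y. a + c *\<^sub>R y) has_derivative (\<lambda>h. c *\<^sub>R h)) (at y)" by (auto intro!: derivative_eq_intros)
  have 2: "(F \<beta> has_derivative (\<lambda>h. \<Sum>i\<in>UNIV. h $ i * F (inc i \<beta>) (a + c *\<^sub>R y))) (at (a + c *\<^sub>R y))"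
    using assms unfolding deriv_family_def by blast
  have "((\<lambda>y. F \<beta> (a + c *\<^sub>R y)) has_derivative (\<lambda>h. \<Sum>i\<in>UNIV. (c *\<^sub>R h) $ i * F (inc i \<beta>) (a + c *\<^sub>R y))) (at y)"
    by (rule has_derivative_compose[OF 1 2])
  from has_derivative_mult_right[OF this, of "C * c ^ mi_order \<beta>"]
  show "((\<lambda>y. C * c ^ mi_order \<beta> * F \<beta> (a + c *\<^sub>R y)) has_derivative
      (\<lambda>h. \<Sum>i\<in>UNIV. h $ i * (C * c ^ mi_order (inc i \<beta>) * F (inc i \<beta>) (a + c *\<^sub>R y)))) (at y)"
    by (rule has_derivative_eq_rhs) (auto simp: mi_order_inc sum_distrib_left mult_ac intro!: sum.cong)
qed

text \<open>As a function of \<open>y\<close>, the translated and reflected mollifier picks up a sign with each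
  derivative.\<close>

lemma mollifier_family:
  fixes x :: "real^'n"
  assumes "\<rho> \<noteq> 0"
  shows "deriv_family (\<lambda>\<beta> y. 1 / (bump_mass TYPE('n) * \<rho> ^ CARD('n)) * (- 1 / \<rho>) ^ mi_order \<beta> * tensor_bump \<beta> ((1 / \<rho>) *\<^sub>R (x - y)))"
    "mollifier \<rho> (x - y) = 1 / (bump_mass TYPE('n) * \<rho> ^ CARD('n)) * (- 1 / \<rho>) ^ mi_order (\<lambda>_::'n. 0) * tensor_bump (\<lambda>_. 0) ((1 / \<rho>) *\<^sub>R (x - y))"
proof -
  have "(1 / \<rho>) *\<^sub>R x + (- 1 / \<rho>) *\<^sub>R y = (1 / \<rho>) *\<^sub>R (x - y)" for y by (simp add: scaleR_diff_right)
  then show "deriv_family (\<lambda>\<beta> y. 1 / (bump_mass TYPE('n) * \<rho> ^ CARD('n)) * (- 1 / \<rho>) ^ mi_order \<beta> * tensor_bump \<beta> ((1 / \<rho>) *\<^sub>R (x - y)))"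
    using deriv_family_affine[OF deriv_family_tensor_bump, of "1 / (bump_mass TYPE('n) * \<rho> ^ CARD('n))" "- 1 / \<rho>" "(1 / \<rho>) *\<^sub>R x"] by simp
qed (simp add: mollifier_def mi_order_zero)

lemma closure_support_subset:
  assumes "\<And>y. f y \<noteq> 0 \<Longrightarrow> y \<in> S" "closed S" shows "closure {y. f y \<noteq> 0} \<subseteq> S"
  using assms by (intro closure_minimal) auto

lemma mollifier_test_function:
  fixes x :: "real^'n"
  assumes "0 < \<rho>" "cball x (real CARD('n) * \<rho>) \<subseteq> \<Omega>"
  shows "(\<lambda>y. mollifier \<rho> (x - y)) \<in> test_functions \<Omega>"
proof -
  have sub: "closure {y. mollifier \<rho> (x - y) \<noteq> 0} \<subseteq> cball x (real CARD('n) * \<rho>)"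
    using mollifier_support[OF assms(1)] by (intro closure_support_subset) (auto simp: dist_norm)
  have "compact (closure {y. mollifier \<rho> (x - y) \<noteq> 0})"
    unfolding compact_eq_bounded_closed using sub bounded_subset[OF bounded_cball] by auto
  moreover have "(\<lambda>y. mollifier \<rho> (x - y)) \<in> smooth_functions UNIV"
    unfolding mollifier_family(2)[OF less_imp_neq[OF assms(1), symmetric]]
    by (rule deriv_family_smooth[OF mollifier_family(1)]) (use assms in simp)
  ultimately show ?thesis using sub assms(2) by (auto simp: test_functions_def)
qed

subsection \<open>Integration by parts\<close>

text \<open>The difference quotients have integral zero by translation invariance.\<close>

lemma integral_partial_deriv_zero:
  fixes w :: "real^'n \<Rightarrow> real"
  assumes w: "w \<in> smooth_functions UNIV" and supp: "\<And>x. r < norm x \<Longrightarrow> w x = 0"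
  shows "(\<integral>x. partial_deriv i w x \<partial>lborel) = 0"
proof -
  let ?e = "axis i 1 :: real^'n"
  define h where "h m = 1 / real (Suc m)" for m
  have h: "0 < h m" "h m \<le> 1" for m by (auto simp: h_def)
  have h0: "h \<longlonglongrightarrow> 0" unfolding h_def using LIMSEQ_inverse_real_of_nat by (simp add: inverse_eq_divide)
  have wc: "continuous_on UNIV w" by (rule smooth_continuous_on[OF w])
  have wm [measurable]: "w \<in> borel_measurable borel" by (rule borel_measurable_continuous_onI[OF wc])
  have wint: "integrable lborel w" by (rule integrable_continuous_bounded_support[OF wc supp])
  have pc: "continuous_on UNIV (partial_deriv j w)" for j
    by (rule smooth_continuous_on[OF smooth_partial_deriv[OF w]])
  have psupp: "partial_deriv j w x = 0" if "r < norm x" for j x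
  proof -
    have "partial_deriv j w x = partial_deriv j (\<lambda>_. 0) x"
      by (rule partial_deriv_cong[of "{x. r < norm x}"]) (use that supp in \<open>auto intro!: open_Collect_less continuous_intros\<close>)
    then show ?thesis by (simp add: partial_deriv_const)
  qed
  have "\<exists>M. \<forall>x. \<bar>partial_deriv j w x\<bar> \<le> M" for j
  proof -
    have "bounded (partial_deriv j w ` cball 0 r)"
      by (intro compact_imp_bounded compact_continuous_image continuous_on_subset[OF pc]) auto
    then obtain M where "\<forall>x\<in>cball 0 r. \<bar>partial_deriv j w x\<bar> \<le> M" by (auto simp: bounded_iff)
    then have "\<bar>partial_deriv j w x\<bar> \<le> max M 0" for x
      using psupp[of x j] by (cases "r < norm x") (auto simp: le_max_iff_disj)
    then show ?thesis by blast
  qed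
  then obtain Mj where Mj: "\<And>j x. \<bar>partial_deriv j w x\<bar> \<le> Mj j" by metis
  define M where "M = Max (range Mj)"
  have M: "\<bar>partial_deriv j w x\<bar> \<le> M" for j x
  proof -
    have "Mj j \<le> M" unfolding M_def by (rule Max_ge) auto
    then show ?thesis using Mj[of j x] by simp
  qed
  define q where "q m x = (w (x + h m *\<^sub>R ?e) - w x) / h m" for m x
  have qint: "(\<integral>x. q m x \<partial>lborel) = 0" for m
  proof -
    have "integrable lborel (\<lambda>x. w (x + h m *\<^sub>R ?e))"
    proof (rule integrable_continuous_bounded_support[of _ "r + 1"])
      show "continuous_on UNIV (\<lambda>x. w (x + h m *\<^sub>R ?e))"
        by (intro continuous_on_compose2[OF wc] continuous_intros) auto
      fix x :: "real^'n" assume "r + 1 < norm x"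
      then have "r < norm (x + h m *\<^sub>R ?e)"
        using norm_diff_ineq[of x "h m *\<^sub>R ?e"] h[of m] by simp
      then show "w (x + h m *\<^sub>R ?e) = 0" by (rule supp)
    qed
    then show ?thesis using wint integral_translate[OF wm, of "h m *\<^sub>R ?e"] by (simp add: q_def)
  qed
  have lim: "(\<lambda>m. q m x) \<longlonglongrightarrow> partial_deriv i w x" for x
  proof -
    have dw: "(w has_derivative frechet_derivative w (at x)) (at (x + 0 *\<^sub>R ?e))"
      using smooth_differentiable[OF w] by (simp add: frechet_derivative_works[symmetric])
    have dl: "((\<lambda>t. x + t *\<^sub>R ?e) has_derivative (\<lambda>t. t *\<^sub>R ?e)) (at 0)"
      by (auto intro!: derivative_eq_intros)
    have "((\<lambda>t. w (x + t *\<^sub>R ?e)) has_derivative (\<lambda>t. frechet_derivative w (at x) (t *\<^sub>R ?e))) (at 0)"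
      by (rule has_derivative_compose[OF dl dw])
    moreover have "(\<lambda>t. frechet_derivative w (at x) (t *\<^sub>R ?e)) = (*) (partial_deriv i w x)"
      using linear_frechet_derivative[OF smooth_differentiable[OF w, of x]]
      by (auto simp: linear_scale partial_deriv_def fun_eq_iff)
    ultimately have "((\<lambda>t. w (x + t *\<^sub>R ?e)) has_real_derivative partial_deriv i w x) (at 0)"
      unfolding has_field_derivative_def by (simp only:)
    then have "((\<lambda>t. (w (x + t *\<^sub>R ?e) - w x) / t) \<longlongrightarrow> partial_deriv i w x) (at 0)"
      by (simp add: DERIV_def)
    moreover have "filterlim h (at 0) sequentially"
      using h0 h(1) by (auto simp: filterlim_at less_imp_neq[symmetric])
    ultimately show ?thesis unfolding q_def by (rule filterlim_compose)
  qed
  have "(\<lambda>m. \<integral>x. q m x \<partial>lborel) \<longlonglongrightarrow> (\<integral>x. partial_deriv i w x \<partial>lborel)"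
  proof (rule integral_dominated_convergence[where w = "\<lambda>x. (real CARD('n) * M) * indicator (cball 0 (r + 1)) x"])
    show "partial_deriv i w \<in> borel_measurable lborel"
      using borel_measurable_continuous_onI[OF pc] by simp
    show "q m \<in> borel_measurable lborel" for m unfolding q_def by measurable
    show "integrable lborel (\<lambda>x::real^'n. (real CARD('n) * M) * indicator (cball 0 (r + 1)) x)"
      using emeasure_lborel_cball_finite[of "0::real^'n" "r + 1"]
      by (intro integrable_mult_right integrable_real_indicator) auto
    show "AE x in lborel. (\<lambda>m. q m x) \<longlonglongrightarrow> partial_deriv i w x" using lim by simp
    show "AE x in lborel. norm (q m x) \<le> (real CARD('n) * M) * indicator (cball 0 (r + 1)) x" for m
    proof (rule AE_I2)
      fix x
      have "\<bar>w (x + h m *\<^sub>R ?e) - w x\<bar> \<le> real CARD('n) * M * dist (x + h m *\<^sub>R ?e) x"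
        by (rule partials_mean_value[of UNIV _ _ w "\<lambda>j z. partial_deriv j w z"])
          (use M has_derivative_partials[OF smooth_differentiable[OF w UNIV_I]] in auto)
      then have b: "\<bar>q m x\<bar> \<le> real CARD('n) * M"
        using h(1)[of m] by (simp add: q_def abs_divide divide_le_eq dist_norm)
      show "norm (q m x) \<le> (real CARD('n) * M) * indicator (cball 0 (r + 1)) x"
      proof (cases "r + 1 < norm x")
        case True
        then have "r < norm (x + h m *\<^sub>R ?e)"
          using norm_diff_ineq[of x "h m *\<^sub>R ?e"] h[of m] by simp
        then show ?thesis using supp True by (simp add: q_def indicator_def)
      qed (use b in \<open>simp add: indicator_def\<close>)
    qed
  qed
  then show ?thesis unfolding qint using LIMSEQ_unique tendsto_const by metis
qed

lemma test_functionD: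
  assumes "\<phi> \<in> test_functions \<Omega>"
  shows "\<phi> \<in> smooth_functions UNIV" "compact (closure {x. \<phi> x \<noteq> 0})" "closure {x. \<phi> x \<noteq> 0} \<subseteq> \<Omega>"
  using assms by (auto simp: test_functions_def)

lemma test_function_partial_deriv:
  assumes "\<phi> \<in> test_functions \<Omega>" shows "partial_deriv i \<phi> \<in> test_functions \<Omega>"
proof -
  note T = test_functionD[OF assms]
  let ?S = "closure {x. \<phi> x \<noteq> 0}"
  have z: "\<phi> y = 0" if "y \<notin> ?S" for y using that closure_subset[of "{x. \<phi> x \<noteq> 0}"] by blast
  have "partial_deriv i \<phi> x = 0" if "x \<notin> ?S" for x
  proof -
    have "partial_deriv i \<phi> x = partial_deriv i (\<lambda>_. 0) x"
    proof (rule partial_deriv_cong[of "- ?S"])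
      show "open (- ?S)" by (intro open_Compl closed_closure)
    qed (use that z in blast)+
    then show ?thesis by (simp add: partial_deriv_const)
  qed
  then have sub: "closure {x. partial_deriv i \<phi> x \<noteq> 0} \<subseteq> ?S"
    by (intro closure_support_subset) auto
  have "compact (closure {x. partial_deriv i \<phi> x \<noteq> 0})"
    unfolding compact_eq_bounded_closed using sub T(2) bounded_subset compact_imp_bounded by blast
  then show ?thesis using sub T smooth_partial_deriv[OF T(1)] by (auto simp: test_functions_def)
qed

lemma test_function_pd_list: "\<phi> \<in> test_functions \<Omega> \<Longrightarrow> pd_list xs \<phi> \<in> test_functions \<Omega>"
  by (induction xs) (auto intro: test_function_partial_deriv)

text \<open>The product is extended by zero outside the domain.\<close>

lemma test_product_smooth:
  assumes "open \<Omega>" "v \<in> smooth_functions \<Omega>" "\<phi> \<in> test_functions \<Omega>"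
    and w_def: "w = (\<lambda>x. if x \<in> \<Omega> then v x * \<phi> x else 0)"
  shows "w \<in> smooth_functions UNIV" "\<exists>r. \<forall>x. r < norm x \<longrightarrow> w x = 0"
    "(LINT x|lebesgue_on \<Omega>. v x * \<phi> x) = (\<integral>x. w x \<partial>lborel)"
proof -
  note T = test_functionD[OF assms(3)]
  let ?S = "closure {x. \<phi> x \<noteq> 0}"
  have z: "\<phi> y = 0" if "y \<notin> ?S" for y using that closure_subset[of "{x. \<phi> x \<noteq> 0}"] by blast
  show ws: "w \<in> smooth_functions UNIV"
  proof (rule smooth_local)
    fix x
    show "\<exists>U. open U \<and> x \<in> U \<and> w \<in> smooth_functions U"
    proof (cases "x \<in> \<Omega>")
      case True
      have "(\<lambda>x. v x * \<phi> x) \<in> smooth_functions \<Omega>"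
        using assms(1,2) smooth_subset[OF _ T(1), of \<Omega>] by (intro smooth_mult) auto
      then have "w \<in> smooth_functions \<Omega>" by (rule smooth_cong[OF assms(1), rotated]) (simp add: w_def)
      then show ?thesis using True assms(1) by blast
    next
      case False
      have "(\<lambda>_. 0) \<in> smooth_functions (- ?S)" by (rule smooth_const)
      then have "w \<in> smooth_functions (- ?S)" 
      proof (rule smooth_cong[rotated 2])
        show "open (- ?S)" by (intro open_Compl closed_closure)
        show "0 = w y" if "y \<in> - ?S" for y using z[of y] that unfolding w_def by simp
      qed
      moreover have "open (- ?S)" "x \<in> - ?S" using False T(3) by blast+
      ultimately show ?thesis by blast
    qed
  qed
  obtain r where r: "\<And>x. x \<in> ?S \<Longrightarrow> norm x \<le> r" using compact_imp_bounded[OF T(2)] by (auto simp: bounded_iff)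
  have "w x = 0" if "r < norm x" for x using r[of x] z[of x] that by (force simp: w_def)
  then show "\<exists>r. \<forall>x. r < norm x \<longrightarrow> w x = 0" by blast
  have "(LINT x|lebesgue_on \<Omega>. v x * \<phi> x) = (\<integral>x. indicator \<Omega> x *\<^sub>R (v x * \<phi> x) \<partial>lebesgue)"
    using assms(1) by (intro integral_restrict_space) auto
  also have "(\<lambda>x. indicator \<Omega> x *\<^sub>R (v x * \<phi> x)) = w" by (auto simp: w_def)
  also have "(\<integral>x. w x \<partial>lebesgue) = (\<integral>x. w x \<partial>lborel)"
    using borel_measurable_continuous_onI[OF smooth_continuous_on[OF ws]] by (intro integral_completion) simp
  finally show "(LINT x|lebesgue_on \<Omega>. v x * \<phi> x) = (\<integral>x. w x \<partial>lborel)" .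
qed

lemma integration_by_parts:
  assumes \<Omega>: "open \<Omega>" and v: "v \<in> smooth_functions \<Omega>" and \<phi>: "\<phi> \<in> test_functions \<Omega>"
  shows "(LINT x|lebesgue_on \<Omega>. v x * partial_deriv i \<phi> x) = - (LINT x|lebesgue_on \<Omega>. partial_deriv i v x * \<phi> x)"
proof -
  note T = test_functionD[OF \<phi>]
  define w where "w = (\<lambda>x. if x \<in> \<Omega> then v x * \<phi> x else 0)"
  define w1 where "w1 = (\<lambda>x. if x \<in> \<Omega> then v x * partial_deriv i \<phi> x else 0)"
  define w2 where "w2 = (\<lambda>x. if x \<in> \<Omega> then partial_deriv i v x * \<phi> x else 0)"
  note W = test_product_smooth[OF \<Omega> v \<phi> w_def]
  note W1 = test_product_smooth[OF \<Omega> v test_function_partial_deriv[OF \<phi>] w1_def]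
  note W2 = test_product_smooth[OF \<Omega> smooth_partial_deriv[OF v] \<phi> w2_def]
  have "partial_deriv i w x = w1 x + w2 x" for x
  proof (cases "x \<in> \<Omega>")
    case True
    have "partial_deriv i w x = partial_deriv i (\<lambda>x. v x * \<phi> x) x"
      by (rule partial_deriv_cong[OF \<Omega> True]) (simp add: w_def)
    also have "\<dots> = w1 x + w2 x"
      using partial_deriv_mult[OF smooth_differentiable[OF v True] smooth_differentiable[OF T(1)], of i] True
      by (simp add: w1_def w2_def)
    finally show ?thesis .
  next
    case False
    let ?S = "closure {x. \<phi> x \<noteq> 0}"
    have "partial_deriv i w x = partial_deriv i (\<lambda>_. 0) x"
    proof (rule partial_deriv_cong[of "- ?S"])
      show "open (- ?S)" by (intro open_Compl closed_closure)
      show "x \<in> - ?S" using False T(3) by blast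
      show "w y = 0" if "y \<in> - ?S" for y
        using that closure_subset[of "{x. \<phi> x \<noteq> 0}"] unfolding w_def by force
    qed
    then show ?thesis using False by (simp add: partial_deriv_const w1_def w2_def)
  qed
  then have pw: "partial_deriv i w = (\<lambda>x. w1 x + w2 x)" by (rule ext)
  from W(2) obtain r where "\<forall>x. r < norm x \<longrightarrow> w x = 0" ..
  then have r: "\<And>x. r < norm x \<Longrightarrow> w x = 0" by simp
  have "(\<integral>x. w1 x + w2 x \<partial>lborel) = 0"
    using integral_partial_deriv_zero[OF W(1) r, where i = i] unfolding pw .
  moreover from W1(2) obtain r1 where r1: "\<forall>x. r1 < norm x \<longrightarrow> w1 x = 0" ..
  then have "integrable lborel w1"
    by (intro integrable_continuous_bounded_support[OF smooth_continuous_on[OF W1(1)], of r1]) simp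
  moreover from W2(2) obtain r2 where r2: "\<forall>x. r2 < norm x \<longrightarrow> w2 x = 0" ..
  then have "integrable lborel w2"
    by (intro integrable_continuous_bounded_support[OF smooth_continuous_on[OF W2(1)], of r2]) simp
  ultimately show ?thesis unfolding W1(3) W2(3) by simp
qed

lemma integration_by_parts_list:
  assumes \<Omega>: "open \<Omega>" and \<phi>: "\<phi> \<in> test_functions \<Omega>"
  shows "v \<in> smooth_functions \<Omega> \<Longrightarrow>
    (LINT x|lebesgue_on \<Omega>. v x * pd_list xs \<phi> x) = (- 1) ^ length xs * (LINT x|lebesgue_on \<Omega>. pd_list (rev xs) v x * \<phi> x)"
proof (induction xs arbitrary: v)
  case (Cons i xs)
  have "(LINT x|lebesgue_on \<Omega>. v x * pd_list (i # xs) \<phi> x) = - (LINT x|lebesgue_on \<Omega>. partial_deriv i v x * pd_list xs \<phi> x)"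
    using integration_by_parts[OF \<Omega> Cons.prems test_function_pd_list[OF \<phi>]] by simp
  then show ?case using Cons.IH[OF smooth_partial_deriv[OF Cons.prems, of i]] by simp
qed simp

subsection \<open>Classical derivatives are weak derivatives\<close>

definition mi_list :: "('n::finite \<Rightarrow> nat) \<Rightarrow> 'n list" where
  "mi_list \<alpha> = (SOME xs. \<forall>i. count_list xs i = \<alpha> i)"

lemma count_mi_list: "count_list (mi_list \<alpha>) = \<alpha>"
  unfolding mi_list_def using someI_ex[OF ex_list_mi, of \<alpha>] by auto

lemma length_mi_list: "length (mi_list \<alpha>) = mi_order \<alpha>"
  using mi_order_count_list[of "mi_list \<alpha>"] by (simp add: count_mi_list)

lemma mixed_partial_eq: "mixed_partial \<alpha> f = pd_list (mi_list \<alpha>) f"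
  by (simp add: mixed_partial_def mi_list_def)

lemma L1_loc_continuous:
  assumes "continuous_on \<Omega> f" shows "f \<in> L1_loc \<Omega>"
  unfolding L1_loc_def
proof (intro CollectI allI impI)
  fix K assume K: "compact K \<and> K \<subseteq> \<Omega>"
  then have "integrable lborel (\<lambda>x. indicator K x *\<^sub>R f x)"
    using assms continuous_on_subset by (intro borel_integrable_compact) auto
  then show "f absolutely_integrable_on K"
    unfolding set_integrable_def by (subst integrable_completion) auto
qed

text \<open>Integrating by parts one derivative at a time reverses their order; hence the reversed list.\<close>

lemma smooth_has_weak_deriv:
  assumes "open \<Omega>" "v \<in> smooth_functions \<Omega>"
  shows "has_weak_deriv \<Omega> \<alpha> v (pd_list (rev (mi_list \<alpha>)) v)"
  unfolding has_weak_deriv_def mixed_partial_eq length_mi_list[symmetric]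
proof (intro conjI ballI)
  show "v \<in> L1_loc \<Omega>" by (rule L1_loc_continuous[OF smooth_continuous_on[OF assms(2)]])
  show "pd_list (rev (mi_list \<alpha>)) v \<in> L1_loc \<Omega>"
    by (rule L1_loc_continuous[OF smooth_continuous_on[OF smooth_pd_list[OF assms(2)]]])
qed (rule integration_by_parts_list[OF assms(1) _ assms(2)])

lemma L1_loc_times_test_integrable:
  assumes \<Omega>: "open \<Omega>" and u: "u \<in> L1_loc \<Omega>" and \<phi>: "\<phi> \<in> test_functions \<Omega>"
  shows "integrable (lebesgue_on \<Omega>) (\<lambda>x. u x * \<phi> x)"
proof -
  note T = test_functionD[OF \<phi>]
  let ?S = "closure {x. \<phi> x \<noteq> 0}"
  have z: "\<phi> y = 0" if "y \<notin> ?S" for y using that closure_subset[of "{x. \<phi> x \<noteq> 0}"] by blast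
  have uS: "integrable lebesgue (\<lambda>x. indicator ?S x *\<^sub>R u x)"
    using u T(2,3) by (auto simp: L1_loc_def set_integrable_def)
  have "bounded (\<phi> ` ?S)"
    using T smooth_continuous_on[OF T(1)] by (intro compact_imp_bounded compact_continuous_image) (auto intro: continuous_on_subset)
  then obtain M where M: "\<And>x. x \<in> ?S \<Longrightarrow> \<bar>\<phi> x\<bar> \<le> M" by (auto simp: bounded_iff)
  have meas: "\<phi> \<in> borel_measurable lebesgue"
    by (rule borel_imp_lebesgue_measurable[OF borel_measurable_continuous_onI[OF smooth_continuous_on[OF T(1)]]])
  have int: "integrable lebesgue (\<lambda>x. indicator ?S x *\<^sub>R u x * \<phi> x)"
  proof (rule Bochner_Integration.integrable_bound[of _ "\<lambda>x. M * (indicator ?S x *\<^sub>R u x)"])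
    show "integrable lebesgue (\<lambda>x. M * (indicator ?S x *\<^sub>R u x))" using uS by (rule integrable_mult_right)
    show "(\<lambda>x. indicator ?S x *\<^sub>R u x * \<phi> x) \<in> borel_measurable lebesgue"
      by (rule borel_measurable_times[OF borel_measurable_integrable[OF uS] meas])
    show "AE x in lebesgue. norm (indicator ?S x *\<^sub>R u x * \<phi> x) \<le> norm (M * (indicator ?S x *\<^sub>R u x))"
    proof (rule AE_I2)
      fix x
      have "\<bar>u x\<bar> * \<bar>\<phi> x\<bar> \<le> \<bar>u x\<bar> * \<bar>M\<bar>" if "x \<in> ?S" using M[OF that] by (intro mult_left_mono) auto
      then show "norm (indicator ?S x *\<^sub>R u x * \<phi> x) \<le> norm (M * (indicator ?S x *\<^sub>R u x))"
        by (auto simp: indicator_def abs_mult mult.commute)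
    qed
  qed
  have eq: "indicator ?S x *\<^sub>R u x * \<phi> x = indicator \<Omega> x *\<^sub>R (u x * \<phi> x)" for x
  proof (cases "x \<in> ?S")
    case True
    then have "x \<in> \<Omega>" using T(3) by blast
    then show ?thesis by (simp only: indicator_simps(1)[OF True] indicator_simps(1) scaleR_one)
  next
    case False
    show ?thesis unfolding z[OF False] by (simp only: mult_zero_right scaleR_zero_right)
  qed
  have "\<Omega> \<inter> space lebesgue \<in> sets lebesgue" using \<Omega> by auto
  from integrable_restrict_space[OF this, of "\<lambda>x. u x * \<phi> x"] show ?thesis
    using int[unfolded eq] by blast
qed

lemma L1_loc_diff: "u \<in> L1_loc \<Omega> \<Longrightarrow> v \<in> L1_loc \<Omega> \<Longrightarrow> (\<lambda>x. u x - v x) \<in> L1_loc \<Omega>"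
  unfolding L1_loc_def by (auto intro!: set_integral_diff)

lemma has_weak_deriv_diff:
  assumes \<Omega>: "open \<Omega>" and u: "has_weak_deriv \<Omega> \<alpha> u g" and v: "has_weak_deriv \<Omega> \<alpha> v h"
  shows "has_weak_deriv \<Omega> \<alpha> (\<lambda>x. u x - v x) (\<lambda>x. g x - h x)"
  unfolding has_weak_deriv_def
proof (intro conjI ballI)
  fix \<phi> assume \<phi>: "\<phi> \<in> test_functions \<Omega>"
  have D: "mixed_partial \<alpha> \<phi> \<in> test_functions \<Omega>" unfolding mixed_partial_eq by (rule test_function_pd_list[OF \<phi>])
  note I = L1_loc_times_test_integrable[OF \<Omega>]
  show "(LINT x|lebesgue_on \<Omega>. (u x - v x) * mixed_partial \<alpha> \<phi> x) = (- 1) ^ mi_order \<alpha> * (LINT x|lebesgue_on \<Omega>. (g x - h x) * \<phi> x)"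
    using u v \<phi> I[OF _ D, of u] I[OF _ D, of v] I[OF _ \<phi>, of g] I[OF _ \<phi>, of h]
    unfolding has_weak_deriv_def by (simp add: left_diff_distrib right_diff_distrib)
qed (use u v L1_loc_diff in \<open>auto simp: has_weak_deriv_def\<close>)

subsection \<open>Uniqueness\<close>

context bounded_domain
begin

lemma compact_inner: assumes "0 < s" shows "compact {x \<in> \<Omega>. s \<le> d x}"
proof -
  have "{x \<in> \<Omega>. s \<le> d x} = closure \<Omega> \<inter> {x. s \<le> d x}"
    using closure_d_pos assms closure_subset[of \<Omega>] by force
  moreover have "closed {x. s \<le> d x}" by (intro closed_Collect_le continuous_intros d_continuous)
  ultimately show ?thesis using bdd by (simp add: compact_closure compact_Int_closed)
qed

lemma cball_inner:
  assumes "x \<in> \<Omega>" "s + r \<le> d x" "0 < s" shows "cball x r \<subseteq> {x \<in> \<Omega>. s \<le> d x}"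
proof
  fix y assume y: "y \<in> cball x r"
  then have "dist x y < d x" using assms by auto
  then have "y \<in> \<Omega>" by (rule lm_ball(1)[OF assms(1)])
  moreover have "s \<le> d y" using d_lipschitz[of x y] y assms by auto
  ultimately show "y \<in> {x \<in> \<Omega>. s \<le> d x}" by simp
qed

text \<open>The mollifications of a function with vanishing pairings vanish, and converge to it.\<close>

lemma vanishing_pairings:
  assumes f: "f \<in> L1_loc \<Omega>" and zero: "\<And>\<phi>. \<phi> \<in> test_functions \<Omega> \<Longrightarrow> (LINT x|lebesgue_on \<Omega>. f x * \<phi> x) = 0"
  shows "AE x in lebesgue_on \<Omega>. f x = 0"
proof -
  have inner: "AE x in lebesgue. x \<in> \<Omega> \<and> 2 * s < d x \<longrightarrow> f x = 0" if s: "0 < s" for s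
  proof -
    define K where "K = {x \<in> \<Omega>. s \<le> d x}"
    have K: "compact K" "K \<subseteq> \<Omega>" using compact_inner[OF s] by (auto simp: K_def)
    define f1 where "f1 x = indicator K x *\<^sub>R f x" for x
    have "f absolutely_integrable_on K" using f K unfolding L1_loc_def by blast
    then have f1: "integrable lebesgue f1" unfolding set_integrable_def f1_def[abs_def] .
    then obtain f2 where f2m: "f2 \<in> borel_measurable lborel" and ae: "AE x in lborel. f1 x = f2 x"
      using completion_ex_borel_measurable_real[of f1 lborel] by auto
    have ae': "AE x in lebesgue. f1 x = f2 x" using ae by (rule AE_completion)
    have f2: "integrable lborel f2"
    proof -
      have "f2 \<in> borel_measurable lebesgue" by (rule borel_imp_lebesgue_measurable) (use f2m in simp)
      then have "integrable lebesgue f2"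
        using integrable_cong_AE[OF borel_measurable_integrable[OF f1] _ ae'] f1 by blast
      then show ?thesis unfolding integrable_completion[OF f2m] .
    qed
    define A where "A = {x \<in> \<Omega>. 2 * s < d x}"
    have Aeq: "A = \<Omega> \<inter> {x. 2 * s < d x}" by (auto simp: A_def)
    have "open A" unfolding Aeq using open_dom by (intro open_Int open_Collect_less continuous_intros d_continuous)
    then have [measurable]: "A \<in> sets borel" by simp
    have [measurable]: "f2 \<in> borel_measurable borel" using f2m by simp
    have van: "(\<integral>y. f2 y * mollifier \<rho> (x - y) \<partial>lborel) = 0" if x: "x \<in> A" and \<rho>: "0 < \<rho>" "real CARD('n) * \<rho> < s" for x \<rho>
    proof -
      have cb: "cball x (real CARD('n) * \<rho>) \<subseteq> K"
        unfolding K_def by (rule cball_inner) (use x \<rho> s in \<open>auto simp: A_def\<close>)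
      have mm: "(\<lambda>y. mollifier \<rho> (x - y)) \<in> borel_measurable borel" by measurable
      have "(\<integral>y. f2 y * mollifier \<rho> (x - y) \<partial>lborel) = (\<integral>y. f2 y * mollifier \<rho> (x - y) \<partial>lebesgue)"
        by (rule integral_completion[symmetric]) measurable
      also have "\<dots> = (\<integral>y. f1 y * mollifier \<rho> (x - y) \<partial>lebesgue)"
        using ae' f1 borel_imp_lebesgue_measurable[OF mm] borel_imp_lebesgue_measurable[of f2]
        by (intro integral_cong_AE borel_measurable_times) auto
      also have "\<dots> = (\<integral>y. indicator \<Omega> y *\<^sub>R (f y * mollifier \<rho> (x - y)) \<partial>lebesgue)"
      proof (rule Bochner_Integration.integral_cong[OF refl])
        fix y
        have "y \<in> K" if "mollifier \<rho> (x - y) \<noteq> 0"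
          using mollifier_support[OF \<rho>(1) that] cb by (auto simp: dist_norm)
        then show "f1 y * mollifier \<rho> (x - y) = indicator \<Omega> y *\<^sub>R (f y * mollifier \<rho> (x - y))"
          using K(2) by (cases "mollifier \<rho> (x - y) = 0") (auto simp: f1_def indicator_def)
      qed
      also have "\<dots> = (LINT y|lebesgue_on \<Omega>. f y * mollifier \<rho> (x - y))"
        using open_dom by (intro integral_restrict_space[symmetric]) auto
      also have "\<dots> = 0" using zero[OF mollifier_test_function[OF \<rho>(1)]] cb K(2) by blast
      finally show ?thesis .
    qed
    have small: "(\<integral>\<^sup>+x\<in>A. ennreal \<bar>f2 x\<bar> \<partial>lborel) \<le> ennreal e" if e: "0 < e" for e
    proof -
      have "(\<integral>\<^sup>+x. ennreal (\<bar>f2 x\<bar> powr 1) \<partial>lborel) < \<infinity>"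
        using f2 by (simp add: integrable_iff_bounded)
      then obtain \<rho>0 where \<rho>0: "\<rho>0 > 0" and m: "\<And>\<rho>. 0 < \<rho> \<and> \<rho> < \<rho>0 \<Longrightarrow>
          (\<integral>\<^sup>+x. ennreal (\<bar>f2 x - (\<integral>y. f2 y * mollifier \<rho> (x - y) \<partial>lborel)\<bar> powr 1) \<partial>lborel) < ennreal e"
        using mollify_Lp[OF order_refl f2 _ e] by blast
      define \<rho> where "\<rho> = min \<rho>0 (s / real CARD('n)) / 2"
      have "\<rho> > 0" "\<rho> < \<rho>0" "\<rho> < s / real CARD('n)" using \<rho>0 s by (auto simp: \<rho>_def min_def field_simps)
      then have \<rho>: "\<rho> > 0" "\<rho> < \<rho>0" "real CARD('n) * \<rho> < s" by (auto simp: field_simps)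
      have "(\<integral>\<^sup>+x\<in>A. ennreal \<bar>f2 x\<bar> \<partial>lborel) \<le>
          (\<integral>\<^sup>+x. ennreal (\<bar>f2 x - (\<integral>y. f2 y * mollifier \<rho> (x - y) \<partial>lborel)\<bar> powr 1) \<partial>lborel)"
        using van[OF _ \<rho>(1,3)] by (intro nn_integral_mono) (auto simp: indicator_def)
      then show ?thesis using m[of \<rho>] \<rho> by simp
    qed
    have "(\<integral>\<^sup>+x\<in>A. ennreal \<bar>f2 x\<bar> \<partial>lborel) = 0"
    proof (rule ccontr)
      assume n: "(\<integral>\<^sup>+x\<in>A. ennreal \<bar>f2 x\<bar> \<partial>lborel) \<noteq> 0"
      have "(\<integral>\<^sup>+x\<in>A. ennreal \<bar>f2 x\<bar> \<partial>lborel) \<le> ennreal 1" by (rule small) simp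
      then obtain z where z: "(\<integral>\<^sup>+x\<in>A. ennreal \<bar>f2 x\<bar> \<partial>lborel) = ennreal z" "0 \<le> z"
        by (cases "\<integral>\<^sup>+x\<in>A. ennreal \<bar>f2 x\<bar> \<partial>lborel") (auto simp: top_unique)
      then have "0 < z" using n by (cases "z = 0") auto
      then show False using small[of "z / 2"] z by simp
    qed
    then have "AE x in lborel. ennreal \<bar>f2 x\<bar> * indicator A x = 0"
      by (subst (asm) nn_integral_0_iff_AE) auto
    then have "AE x in lebesgue. ennreal \<bar>f2 x\<bar> * indicator A x = 0" by (rule AE_completion)
    with ae' show ?thesis
    proof eventually_elim
      case (elim x)
      show ?case
      proof
        assume "x \<in> \<Omega> \<and> 2 * s < d x"
        then have "x \<in> A" "x \<in> K" using s by (auto simp: A_def K_def)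
        then show "f x = 0" using elim by (simp add: f1_def)
      qed
    qed
  qed
  have "AE x in lebesgue. \<forall>m. x \<in> \<Omega> \<and> 2 * (1 / real (Suc m)) < d x \<longrightarrow> f x = 0"
    unfolding AE_all_countable by (intro allI inner) simp
  then have "AE x in lebesgue. x \<in> \<Omega> \<longrightarrow> f x = 0"
  proof eventually_elim
    case (elim x)
    show ?case
    proof
      assume x: "x \<in> \<Omega>"
      obtain m where "inverse (real (Suc m)) < d x / 2" using reals_Archimedean[of "d x / 2"] d_pos[OF x] by auto
      then show "f x = 0" using elim x by (auto simp: inverse_eq_divide)
    qed
  qed
  then show ?thesis using open_dom by (simp add: AE_restrict_space_iff)
qed

lemma weak_deriv_unique:
  assumes "has_weak_deriv \<Omega> \<alpha> u g" "has_weak_deriv \<Omega> \<alpha> u h"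
  shows "AE x in lebesgue_on \<Omega>. g x = h x"
proof -
  have "AE x in lebesgue_on \<Omega>. g x - h x = 0"
  proof (rule vanishing_pairings)
    show "(\<lambda>x. g x - h x) \<in> L1_loc \<Omega>" using assms L1_loc_diff by (auto simp: has_weak_deriv_def)
    fix \<phi> assume \<phi>: "\<phi> \<in> test_functions \<Omega>"
    have "(- 1) ^ mi_order \<alpha> * (LINT x|lebesgue_on \<Omega>. g x * \<phi> x) = (- 1) ^ mi_order \<alpha> * (LINT x|lebesgue_on \<Omega>. h x * \<phi> x)"
      using assms[unfolded has_weak_deriv_def, THEN conjunct2, THEN conjunct2, THEN bspec, OF \<phi>] by simp
    then have "(LINT x|lebesgue_on \<Omega>. g x * \<phi> x) = (LINT x|lebesgue_on \<Omega>. h x * \<phi> x)" by simp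
    then show "(LINT x|lebesgue_on \<Omega>. (g x - h x) * \<phi> x) = 0"
      using assms L1_loc_times_test_integrable[OF open_dom _ \<phi>] by (simp add: has_weak_deriv_def left_diff_distrib)
  qed
  then show ?thesis by simp
qed

text \<open>The weak derivative in the definition of the seminorm is chosen arbitrarily, but it is determined
  almost everywhere.\<close>

lemma seminorm_eq:
  assumes p: "p < \<infinity>" and h: "\<And>\<alpha>. mi_order \<alpha> = k \<Longrightarrow> has_weak_deriv \<Omega> \<alpha> u (h \<alpha>)"
  shows "hom_sobolev_seminorm k p \<Omega> u = (\<Sum>\<alpha> | mi_order \<alpha> = k. Lp_norm p \<Omega> (h \<alpha>))"
  unfolding hom_sobolev_seminorm_def
proof (rule sum.cong[OF refl])
  fix \<alpha> :: "'n \<Rightarrow> nat" assume "\<alpha> \<in> {\<alpha>. mi_order \<alpha> = k}"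
  then have \<alpha>: "mi_order \<alpha> = k" by simp
  have "has_weak_deriv \<Omega> \<alpha> u (weak_deriv \<Omega> \<alpha> u)" unfolding weak_deriv_def by (rule someI[of _ "h \<alpha>"]) (rule h[OF \<alpha>])
  then have "AE x in lebesgue_on \<Omega>. weak_deriv \<Omega> \<alpha> u x = h \<alpha> x" using h[OF \<alpha>] by (rule weak_deriv_unique)
  then have "AE x in lebesgue_on \<Omega>. ennreal (\<bar>weak_deriv \<Omega> \<alpha> u x\<bar> powr enn2real p) = ennreal (\<bar>h \<alpha> x\<bar> powr enn2real p)"
    by eventually_elim simp
  then have "(\<integral>\<^sup>+x. ennreal (\<bar>weak_deriv \<Omega> \<alpha> u x\<bar> powr enn2real p) \<partial>lebesgue_on \<Omega>) =
      (\<integral>\<^sup>+x. ennreal (\<bar>h \<alpha> x\<bar> powr enn2real p) \<partial>lebesgue_on \<Omega>)" by (rule nn_integral_cong_AE)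
  then show "Lp_norm p \<Omega> (weak_deriv \<Omega> \<alpha> u) = Lp_norm p \<Omega> (h \<alpha>)"
    using less_imp_neq[OF p] by (simp add: Lp_norm_def)
qed

end

section \<open>Taylor polynomials of a mollified function\<close>

subsection \<open>Smooth mollification and all its derivatives\<close>

text \<open>The derivative of order \<open>\<beta>\<close> of the convolution of \<open>f\<close> with the mollifier, all derivatives being taken
  of the kernel.\<close>

definition mollify :: "(real^'n \<Rightarrow> real) \<Rightarrow> real \<Rightarrow> ('n \<Rightarrow> nat) \<Rightarrow> real^'n \<Rightarrow> real" where
  "mollify f \<rho> \<beta> x = (\<integral>y. f y * (1 / (bump_mass TYPE('n) * \<rho> ^ CARD('n)) * (1 / \<rho>) ^ mi_order \<beta> *
     tensor_bump \<beta> ((1 / \<rho>) *\<^sub>R (x - y))) \<partial>lborel)"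

lemma kernel_family:
  "deriv_family (\<lambda>\<beta> x. C * (1 / \<rho>) ^ mi_order \<beta> * tensor_bump \<beta> ((1 / \<rho>) *\<^sub>R (x - y)))"
  using deriv_family_affine[OF deriv_family_tensor_bump, of C "1 / \<rho>" "- (1 / \<rho>) *\<^sub>R y"]
  by (simp add: scaleR_diff_right)

lemma integrable_times_bounded:
  fixes f \<psi> :: "'a::euclidean_space \<Rightarrow> real"
  assumes f: "integrable lborel f" and [measurable]: "\<psi> \<in> borel_measurable borel" and M: "\<And>y. \<bar>\<psi> y\<bar> \<le> M"
  shows "integrable lborel (\<lambda>y. f y * \<psi> y)" "\<bar>\<integral>y. f y * \<psi> y \<partial>lborel\<bar> \<le> M * (\<integral>y. \<bar>f y\<bar> \<partial>lborel)"
proof -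
  have le: "norm (f y * \<psi> y) \<le> norm (M * f y)" for y
  proof -
    have "\<bar>f y\<bar> * \<bar>\<psi> y\<bar> \<le> \<bar>f y\<bar> * \<bar>M\<bar>" using M[of y] by (intro mult_left_mono) auto
    then show ?thesis by (simp add: abs_mult mult.commute)
  qed
  have "integrable lborel (\<lambda>y. M * f y)" using f by simp
  then show int: "integrable lborel (\<lambda>y. f y * \<psi> y)"
    by (rule Bochner_Integration.integrable_bound) (use f le in auto)
  have "\<bar>\<integral>y. f y * \<psi> y \<partial>lborel\<bar> \<le> (\<integral>y. \<bar>f y * \<psi> y\<bar> \<partial>lborel)" by (rule integral_abs_bound)
  also have "\<dots> \<le> (\<integral>y. M * \<bar>f y\<bar> \<partial>lborel)"
  proof (rule integral_mono)
    show "\<bar>f y * \<psi> y\<bar> \<le> M * \<bar>f y\<bar>" for y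
      using M[of y] by (simp add: abs_mult mult.commute[of M] mult_left_mono)
  qed (use int f in auto)
  finally show "\<bar>\<integral>y. f y * \<psi> y \<partial>lborel\<bar> \<le> M * (\<integral>y. \<bar>f y\<bar> \<partial>lborel)" by simp
qed

text \<open>Differentiation under the integral sign: the second order remainders of the kernels are bounded
  uniformly in the parameter.\<close>

lemma deriv_family_mollify:
  fixes f :: "real^'n \<Rightarrow> real"
  assumes f: "integrable lborel f" shows "deriv_family (mollify f \<rho>)"
  unfolding deriv_family_def
proof (intro allI)
  fix \<beta> :: "'n \<Rightarrow> nat" and x :: "real^'n"
  define F where "F y \<beta> x = 1 / (bump_mass TYPE('n) * \<rho> ^ CARD('n)) * (1 / \<rho>) ^ mi_order \<beta> * tensor_bump \<beta> ((1 / \<rho>) *\<^sub>R (x - y))"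
    for y x :: "real^'n" and \<beta> :: "'n \<Rightarrow> nat"
  have fam: "deriv_family (F y)" for y unfolding F_def by (rule kernel_family)
  have [measurable]: "(\<lambda>y. F y \<beta> x) \<in> borel_measurable borel" for \<beta> x unfolding F_def by measurable
  have "\<forall>m. \<exists>M. \<forall>\<beta>::'n \<Rightarrow> nat. mi_order \<beta> \<le> m \<longrightarrow> (\<forall>z. \<bar>tensor_bump \<beta> z\<bar> \<le> M)"
    using tensor_bump_bounded by blast
  from choice[OF this] obtain B where B: "\<And>m \<beta> z. mi_order (\<beta> :: 'n \<Rightarrow> nat) \<le> m \<Longrightarrow> \<bar>tensor_bump \<beta> z\<bar> \<le> B m"
    by blast
  define M where "M \<beta> = \<bar>1 / (bump_mass TYPE('n) * \<rho> ^ CARD('n)) * (1 / \<rho>) ^ mi_order \<beta>\<bar> * B (mi_order \<beta>)" for \<beta> :: "'n \<Rightarrow> nat"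
  have FB: "\<bar>F y \<beta> x\<bar> \<le> M \<beta>" for y \<beta> x
    unfolding F_def abs_mult M_def using B[of \<beta>] by (intro mult_left_mono) auto
  have int: "integrable lborel (\<lambda>y. f y * F y \<beta> x)" for \<beta> x
    by (rule integrable_times_bounded(1)[OF f _ FB]) measurable
  define M2 where "M2 = Max ((\<lambda>(i, j). M (inc j (inc i \<beta>))) ` UNIV)"
  have M2: "\<bar>F y (inc j (inc i \<beta>)) z\<bar> \<le> M2" for y i j z
  proof -
    have "M (inc j (inc i \<beta>)) \<in> (\<lambda>(i, j). M (inc j (inc i \<beta>))) ` UNIV" by (rule image_eqI[of _ _ "(i, j)"]) auto
    then have "M (inc j (inc i \<beta>)) \<le> M2" unfolding M2_def by (intro Max_ge) auto
    then show ?thesis using FB[of y "inc j (inc i \<beta>)" z] by linarith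
  qed
  define C where "C = real CARD('n) * (real CARD('n) * M2) * (\<integral>y. \<bar>f y\<bar> \<partial>lborel)"
  have rem: "\<bar>mollify f \<rho> \<beta> (x + h) - mollify f \<rho> \<beta> x - (\<Sum>i\<in>UNIV. h $ i * mollify f \<rho> (inc i \<beta>) x)\<bar> \<le> C * (norm h)\<^sup>2" for h
  proof -
    let ?R = "\<lambda>y. F y \<beta> (x + h) - F y \<beta> x - (\<Sum>i\<in>UNIV. h $ i * F y (inc i \<beta>) x)"
    have "mollify f \<rho> \<beta> (x + h) - mollify f \<rho> \<beta> x - (\<Sum>i\<in>UNIV. h $ i * mollify f \<rho> (inc i \<beta>) x) =
        (\<integral>y. f y * F y \<beta> (x + h) \<partial>lborel) - (\<integral>y. f y * F y \<beta> x \<partial>lborel) -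
        (\<Sum>i\<in>UNIV. (\<integral>y. h $ i * (f y * F y (inc i \<beta>) x) \<partial>lborel))"
      unfolding mollify_def F_def by simp
    also have "\<dots> = (\<integral>y. f y * F y \<beta> (x + h) - f y * F y \<beta> x - (\<Sum>i\<in>UNIV. h $ i * (f y * F y (inc i \<beta>) x)) \<partial>lborel)"
      using int by simp
    also have "\<dots> = (\<integral>y. f y * ?R y \<partial>lborel)"
      by (intro Bochner_Integration.integral_cong refl) (simp add: algebra_simps sum_distrib_left)
    also have "\<bar>\<dots>\<bar> \<le> (real CARD('n) * (real CARD('n) * M2) * (norm h)\<^sup>2) * (\<integral>y. \<bar>f y\<bar> \<partial>lborel)"
    proof (rule integrable_times_bounded(2)[OF f])
      show "\<bar>?R y\<bar> \<le> real CARD('n) * (real CARD('n) * M2) * (norm h)\<^sup>2" for y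
        by (rule deriv_family_second_order[OF fam M2])
    qed measurable
    finally show ?thesis by (simp add: C_def mult_ac)
  qed
  show "(mollify f \<rho> \<beta> has_derivative (\<lambda>h. \<Sum>i\<in>UNIV. h $ i * mollify f \<rho> (inc i \<beta>) x)) (at x)"
  proof (rule has_derivativeI_sandwich[of 1 _ _ _ _ "\<lambda>y. C * norm (y - x)"])
    show "bounded_linear (\<lambda>h. \<Sum>i\<in>UNIV. h $ i * mollify f \<rho> (inc i \<beta>) x)"
      by (intro bounded_linear_sum bounded_linear_mult_const bounded_linear_vec_nth)
    show "((\<lambda>y. C * norm (y - x)) \<longlongrightarrow> 0) (at x)"
      by (rule tendsto_eq_intros refl | simp)+
    fix y assume "y \<noteq> x"
    then show "norm (mollify f \<rho> \<beta> y - mollify f \<rho> \<beta> x - (\<Sum>i\<in>UNIV. (y - x) $ i * mollify f \<rho> (inc i \<beta>) x)) / norm (y - x) \<le> C * norm (y - x)"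
      using rem[of "y - x"] by (simp add: divide_le_eq power2_eq_square mult_ac)
  qed simp
qed

lemma pairing_borel:
  assumes \<Omega>: "open \<Omega>" and K: "compact K" "K \<subseteq> \<Omega>" and u: "u \<in> L1_loc \<Omega>" and f: "f \<in> borel_measurable borel"
    and ae: "AE y in lebesgue. y \<in> K \<longrightarrow> f y = u y" and \<psi>: "\<psi> \<in> borel_measurable borel" "\<And>y. \<psi> y \<noteq> 0 \<Longrightarrow> y \<in> K"
  shows "(LINT y|lebesgue_on \<Omega>. u y * \<psi> y) = (\<integral>y. f y * \<psi> y \<partial>lborel)"
proof -
  have "u absolutely_integrable_on K" using u K unfolding L1_loc_def by blast
  then have uK: "(\<lambda>y. indicator K y *\<^sub>R u y) \<in> borel_measurable lebesgue"
    unfolding set_integrable_def by (rule borel_measurable_integrable)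
  have "(LINT y|lebesgue_on \<Omega>. u y * \<psi> y) = (\<integral>y. indicator \<Omega> y *\<^sub>R (u y * \<psi> y) \<partial>lebesgue)"
    using \<Omega> by (intro integral_restrict_space) auto
  also have "\<dots> = (\<integral>y. indicator K y *\<^sub>R u y * \<psi> y \<partial>lebesgue)"
  proof (rule Bochner_Integration.integral_cong[OF refl])
    fix y
    show "indicator \<Omega> y *\<^sub>R (u y * \<psi> y) = indicator K y *\<^sub>R u y * \<psi> y"
      using \<psi>(2)[of y] K(2) by (cases "\<psi> y = 0") (auto simp: indicator_def)
  qed
  also have "\<dots> = (\<integral>y. f y * \<psi> y \<partial>lebesgue)"
  proof (rule integral_cong_AE)
    show "(\<lambda>y. indicator K y *\<^sub>R u y * \<psi> y) \<in> borel_measurable lebesgue"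
      by (rule borel_measurable_times[OF uK borel_imp_lebesgue_measurable[OF \<psi>(1)]])
    show "(\<lambda>y. f y * \<psi> y) \<in> borel_measurable lebesgue"
      by (intro borel_measurable_times borel_imp_lebesgue_measurable f \<psi>(1))
    show "AE y in lebesgue. indicator K y *\<^sub>R u y * \<psi> y = f y * \<psi> y"
      using ae by eventually_elim (use \<psi>(2) in \<open>auto simp: indicator_def\<close>)
  qed
  also have "\<dots> = (\<integral>y. f y * \<psi> y \<partial>lborel)"
    by (rule integral_completion) (use f \<psi>(1) in simp)
  finally show ?thesis .
qed

text \<open>The mollifier centred at \<open>x\<close> is a test function of \<open>y\<close>. The sign from the definition of the weak
  derivative cancels the one from differentiating with respect to \<open>y\<close> instead of \<open>x\<close>.\<close>

lemma mollify_weak_deriv: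
  fixes x :: "real^'n"
  assumes \<Omega>: "open \<Omega>" and w: "has_weak_deriv \<Omega> \<alpha> u g" and K: "compact K" "K \<subseteq> \<Omega>"
    and f: "f \<in> borel_measurable borel" "AE y in lebesgue. y \<in> K \<longrightarrow> f y = u y"
    and g': "g' \<in> borel_measurable borel" "AE y in lebesgue. y \<in> K \<longrightarrow> g' y = g y"
    and \<rho>: "0 < \<rho>" "cball x (real CARD('n) * \<rho>) \<subseteq> K"
  shows "mollify f \<rho> \<alpha> x = (\<integral>y. g' y * mollifier \<rho> (x - y) \<partial>lborel)"
proof -
  let ?c = "1 / (bump_mass TYPE('n) * \<rho> ^ CARD('n))"
  let ?\<phi> = "\<lambda>y. mollifier \<rho> (x - y)"
  have \<phi>: "?\<phi> \<in> test_functions \<Omega>"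
    by (rule mollifier_test_function[OF \<rho>(1)]) (use \<rho>(2) K(2) in blast)
  have inK: "y \<in> K" if "norm (x - y) \<le> real CARD('n) * \<rho>" for y using that \<rho>(2) by (auto simp: dist_norm)
  have D: "mixed_partial \<alpha> ?\<phi> = (\<lambda>y. ?c * (- 1 / \<rho>) ^ mi_order \<alpha> * tensor_bump \<alpha> ((1 / \<rho>) *\<^sub>R (x - y)))"
    using deriv_family_mixed_partial[OF mollifier_family(1)[of \<rho> x], of \<alpha>] \<rho>(1)
    unfolding mollifier_family(2)[OF less_imp_neq[OF \<rho>(1), symmetric], abs_def] by simp
  have "(\<integral>y. f y * mixed_partial \<alpha> ?\<phi> y \<partial>lborel) = (LINT y|lebesgue_on \<Omega>. u y * mixed_partial \<alpha> ?\<phi> y)"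
  proof (rule pairing_borel[OF \<Omega> K _ f, symmetric])
    show "u \<in> L1_loc \<Omega>" using w by (simp add: has_weak_deriv_def)
    show "mixed_partial \<alpha> ?\<phi> \<in> borel_measurable borel" unfolding D by measurable
    fix y assume "mixed_partial \<alpha> ?\<phi> y \<noteq> 0"
    then have "norm ((1 / \<rho>) *\<^sub>R (x - y)) \<le> real CARD('n)" unfolding D by (intro tensor_bump_support) auto
    then show "y \<in> K" using \<rho>(1) unfolding norm_scaleR by (intro inK) (simp add: field_simps)
  qed
  also have "\<dots> = (- 1) ^ mi_order \<alpha> * (LINT y|lebesgue_on \<Omega>. g y * ?\<phi> y)"
    using w \<phi> unfolding has_weak_deriv_def by blast
  also have "(LINT y|lebesgue_on \<Omega>. g y * ?\<phi> y) = (\<integral>y. g' y * ?\<phi> y \<partial>lborel)"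
  proof (rule pairing_borel[OF \<Omega> K _ g'])
    show "g \<in> L1_loc \<Omega>" using w by (simp add: has_weak_deriv_def)
    show "?\<phi> \<in> borel_measurable borel" by measurable
    show "y \<in> K" if "mollifier \<rho> (x - y) \<noteq> 0" for y using mollifier_support[OF \<rho>(1) that] by (rule inK)
  qed
  finally have 1: "(\<integral>y. f y * mixed_partial \<alpha> ?\<phi> y \<partial>lborel) = (- 1) ^ mi_order \<alpha> * (\<integral>y. g' y * ?\<phi> y \<partial>lborel)" .
  have "mollify f \<rho> \<alpha> x = (\<integral>y. (- 1) ^ mi_order \<alpha> * (f y * mixed_partial \<alpha> ?\<phi> y) \<partial>lborel)"
    unfolding mollify_def D
  proof (rule Bochner_Integration.integral_cong[OF refl])
    fix y
    have "(1 / \<rho>) ^ mi_order \<alpha> = (- 1) ^ mi_order \<alpha> * (- 1 / \<rho>) ^ mi_order \<alpha>"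
      by (simp flip: power_mult_distrib)
    then show "f y * (?c * (1 / \<rho>) ^ mi_order \<alpha> * tensor_bump \<alpha> ((1 / \<rho>) *\<^sub>R (x - y))) =
        (- 1) ^ mi_order \<alpha> * (f y * (?c * (- 1 / \<rho>) ^ mi_order \<alpha> * tensor_bump \<alpha> ((1 / \<rho>) *\<^sub>R (x - y))))"
      by (simp only: mult_ac)
  qed
  also have "\<dots> = (- 1) ^ mi_order \<alpha> * ((- 1) ^ mi_order \<alpha> * (\<integral>y. g' y * ?\<phi> y \<partial>lborel))"
    unfolding integral_mult_right_zero 1 ..
  also have "\<dots> = (\<integral>y. g' y * ?\<phi> y \<partial>lborel)" by (simp flip: mult.assoc power_mult_distrib)
  finally show ?thesis .
qed

subsection \<open>Taylor polynomials with variable base point\<close>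

text \<open>For a family \<open>U\<close> of derivatives, this is the \<open>j\<close>-th directional derivative of \<open>U \<beta>\<close> along \<open>h\<close> at
  \<open>z\<close>.\<close>

fun dir_deriv :: "(('n::finite \<Rightarrow> nat) \<Rightarrow> real^'n \<Rightarrow> real) \<Rightarrow> nat \<Rightarrow> real^'n \<Rightarrow> ('n \<Rightarrow> nat) \<Rightarrow> real^'n \<Rightarrow> real" where
  "dir_deriv U 0 h \<beta> z = U \<beta> z"
| "dir_deriv U (Suc j) h \<beta> z = (\<Sum>i\<in>UNIV. h $ i * dir_deriv U j h (inc i \<beta>) z)"

text \<open>The Taylor polynomial of \<open>U \<beta>\<close> at \<open>z\<close> of degree less than \<open>l\<close>, evaluated at \<open>x\<close>.\<close>

definition taylor :: "(('n::finite \<Rightarrow> nat) \<Rightarrow> real^'n \<Rightarrow> real) \<Rightarrow> nat \<Rightarrow> real^'n \<Rightarrow> ('n \<Rightarrow> nat) \<Rightarrow> real^'n \<Rightarrow> real" where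
  "taylor U l z \<beta> x = (\<Sum>j<l. dir_deriv U j (x - z) \<beta> z / fact j)"

lemma inc_commute: "inc i (inc j \<beta>) = inc j (inc i (\<beta> :: 'n \<Rightarrow> nat))"
  by (cases "i = j") (auto simp: inc_def fun_upd_twist)

lemma dir_deriv_Suc_inc:
  "(\<Sum>i\<in>UNIV. h $ i * dir_deriv U j h (inc l (inc i \<beta>)) z) = dir_deriv U (Suc j) h (inc l \<beta>) z"
  by (simp add: inc_commute[where i = l])

lemma sum_swap_factor:
  fixes a b :: "'n::finite \<Rightarrow> real"
  shows "(\<Sum>i\<in>UNIV. a i * (\<Sum>l\<in>UNIV. b l * c l i)) = (\<Sum>l\<in>UNIV. b l * (\<Sum>i\<in>UNIV. a i * c l i))"
  unfolding sum_distrib_left by (subst sum.swap) (intro sum.cong refl, simp add: mult_ac)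

text \<open>Moving the argument lowers the order; moving the base point does the same with the opposite sign,
  and also differentiates the coefficients. In the Taylor polynomial these contributions telescope.\<close>

lemma dir_deriv_argument:
  "((\<lambda>x. dir_deriv U j (x - z) \<beta> z) has_derivative (\<lambda>k. \<Sum>l\<in>UNIV. k $ l * (real j * dir_deriv U (j - 1) (x - z) (inc l \<beta>) z))) (at x)"
proof (induction j arbitrary: \<beta>)
  case (Suc j)
  have "((\<lambda>x. (x - z) $ i * dir_deriv U j (x - z) (inc i \<beta>) z) has_derivative
      (\<lambda>k. (x - z) $ i * (\<Sum>l\<in>UNIV. k $ l * (real j * dir_deriv U (j - 1) (x - z) (inc l (inc i \<beta>)) z)) +
        k $ i * dir_deriv U j (x - z) (inc i \<beta>) z)) (at x)" for i
    by (rule has_derivative_mult[OF _ Suc.IH])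
      (auto intro!: derivative_eq_intros bounded_linear.has_derivative[OF bounded_linear_vec_nth])
  then have "((\<lambda>x. dir_deriv U (Suc j) (x - z) \<beta> z) has_derivative
      (\<lambda>k. \<Sum>i\<in>UNIV. (x - z) $ i * (\<Sum>l\<in>UNIV. k $ l * (real j * dir_deriv U (j - 1) (x - z) (inc l (inc i \<beta>)) z)) +
        k $ i * dir_deriv U j (x - z) (inc i \<beta>) z)) (at x)"
    unfolding dir_deriv.simps by (rule has_derivative_sum)
  moreover have "(\<Sum>i\<in>UNIV. (x - z) $ i * (\<Sum>l\<in>UNIV. k $ l * (real j * dir_deriv U (j - 1) (x - z) (inc l (inc i \<beta>)) z)) +
        k $ i * dir_deriv U j (x - z) (inc i \<beta>) z) =
      (\<Sum>l\<in>UNIV. k $ l * (real (Suc j) * dir_deriv U j (x - z) (inc l \<beta>) z))" for k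
  proof -
    have G: "(\<Sum>i\<in>UNIV. (x - z) $ i * (real j * dir_deriv U (j - 1) (x - z) (inc l (inc i \<beta>)) z)) = real j * dir_deriv U j (x - z) (inc l \<beta>) z" for l
    proof (cases j)
      case (Suc j')
      have "(\<Sum>i\<in>UNIV. (x - z) $ i * (real j * dir_deriv U j' (x - z) (inc l (inc i \<beta>)) z)) =
          real j * (\<Sum>i\<in>UNIV. (x - z) $ i * dir_deriv U j' (x - z) (inc l (inc i \<beta>)) z)"
        unfolding sum_distrib_left by (intro sum.cong refl) (simp only: mult_ac)
      then show ?thesis unfolding dir_deriv_Suc_inc using Suc by simp
    qed simp
    show ?thesis
      unfolding sum.distrib sum_swap_factor G unfolding sum.distrib[symmetric]
      by (intro sum.cong refl) (simp add: distrib_right distrib_left del: dir_deriv.simps)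
  qed
  ultimately show ?case by (simp only: diff_Suc_1)
qed simp

lemma dir_deriv_base:
  assumes U: "deriv_family U"
  shows "((\<lambda>z. dir_deriv U j (x - z) \<beta> z) has_derivative
    (\<lambda>k. \<Sum>l\<in>UNIV. k $ l * (dir_deriv U j (x - z) (inc l \<beta>) z - real j * dir_deriv U (j - 1) (x - z) (inc l \<beta>) z))) (at z)"
proof (induction j arbitrary: \<beta>)
  case 0
  show ?case unfolding dir_deriv.simps of_nat_0 mult_zero_left diff_zero
    by (rule U[unfolded deriv_family_def, rule_format])
next
  case (Suc j)
  let ?G = "\<lambda>l i. dir_deriv U j (x - z) (inc l (inc i \<beta>)) z - real j * dir_deriv U (j - 1) (x - z) (inc l (inc i \<beta>)) z"
  have "((\<lambda>z. (x - z) $ i * dir_deriv U j (x - z) (inc i \<beta>) z) has_derivative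
      (\<lambda>k. (x - z) $ i * (\<Sum>l\<in>UNIV. k $ l * ?G l i) + (- k $ i) * dir_deriv U j (x - z) (inc i \<beta>) z)) (at z)" for i
  proof (rule has_derivative_mult[OF _ Suc.IH])
    have "((\<lambda>z. x - z) has_derivative (\<lambda>k. - k)) (at z)" by (auto intro!: derivative_eq_intros)
    from bounded_linear.has_derivative[OF bounded_linear_vec_nth this]
    show "((\<lambda>z. (x - z) $ i) has_derivative (\<lambda>k. - k $ i)) (at z)" by simp
  qed
  then have "((\<lambda>z. dir_deriv U (Suc j) (x - z) \<beta> z) has_derivative
      (\<lambda>k. \<Sum>i\<in>UNIV. (x - z) $ i * (\<Sum>l\<in>UNIV. k $ l * ?G l i) + (- k $ i) * dir_deriv U j (x - z) (inc i \<beta>) z)) (at z)"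
    unfolding dir_deriv.simps by (rule has_derivative_sum)
  moreover have "(\<Sum>i\<in>UNIV. (x - z) $ i * (\<Sum>l\<in>UNIV. k $ l * ?G l i) + (- k $ i) * dir_deriv U j (x - z) (inc i \<beta>) z) =
      (\<Sum>l\<in>UNIV. k $ l * (dir_deriv U (Suc j) (x - z) (inc l \<beta>) z - real (Suc j) * dir_deriv U j (x - z) (inc l \<beta>) z))" for k
  proof -
    have G: "(\<Sum>i\<in>UNIV. (x - z) $ i * ?G l i) = dir_deriv U (Suc j) (x - z) (inc l \<beta>) z - real j * dir_deriv U j (x - z) (inc l \<beta>) z" for l
    proof -
      have "(\<Sum>i\<in>UNIV. (x - z) $ i * ?G l i) = (\<Sum>i\<in>UNIV. (x - z) $ i * dir_deriv U j (x - z) (inc l (inc i \<beta>)) z) -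
          real j * (\<Sum>i\<in>UNIV. (x - z) $ i * dir_deriv U (j - 1) (x - z) (inc l (inc i \<beta>)) z)"
        unfolding right_diff_distrib sum_subtractf sum_distrib_left by (simp only: mult.left_commute)
      also have "\<dots> = dir_deriv U (Suc j) (x - z) (inc l \<beta>) z - real j * dir_deriv U j (x - z) (inc l \<beta>) z"
        unfolding dir_deriv_Suc_inc by (cases j) simp_all
      finally show ?thesis .
    qed
    show ?thesis unfolding sum.distrib sum_swap_factor G
      unfolding sum.distrib[symmetric] by (intro sum.cong refl) (simp add: algebra_simps del: dir_deriv.simps)
  qed
  ultimately show ?case by (simp only: diff_Suc_1)
qed

lemma taylor_argument:
  "((\<lambda>x. taylor U l z \<beta> x) has_derivative (\<lambda>k. \<Sum>i\<in>UNIV. k $ i * taylor U (l - 1) z (inc i \<beta>) x)) (at x)"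
proof -
  have "((\<lambda>x. taylor U l z \<beta> x) has_derivative
      (\<lambda>k. \<Sum>j<l. (\<Sum>i\<in>UNIV. k $ i * (real j * dir_deriv U (j - 1) (x - z) (inc i \<beta>) z)) / fact j)) (at x)"
    unfolding taylor_def by (intro has_derivative_sum bounded_linear.has_derivative[OF bounded_linear_divide] dir_deriv_argument)
  moreover have "(\<Sum>j<l. (\<Sum>i\<in>UNIV. k $ i * (real j * dir_deriv U (j - 1) (x - z) (inc i \<beta>) z)) / fact j) =
      (\<Sum>i\<in>UNIV. k $ i * taylor U (l - 1) z (inc i \<beta>) x)" for k
  proof (cases l)
    case (Suc m)
    have "(\<Sum>j<l. (\<Sum>i\<in>UNIV. k $ i * (real j * dir_deriv U (j - 1) (x - z) (inc i \<beta>) z)) / fact j) =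
        (\<Sum>j<m. (\<Sum>i\<in>UNIV. k $ i * dir_deriv U j (x - z) (inc i \<beta>) z) / fact j)"
      unfolding Suc sum.lessThan_Suc_shift
      by (simp del: of_nat_Suc add: sum_divide_distrib fact_Suc)
    also have "\<dots> = (\<Sum>i\<in>UNIV. k $ i * taylor U (l - 1) z (inc i \<beta>) x)"
      unfolding taylor_def Suc sum_divide_distrib sum_distrib_left by (subst sum.swap) simp
    finally show ?thesis .
  qed (simp add: taylor_def)
  ultimately show ?thesis by simp
qed

lemma taylor_base:
  assumes U: "deriv_family U"
  shows "((\<lambda>z. taylor U (Suc l) z \<beta> x) has_derivative (\<lambda>k. \<Sum>i\<in>UNIV. k $ i * (dir_deriv U l (x - z) (inc i \<beta>) z / fact l))) (at z)"
proof (induction l)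
  case 0
  show ?case using U by (simp add: taylor_def deriv_family_def)
next
  case (Suc l)
  have "((\<lambda>z. taylor U (Suc l) z \<beta> x + dir_deriv U (Suc l) (x - z) \<beta> z / fact (Suc l)) has_derivative
      (\<lambda>k. (\<Sum>i\<in>UNIV. k $ i * (dir_deriv U l (x - z) (inc i \<beta>) z / fact l)) +
        (\<Sum>i\<in>UNIV. k $ i * (dir_deriv U (Suc l) (x - z) (inc i \<beta>) z - real (Suc l) * dir_deriv U (Suc l - 1) (x - z) (inc i \<beta>) z)) / fact (Suc l))) (at z)"
    by (intro has_derivative_add Suc.IH bounded_linear.has_derivative[OF bounded_linear_divide] dir_deriv_base[OF U])
  moreover have "(\<Sum>i\<in>UNIV. k $ i * (dir_deriv U l (x - z) (inc i \<beta>) z / fact l)) +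
        (\<Sum>i\<in>UNIV. k $ i * (dir_deriv U (Suc l) (x - z) (inc i \<beta>) z - real (Suc l) * dir_deriv U (Suc l - 1) (x - z) (inc i \<beta>) z)) / fact (Suc l) =
      (\<Sum>i\<in>UNIV. k $ i * (dir_deriv U (Suc l) (x - z) (inc i \<beta>) z / fact (Suc l)))" for k
    unfolding sum_divide_distrib sum.distrib[symmetric]
  proof (rule sum.cong[OF refl])
    fix i
    have "real (Suc l) / fact (Suc l) = 1 / fact l" by (simp del: of_nat_Suc add: fact_Suc)
    then show "k $ i * (dir_deriv U l (x - z) (inc i \<beta>) z / fact l) +
        k $ i * (dir_deriv U (Suc l) (x - z) (inc i \<beta>) z - real (Suc l) * dir_deriv U (Suc l - 1) (x - z) (inc i \<beta>) z) / fact (Suc l) =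
        k $ i * (dir_deriv U (Suc l) (x - z) (inc i \<beta>) z / fact (Suc l))"
      by (simp del: of_nat_Suc fact_Suc dir_deriv.simps add: diff_divide_distrib right_diff_distrib) (simp add: fact_Suc)
  qed
  moreover have "taylor U (Suc (Suc l)) z \<beta> x = taylor U (Suc l) z \<beta> x + dir_deriv U (Suc l) (x - z) \<beta> z / fact (Suc l)" for z
    by (simp add: taylor_def)
  ultimately show ?case by (simp only:)
qed

lemma deriv_family_taylor: "deriv_family (\<lambda>\<beta> x. taylor U (k - mi_order \<beta>) z \<beta> x)"
proof -
  have e: "k - Suc (mi_order \<beta>) = k - mi_order \<beta> - 1" for \<beta> :: "'a \<Rightarrow> nat" by simp
  show ?thesis unfolding deriv_family_def mi_order_inc e by (intro allI taylor_argument)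
qed

lemma dir_deriv_bound:
  fixes h :: "real^'n"
  assumes "\<And>\<gamma>. mi_order \<gamma> = mi_order \<beta> + j \<Longrightarrow> \<bar>U \<gamma> z\<bar> \<le> M"
  shows "\<bar>dir_deriv U j h \<beta> z\<bar> \<le> (real CARD('n) * norm h) ^ j * M"
  using assms
proof (induction j arbitrary: \<beta>)
  case (Suc j)
  have "\<bar>dir_deriv U j h (inc i \<beta>) z\<bar> \<le> (real CARD('n) * norm h) ^ j * M" for i
  proof (rule Suc.IH)
    fix \<gamma> :: "'n \<Rightarrow> nat" assume "mi_order \<gamma> = mi_order (inc i \<beta>) + j"
    then have "mi_order \<gamma> = mi_order \<beta> + Suc j" unfolding mi_order_inc by simp
    then show "\<bar>U \<gamma> z\<bar> \<le> M" by (rule Suc.prems)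
  qed
  then have "\<bar>dir_deriv U (Suc j) h \<beta> z\<bar> \<le> real CARD('n) * ((real CARD('n) * norm h) ^ j * M) * norm h"
    unfolding dir_deriv.simps by (rule abs_sum_components_le)
  then show ?case by (simp add: mult_ac)
qed simp

lemma taylor_at_base: "0 < l \<Longrightarrow> taylor U l x \<beta> x = U \<beta> x"
proof -
  assume "0 < l"
  then obtain m where m: "l = Suc m" by (cases l) auto
  have "dir_deriv U (Suc j) 0 \<beta> x = 0" for j by simp
  then show ?thesis unfolding taylor_def m sum.lessThan_Suc_shift by (simp del: dir_deriv.simps(2))
qed

subsection \<open>Variation along connected sets\<close>

text \<open>The values of \<open>f\<close> on \<open>A\<close> contain the interval between \<open>f y\<close> and \<open>f y'\<close>, and they are covered by one
  interval of length \<open>2 D\<close> for each ball. Comparing lengths avoids the choice of a chain of balls.\<close>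

lemma connected_variation:
  fixes f :: "'a::metric_space \<Rightarrow> real"
  assumes A: "connected A" "continuous_on A f" and X: "finite X" "A \<subseteq> (\<Union>c\<in>X. ball c e)"
    and step: "\<And>y y'. y \<in> A \<Longrightarrow> y' \<in> A \<Longrightarrow> dist y y' < 2 * e \<Longrightarrow> \<bar>f y - f y'\<bar> \<le> D"
    and y: "y \<in> A" "y' \<in> A" and D: "0 \<le> D"
  shows "\<bar>f y - f y'\<bar> \<le> real (card X) * (2 * D)"
proof -
  have main: "f y' - f y \<le> real (card X) * (2 * D)" if y: "y \<in> A" "y' \<in> A" "f y \<le> f y'" for y y'
  proof -
    define a where "a c = (SOME z. z \<in> A \<inter> ball c e)" for c
    have a: "a c \<in> A \<inter> ball c e" if "A \<inter> ball c e \<noteq> {}" for c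
      unfolding a_def using that by (metis some_in_eq)
    have "connected (f ` A)" by (rule connected_continuous_image[OF A(2,1)])
    then have "{f y..f y'} \<subseteq> f ` A" using y by (intro connected_contains_Icc) auto
    also have "\<dots> \<subseteq> (\<Union>c\<in>X. {f (a c) - D..f (a c) + D})"
    proof clarify
      fix z assume z: "z \<in> A"
      then obtain c where c: "c \<in> X" "z \<in> ball c e" using X(2) by blast
      then have ac: "a c \<in> A \<inter> ball c e" using a z by blast
      then have "dist (a c) z < 2 * e" using c(2) dist_triangle_less_add[of "a c" c e z e] by (auto simp: dist_commute)
      then have "\<bar>f (a c) - f z\<bar> \<le> D" using step ac z by blast
      then show "f z \<in> (\<Union>c\<in>X. {f (a c) - D..f (a c) + D})" using c(1) by (intro UN_I[of c]) auto
    qed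
    finally have sub: "{f y..f y'} \<subseteq> (\<Union>c\<in>X. {f (a c) - D..f (a c) + D})" .
    have Icc: "{u..v} \<in> fmeasurable lborel" for u v :: real by (metis box_real(2) fmeasurable_cbox)
    have "measure lborel {f y..f y'} \<le> measure lborel (\<Union>c\<in>X. {f (a c) - D..f (a c) + D})"
      using X(1) Icc sub by (intro measure_mono_fmeasurable fmeasurable.finite_UN) auto
    also have "\<dots> \<le> (\<Sum>c\<in>X. measure lborel {f (a c) - D..f (a c) + D})"
      using X(1) by (intro measure_UNION_le) auto
    also have "\<dots> = real (card X) * (2 * D)" using D by simp
    finally show ?thesis using y(3) by simp
  qed
  show ?thesis using main[OF y] main[OF y(2,1)] by (cases "f y \<le> f y'") auto
qed

text \<open>When the base point moves, a Taylor polynomial only changes by terms of the top order; so bounds on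
  the derivatives of this order control the change along a connected set.\<close>

lemma taylor_variation:
  fixes x :: "real^'n"
  assumes U: "deriv_family U" and A: "connected A" "z \<in> A" "z' \<in> A"
    and X: "finite X" "A \<subseteq> (\<Union>c\<in>X. ball c (h / 2))" and h: "0 < h"
    and M: "\<And>y w \<gamma>. y \<in> A \<Longrightarrow> w \<in> ball y h \<Longrightarrow> mi_order \<gamma> = mi_order \<beta> + Suc l \<Longrightarrow> \<bar>U \<gamma> w\<bar> \<le> M"
    and D: "\<And>y w. y \<in> A \<Longrightarrow> w \<in> ball y h \<Longrightarrow> dist x w \<le> D" and M0: "0 \<le> M"
  shows "\<bar>taylor U (Suc l) z \<beta> x - taylor U (Suc l) z' \<beta> x\<bar> \<le>
    real (card X) * (2 * (real CARD('n) * ((real CARD('n) * D) ^ l * M) * h))"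
proof (rule connected_variation[OF A(1) _ X _ A(2,3)])
  let ?n = "real CARD('n)"
  note der = taylor_base[OF U, of l \<beta> x]
  show "continuous_on A (\<lambda>z. taylor U (Suc l) z \<beta> x)"
    by (intro continuous_at_imp_continuous_on ballI has_derivative_continuous[OF der])
  have "dist x z \<le> D" using h by (intro D[OF A(2)]) simp
  then have "0 \<le> D" using zero_le_dist[of x z] by linarith
  then show "0 \<le> ?n * ((?n * D) ^ l * M) * h" using M0 h by simp
  fix y y' assume y: "y \<in> A" "y' \<in> A" "dist y y' < 2 * (h / 2)"
  have "\<bar>taylor U (Suc l) y \<beta> x - taylor U (Suc l) y' \<beta> x\<bar> \<le> ?n * ((?n * D) ^ l * M) * dist y y'"
  proof (rule partials_mean_value[OF convex_ball[of y h] _ _ der])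
    fix w i assume w: "w \<in> ball y h"
    have "\<bar>dir_deriv U l (x - w) (inc i \<beta>) w / fact l\<bar> \<le> \<bar>dir_deriv U l (x - w) (inc i \<beta>) w\<bar>"
      unfolding abs_divide using fact_ge_1[of l, where 'a = real]
      by (simp add: divide_le_eq mult_le_cancel_left1)
    also have "\<dots> \<le> (?n * norm (x - w)) ^ l * M"
    proof (rule dir_deriv_bound)
      fix \<gamma> :: "'n \<Rightarrow> nat" assume "mi_order \<gamma> = mi_order (inc i \<beta>) + l"
      then have "mi_order \<gamma> = mi_order \<beta> + Suc l" unfolding mi_order_inc by simp
      then show "\<bar>U \<gamma> w\<bar> \<le> M" by (rule M[OF y(1) w])
    qed
    also have "\<dots> \<le> (?n * D) ^ l * M"
      using D[OF y(1) w] M0 by (intro mult_right_mono power_mono) (auto simp: dist_norm)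
    finally show "\<bar>dir_deriv U l (x - w) (inc i \<beta>) w / fact l\<bar> \<le> (?n * D) ^ l * M" .
  qed (use y h in auto)
  also have "\<dots> \<le> ?n * ((?n * D) ^ l * M) * h"
    using y(3) \<open>0 \<le> D\<close> M0 by (intro mult_left_mono) auto
  finally show "\<bar>taylor U (Suc l) y \<beta> x - taylor U (Suc l) y' \<beta> x\<bar> \<le> ?n * ((?n * D) ^ l * M) * h" .
qed

section \<open>The approximating function\<close>

text \<open>By scaling, the number of balls does not depend on the scale \<open>T\<close>.\<close>

lemma covering_number:
  assumes "0 < e"
  shows "\<exists>N. \<forall>T>0. \<forall>x::real^'n. \<exists>X. finite X \<and> card X \<le> N \<and> ball x (D * T) \<subseteq> (\<Union>c\<in>X. ball c (e * T))"
proof -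
  obtain k where k: "finite k" "cball (0::real^'n) D \<subseteq> (\<Union>c\<in>k. ball c e)"
    using compact_eq_totally_bounded[of "cball (0::real^'n) D"] assms by auto
  have "\<exists>X. finite X \<and> card X \<le> card k \<and> ball x (D * T) \<subseteq> (\<Union>c\<in>X. ball c (e * T))" if T: "0 < T" for T and x :: "real^'n"
  proof (intro exI conjI subsetI)
    let ?X = "(\<lambda>c. x + T *\<^sub>R c) ` k"
    show "finite ?X" "card ?X \<le> card k" using k(1) by (auto intro: card_image_le)
    fix y assume "y \<in> ball x (D * T)"
    then have "(1 / T) *\<^sub>R (y - x) \<in> cball 0 D" using T by (auto simp: dist_norm norm_minus_commute divide_le_eq)
    then have "(1 / T) *\<^sub>R (y - x) \<in> (\<Union>c\<in>k. ball c e)" using k(2) by blast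
    then have "\<exists>c\<in>k. dist c ((1 / T) *\<^sub>R (y - x)) < e" by (simp only: UN_iff mem_ball)
    then obtain c where c: "c \<in> k" "dist c ((1 / T) *\<^sub>R (y - x)) < e" by blast
    have "x + T *\<^sub>R c - y = T *\<^sub>R (c - (1 / T) *\<^sub>R (y - x))" using T by (simp add: algebra_simps)
    then have "dist (x + T *\<^sub>R c) y = T * dist c ((1 / T) *\<^sub>R (y - x))"
      unfolding dist_norm using T by (simp only: norm_scaleR)
    also have "\<dots> < e * T" using c(2) T by simp
    finally show "y \<in> (\<Union>c\<in>?X. ball c (e * T))" using c(1) by auto
  qed
  then show ?thesis by blast
qed

text \<open>Here \<open>f\<close> stands for a function that agrees with the one to be approximated at distance at least
  \<open>a T / 8\<close> from the boundary.\<close>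

locale patching = bounded_domain \<Omega> for \<Omega> :: "(real^'n) set" +
  fixes a b s T :: real and k :: nat and Z :: "real^'n \<Rightarrow> (real^'n) option" and f :: "real^'n \<Rightarrow> real"
  assumes a: "0 < a" "a \<le> 1" and b: "0 < b" and T: "0 < T"
    and gates: "gate_system a b s T Z" and f: "integrable lborel f"
begin

text \<open>The mollifier has its support in a ball of radius \<open>a T / 8\<close>. The cubes below have diameter at most
  \<open>T / 4\<close>, so that the union of two intersecting ones is small enough for the gate system.\<close>

definition "moll_radius = a * T / (8 * real CARD('n))"
definition "side = T / (16 * real CARD('n))"

abbreviation "U \<equiv> mollify f moll_radius"

text \<open>The subtraction \<open>k - mi_order \<beta>\<close> keeps the degree below \<open>k\<close> in total; at order \<open>k\<close> the polynomial
  vanishes.\<close>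

definition piece :: "(real^'n) option \<Rightarrow> ('n \<Rightarrow> nat) \<Rightarrow> real^'n \<Rightarrow> real" where
  "piece q \<beta> x = (case q of None \<Rightarrow> U \<beta> x | Some m \<Rightarrow> taylor U (k - mi_order \<beta>) m \<beta> x)"

text \<open>The cube is twice as wide as the support of the cutoff around the same lattice point; so a
  cutoff whose cube does not contain a point vanishes near that point.\<close>

definition cube :: "('n \<Rightarrow> int) \<Rightarrow> (real^'n) set" where
  "cube j = {x. \<forall>i. \<bar>((1 / side) *\<^sub>R x) $ i - of_int (j i)\<bar> < 2}"

definition chamber :: "('n \<Rightarrow> int) \<Rightarrow> real^'n \<Rightarrow> (real^'n) set" where
  "chamber j x = connected_component_set (\<Omega> \<inter> cube j) x"

text \<open>All points of a chamber share the base point, so that the tag below is constant on chambers. Two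
  chambers of the same cube may lie on different sides of the boundary and get different tags.\<close>

definition base :: "('n \<Rightarrow> int) \<Rightarrow> real^'n \<Rightarrow> real^'n" where
  "base j x = (SOME z. z \<in> chamber j x)"

abbreviation tag :: "('n \<Rightarrow> int) \<Rightarrow> real^'n \<Rightarrow> (real^'n) option" where
  "tag j x \<equiv> Z (base j x)"

definition cutoff :: "('n \<Rightarrow> int) \<Rightarrow> ('n \<Rightarrow> nat) \<Rightarrow> real^'n \<Rightarrow> real" where
  "cutoff j \<beta> x = (1 / side) ^ mi_order \<beta> * tensor_bump \<beta> ((1 / side) *\<^sub>R x - lattice_point j)"

definition index :: "('n \<Rightarrow> int) set" where
  "index = {j. cube j \<inter> \<Omega> \<noteq> {}}"

definition patched :: "real^'n \<Rightarrow> real" where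
  "patched x = (\<Sum>j\<in>index. cutoff j (\<lambda>_. 0) x * piece (tag j x) (\<lambda>_. 0) x)"

definition near :: "real^'n \<Rightarrow> ('n \<Rightarrow> int) set" where
  "near x = {j \<in> index. x \<in> cube j}"

lemma card_ge_1: "1 \<le> real CARD('n)" by simp

lemma side_pos: "0 < side" and side_le: "side \<le> T" and moll_radius_pos: "0 < moll_radius"
  and moll_support: "real CARD('n) * moll_radius = a * T / 8" and side_dim: "real CARD('n) * (4 * side) = T / 4"
proof -
  have "1 \<le> 16 * real CARD('n)" using card_ge_1 by linarith
  then show "side \<le> T" using T by (simp add: side_def divide_le_eq)
qed (use T a in \<open>auto simp: side_def moll_radius_def field_simps\<close>)

lemma U_family: "deriv_family U"
  by (rule deriv_family_mollify[OF f])

lemma piece_family: "deriv_family (piece q)"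
proof (cases q)
  case None
  then show ?thesis using U_family by (simp add: piece_def[abs_def])
next
  case (Some m)
  then show ?thesis using deriv_family_taylor[of U k m] by (simp add: piece_def[abs_def])
qed

lemma cutoff_family: "deriv_family (cutoff j)"
  using deriv_family_affine[OF deriv_family_tensor_bump, of 1 "1 / side" "- lattice_point j"]
  by (simp add: cutoff_def[abs_def])

lemma open_cube: "open (cube j)"
proof -
  have "cube j = (\<Inter>i\<in>UNIV. {x. \<bar>((1 / side) *\<^sub>R x) $ i - of_int (j i)\<bar> < 2})" by (auto simp: cube_def)
  moreover have "open {x :: real^'n. \<bar>((1 / side) *\<^sub>R x) $ i - of_int (j i)\<bar> < 2}" for i
    by (intro open_Collect_less continuous_intros)
  ultimately show ?thesis by (simp only:) (intro open_INT, auto)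
qed

lemma cube_diameter: assumes "x \<in> cube j" "y \<in> cube j" shows "dist x y \<le> T / 4"
proof -
  have "\<bar>(x - y) $ i\<bar> \<le> 4 * side" for i
  proof -
    have "\<bar>((1 / side) *\<^sub>R x) $ i - of_int (j i)\<bar> < 2" "\<bar>((1 / side) *\<^sub>R y) $ i - of_int (j i)\<bar> < 2"
      using assms by (auto simp: cube_def)
    then have "\<bar>((1 / side) *\<^sub>R x) $ i - ((1 / side) *\<^sub>R y) $ i\<bar> \<le> 4" by linarith
    moreover have "((1 / side) *\<^sub>R x) $ i - ((1 / side) *\<^sub>R y) $ i = (x - y) $ i / side"
      by (simp add: diff_divide_distrib)
    ultimately show ?thesis using side_pos by (simp add: divide_le_eq)
  qed
  then have "(\<Sum>i\<in>UNIV. \<bar>(x - y) $ i\<bar>) \<le> (\<Sum>i\<in>(UNIV::'n set). 4 * side)" by (intro sum_mono)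
  then show ?thesis using norm_le_l1_cart[of "x - y"] side_dim by (simp add: dist_norm)
qed

lemma chamber_props:
  assumes "x \<in> \<Omega>" "x \<in> cube j"
  shows "x \<in> chamber j x" "open (chamber j x)" "connected (chamber j x)" "chamber j x \<subseteq> \<Omega>" "chamber j x \<subseteq> cube j"
    "base j x \<in> chamber j x" "\<And>y. y \<in> chamber j x \<Longrightarrow> base j y = base j x"
proof -
  show x: "x \<in> chamber j x" unfolding chamber_def using assms by (simp add: connected_component_refl)
  show "open (chamber j x)" unfolding chamber_def by (intro open_connected_component open_Int open_dom open_cube)
  show "connected (chamber j x)" by (simp add: chamber_def)
  show "chamber j x \<subseteq> \<Omega>" "chamber j x \<subseteq> cube j"
    unfolding chamber_def using connected_component_subset[of "\<Omega> \<inter> cube j" x] by auto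
  show "base j x \<in> chamber j x" unfolding base_def using x by (rule someI)
  show "base j y = base j x" if "y \<in> chamber j x" for y
    using connected_component_eq[of y "\<Omega> \<inter> cube j" x] that by (simp add: base_def chamber_def)
qed

lemma finite_index: "finite index"
proof -
  obtain B where B: "\<And>x. x \<in> \<Omega> \<Longrightarrow> norm x \<le> B" using bdd by (auto simp: bounded_iff)
  let ?N = "\<lceil>B / side + 2\<rceil>"
  have "index \<subseteq> PiE UNIV (\<lambda>_. {- ?N..?N})"
  proof
    fix j assume "j \<in> index"
    then obtain x where x: "x \<in> cube j" "x \<in> \<Omega>" by (auto simp: index_def)
    have "j i \<in> {- ?N..?N}" for i
    proof -
      have "\<bar>x $ i / side\<bar> \<le> B / side"
        using component_le_norm_cart[of x i] B[OF x(2)] side_pos by (simp add: abs_divide divide_right_mono)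
      moreover have "\<bar>x $ i / side - of_int (j i)\<bar> < 2" using x(1) by (auto simp: cube_def)
      ultimately have "\<bar>real_of_int (j i)\<bar> \<le> B / side + 2" by linarith
      then show ?thesis by (auto simp: abs_le_iff) linarith+
    qed
    then show "j \<in> PiE UNIV (\<lambda>_. {- ?N..?N})" by (simp add: PiE_UNIV_domain)
  qed
  then show ?thesis by (rule finite_subset) (intro finite_PiE, auto)
qed

lemma finite_near: "finite (near x)" using finite_index by (simp add: near_def)

lemma card_near: "card (near x) \<le> 6 ^ CARD('n)"
proof -
  have "near x \<subseteq> {j. \<forall>i. \<bar>((1 / side) *\<^sub>R x) $ i - of_int (j i)\<bar> < 2}" by (auto simp: near_def cube_def)
  then have "card (near x) \<le> card {j. \<forall>i. \<bar>((1 / side) *\<^sub>R x) $ i - of_int (j i)\<bar> < 2}"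
    by (intro card_mono finite_lattice_near)
  then show ?thesis using card_lattice_near[of "(1 / side) *\<^sub>R x"] by linarith
qed

lemma cutoff_sum: assumes "x \<in> \<Omega>" shows "(\<Sum>j\<in>index. cutoff j (\<lambda>_. 0) x) = 1"
proof -
  have "(\<Sum>j\<in>index. tensor_bump (\<lambda>_. 0) ((1 / side) *\<^sub>R x - lattice_point j)) = 1"
    by (rule tensor_bump_partition[OF finite_index]) (use assms in \<open>auto simp: index_def cube_def\<close>)
  then show ?thesis by (simp add: cutoff_def mi_order_zero)
qed

text \<open>Near a given point the chambers are constant, so that the function is a finite sum of products
  of smooth functions there.\<close>

lemma local_form:
  assumes x0: "x0 \<in> \<Omega>"
  shows "\<exists>W. open W \<and> x0 \<in> W \<and> W \<subseteq> \<Omega> \<and> (\<forall>x\<in>W. patched x = (\<Sum>j\<in>near x0. cutoff j (\<lambda>_. 0) x * piece (tag j x0) (\<lambda>_. 0) x) \<and>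
    (\<Sum>j\<in>near x0. cutoff j (\<lambda>_. 0) x) = 1)"
proof -
  define off where "off j = {x :: real^'n. \<exists>i. 1 < \<bar>((1 / side) *\<^sub>R x) $ i - of_int (j i)\<bar>}" for j :: "'n \<Rightarrow> int"
  define W where "W = \<Omega> \<inter> (\<Inter>j\<in>near x0. chamber j x0) \<inter> (\<Inter>j\<in>index - near x0. off j)"
  have nr: "x0 \<in> cube j" if "j \<in> near x0" for j using that by (simp add: near_def)
  have "off j = (\<Union>i\<in>UNIV. {x. 1 < \<bar>((1 / side) *\<^sub>R x) $ i - of_int (j i)\<bar>})" for j by (auto simp: off_def)
  moreover have "open {x :: real^'n. 1 < \<bar>((1 / side) *\<^sub>R x) $ i - of_int (j i)\<bar>}" for i and j :: "'n \<Rightarrow> int"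
    by (intro open_Collect_less continuous_intros)
  ultimately have open_off: "open (off j)" for j by (simp only:) (intro open_UN, auto)
  have oW: "open W"
    unfolding W_def using open_dom finite_near finite_index open_off chamber_props(2)[OF x0 nr]
    by (intro open_Int open_INT) auto
  have xW: "x0 \<in> W"
  proof -
    have "x0 \<in> off j" if "j \<in> index - near x0" for j
    proof -
      have "x0 \<notin> cube j" using that by (simp add: near_def)
      then obtain i where "\<not> \<bar>((1 / side) *\<^sub>R x0) $ i - of_int (j i)\<bar> < 2" unfolding cube_def by blast
      then have "1 < \<bar>((1 / side) *\<^sub>R x0) $ i - of_int (j i)\<bar>" by linarith
      then show ?thesis unfolding off_def by blast
    qed
    then show ?thesis using x0 chamber_props(1)[OF x0 nr] by (auto simp: W_def)
  qed
  have zero: "cutoff j (\<lambda>_. 0) x = 0" if "x \<in> W" "j \<in> index - near x0" for x j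
  proof (rule ccontr)
    assume n: "cutoff j (\<lambda>_. 0) x \<noteq> 0"
    then have "tensor_bump (\<lambda>_. 0) ((1 / side) *\<^sub>R x - lattice_point j) \<noteq> 0" by (auto simp: cutoff_def)
    from tensor_bump_component[OF this] have "\<bar>((1 / side) *\<^sub>R x) $ i - of_int (j i)\<bar> \<le> 1" for i by simp
    then have "x \<notin> off j" by (auto simp: off_def not_less)
    then show False using that by (auto simp: W_def)
  qed
  have sub: "near x0 \<subseteq> index" by (auto simp: near_def)
  show ?thesis
  proof (intro exI[of _ W] conjI ballI)
    show "open W" "x0 \<in> W" by (rule oW, rule xW)
    show "W \<subseteq> \<Omega>" by (auto simp: W_def)
    fix x assume x: "x \<in> W"
    have "patched x = (\<Sum>j\<in>near x0. cutoff j (\<lambda>_. 0) x * piece (tag j x) (\<lambda>_. 0) x)"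
      unfolding patched_def by (rule sum.mono_neutral_right[OF finite_index sub]) (use zero[OF x] in simp)
    also have "\<dots> = (\<Sum>j\<in>near x0. cutoff j (\<lambda>_. 0) x * piece (tag j x0) (\<lambda>_. 0) x)"
    proof (rule sum.cong[OF refl])
      fix j assume j: "j \<in> near x0"
      then have "x \<in> chamber j x0" using x by (auto simp: W_def)
      then show "cutoff j (\<lambda>_. 0) x * piece (tag j x) (\<lambda>_. 0) x = cutoff j (\<lambda>_. 0) x * piece (tag j x0) (\<lambda>_. 0) x"
        using chamber_props(7)[OF x0 nr[OF j]] by simp
    qed
    finally show "patched x = (\<Sum>j\<in>near x0. cutoff j (\<lambda>_. 0) x * piece (tag j x0) (\<lambda>_. 0) x)" .
    have "(\<Sum>j\<in>near x0. cutoff j (\<lambda>_. 0) x) = (\<Sum>j\<in>index. cutoff j (\<lambda>_. 0) x)"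
      by (rule sum.mono_neutral_left[OF finite_index sub]) (use zero[OF x] in simp)
    then show "(\<Sum>j\<in>near x0. cutoff j (\<lambda>_. 0) x) = 1" using cutoff_sum[of x] x by (auto simp: W_def)
  qed
qed

lemma smooth_pieces: "piece q \<beta> \<in> smooth_functions S" "cutoff j \<beta> \<in> smooth_functions S"
  by (rule deriv_family_smooth[OF piece_family], rule deriv_family_smooth[OF cutoff_family])

lemma smooth_patched: "patched \<in> smooth_functions \<Omega>"
proof (rule smooth_local)
  fix x0 assume "x0 \<in> \<Omega>"
  from local_form[OF this] obtain W where "open W \<and> x0 \<in> W \<and> W \<subseteq> \<Omega> \<and> (\<forall>x\<in>W. patched x = (\<Sum>j\<in>near x0. cutoff j (\<lambda>_. 0) x * piece (tag j x0) (\<lambda>_. 0) x) \<and> (\<Sum>j\<in>near x0. cutoff j (\<lambda>_. 0) x) = 1)" ..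
  then have W: "open W" "x0 \<in> W" "\<And>x. x \<in> W \<Longrightarrow> patched x = (\<Sum>j\<in>near x0. cutoff j (\<lambda>_. 0) x * piece (tag j x0) (\<lambda>_. 0) x)" by simp_all
  have "(\<lambda>x. \<Sum>j\<in>near x0. cutoff j (\<lambda>_. 0) x * piece (tag j x0) (\<lambda>_. 0) x) \<in> smooth_functions W"
    by (intro smooth_sum smooth_mult W(1) smooth_pieces)
  then have "patched \<in> smooth_functions W" by (rule smooth_cong[OF W(1), rotated]) (simp add: W(3))
  then show "\<exists>W. open W \<and> x0 \<in> W \<and> patched \<in> smooth_functions W" using W by blast
qed

text \<open>The cutoffs sum to one, so a common piece \<open>q\<close> can be subtracted from all pieces.\<close>

lemma pd_patched:
  assumes x0: "x0 \<in> \<Omega>"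
  shows "pd_list xs patched x0 = piece q (count_list xs) x0 +
    (\<Sum>j\<in>near x0. pd_list xs (\<lambda>x. cutoff j (\<lambda>_. 0) x * (piece (tag j x0) (\<lambda>_. 0) x - piece q (\<lambda>_. 0) x)) x0)"
proof -
  from local_form[OF x0] obtain W where "open W \<and> x0 \<in> W \<and> W \<subseteq> \<Omega> \<and> (\<forall>x\<in>W. patched x = (\<Sum>j\<in>near x0. cutoff j (\<lambda>_. 0) x * piece (tag j x0) (\<lambda>_. 0) x) \<and> (\<Sum>j\<in>near x0. cutoff j (\<lambda>_. 0) x) = 1)" ..
  then have W: "open W" "x0 \<in> W" "\<And>x. x \<in> W \<Longrightarrow> patched x = (\<Sum>j\<in>near x0. cutoff j (\<lambda>_. 0) x * piece (tag j x0) (\<lambda>_. 0) x)"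
    "\<And>x. x \<in> W \<Longrightarrow> (\<Sum>j\<in>near x0. cutoff j (\<lambda>_. 0) x) = 1" by simp_all
  let ?g = "\<lambda>j x. cutoff j (\<lambda>_. 0) x * (piece (tag j x0) (\<lambda>_. 0) x - piece q (\<lambda>_. 0) x)"
  have g: "?g j \<in> smooth_functions W" for j by (intro smooth_mult smooth_diff W(1) smooth_pieces)
  have "pd_list xs patched x0 = pd_list xs (\<lambda>x. piece q (\<lambda>_. 0) x + (\<Sum>j\<in>near x0. ?g j x)) x0"
  proof (rule pd_list_cong[OF W(1,2)])
    fix x assume x: "x \<in> W"
    have "(\<Sum>j\<in>near x0. ?g j x) = (\<Sum>j\<in>near x0. cutoff j (\<lambda>_. 0) x * piece (tag j x0) (\<lambda>_. 0) x) -
        (\<Sum>j\<in>near x0. cutoff j (\<lambda>_. 0) x) * piece q (\<lambda>_. 0) x"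
      unfolding right_diff_distrib sum_subtractf sum_distrib_right ..
    then show "patched x = piece q (\<lambda>_. 0) x + (\<Sum>j\<in>near x0. ?g j x)" using W(3,4)[OF x] by simp
  qed
  also have "\<dots> = pd_list xs (piece q (\<lambda>_. 0)) x0 + pd_list xs (\<lambda>x. \<Sum>j\<in>near x0. ?g j x) x0"
    by (intro pd_list_add[OF W(1) _ _ W(2)] smooth_sum W(1) g smooth_pieces)
  also have "pd_list xs (piece q (\<lambda>_. 0)) x0 = piece q (count_list xs) x0"
    unfolding deriv_family_pd_list[OF piece_family] by simp
  also have "pd_list xs (\<lambda>x. \<Sum>j\<in>near x0. ?g j x) x0 = (\<Sum>j\<in>near x0. pd_list xs (?g j) x0)"
    by (rule pd_list_sum[OF W(1) g W(2)])
  finally show ?thesis .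
qed

lemma near_nonempty: assumes "x0 \<in> \<Omega>" shows "near x0 \<noteq> {}"
proof -
  have "(\<Sum>j\<in>near x0. cutoff j (\<lambda>_. 0) x0) = 1" using local_form[OF assms] by blast
  then show ?thesis by force
qed

lemma base_near:
  assumes "x0 \<in> \<Omega>" "j \<in> near x0"
  shows "base j x0 \<in> \<Omega>" "dist (base j x0) x0 \<le> T / 4"
proof -
  have c: "x0 \<in> cube j" using assms(2) by (simp add: near_def)
  note C = chamber_props[OF assms(1) c]
  show "base j x0 \<in> \<Omega>" using C(4,6) by blast
  show "dist (base j x0) x0 \<le> T / 4" using C(5,6) c by (intro cube_diameter) auto
qed

lemma patched_interior:
  assumes x0: "x0 \<in> \<Omega>" "s + T / 4 \<le> d x0" shows "pd_list xs patched x0 = U (count_list xs) x0"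
proof -
  have none: "tag j x0 = None" if j: "j \<in> near x0" for j
  proof -
    have "s \<le> d (base j x0)"
      using base_near[OF x0(1) j] d_lipschitz[of "base j x0" x0] x0(2) by linarith
    then show ?thesis using gates base_near(1)[OF x0(1) j] by (simp add: gate_system_def)
  qed
  have "pd_list xs patched x0 = piece None (count_list xs) x0 + (\<Sum>j\<in>near x0. 0)"
    unfolding pd_patched[OF x0(1), of xs None] by (intro arg_cong2[of _ _ _ _ "(+)"] sum.cong refl) (simp add: none pd_list_zero)
  then show ?thesis by (simp add: piece_def)
qed

text \<open>Only finitely many pieces occur, and each of them is smooth on the whole space.\<close>

lemma patched_bounded: "\<exists>B. \<forall>x\<in>\<Omega>. \<forall>xs. length xs \<le> k \<longrightarrow> \<bar>pd_list xs patched x\<bar> \<le> B"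
proof -
  have comp: "compact (closure \<Omega>)" using bdd by (simp add: compact_closure)
  have "\<exists>B. \<forall>x\<in>\<Omega>. \<bar>piece q \<beta> x\<bar> \<le> B" for q \<beta>
  proof -
    have "bounded (piece q \<beta> ` closure \<Omega>)"
      by (intro compact_imp_bounded compact_continuous_image comp smooth_continuous_on smooth_pieces)
    then show ?thesis using closure_subset[of \<Omega>] by (auto simp: bounded_iff)
  qed
  then obtain B1 where B1: "\<And>q \<beta> x. x \<in> \<Omega> \<Longrightarrow> \<bar>piece q \<beta> x\<bar> \<le> B1 q \<beta>" by metis
  define P where "P = Max (insert 0 ((\<lambda>(q, \<beta>). B1 q \<beta>) ` (range Z \<times> {\<beta>. mi_order \<beta> \<le> k})))"
  have finR: "finite (range Z)" using gates by (simp add: gate_system_def)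
  have fin: "finite (insert 0 ((\<lambda>(q, \<beta>). B1 q \<beta>) ` (range Z \<times> {\<beta>. mi_order \<beta> \<le> k})))"
    using finR finite_mi_order_le by blast
  have P: "\<bar>piece (Z y) \<beta> x\<bar> \<le> P" if "x \<in> \<Omega>" "mi_order \<beta> \<le> k" for x y \<beta>
  proof -
    have "B1 (Z y) \<beta> \<le> P" unfolding P_def using that(2) by (intro Max_ge[OF fin]) force
    then show ?thesis using B1[OF that(1), of "Z y" \<beta>] by linarith
  qed
  have P0: "0 \<le> P" unfolding P_def by (intro Max_ge[OF fin]) simp
  obtain M where M: "M > 0" "\<And>\<beta> z. mi_order (\<beta> :: 'n \<Rightarrow> nat) \<le> k \<Longrightarrow> \<bar>tensor_bump \<beta> z\<bar> \<le> M"
    using tensor_bump_bounded by metis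
  define A where "A = max 1 (1 / side) ^ k * M"
  have A0: "0 \<le> A" using M(1) by (simp add: A_def)
  have cut: "\<bar>cutoff j \<beta> x\<bar> \<le> A" if "mi_order \<beta> \<le> k" for j \<beta> x
  proof -
    have "(1 / side) ^ mi_order \<beta> \<le> max 1 (1 / side) ^ mi_order \<beta>"
      using side_pos by (intro power_mono) auto
    also have "\<dots> \<le> max 1 (1 / side) ^ k" using that by (intro power_increasing) auto
    finally show ?thesis
      unfolding cutoff_def A_def abs_mult using M(2)[OF that] side_pos by (intro mult_mono) auto
  qed
  have "\<bar>pd_list xs patched x0\<bar> \<le> real (card index) * (2 ^ k * (A * P))" if x0: "x0 \<in> \<Omega>" and xs: "length xs \<le> k" for x0 xs
  proof -
    from local_form[OF x0] obtain W where "open W \<and> x0 \<in> W \<and> W \<subseteq> \<Omega> \<and> (\<forall>x\<in>W. patched x = (\<Sum>j\<in>near x0. cutoff j (\<lambda>_. 0) x * piece (tag j x0) (\<lambda>_. 0) x) \<and> (\<Sum>j\<in>near x0. cutoff j (\<lambda>_. 0) x) = 1)" ..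
    then have W: "open W" "x0 \<in> W" "\<And>x. x \<in> W \<Longrightarrow> patched x = (\<Sum>j\<in>near x0. cutoff j (\<lambda>_. 0) x * piece (tag j x0) (\<lambda>_. 0) x)" by simp_all
    have "pd_list xs patched x0 = pd_list xs (\<lambda>x. \<Sum>j\<in>near x0. cutoff j (\<lambda>_. 0) x * piece (tag j x0) (\<lambda>_. 0) x) x0"
      by (rule pd_list_cong[OF W])
    also have "\<dots> = (\<Sum>j\<in>near x0. pd_list xs (\<lambda>x. cutoff j (\<lambda>_. 0) x * piece (tag j x0) (\<lambda>_. 0) x) x0)"
      by (intro pd_list_sum[OF W(1) _ W(2)] smooth_mult W(1) smooth_pieces)
    also have "\<bar>\<dots>\<bar> \<le> (\<Sum>j\<in>near x0. 2 ^ k * (A * P))"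
    proof (rule order_trans[OF sum_abs sum_mono])
      fix j
      have "\<bar>pd_list xs (\<lambda>x. cutoff j (\<lambda>_. 0) x * piece (tag j x0) (\<lambda>_. 0) x) x0\<bar> \<le> 2 ^ length xs * (A * P) * 1 ^ length xs"
      proof (rule pd_list_mult_bound[OF W(1,2) A0 P0 _ smooth_pieces(2,1)])
        fix js :: "'n list" assume js: "length js \<le> length xs"
        then have o: "mi_order (count_list js) \<le> k" using xs by (simp add: mi_order_count_list)
        show "\<bar>pd_list js (cutoff j (\<lambda>_. 0)) x0\<bar> \<le> A * 1 ^ length js"
          unfolding deriv_family_pd_list[OF cutoff_family] using cut[OF o] by simp
        show "\<bar>pd_list js (piece (tag j x0) (\<lambda>_. 0)) x0\<bar> \<le> P * 1 ^ length js"
          unfolding deriv_family_pd_list[OF piece_family] using P[OF x0 o] by simp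
      qed simp
      also have "\<dots> \<le> 2 ^ k * (A * P)"
        using xs A0 P0 by (simp add: mult_right_mono power_increasing)
      finally show "\<bar>pd_list xs (\<lambda>x. cutoff j (\<lambda>_. 0) x * piece (tag j x0) (\<lambda>_. 0) x) x0\<bar> \<le> 2 ^ k * (A * P)" .
    qed
    also have "\<dots> \<le> real (card index) * (2 ^ k * (A * P))"
      using A0 P0 card_mono[OF finite_index, of "near x0"] by (auto simp: near_def intro!: mult_right_mono)
    finally show ?thesis .
  qed
  then show ?thesis by blast
qed

text \<open>Two pieces that meet at a point are Taylor polynomials of the same function, where the mollification
  itself counts as its own Taylor polynomial based at \<open>x0\<close>. Their base points are joined, through the
  gates of the two chambers, by a connected set of controlled size away from the boundary.\<close>

lemma piece_difference:
  assumes x0: "x0 \<in> \<Omega>" and j: "j \<in> near x0" "j' \<in> near x0" and \<beta>: "mi_order \<beta> \<le> k" and M0: "0 \<le> M"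
    and M: "\<And>\<gamma> w. mi_order \<gamma> = k \<Longrightarrow> w \<in> \<Omega> \<Longrightarrow> a * T / 4 < d w \<Longrightarrow> dist x0 w < (b + 2) * T \<Longrightarrow> \<bar>U \<gamma> w\<bar> \<le> M"
    and N: "finite X" "card X \<le> N" "ball x0 ((b + 1) * T) \<subseteq> (\<Union>c\<in>X. ball c ((a / 8) * T))"
  shows "\<bar>piece (tag j x0) \<beta> x0 - piece (tag j' x0) \<beta> x0\<bar> \<le> (2 + 2 * real N * real CARD('n) * (real CARD('n) * (b + 2)) ^ k) * M * T ^ (k - mi_order \<beta>)"
    (is "_ \<le> (2 + ?C) * M * _")
proof (cases "tag j x0 = tag j' x0")
  case True
  then show ?thesis using M0 T b by simp
next
  case False
  have aT: "a * T \<le> T" "0 < a * T" using a T by (auto simp: mult_left_le_one_le)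
  have C0: "0 \<le> ?C" using b by simp
  have none: "a * T < d (base i x0)" "T - T / 4 \<le> d x0" if "i \<in> near x0" "tag i x0 = None" for i
  proof -
    have "T < d (base i x0)" using gates base_near(1)[OF x0 that(1)] that(2) by (simp add: gate_system_def)
    then show "a * T < d (base i x0)" "T - T / 4 \<le> d x0"
      using aT base_near(2)[OF x0 that(1)] d_lipschitz[of "base i x0" x0] by linarith+
  qed
  show ?thesis
  proof (cases "mi_order \<beta> = k")
    case eq: True
    have "\<bar>piece (tag i x0) \<beta> x0\<bar> \<le> M" if i: "i \<in> near x0" for i
    proof (cases "tag i x0")
      case None
      have "\<bar>U \<beta> x0\<bar> \<le> M" using M[OF eq x0] none(2)[OF i None] aT b T by simp
      then show ?thesis using None by (simp add: piece_def)
    next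
      case (Some m)
      then show ?thesis using eq M0 by (simp add: piece_def taylor_def)
    qed
    from this[OF j(1)] this[OF j(2)] have "\<bar>piece (tag j x0) \<beta> x0 - piece (tag j' x0) \<beta> x0\<bar> \<le> 2 * M" by linarith
    also have "\<dots> \<le> (2 + ?C) * M" using C0 M0 by (intro mult_right_mono) auto
    finally show ?thesis using eq by simp
  next
    case neq: False
    define l where "l = k - mi_order \<beta> - 1"
    have l: "k - mi_order \<beta> = Suc l" "mi_order \<beta> + Suc l = k" using neq \<beta> by (auto simp: l_def)
    define pt where "pt q = (case q of None \<Rightarrow> x0 | Some m \<Rightarrow> m)" for q
    have piece_pt: "piece q \<beta> x0 = taylor U (Suc l) (pt q) \<beta> x0" for q
      using l(1) taylor_at_base[of "Suc l" U x0 \<beta>] by (cases q) (auto simp: piece_def pt_def)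
    have cc: "x0 \<in> cube j" "x0 \<in> cube j'" using j by (auto simp: near_def)
    note Cj = chamber_props[OF x0 cc(1)] and Cj' = chamber_props[OF x0 cc(2)]
    let ?S = "chamber j x0 \<union> chamber j' x0"
    have diam: "dist x0 u \<le> T / 4" if "u \<in> ?S" for u
      using that cube_diameter[of x0 j u] cube_diameter[of x0 j' u] Cj(5) Cj'(5) cc by blast
    have "connected ?S" using Cj(1,3) Cj'(1,3) by (intro connected_Un) auto
    moreover have "dist u v \<le> T / 2" if "u \<in> ?S" "v \<in> ?S" for u v
      using diam[OF that(1)] diam[OF that(2)] dist_triangle[of u v x0] by (simp add: dist_commute)
    moreover have "?S \<subseteq> \<Omega>" using Cj(4) Cj'(4) by auto
    ultimately have "connected_component {z \<in> \<Omega>. a * T < d z \<and> dist (base j x0) z < b * T} (gate_of Z (base j x0)) (gate_of Z (base j' x0))"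
      using gates Cj(6) Cj'(6) False unfolding gate_system_def by blast
    then obtain A0 where A0: "connected A0" "A0 \<subseteq> {z \<in> \<Omega>. a * T < d z \<and> dist (base j x0) z < b * T}"
      "gate_of Z (base j x0) \<in> A0" "gate_of Z (base j' x0) \<in> A0" unfolding connected_component_def by blast
    \<comment> \<open>If a chamber has no gate, the gate system links its base point; the segment leads on to \<open>x0\<close>.\<close>
    define seg where "seg i = closed_segment (gate_of Z (base i x0)) (pt (tag i x0))" for i
    have seg_some: "seg i = {gate_of Z (base i x0)}" if "tag i x0 = Some m" for i m
      using that by (simp add: seg_def gate_of_def pt_def)
    have seg_none: "dist (base i x0) y \<le> T / 4" "dist x0 y \<le> T / 4" if "i \<in> near x0" "tag i x0 = None" "y \<in> seg i" for i y
    proof -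
      have "y \<in> closed_segment (base i x0) x0" using that(2,3) by (simp add: seg_def gate_of_def pt_def)
      from dist_in_closed_segment[OF this] base_near(2)[OF x0 that(1)]
      show "dist (base i x0) y \<le> T / 4" "dist x0 y \<le> T / 4" by (auto simp: dist_commute)
    qed
    define A where "A = A0 \<union> (seg j \<union> seg j')"
    have conA: "connected A"
    proof -
      have "connected (A0 \<union> seg j)" using A0 by (intro connected_Un) (auto simp: seg_def)
      then have "connected ((A0 \<union> seg j) \<union> seg j')" using A0 by (intro connected_Un) (auto simp: seg_def)
      then show ?thesis by (simp add: A_def Un_assoc)
    qed
    have inA: "pt (tag j x0) \<in> A" "pt (tag j' x0) \<in> A" by (auto simp: A_def seg_def)
    have A: "y \<in> \<Omega> \<and> a * T / 2 < d y \<and> dist x0 y < (b + 1) * T" if y: "y \<in> A" for y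
    proof -
      have A0case: "y \<in> \<Omega> \<and> a * T / 2 < d y \<and> dist x0 y < (b + 1) * T" if "y \<in> A0" for y
      proof -
        have "y \<in> \<Omega>" "a * T < d y" "dist (base j x0) y < b * T" using A0(2) that by auto
        moreover have "dist x0 y \<le> dist (base j x0) x0 + dist (base j x0) y" by (metis dist_commute dist_triangle)
        ultimately show ?thesis using base_near(2)[OF x0 j(1)] aT T by (simp add: algebra_simps)
      qed
      have segcase: "y \<in> \<Omega> \<and> a * T / 2 < d y \<and> dist x0 y < (b + 1) * T"
        if i: "i \<in> near x0" "gate_of Z (base i x0) \<in> A0" "y \<in> seg i" for i
      proof (cases "tag i x0")
        case None
        have "T < d (base i x0)" using gates base_near(1)[OF x0 i(1)] None by (simp add: gate_system_def)
        then have "dist (base i x0) y < d (base i x0)" "a * T / 2 < d y"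
          using seg_none(1)[OF i(1) None i(3)] d_lipschitz[of "base i x0" y] aT T by linarith+
        moreover from this have "y \<in> \<Omega>" using lm_ball(1)[OF base_near(1)[OF x0 i(1)]] by blast
        moreover have "0 < b * T" using b T by simp
        then have "dist x0 y < (b + 1) * T" using seg_none(2)[OF i(1) None i(3)] T unfolding distrib_right by linarith
        ultimately show ?thesis by simp
      next
        case (Some m)
        then show ?thesis using A0case seg_some[OF Some] i by auto
      qed
      show ?thesis using y A0case segcase[OF j(1) A0(3)] segcase[OF j(2) A0(4)] unfolding A_def by blast
    qed
    define h where "h = a * T / 4"
    have h: "h > 0" "h / 2 = (a / 8) * T" using aT by (auto simp: h_def)
    have ball_h: "w \<in> \<Omega> \<and> a * T / 4 < d w \<and> dist x0 w < (b + 2) * T" if "y \<in> A" "w \<in> ball y h" for y w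
    proof -
      have w: "dist y w < a * T / 4" using that(2) by (simp add: h_def)
      have y: "y \<in> \<Omega>" "a * T / 2 < d y" "dist x0 y < (b + 1) * T" using A[OF that(1)] by auto
      have "w \<in> \<Omega>" by (rule lm_ball(1)[OF y(1)]) (use w y aT in linarith)
      moreover have "a * T / 4 < d w" using d_lipschitz[of y w] w y(2) by linarith
      moreover have "dist x0 w < (b + 2) * T"
        using dist_triangle[of x0 w y] w y(3) aT T unfolding distrib_right by linarith
      ultimately show ?thesis by simp
    qed
    have cov: "A \<subseteq> (\<Union>c\<in>X. ball c (h / 2))" unfolding h(2)
    proof
      fix y assume "y \<in> A"
      then have "y \<in> ball x0 ((b + 1) * T)" using A by simp
      then show "y \<in> (\<Union>c\<in>X. ball c ((a / 8) * T))" using N(3) by blast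
    qed
    let ?D = "(b + 2) * T"
    have "\<bar>taylor U (Suc l) (pt (tag j x0)) \<beta> x0 - taylor U (Suc l) (pt (tag j' x0)) \<beta> x0\<bar> \<le>
        real (card X) * (2 * (real CARD('n) * ((real CARD('n) * ?D) ^ l * M) * h))"
    proof (rule taylor_variation[OF U_family conA inA N(1) cov h(1) _ _ M0])
      fix y w and \<gamma> :: "'n \<Rightarrow> nat" assume yw: "y \<in> A" "w \<in> ball y h"
      show "\<bar>U \<gamma> w\<bar> \<le> M" if "mi_order \<gamma> = mi_order \<beta> + Suc l"
        using M[of \<gamma> w] ball_h[OF yw] that l(2) by simp
      show "dist x0 w \<le> ?D" using ball_h[OF yw] by simp
    qed
    also have "\<dots> \<le> real N * (2 * (real CARD('n) * ((real CARD('n) * (b + 2)) ^ k * T ^ l * M) * T))"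
    proof -
      have "(real CARD('n) * ?D) ^ l = (real CARD('n) * (b + 2)) ^ l * T ^ l" by (simp add: power_mult_distrib mult_ac)
      also have "\<dots> \<le> (real CARD('n) * (b + 2)) ^ k * T ^ l"
      proof (rule mult_right_mono[OF power_increasing])
        show "l \<le> k" using l(2) by simp
        have "1 * 1 \<le> real CARD('n) * (b + 2)" using b card_ge_1 by (intro mult_mono) auto
        then show "1 \<le> real CARD('n) * (b + 2)" by simp
      qed (use T in simp)
      finally have e: "(real CARD('n) * ?D) ^ l \<le> (real CARD('n) * (b + 2)) ^ k * T ^ l" .
      have hT: "h \<le> T" using aT T by (simp add: h_def)
      show ?thesis
        using N(2) e hT h(1) M0 b T by (intro mult_mono mult_left_mono mult_right_mono) auto
    qed
    also have "\<dots> = ?C * M * T ^ Suc l" by (simp add: mult_ac)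
    also have "\<dots> \<le> (2 + ?C) * M * T ^ Suc l" using M0 T by (intro mult_right_mono) auto
    finally show ?thesis unfolding piece_pt l(1) .
  qed
qed

text \<open>Each derivative of a cutoff costs a factor comparable to \<open>1 / T\<close>, which the corresponding power of
  \<open>T\<close> in \<open>piece_difference\<close> compensates.\<close>

lemma pd_patched_bound:
  assumes x0: "x0 \<in> \<Omega>" and xs: "length xs = k" and M0: "0 \<le> M"
    and M: "\<And>\<gamma> w. mi_order \<gamma> = k \<Longrightarrow> w \<in> \<Omega> \<Longrightarrow> a * T / 4 < d w \<Longrightarrow> dist x0 w < (b + 2) * T \<Longrightarrow> \<bar>U \<gamma> w\<bar> \<le> M"
    and N: "finite X" "card X \<le> N" "ball x0 ((b + 1) * T) \<subseteq> (\<Union>c\<in>X. ball c ((a / 8) * T))"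
    and B: "0 \<le> B" "\<And>\<beta> z. mi_order (\<beta> :: 'n \<Rightarrow> nat) \<le> k \<Longrightarrow> \<bar>tensor_bump \<beta> z\<bar> \<le> B"
  shows "\<bar>pd_list xs patched x0\<bar> \<le>
    (1 + 6 ^ CARD('n) * (2 ^ k * (B * (2 + 2 * real N * real CARD('n) * (real CARD('n) * (b + 2)) ^ k)) * (16 * real CARD('n)) ^ k)) * M"
proof -
  let ?C = "2 + 2 * real N * real CARD('n) * (real CARD('n) * (b + 2)) ^ k"
  have C0: "0 \<le> ?C" using b by simp
  obtain j0 where j0: "j0 \<in> near x0" using near_nonempty[OF x0] by blast
  let ?q = "tag j0 x0"
  have first: "\<bar>piece ?q (count_list xs) x0\<bar> \<le> M"
  proof (cases ?q)
    case None
    have "T < d (base j0 x0)" using gates base_near(1)[OF x0 j0] None by (simp add: gate_system_def)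
    then have "T - T / 4 \<le> d x0" using base_near(2)[OF x0 j0] d_lipschitz[of "base j0 x0" x0] by linarith
    moreover have "a * T \<le> T" using a T by (simp add: mult_left_le_one_le)
    ultimately have "a * T / 4 < d x0" using T by linarith
    moreover have "dist x0 x0 < (b + 2) * T" using b T by simp
    ultimately show ?thesis using M[of "count_list xs" x0] x0 None xs by (simp add: piece_def mi_order_count_list)
  next
    case (Some m)
    then show ?thesis using M0 xs by (simp add: piece_def taylor_def mi_order_count_list)
  qed
  have summand: "\<bar>pd_list xs (\<lambda>x. cutoff j (\<lambda>_. 0) x * (piece (tag j x0) (\<lambda>_. 0) x - piece ?q (\<lambda>_. 0) x)) x0\<bar>
      \<le> 2 ^ k * (B * ?C) * (16 * real CARD('n)) ^ k * M" if j: "j \<in> near x0" for j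
  proof -
    have "\<bar>pd_list xs (\<lambda>x. cutoff j (\<lambda>_. 0) x * (piece (tag j x0) (\<lambda>_. 0) x - piece ?q (\<lambda>_. 0) x)) x0\<bar>
        \<le> 2 ^ length xs * (B * (?C * M * T ^ k)) * (1 / side) ^ length xs"
    proof (rule pd_list_mult_bound[OF open_dom x0 B(1) _ _ smooth_pieces(2) smooth_diff[OF open_dom smooth_pieces(1) smooth_pieces(1)]])
      show "0 \<le> ?C * M * T ^ k" using C0 M0 T by simp
      show "0 \<le> 1 / side" using side_pos by simp
      fix js :: "'n list" assume "length js \<le> length xs"
      then have js: "mi_order (count_list js) \<le> k" using xs by (simp add: mi_order_count_list)
      show "\<bar>pd_list js (cutoff j (\<lambda>_. 0)) x0\<bar> \<le> B * (1 / side) ^ length js"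
        unfolding deriv_family_pd_list[OF cutoff_family] using B(2)[OF js] side_pos
        by (simp add: cutoff_def abs_mult mi_order_count_list mult.commute mult_left_mono divide_right_mono)
      have "pd_list js (\<lambda>x. piece (tag j x0) (\<lambda>_. 0) x - piece ?q (\<lambda>_. 0) x) x0 =
          piece (tag j x0) (count_list js) x0 - piece ?q (count_list js) x0"
        using pd_list_diff[OF open_dom smooth_pieces(1) smooth_pieces(1) x0, of js "tag j x0" "\<lambda>_. 0" ?q "\<lambda>_. 0"]
        unfolding deriv_family_pd_list[OF piece_family] by simp
      also have "\<bar>\<dots>\<bar> \<le> ?C * M * T ^ (k - mi_order (count_list js))"
        by (rule piece_difference[OF x0 j j0 js M0 M N])
      also have "T ^ (k - mi_order (count_list js)) = T ^ k * (1 / T) ^ length js"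
        using T js by (simp add: mi_order_count_list power_diff power_one_over)
      also have "?C * M * (T ^ k * (1 / T) ^ length js) \<le> ?C * M * (T ^ k * (1 / side) ^ length js)"
        using C0 M0 T side_pos side_le by (intro mult_left_mono power_mono divide_left_mono) auto
      finally show "\<bar>pd_list js (\<lambda>x. piece (tag j x0) (\<lambda>_. 0) x - piece ?q (\<lambda>_. 0) x) x0\<bar> \<le> ?C * M * T ^ k * (1 / side) ^ length js"
        by (simp only: mult.assoc)
    qed
    also have "\<dots> = 2 ^ k * (B * ?C) * (T * (1 / side)) ^ k * M" unfolding xs power_mult_distrib by (simp only: mult_ac)
    also have "T * (1 / side) = 16 * real CARD('n)" using T by (simp add: side_def)
    finally show ?thesis .
  qed
  have "\<bar>pd_list xs patched x0\<bar> \<le> \<bar>piece ?q (count_list xs) x0\<bar> +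
      \<bar>\<Sum>j\<in>near x0. pd_list xs (\<lambda>x. cutoff j (\<lambda>_. 0) x * (piece (tag j x0) (\<lambda>_. 0) x - piece ?q (\<lambda>_. 0) x)) x0\<bar>"
    unfolding pd_patched[OF x0, of xs ?q] by (rule abs_triangle_ineq)
  also have "\<dots> \<le> M + (\<Sum>j\<in>near x0. 2 ^ k * (B * ?C) * (16 * real CARD('n)) ^ k * M)"
    using first summand by (intro add_mono order_trans[OF sum_abs sum_mono]) auto
  also have "(\<Sum>j\<in>near x0. 2 ^ k * (B * ?C) * (16 * real CARD('n)) ^ k * M) = real (card (near x0)) * (2 ^ k * (B * ?C) * (16 * real CARD('n)) ^ k * M)" by simp
  also have "M + \<dots> \<le> M + 6 ^ CARD('n) * (2 ^ k * (B * ?C) * (16 * real CARD('n)) ^ k * M)"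
  proof (rule add_left_mono, rule mult_right_mono)
    have "real (card (near x0)) \<le> real (6 ^ CARD('n))" using card_near of_nat_le_iff by blast
    then show "real (card (near x0)) \<le> 6 ^ CARD('n)" by simp
    show "0 \<le> 2 ^ k * (B * ?C) * (16 * real CARD('n)) ^ k * M" using B(1) C0 M0 by simp
  qed
  also have "\<dots> = (1 + 6 ^ CARD('n) * (2 ^ k * (B * ?C) * (16 * real CARD('n)) ^ k)) * M" by (simp only: distrib_right mult_1 mult.assoc)
  finally show ?thesis .
qed

end

section \<open>Density\<close>

lemma nn_integral_lebesgue_on:
  fixes h h' :: "real^'n \<Rightarrow> real"
  assumes \<Omega>: "open \<Omega>" and ae: "AE y in lebesgue. y \<in> \<Omega> \<longrightarrow> h' y = h y"
  shows "(\<integral>\<^sup>+x. ennreal (\<bar>h x\<bar> powr q) \<partial>lebesgue_on \<Omega>) = (\<integral>\<^sup>+x\<in>\<Omega>. ennreal (\<bar>h' x\<bar> powr q) \<partial>lborel)"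
proof -
  have "(\<integral>\<^sup>+x. ennreal (\<bar>h x\<bar> powr q) \<partial>lebesgue_on \<Omega>) = (\<integral>\<^sup>+x\<in>\<Omega>. ennreal (\<bar>h x\<bar> powr q) \<partial>lebesgue)"
    using \<Omega> by (intro nn_integral_restrict_space) auto
  also have "\<dots> = (\<integral>\<^sup>+x\<in>\<Omega>. ennreal (\<bar>h' x\<bar> powr q) \<partial>lebesgue)"
    by (rule nn_integral_cong_AE) (use ae in \<open>eventually_elim, auto simp: indicator_def\<close>)
  finally show ?thesis by (simp only: nn_integral_completion)
qed

lemma Lp_norm_less:
  assumes p: "1 \<le> p" "p < \<infinity>" and e: "0 < e"
    and I: "(\<integral>\<^sup>+x. ennreal (\<bar>f x\<bar> powr enn2real p) \<partial>lebesgue_on \<Omega>) < ennreal (e powr enn2real p)"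
  shows "Lp_norm p \<Omega> f < ennreal e"
proof -
  define J where "J = (\<integral>\<^sup>+x. ennreal (\<bar>f x\<bar> powr enn2real p) \<partial>lebesgue_on \<Omega>)"
  have q: "0 < enn2real p" using p by (simp add: enn2real_positive_iff order.strict_trans2[of 0 1 p])
  have J: "J < \<infinity>" using I unfolding J_def by (rule order.strict_trans) simp
  have "enn2real J < e powr enn2real p"
    using I J unfolding J_def[symmetric] by (metis enn2real_less_iff infinity_ennreal_def powr_ge_zero ennreal_enn2real_if ennreal_less_iff enn2real_nonneg less_irrefl)
  then have "enn2real J powr (1 / enn2real p) < (e powr enn2real p) powr (1 / enn2real p)"
    using q by (intro powr_less_mono2) auto
  also have "\<dots> = e" using q e by (simp add: powr_powr)
  finally show ?thesis using J p e unfolding Lp_norm_def J_def[symmetric] by (auto simp: Let_def ennreal_lessI)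
qed

lemma AE_borel_version:
  fixes h :: "real^'n \<Rightarrow> real"
  assumes "h \<in> borel_measurable lebesgue"
  obtains h' where "h' \<in> borel_measurable borel" "AE y in lebesgue. h y = h' y"
proof -
  obtain h' where "h' \<in> borel_measurable lborel" "AE y in lborel. h y = h' y"
    using completion_ex_borel_measurable_real[OF assms] by blast
  then show ?thesis using that[of h'] AE_completion[of "\<lambda>y. h y = h' y" lborel] by simp
qed

lemma integrable_borel_version:
  fixes u :: "real^'n \<Rightarrow> real"
  assumes "u \<in> L1_loc \<Omega>" "compact K" "K \<subseteq> \<Omega>"
  obtains f where "f \<in> borel_measurable borel" "integrable lborel f" "AE y in lebesgue. y \<in> K \<longrightarrow> f y = u y"
proof -
  define h where "h = (\<lambda>y. indicator K y *\<^sub>R u y)"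
  have "u absolutely_integrable_on K" using assms unfolding L1_loc_def by blast
  then have h: "integrable lebesgue h" unfolding set_integrable_def h_def .
  then obtain f where f: "f \<in> borel_measurable borel" "AE y in lebesgue. h y = f y"
    using AE_borel_version[OF borel_measurable_integrable] by blast
  have "integrable lebesgue f"
    using h f by (subst integrable_cong_AE[symmetric, of h]) (auto intro: borel_measurable_integrable borel_imp_lebesgue_measurable)
  then have "integrable lborel f" using f(1) by (subst (asm) integrable_completion) auto
  moreover have "AE y in lebesgue. y \<in> K \<longrightarrow> f y = u y"
    using f(2) by eventually_elim (auto simp: h_def)
  ultimately show ?thesis using that f(1) by blast
qed

definition average_kernel :: "real \<Rightarrow> real^'n \<Rightarrow> real" where
  "average_kernel r z = indicator (ball 0 r) z / measure lborel (ball (0::real^'n) r)"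

lemma average_kernel_nonneg: "0 \<le> average_kernel r z"
  by (simp add: average_kernel_def)

lemma average_kernel_measurable [measurable]: "average_kernel r \<in> borel_measurable borel"
  unfolding average_kernel_def[abs_def] by (intro borel_measurable_divide borel_measurable_indicator borel_measurable_const) simp

lemma average_kernel_mass: "(\<integral>\<^sup>+z. ennreal (average_kernel r (z :: real^'n)) \<partial>lborel) \<le> 1"
proof -
  define V where "V = measure lborel (ball (0::real^'n) r)"
  have "(\<integral>\<^sup>+z. ennreal (average_kernel r (z :: real^'n)) \<partial>lborel) = (\<integral>\<^sup>+z. ennreal (1 / V) * indicator (ball 0 r) (z :: real^'n) \<partial>lborel)"
    unfolding average_kernel_def V_def by (intro nn_integral_cong) (auto simp: indicator_def)
  also have "\<dots> = ennreal (1 / V) * emeasure lborel (ball (0::real^'n) r)"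
    by (rule nn_integral_cmult_indicator) simp
  also have "\<dots> = ennreal (1 / V) * ennreal V"
    unfolding V_def using emeasure_lborel_ball_finite by (subst emeasure_eq_ennreal_measure) (auto simp: less_top)
  also have "\<dots> \<le> 1" by (cases "V = 0") (simp_all add: ennreal_mult[symmetric] V_def)
  finally show ?thesis .
qed

lemma integrable_times_average_kernel:
  fixes G :: "real^'n \<Rightarrow> real"
  assumes G: "integrable lborel G" shows "integrable lborel (\<lambda>y. G y * average_kernel r (x - y))"
proof (rule integrable_times_bounded(1)[OF G, where M = "1 / measure lborel (ball (0::real^'n) r)"])
  show "\<bar>average_kernel r (x - y)\<bar> \<le> 1 / measure lborel (ball (0::real^'n) r)" for y
    by (auto simp: average_kernel_def indicator_def)
qed measurable

context bounded_domain
begin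

text \<open>As the domain is bounded, a function in \<open>L\<^sup>p\<close> is integrable.\<close>

lemma Lp_borel_version:
  assumes p: "1 \<le> p" "p < \<infinity>" and g: "g \<in> Lp_space p \<Omega>"
  obtains g' where "g' \<in> borel_measurable borel" "\<And>y. y \<notin> \<Omega> \<Longrightarrow> g' y = 0"
    "AE y in lebesgue. y \<in> \<Omega> \<longrightarrow> g' y = g y" "(\<integral>\<^sup>+x. ennreal (\<bar>g' x\<bar> powr enn2real p) \<partial>lborel) < \<infinity>"
    "integrable lborel g'"
proof -
  define q where "q = enn2real p"
  have q: "1 \<le> q" using p enn2real_mono[of 1 p] by (simp add: q_def)
  have gm: "g \<in> borel_measurable (lebesgue_on \<Omega>)" "Lp_norm p \<Omega> g < \<infinity>" using g by (auto simp: Lp_space_def)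
  have "(\<lambda>y. if y \<in> \<Omega> then g y else 0) \<in> borel_measurable lebesgue"
    using gm(1) open_dom by (subst borel_measurable_if) auto
  then obtain h where h: "h \<in> borel_measurable borel" "AE y in lebesgue. (if y \<in> \<Omega> then g y else 0) = h y"
    using AE_borel_version by blast
  define g' where "g' y = h y * indicator \<Omega> y" for y
  have [measurable]: "\<Omega> \<in> sets borel" using open_dom by simp
  have [measurable]: "g' \<in> borel_measurable borel" using h(1) unfolding g'_def by measurable
  have ae: "AE y in lebesgue. y \<in> \<Omega> \<longrightarrow> g' y = g y"
    using h(2) by eventually_elim (auto simp: g'_def)
  have off: "g' y = 0" if "y \<notin> \<Omega>" for y using that by (simp add: g'_def)
  have "(\<integral>\<^sup>+x. ennreal (\<bar>g' x\<bar> powr q) \<partial>lborel) = (\<integral>\<^sup>+x\<in>\<Omega>. ennreal (\<bar>g' x\<bar> powr q) \<partial>lborel)"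
    by (intro nn_integral_cong) (auto simp: indicator_def off)
  also have "\<dots> = (\<integral>\<^sup>+x. ennreal (\<bar>g x\<bar> powr q) \<partial>lebesgue_on \<Omega>)"
    by (rule nn_integral_lebesgue_on[OF open_dom ae, symmetric])
  also have "\<dots> < \<infinity>"
    using gm(2) p unfolding Lp_norm_def q_def[symmetric] by (auto simp: Let_def less_top split: if_splits)
  finally have fin: "(\<integral>\<^sup>+x. ennreal (\<bar>g' x\<bar> powr q) \<partial>lborel) < \<infinity>" .
  have "integrable lborel g'"
  proof (rule integrableI_bounded)
    have "(\<integral>\<^sup>+x. ennreal (norm (g' x)) \<partial>lborel) \<le> (\<integral>\<^sup>+x. indicator \<Omega> x + ennreal (\<bar>g' x\<bar> powr q) \<partial>lborel)"
    proof (rule nn_integral_mono)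
      fix x
      show "ennreal (norm (g' x)) \<le> indicator \<Omega> x + ennreal (\<bar>g' x\<bar> powr q)"
      proof (cases "x \<in> \<Omega>")
        case True
        have "\<bar>g' x\<bar> \<le> 1 + \<bar>g' x\<bar> powr q"
        proof (cases "\<bar>g' x\<bar> \<le> 1")
          case False
          then have "\<bar>g' x\<bar> powr 1 \<le> \<bar>g' x\<bar> powr q" using q by (intro powr_mono) auto
          then show ?thesis using False by simp
        qed (simp add: add_increasing2)
        then have "ennreal \<bar>g' x\<bar> \<le> ennreal (1 + \<bar>g' x\<bar> powr q)" by (rule ennreal_leI)
        then show ?thesis using True by simp
      qed (simp add: off)
    qed
    also have "\<dots> = emeasure lborel \<Omega> + (\<integral>\<^sup>+x. ennreal (\<bar>g' x\<bar> powr q) \<partial>lborel)"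
      by (subst nn_integral_add) auto
    also have "\<dots> < \<infinity>" using fin emeasure_bounded_finite[OF bdd] by (simp add: less_top)
    finally show "(\<integral>\<^sup>+x. ennreal (norm (g' x)) \<partial>lborel) < \<infinity>" .
  qed simp
  then show ?thesis using that[of g'] off ae fin unfolding q_def by auto
qed

text \<open>The strips near the boundary decrease to a set on which \<open>G\<close> vanishes.\<close>

lemma small_power_integral_near_boundary:
  assumes [measurable]: "G \<in> borel_measurable borel" and off: "\<And>y. y \<notin> \<Omega> \<Longrightarrow> G y = 0"
    and fin: "(\<integral>\<^sup>+x. ennreal (\<bar>G x\<bar> powr q) \<partial>lborel) < \<infinity>" and e: "0 < e"
  shows "\<exists>s>0. (\<integral>\<^sup>+x\<in>{x. d x < s}. ennreal (\<bar>G x\<bar> powr q) \<partial>lborel) < ennreal e"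
proof -
  have [measurable]: "d \<in> borel_measurable borel" by (rule borel_measurable_continuous_onI[OF d_continuous])
  let ?f = "\<lambda>n x. ennreal (\<bar>G x\<bar> powr q) * indicator {x. d x < 1 / real (Suc n)} x"
  have "(\<lambda>n. \<integral>\<^sup>+x. ?f n x \<partial>lborel) \<longlonglongrightarrow> (\<integral>\<^sup>+x. 0 \<partial>(lborel :: (real^'n) measure))"
  proof (rule nn_integral_dominated_convergence[where w = "\<lambda>x. ennreal (\<bar>G x\<bar> powr q)"])
    show "AE x in lborel. (\<lambda>n. ?f n x) \<longlonglongrightarrow> 0"
    proof (rule AE_I2)
      fix x
      show "(\<lambda>n. ?f n x) \<longlonglongrightarrow> 0"
      proof (cases "x \<in> \<Omega>")
        case True
        then obtain n0 where n0: "1 / real (Suc n0) < d x" using d_pos[OF True] nat_approx_posE by blast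
        have "eventually (\<lambda>n. ?f n x = 0) sequentially"
        proof (rule eventually_sequentiallyI)
          fix n assume "n0 \<le> n"
          then have "1 / real (Suc n) \<le> 1 / real (Suc n0)" by (simp add: frac_le)
          then show "?f n x = 0" using n0 by (simp add: indicator_def)
        qed
        then show ?thesis by (rule tendsto_eventually)
      qed (simp add: off)
    qed
    show "AE x in lborel. ?f n x \<le> ennreal (\<bar>G x\<bar> powr q)" for n
      by (rule AE_I2) (simp add: indicator_def)
  qed (use fin in auto)
  then have "eventually (\<lambda>n. (\<integral>\<^sup>+x. ?f n x \<partial>lborel) < ennreal e) sequentially"
    using e by (intro order_tendstoD(2)) auto
  then obtain n where "(\<integral>\<^sup>+x. ?f n x \<partial>lborel) < ennreal e" by (auto simp: eventually_sequentially)
  then show ?thesis by (intro exI[of _ "1 / real (Suc n)"]) simp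
qed

end

text \<open>The factor between the derivatives of the patched function and an average of the weak derivatives.
  It does not involve the scale.\<close>

definition patch_constant :: "'n::finite itself \<Rightarrow> real \<Rightarrow> real \<Rightarrow> nat \<Rightarrow> nat \<Rightarrow> real \<Rightarrow> real" where
  "patch_constant _ a b k N B =
    (1 + 6 ^ CARD('n) * (2 ^ k * (B * (2 + 2 * real N * real CARD('n) * (real CARD('n) * (b + 2)) ^ k)) * (16 * real CARD('n)) ^ k)) *
    (B * measure lborel (ball (0::real^'n) 1) * (8 * real CARD('n) * (b + 3) / a) ^ CARD('n) / bump_mass TYPE('n))"

lemma mollifier_le:
  fixes z :: "real^'n"
  assumes \<rho>: "0 < \<rho>" and B: "\<And>z::real^'n. \<bar>tensor_bump (\<lambda>_. 0) z\<bar> \<le> B"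
  shows "\<bar>mollifier \<rho> z\<bar> \<le> B / (bump_mass TYPE('n) * \<rho> ^ CARD('n))"
proof -
  have "0 < bump_mass TYPE('n) * \<rho> ^ CARD('n)" using \<rho> bump_mass_pos[where 'n = 'n] by simp
  then show ?thesis unfolding mollifier_def abs_divide by (intro frac_le) (use B in \<open>auto intro: order_trans[OF abs_ge_zero]\<close>)
qed

context patching
begin

text \<open>The mollifier is bounded by a multiple of the averaging kernel of a larger ball. Both radii are
  proportional to \<open>T\<close>, which therefore cancels in the factor.\<close>

lemma mollified_le_average:
  fixes g G :: "real^'n \<Rightarrow> real"
  assumes B: "\<And>z::real^'n. \<bar>tensor_bump (\<lambda>_. 0) z\<bar> \<le> B"
    and G: "integrable lborel G" "\<And>y. \<bar>g y\<bar> \<le> G y" and w: "dist x w < (b + 2) * T"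
  shows "\<bar>\<integral>y. g y * mollifier moll_radius (w - y) \<partial>lborel\<bar> \<le>
    (B * measure lborel (ball (0::real^'n) 1) * (8 * real CARD('n) * (b + 3) / a) ^ CARD('n) / bump_mass TYPE('n)) *
    (\<integral>y. G y * average_kernel ((b + 3) * T) (x - y) \<partial>lborel)"
    (is "_ \<le> ?Q * _")
proof -
  let ?r = "(b + 3) * T"
  let ?V = "measure lborel (ball (0::real^'n) 1)"
  let ?n = "CARD('n)"
  have r: "0 < ?r" using b T by simp
  have V: "0 < ?V" using content_ball_pos[of 1 "0::real^'n"] by simp
  have Vr: "measure lborel (ball (0::real^'n) ?r) = ?r ^ ?n * ?V"
    using content_ball_conv_unit_ball[of ?r "0::real^'n"] r by simp
  have quot: "8 * real ?n * (b + 3) / a = ?r / moll_radius"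
    using T a by (simp add: moll_radius_def field_simps)
  have "?Q / (?r ^ ?n * ?V) = B / (bump_mass TYPE('n) * moll_radius ^ ?n)"
    unfolding quot using V r moll_radius_pos bump_mass_pos[where 'n = 'n] by (simp add: power_divide field_simps)
  then have Q: "?Q / measure lborel (ball (0::real^'n) ?r) = B / (bump_mass TYPE('n) * moll_radius ^ ?n)"
    unfolding Vr .
  have G0: "0 \<le> G y" for y using G(2)[of y] by linarith
  have le: "\<bar>g y * mollifier moll_radius (w - y)\<bar> \<le> ?Q * (G y * average_kernel ?r (x - y))" for y
  proof (cases "mollifier moll_radius (w - y) = 0")
    case True
    have "0 \<le> B" using B[of 0] by linarith
    then show ?thesis using True G0[of y] a b bump_mass_pos[where 'n = 'n] average_kernel_nonneg[of ?r "x - y"] by simp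
  next
    case False
    have "norm (w - y) \<le> a * T / 8"
      using mollifier_support[OF moll_radius_pos False] moll_support by simp
    also have "\<dots> \<le> T" using a T mult_right_mono[of a 1 T] by simp
    finally have "dist x y < ?r"
      using w dist_triangle[of x y w] by (simp add: dist_norm algebra_simps)
    then have k: "?Q * average_kernel ?r (x - y) = ?Q / measure lborel (ball (0::real^'n) ?r)"
      by (simp add: average_kernel_def dist_norm indicator_def norm_minus_commute)
    have "\<bar>g y * mollifier moll_radius (w - y)\<bar> \<le> G y * (?Q * average_kernel ?r (x - y))"
      unfolding k Q abs_mult using mollifier_le[OF moll_radius_pos B] G(2) G0 by (intro mult_mono) auto
    then show ?thesis by (simp add: mult_ac)
  qed
  have int: "integrable lborel (\<lambda>y. ?Q * (G y * average_kernel ?r (x - y)))"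
    by (intro integrable_mult_right integrable_times_average_kernel G(1))
  have "\<bar>\<integral>y. g y * mollifier moll_radius (w - y) \<partial>lborel\<bar> \<le> (\<integral>y. ?Q * (G y * average_kernel ?r (x - y)) \<partial>lborel)"
    by (rule order_trans[OF integral_abs_bound integral_mono'[OF int le order_trans[OF abs_ge_zero le]]])
  then show ?thesis by simp
qed

lemma pd_patched_le_average:
  fixes g :: "('n \<Rightarrow> nat) \<Rightarrow> real^'n \<Rightarrow> real" and G :: "real^'n \<Rightarrow> real"
  assumes B: "\<And>\<beta> z. mi_order (\<beta> :: 'n \<Rightarrow> nat) \<le> k \<Longrightarrow> \<bar>tensor_bump \<beta> z\<bar> \<le> B"
    and N: "\<And>x::real^'n. \<exists>X. finite X \<and> card X \<le> N \<and> ball x ((b + 1) * T) \<subseteq> (\<Union>c\<in>X. ball c ((a / 8) * T))"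
    and rep: "\<And>\<gamma> w. mi_order \<gamma> = k \<Longrightarrow> w \<in> \<Omega> \<Longrightarrow> a * T / 4 < d w \<Longrightarrow> U \<gamma> w = (\<integral>y. g \<gamma> y * mollifier moll_radius (w - y) \<partial>lborel)"
    and G: "integrable lborel G" "\<And>\<gamma> y. mi_order \<gamma> = k \<Longrightarrow> \<bar>g \<gamma> y\<bar> \<le> G y" and G0: "\<And>y. 0 \<le> G y"
    and x: "x \<in> \<Omega>" and xs: "length xs = k"
  shows "\<bar>pd_list xs patched x\<bar> \<le> patch_constant TYPE('n) a b k N B * (\<integral>y. G y * average_kernel ((b + 3) * T) (x - y) \<partial>lborel)"
proof -
  define I where "I = (\<integral>y. G y * average_kernel ((b + 3) * T) (x - y) \<partial>lborel)"
  define Q where "Q = B * measure lborel (ball (0::real^'n) 1) * (8 * real CARD('n) * (b + 3) / a) ^ CARD('n) / bump_mass TYPE('n)"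
  obtain X where X: "finite X" "card X \<le> N" "ball x ((b + 1) * T) \<subseteq> (\<Union>c\<in>X. ball c ((a / 8) * T))"
    using N[of x] by (elim exE conjE)
  have B': "\<bar>tensor_bump (\<lambda>_. 0) (z::real^'n)\<bar> \<le> B" for z using B[of "\<lambda>_. 0"] by (simp add: mi_order_def)
  have B0: "0 \<le> B" using B'[of 0] by linarith
  have I0: "0 \<le> I" unfolding I_def by (intro integral_nonneg_AE AE_I2 mult_nonneg_nonneg G0 average_kernel_nonneg)
  have Q0: "0 \<le> Q" unfolding Q_def using B0 a b bump_mass_pos[where 'n = 'n] by simp
  have "\<bar>pd_list xs patched x\<bar> \<le>
    (1 + 6 ^ CARD('n) * (2 ^ k * (B * (2 + 2 * real N * real CARD('n) * (real CARD('n) * (b + 2)) ^ k)) * (16 * real CARD('n)) ^ k)) * (Q * I)"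
  proof (rule pd_patched_bound[OF x xs _ _ X B0 B])
    fix \<gamma> :: "'n \<Rightarrow> nat" and w
    assume \<gamma>: "mi_order \<gamma> = k" and w: "w \<in> \<Omega>" "a * T / 4 < d w" "dist x w < (b + 2) * T"
    show "\<bar>U \<gamma> w\<bar> \<le> Q * I"
      unfolding rep[OF \<gamma> w(1,2)] Q_def I_def by (rule mollified_le_average[OF B' G(1) G(2)[OF \<gamma>] w(3)])
  qed (use I0 Q0 in simp_all)
  then show ?thesis unfolding patch_constant_def I_def[symmetric] Q_def[symmetric] by (simp only: mult.assoc)
qed

end


lemma rev_mi_list: "count_list (rev (mi_list \<alpha>)) = \<alpha>" "length (rev (mi_list \<alpha>)) = mi_order \<alpha>"
  by (auto simp: fun_eq_iff count_mi_list[unfolded fun_eq_iff] length_mi_list)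

context bounded_domain
begin

text \<open>First \<open>s\<close> is chosen such that the strip \<open>d < 3 s\<close> contributes little, with a constant that is already
  known at this stage, and then the scale \<open>T\<close> such that the gates for \<open>s\<close> exist, averages over balls of
  radius \<open>(b + 3) T\<close> lead from the strip \<open>d < 2 s\<close> at most into the strip \<open>d < 3 s\<close>, and the mollification
  at a radius less than \<open>T\<close> is accurate.\<close>

lemma smooth_approximation:
  fixes g :: "('n \<Rightarrow> nat) \<Rightarrow> real^'n \<Rightarrow> real"
  assumes ab: "0 < a" "a \<le> 1" "0 < b"
    and gates: "\<And>s. 0 < s \<Longrightarrow> \<exists>T0>0. \<forall>T. 0 < T \<and> T < T0 \<longrightarrow> (\<exists>Z. gate_system a b s T Z)"
    and q: "1 \<le> q"
    and weak: "\<And>\<alpha>. mi_order \<alpha> = k \<Longrightarrow> has_weak_deriv \<Omega> \<alpha> u (g \<alpha>)"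
    and g': "\<And>\<alpha>. mi_order \<alpha> = k \<Longrightarrow> g' \<alpha> \<in> borel_measurable borel"
      "\<And>\<alpha> y. mi_order \<alpha> = k \<Longrightarrow> y \<notin> \<Omega> \<Longrightarrow> g' \<alpha> y = 0"
      "\<And>\<alpha>. mi_order \<alpha> = k \<Longrightarrow> AE y in lebesgue. y \<in> \<Omega> \<longrightarrow> g' \<alpha> y = g \<alpha> y"
      "\<And>\<alpha>. mi_order \<alpha> = k \<Longrightarrow> (\<integral>\<^sup>+x. ennreal (\<bar>g' \<alpha> x\<bar> powr q) \<partial>lborel) < \<infinity>"
      "\<And>\<alpha>. mi_order \<alpha> = k \<Longrightarrow> integrable lborel (g' \<alpha>)"
    and u: "u \<in> L1_loc \<Omega>" and e: "0 < e"
  shows "\<exists>v\<in>smooth_functions \<Omega>. (\<exists>B. \<forall>x\<in>\<Omega>. \<forall>xs. length xs \<le> k \<longrightarrow> \<bar>pd_list xs v x\<bar> \<le> B) \<and>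
    (\<forall>\<alpha>. mi_order \<alpha> = k \<longrightarrow> (\<integral>\<^sup>+x\<in>\<Omega>. ennreal (\<bar>g' \<alpha> x - pd_list (rev (mi_list \<alpha>)) v x\<bar> powr q) \<partial>lborel) < ennreal e)"
proof -
  let ?A = "{\<alpha>::'n \<Rightarrow> nat. mi_order \<alpha> = k}"
  have fin: "finite ?A" by (rule finite_subset[OF _ finite_mi_order_le[of k]]) auto
  have [measurable]: "d \<in> borel_measurable borel" by (rule borel_measurable_continuous_onI[OF d_continuous])
  have [measurable]: "\<Omega> \<in> sets borel" using open_dom by simp
  define G where "G y = (\<Sum>\<alpha>\<in>?A. \<bar>g' \<alpha> y\<bar>)" for y
  have G0: "0 \<le> G y" for y unfolding G_def by (intro sum_nonneg) simp
  have gG: "\<bar>g' \<alpha> y\<bar> \<le> G y" if "mi_order \<alpha> = k" for \<alpha> y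
    unfolding G_def using member_le_sum[of \<alpha> ?A "\<lambda>\<alpha>. \<bar>g' \<alpha> y\<bar>"] that fin by simp
  have Gint: "integrable lborel G" unfolding G_def by (intro Bochner_Integration.integrable_sum integrable_abs g'(5)) simp
  then have [measurable]: "G \<in> borel_measurable borel" by simp
  have Goff: "G y = 0" if "y \<notin> \<Omega>" for y using that g'(2) by (simp add: G_def)
  have Gfin: "(\<integral>\<^sup>+x. ennreal (\<bar>G x\<bar> powr q) \<partial>lborel) < \<infinity>"
  proof -
    have "(\<lambda>x. \<Sum>\<alpha>\<in>S. \<bar>g' \<alpha> x\<bar>) \<in> borel_measurable borel \<and> (\<integral>\<^sup>+x. ennreal (\<bar>\<Sum>\<alpha>\<in>S. \<bar>g' \<alpha> x\<bar>\<bar> powr q) \<partial>lborel) < \<infinity>" if "S \<subseteq> ?A" for S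
      using finite_subset[OF that fin] that
    proof (induction S rule: finite_induct)
      case (insert \<alpha> S)
      then have \<alpha>: "mi_order \<alpha> = k" and IH: "(\<lambda>x. \<Sum>\<alpha>\<in>S. \<bar>g' \<alpha> x\<bar>) \<in> borel_measurable borel"
        "(\<integral>\<^sup>+x. ennreal (\<bar>\<Sum>\<alpha>\<in>S. \<bar>g' \<alpha> x\<bar>\<bar> powr q) \<partial>lborel) < \<infinity>" by auto
      have [measurable]: "g' \<alpha> \<in> borel_measurable borel" using g'(1) \<alpha> by simp
      have "(\<integral>\<^sup>+x. ennreal (\<bar>\<bar>g' \<alpha> x\<bar> + (\<Sum>\<alpha>\<in>S. \<bar>g' \<alpha> x\<bar>)\<bar> powr q) \<partial>lborel) \<le>
        ennreal (2 powr q) * ((\<integral>\<^sup>+x. ennreal (\<bar>\<bar>g' \<alpha> x\<bar>\<bar> powr q) \<partial>lborel) + (\<integral>\<^sup>+x. ennreal (\<bar>\<Sum>\<alpha>\<in>S. \<bar>g' \<alpha> x\<bar>\<bar> powr q) \<partial>lborel))"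
        using q IH(1) by (intro power_integral_add) auto
      also have "\<dots> < \<infinity>" using IH(2) g'(4)[OF \<alpha>] by (simp add: ennreal_mult_less_top less_top)
      finally show ?case using insert.hyps IH(1) by (simp add: less_top)
    qed simp
    then show ?thesis unfolding G_def by blast
  qed
  have a8: "0 < a / 8" using ab by simp
  obtain N where N': "\<forall>T>0. \<forall>x::real^'n. \<exists>X. finite X \<and> card X \<le> N \<and> ball x ((b + 1) * T) \<subseteq> (\<Union>c\<in>X. ball c ((a / 8) * T))"
    using covering_number[OF a8, where D = "b + 1" and 'n = 'n] by (elim exE)
  then have N: "\<exists>X. finite X \<and> card X \<le> N \<and> ball (x::real^'n) ((b + 1) * T) \<subseteq> (\<Union>c\<in>X. ball c ((a / 8) * T))" if "0 < T" for T x
    using that by simp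
  obtain B where B: "\<And>(\<beta>::'n \<Rightarrow> nat) z. mi_order \<beta> \<le> k \<Longrightarrow> \<bar>tensor_bump \<beta> z\<bar> \<le> B"
    using tensor_bump_bounded[where ?'n = 'n, of k] by blast
  define C where "C = patch_constant TYPE('n) a b k N B"
  \<comment> \<open>The error in the strip is at most this multiple of the power integral of \<open>G\<close> over the wider
    strip.\<close>
  define E where "E = 2 powr q * (1 + \<bar>C\<bar> powr q)"
  have E: "0 < E" unfolding E_def by (intro mult_pos_pos add_pos_nonneg) simp_all
  obtain s0 where s0: "0 < s0" "(\<integral>\<^sup>+x\<in>{x. d x < s0}. ennreal (\<bar>G x\<bar> powr q) \<partial>lborel) < ennreal (e / (2 * E))"
    using small_power_integral_near_boundary[OF _ Goff Gfin, of "e / (2 * E)"] e E by auto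
  define s where "s = s0 / 3"
  have s: "0 < s" "3 * s = s0" using s0 by (simp_all add: s_def)
  obtain T0 where T0: "0 < T0" "\<And>T. 0 < T \<Longrightarrow> T < T0 \<Longrightarrow> \<exists>Z. gate_system a b s T Z"
    using gates[OF s(1)] by blast
  have "\<exists>\<rho>0>0. \<forall>\<rho>. 0 < \<rho> \<and> \<rho> < \<rho>0 \<longrightarrow>
      (\<forall>\<alpha>\<in>?A. (\<integral>\<^sup>+x. ennreal (\<bar>g' \<alpha> x - (\<integral>y. g' \<alpha> y * mollifier \<rho> (x - y) \<partial>lborel)\<bar> powr q) \<partial>lborel) < ennreal (e / 2))"
  proof -
    have "\<forall>\<alpha>\<in>?A. \<exists>r>0. \<forall>\<rho>. 0 < \<rho> \<and> \<rho> < r \<longrightarrow>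
      (\<integral>\<^sup>+x. ennreal (\<bar>g' \<alpha> x - (\<integral>y. g' \<alpha> y * mollifier \<rho> (x - y) \<partial>lborel)\<bar> powr q) \<partial>lborel) < ennreal (e / 2)"
      using mollify_Lp[OF q g'(5) g'(4), of _ "e / 2"] e by simp
    then obtain r where r: "\<forall>\<alpha>\<in>?A. 0 < r \<alpha> \<and> (\<forall>\<rho>. 0 < \<rho> \<and> \<rho> < r \<alpha> \<longrightarrow>
      (\<integral>\<^sup>+x. ennreal (\<bar>g' \<alpha> x - (\<integral>y. g' \<alpha> y * mollifier \<rho> (x - y) \<partial>lborel)\<bar> powr q) \<partial>lborel) < ennreal (e / 2))"
      unfolding bchoice_iff by blast
    define r0 where "r0 = Min (insert 1 (r ` ?A))"
    have r0: "0 < r0" unfolding r0_def using fin r by (subst Min_gr_iff) auto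
    have r0': "r0 \<le> r \<alpha>" if "\<alpha> \<in> ?A" for \<alpha>
      unfolding r0_def using fin that by (intro Min_le) auto
    show ?thesis
    proof (intro exI[of _ r0] conjI allI impI ballI)
      fix \<rho> \<alpha> assume "0 < \<rho> \<and> \<rho> < r0" "\<alpha> \<in> ?A"
      then show "(\<integral>\<^sup>+x. ennreal (\<bar>g' \<alpha> x - (\<integral>y. g' \<alpha> y * mollifier \<rho> (x - y) \<partial>lborel)\<bar> powr q) \<partial>lborel) < ennreal (e / 2)"
        using r r0'[of \<alpha>] by force
    qed (rule r0)
  qed
  then obtain \<rho>0 where \<rho>0: "0 < \<rho>0" "\<And>\<rho> \<alpha>. 0 < \<rho> \<Longrightarrow> \<rho> < \<rho>0 \<Longrightarrow> mi_order \<alpha> = k \<Longrightarrow>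
      (\<integral>\<^sup>+x. ennreal (\<bar>g' \<alpha> x - (\<integral>y. g' \<alpha> y * mollifier \<rho> (x - y) \<partial>lborel)\<bar> powr q) \<partial>lborel) < ennreal (e / 2)"
    by blast
  define T where "T = min (T0 / 2) (min (s / (b + 3)) \<rho>0)"
  have TT: "0 < T" "T < T0" "T \<le> s / (b + 3)" "T \<le> \<rho>0" using T0 s \<rho>0(1) ab by (auto simp: T_def)
  then have bT: "(b + 3) * T \<le> s" using ab by (simp add: field_simps)
  have "0 \<le> (b + 2) * T" using ab TT(1) by simp
  then have Ts: "T \<le> s" using bT by (simp add: distrib_right)
  obtain Z where Z: "gate_system a b s T Z" using T0(2) TT by blast
  define K where "K = {x \<in> \<Omega>. a * T / 8 \<le> d x}"
  have K: "compact K" "K \<subseteq> \<Omega>" unfolding K_def using compact_inner[of "a * T / 8"] ab TT(1) by simp_all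
  obtain f where fu: "f \<in> borel_measurable borel" "integrable lborel f" "AE y in lebesgue. y \<in> K \<longrightarrow> f y = u y"
    using integrable_borel_version[OF u K] by blast
  interpret patching \<Omega> a b s T k Z f
    using ab TT(1) Z fu(2) by unfold_locales
  have rep: "U \<gamma> w = (\<integral>y. g' \<gamma> y * mollifier moll_radius (w - y) \<partial>lborel)"
    if \<gamma>: "mi_order \<gamma> = k" and w: "w \<in> \<Omega>" "a * T / 4 < d w" for \<gamma> w
  proof (rule mollify_weak_deriv[OF open_dom weak[OF \<gamma>] K fu(1,3) g'(1)[OF \<gamma>] _ moll_radius_pos])
    show "AE y in lebesgue. y \<in> K \<longrightarrow> g' \<gamma> y = g \<gamma> y"
      using g'(3)[OF \<gamma>] by eventually_elim (use K(2) in auto)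
    show "cball w (real CARD('n) * moll_radius) \<subseteq> K"
      unfolding K_def moll_support by (rule cball_inner[OF w(1)]) (use w(2) ab TT(1) in \<open>simp_all add: mult.commute\<close>)
  qed
  have "moll_radius \<le> a * T / 8" using moll_support card_ge_1 moll_radius_pos
    by (metis mult_right_mono mult_1 less_imp_le)
  also have "\<dots> < T" using ab T mult_right_mono[of a 1 T] by simp
  finally have rad: "moll_radius < \<rho>0" using TT(4) by simp
  define h where "h x = (\<integral>y. (\<bar>C\<bar> * G y) * average_kernel ((b + 3) * T) (x - y) \<partial>lborel)" for x
  have h_meas [measurable]: "h \<in> borel_measurable borel" unfolding h_def[abs_def] by measurable
  have pd_le: "\<bar>pd_list xs patched x\<bar> \<le> \<bar>h x\<bar>" if x: "x \<in> \<Omega>" and xs: "length xs = k" for x xs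
  proof -
    define I where "I = (\<integral>y. G y * average_kernel ((b + 3) * T) (x - y) \<partial>lborel)"
    have "\<bar>pd_list xs patched x\<bar> \<le> C * I"
      unfolding C_def I_def by (rule pd_patched_le_average[OF B N[OF TT(1)] rep Gint gG G0 x xs])
    also have "\<dots> \<le> \<bar>\<bar>C\<bar> * I\<bar>" by (simp add: abs_mult[symmetric])
    also have "\<bar>C\<bar> * I = h x" unfolding h_def I_def by (simp add: mult.assoc)
    finally show ?thesis .
  qed
  have hb: "(\<integral>\<^sup>+x\<in>{x. d x < 2 * s}. ennreal (\<bar>h x\<bar> powr q) \<partial>lborel) \<le>
    ennreal (\<bar>C\<bar> powr q) * (\<integral>\<^sup>+x\<in>{x. d x < s0}. ennreal (\<bar>G x\<bar> powr q) \<partial>lborel)"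
  proof -
    have "(\<integral>\<^sup>+x\<in>{x. d x < 2 * s}. ennreal (\<bar>h x\<bar> powr q) \<partial>lborel) \<le>
      (\<integral>\<^sup>+x\<in>{x. d x < s0}. ennreal (\<bar>\<bar>C\<bar> * G x\<bar> powr q) \<partial>lborel)"
      unfolding h_def
    proof (rule convolution_power_bound[OF q _ average_kernel_measurable average_kernel_nonneg average_kernel_mass])
      show "integrable lborel (\<lambda>y. \<bar>C\<bar> * G y * average_kernel ((b + 3) * T) (x - y))" for x
        by (intro integrable_times_average_kernel integrable_mult_right Gint)
      fix x y :: "real^'n"
      assume x: "x \<in> {x. d x < 2 * s}" and "average_kernel ((b + 3) * T) (x - y) \<noteq> 0"
      then have "norm (x - y) < (b + 3) * T" by (auto simp: average_kernel_def indicator_def split: if_splits)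
      then have "dist y x < s" using bT by (simp add: dist_norm norm_minus_commute)
      then show "y \<in> {x. d x < s0}" using x d_lipschitz[of y x] s(2) by simp
    qed measurable
    also have "\<dots> = (\<integral>\<^sup>+x. ennreal (\<bar>C\<bar> powr q) * (ennreal (\<bar>G x\<bar> powr q) * indicator {x. d x < s0} x) \<partial>lborel)"
      by (intro nn_integral_cong) (simp add: abs_mult powr_mult ennreal_mult mult.assoc)
    also have "\<dots> = ennreal (\<bar>C\<bar> powr q) * (\<integral>\<^sup>+x\<in>{x. d x < s0}. ennreal (\<bar>G x\<bar> powr q) \<partial>lborel)"
      by (rule nn_integral_cmult) measurable
    finally show ?thesis .
  qed
  have main: "(\<integral>\<^sup>+x\<in>\<Omega>. ennreal (\<bar>g' \<alpha> x - pd_list (rev (mi_list \<alpha>)) patched x\<bar> powr q) \<partial>lborel) < ennreal e"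
    if \<alpha>: "mi_order \<alpha> = k" for \<alpha>
  proof -
    have [measurable]: "g' \<alpha> \<in> borel_measurable borel" using g'(1) \<alpha> by simp
    have arith: "ennreal x * (ennreal y + ennreal z * ennreal y) = ennreal (x * (y + z * y))" if "0 \<le> x" "0 \<le> y" "0 \<le> z" for x y z
      using that by (simp add: ennreal_mult)
    let ?m = "\<lambda>x. ennreal (\<bar>g' \<alpha> x - (\<integral>y. g' \<alpha> y * mollifier moll_radius (x - y) \<partial>lborel)\<bar> powr q)"
    let ?c = "\<lambda>x. ennreal (2 powr q) * (ennreal (\<bar>G x\<bar> powr q) * indicator {x. d x < s0} x + ennreal (\<bar>h x\<bar> powr q) * indicator {x. d x < 2 * s} x)"
    have "(\<integral>\<^sup>+x\<in>\<Omega>. ennreal (\<bar>g' \<alpha> x - pd_list (rev (mi_list \<alpha>)) patched x\<bar> powr q) \<partial>lborel) \<le> (\<integral>\<^sup>+x. ?m x + ?c x \<partial>lborel)"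
    proof (rule nn_integral_mono)
      fix x
      show "ennreal (\<bar>g' \<alpha> x - pd_list (rev (mi_list \<alpha>)) patched x\<bar> powr q) * indicator \<Omega> x \<le> ?m x + ?c x"
      proof (cases "x \<in> \<Omega>")
        case x: True
        show ?thesis
        proof (cases "d x < 2 * s")
          case True
          have "\<bar>g' \<alpha> x + - pd_list (rev (mi_list \<alpha>)) patched x\<bar> powr q \<le>
            2 powr q * (\<bar>g' \<alpha> x\<bar> powr q + \<bar>- pd_list (rev (mi_list \<alpha>)) patched x\<bar> powr q)"
            using q by (intro powr_add_le) simp
          also have "\<dots> \<le> 2 powr q * (\<bar>G x\<bar> powr q + \<bar>h x\<bar> powr q)"
            using q gG[OF \<alpha>, of x] G0[of x] pd_le[OF x, of "rev (mi_list \<alpha>)"] \<alpha> rev_mi_list(2)[of \<alpha>]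
            by (intro mult_left_mono add_mono powr_mono2) auto
          finally have "ennreal (\<bar>g' \<alpha> x - pd_list (rev (mi_list \<alpha>)) patched x\<bar> powr q) \<le>
            ennreal (2 powr q) * (ennreal (\<bar>G x\<bar> powr q) + ennreal (\<bar>h x\<bar> powr q))"
            by (simp add: ennreal_mult[symmetric] ennreal_plus[symmetric] del: ennreal_plus)
          then show ?thesis using x True s by (simp add: add_increasing)
        next
          case False
          have "a * T / 4 < T" using ab T mult_right_mono[of a 1 T] by simp
          then have "a * T / 4 < d x" "s + T / 4 \<le> d x" using False Ts TT(1) s(1) by linarith+
          then have "pd_list (rev (mi_list \<alpha>)) patched x = (\<integral>y. g' \<alpha> y * mollifier moll_radius (x - y) \<partial>lborel)"
            using patched_interior[OF x] rep[OF \<alpha> x] by (simp add: rev_mi_list)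
          then show ?thesis using x by (simp add: add_increasing2)
        qed
      qed simp
    qed
    also have "\<dots> = (\<integral>\<^sup>+x. ?m x \<partial>lborel) + (\<integral>\<^sup>+x. ?c x \<partial>lborel)"
      by (rule nn_integral_add) measurable
    also have "(\<integral>\<^sup>+x. ?c x \<partial>lborel) = ennreal (2 powr q) *
      ((\<integral>\<^sup>+x\<in>{x. d x < s0}. ennreal (\<bar>G x\<bar> powr q) \<partial>lborel) + (\<integral>\<^sup>+x\<in>{x. d x < 2 * s}. ennreal (\<bar>h x\<bar> powr q) \<partial>lborel))"
      by (subst nn_integral_cmult, measurable, subst nn_integral_add, measurable)
    also have "\<dots> \<le> ennreal (2 powr q) * (ennreal (e / (2 * E)) + ennreal (\<bar>C\<bar> powr q) * ennreal (e / (2 * E)))"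
      using order_trans[OF hb mult_left_mono[OF less_imp_le[OF s0(2)]]] s0(2) by (intro mult_left_mono add_mono) auto
    also have "\<dots> = ennreal (2 powr q * (e / (2 * E) + \<bar>C\<bar> powr q * (e / (2 * E))))"
      by (rule arith) (use e E in simp_all)
    also have "2 powr q * (e / (2 * E) + \<bar>C\<bar> powr q * (e / (2 * E))) = E * (e / (2 * E))"
      unfolding E_def by (simp add: algebra_simps add_divide_distrib)
    also have "\<dots> = e / 2" using E by simp
    finally have "(\<integral>\<^sup>+x\<in>\<Omega>. ennreal (\<bar>g' \<alpha> x - pd_list (rev (mi_list \<alpha>)) patched x\<bar> powr q) \<partial>lborel) \<le>
      (\<integral>\<^sup>+x. ?m x \<partial>lborel) + ennreal (e / 2)" by (simp add: add_left_mono)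
    also have "\<dots> < ennreal (e / 2) + ennreal (e / 2)"
      using \<rho>0(2)[OF moll_radius_pos rad \<alpha>] by (subst add.commute) (simp add: ennreal_add_left_cancel_less)
    also have "\<dots> = ennreal e" using e by (simp add: ennreal_plus[symmetric] del: ennreal_plus)
    finally show ?thesis .
  qed
  show ?thesis using smooth_patched patched_bounded main by blast
qed

end

context bounded_domain
begin

lemma bounded_derivatives_sobolev:
  assumes v: "v \<in> smooth_functions \<Omega>" and B: "\<And>x xs. x \<in> \<Omega> \<Longrightarrow> length xs \<le> k \<Longrightarrow> \<bar>pd_list xs v x\<bar> \<le> B"
  shows "v \<in> sobolev k \<infinity> \<Omega>"
proof -
  have "pd_list (rev (mi_list \<alpha>)) v \<in> Lp_space \<infinity> \<Omega>" if \<alpha>: "mi_order \<alpha> \<le> k" for \<alpha>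
  proof -
    have m: "pd_list (rev (mi_list \<alpha>)) v \<in> borel_measurable (lebesgue_on \<Omega>)"
      using open_dom by (intro continuous_imp_measurable_on_sets_lebesgue smooth_continuous_on smooth_pd_list v) auto
    have "esssup (lebesgue_on \<Omega>) (\<lambda>x. ennreal \<bar>pd_list (rev (mi_list \<alpha>)) v x\<bar>) \<le> ennreal B"
      using m B \<alpha> by (intro esssup_I AE_I2) (auto intro!: ennreal_leI simp: length_mi_list)
    then have "esssup (lebesgue_on \<Omega>) (\<lambda>x. ennreal \<bar>pd_list (rev (mi_list \<alpha>)) v x\<bar>) < \<infinity>"
      by (rule order.strict_trans1) simp
    then show ?thesis using m by (simp add: Lp_space_def Lp_norm_def)
  qed
  then show ?thesis unfolding sobolev_def
    using smooth_has_weak_deriv[OF open_dom v] L1_loc_continuous[OF smooth_continuous_on[OF v]] by blast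
qed

lemma Linfty_subset_Lp:
  assumes p: "p < \<infinity>" and g: "g \<in> Lp_space \<infinity> \<Omega>"
  shows "g \<in> Lp_space p \<Omega>"
proof -
  have gm: "g \<in> borel_measurable (lebesgue_on \<Omega>)" and "esssup (lebesgue_on \<Omega>) (\<lambda>x. ennreal \<bar>g x\<bar>) < \<infinity>"
    using g by (simp_all add: Lp_space_def Lp_norm_def)
  then obtain M where M: "0 \<le> M" "esssup (lebesgue_on \<Omega>) (\<lambda>x. ennreal \<bar>g x\<bar>) = ennreal M"
    by (cases "esssup (lebesgue_on \<Omega>) (\<lambda>x. ennreal \<bar>g x\<bar>)") auto
  have "AE x in lebesgue_on \<Omega>. ennreal \<bar>g x\<bar> \<le> ennreal M"
    unfolding M(2)[symmetric] by (rule esssup_AE)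
  then have "AE x in lebesgue_on \<Omega>. ennreal (\<bar>g x\<bar> powr enn2real p) \<le> ennreal (M powr enn2real p)"
    by eventually_elim (use M(1) in \<open>auto intro!: ennreal_leI powr_mono2\<close>)
  then have "(\<integral>\<^sup>+x. ennreal (\<bar>g x\<bar> powr enn2real p) \<partial>lebesgue_on \<Omega>) \<le> (\<integral>\<^sup>+x. ennreal (M powr enn2real p) \<partial>lebesgue_on \<Omega>)"
    by (rule nn_integral_mono_AE)
  also have "\<dots> = ennreal (M powr enn2real p) * emeasure lborel \<Omega>"
    using open_dom by (simp add: emeasure_restrict_space)
  also have "\<dots> < \<infinity>" using emeasure_bounded_finite[OF bdd] by (simp add: ennreal_mult_less_top less_top)
  finally show ?thesis using gm p by (auto simp: Lp_space_def Lp_norm_def Let_def)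
qed

lemma sobolev_infinity_subset:
  assumes "p < \<infinity>" shows "sobolev k \<infinity> \<Omega> \<subseteq> hom_sobolev k p \<Omega>"
  using Linfty_subset_Lp[OF assms] by (fastforce simp: sobolev_def hom_sobolev_def)

lemma dense_of_gate_systems:
  assumes p: "1 \<le> p" "p < \<infinity>" and ab: "0 < a" "a \<le> 1" "0 < b"
    and gates: "\<And>s. 0 < s \<Longrightarrow> \<exists>T0>0. \<forall>T. 0 < T \<and> T < T0 \<longrightarrow> (\<exists>Z. gate_system a b s T Z)"
  shows "dense_wrt_seminorm (hom_sobolev_seminorm k p \<Omega>) (smooth_functions \<Omega> \<inter> sobolev k \<infinity> \<Omega>) (hom_sobolev k p \<Omega>)"
  unfolding dense_wrt_seminorm_def
proof (intro conjI ballI allI impI)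
  show "smooth_functions \<Omega> \<inter> sobolev k \<infinity> \<Omega> \<subseteq> hom_sobolev k p \<Omega>"
    using sobolev_infinity_subset[OF p(2)] by blast
  fix u and \<epsilon> :: real
  assume u: "u \<in> hom_sobolev k p \<Omega>" and \<epsilon>: "0 < \<epsilon>"
  define q where "q = enn2real p"
  have q: "1 \<le> q" using p enn2real_mono[of 1 p] by (simp add: q_def)
  let ?A = "{\<alpha>::'n \<Rightarrow> nat. mi_order \<alpha> = k}"
  have fin: "finite ?A" by (rule finite_subset[OF _ finite_mi_order_le[of k]]) auto
  define \<delta> where "\<delta> = \<epsilon> / (real (card ?A) + 1)"
  have \<delta>: "0 < \<delta>" using \<epsilon> by (simp add: \<delta>_def)
  have u1: "u \<in> L1_loc \<Omega>" and ex: "\<forall>\<alpha>\<in>?A. \<exists>g. g \<in> Lp_space p \<Omega> \<and> has_weak_deriv \<Omega> \<alpha> u g"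
    using u by (auto simp: hom_sobolev_def)
  obtain g where "\<forall>\<alpha>\<in>?A. g \<alpha> \<in> Lp_space p \<Omega> \<and> has_weak_deriv \<Omega> \<alpha> u (g \<alpha>)"
    using bchoice[OF ex] ..
  then have g: "\<And>\<alpha>. mi_order \<alpha> = k \<Longrightarrow> g \<alpha> \<in> Lp_space p \<Omega>" "\<And>\<alpha>. mi_order \<alpha> = k \<Longrightarrow> has_weak_deriv \<Omega> \<alpha> u (g \<alpha>)"
    by simp_all
  have ex': "\<forall>\<alpha>\<in>?A. \<exists>g'. g' \<in> borel_measurable borel \<and> (\<forall>y. y \<notin> \<Omega> \<longrightarrow> g' y = 0) \<and> (AE y in lebesgue. y \<in> \<Omega> \<longrightarrow> g' y = g \<alpha> y) \<and>
    (\<integral>\<^sup>+x. ennreal (\<bar>g' x\<bar> powr q) \<partial>lborel) < \<infinity> \<and> integrable lborel g'"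
  proof
    fix \<alpha> assume "\<alpha> \<in> ?A"
    then have g\<alpha>: "g \<alpha> \<in> Lp_space p \<Omega>" using g(1) by simp
    show "\<exists>g'. g' \<in> borel_measurable borel \<and> (\<forall>y. y \<notin> \<Omega> \<longrightarrow> g' y = 0) \<and> (AE y in lebesgue. y \<in> \<Omega> \<longrightarrow> g' y = g \<alpha> y) \<and>
      (\<integral>\<^sup>+x. ennreal (\<bar>g' x\<bar> powr q) \<partial>lborel) < \<infinity> \<and> integrable lborel g'"
      by (rule Lp_borel_version[OF p g\<alpha>]) (intro exI conjI allI impI, assumption+, unfold q_def)
  qed
  obtain g' where g': "\<forall>\<alpha>\<in>?A. g' \<alpha> \<in> borel_measurable borel \<and> (\<forall>y. y \<notin> \<Omega> \<longrightarrow> g' \<alpha> y = 0) \<and> (AE y in lebesgue. y \<in> \<Omega> \<longrightarrow> g' \<alpha> y = g \<alpha> y) \<and>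
    (\<integral>\<^sup>+x. ennreal (\<bar>g' \<alpha> x\<bar> powr q) \<partial>lborel) < \<infinity> \<and> integrable lborel (g' \<alpha>)"
    using bchoice[OF ex'] ..
  have "0 < \<delta> powr q" using \<delta> by simp
  from smooth_approximation[OF ab gates q g(2) _ _ _ _ _ u1 this, where g' = g']
  obtain v B where v: "v \<in> smooth_functions \<Omega>" and B: "\<forall>x\<in>\<Omega>. \<forall>xs. length xs \<le> k \<longrightarrow> \<bar>pd_list xs v x\<bar> \<le> B"
    and close: "\<And>\<alpha>. mi_order \<alpha> = k \<Longrightarrow> (\<integral>\<^sup>+x\<in>\<Omega>. ennreal (\<bar>g' \<alpha> x - pd_list (rev (mi_list \<alpha>)) v x\<bar> powr q) \<partial>lborel) < ennreal (\<delta> powr q)"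
    using g' by blast
  have "Lp_norm p \<Omega> (\<lambda>x. g \<alpha> x - pd_list (rev (mi_list \<alpha>)) v x) \<le> ennreal \<delta>" if \<alpha>: "\<alpha> \<in> ?A" for \<alpha>
  proof (rule less_imp_le, rule Lp_norm_less[OF p \<delta>])
    have "AE y in lebesgue. y \<in> \<Omega> \<longrightarrow> g' \<alpha> y = g \<alpha> y" using g' \<alpha> by blast
    then have ae: "AE y in lebesgue. y \<in> \<Omega> \<longrightarrow> g' \<alpha> y - pd_list (rev (mi_list \<alpha>)) v y = g \<alpha> y - pd_list (rev (mi_list \<alpha>)) v y"
      by eventually_elim simp
    show "(\<integral>\<^sup>+x. ennreal (\<bar>g \<alpha> x - pd_list (rev (mi_list \<alpha>)) v x\<bar> powr enn2real p) \<partial>lebesgue_on \<Omega>) < ennreal (\<delta> powr enn2real p)"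
      using nn_integral_lebesgue_on[OF open_dom ae, of q] close[of \<alpha>] \<alpha> by (simp add: q_def)
  qed
  then have "(\<Sum>\<alpha>\<in>?A. Lp_norm p \<Omega> (\<lambda>x. g \<alpha> x - pd_list (rev (mi_list \<alpha>)) v x)) \<le> (\<Sum>\<alpha>\<in>?A. ennreal \<delta>)"
    by (rule sum_mono)
  also have "\<dots> = ennreal (real (card ?A) * \<delta>)"
    using \<delta> by (simp add: ennreal_mult ennreal_of_nat_eq_real_of_nat)
  also have "\<dots> < ennreal \<epsilon>"
    using \<epsilon> by (intro ennreal_lessI) (simp_all add: \<delta>_def field_simps)
  also have "(\<Sum>\<alpha>\<in>?A. Lp_norm p \<Omega> (\<lambda>x. g \<alpha> x - pd_list (rev (mi_list \<alpha>)) v x)) = hom_sobolev_seminorm k p \<Omega> (\<lambda>x. u x - v x)"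
    by (rule seminorm_eq[symmetric, OF p(2) has_weak_deriv_diff[OF open_dom g(2) smooth_has_weak_deriv[OF open_dom v]]])
  finally have "hom_sobolev_seminorm k p \<Omega> (\<lambda>x. u x - v x) < ennreal \<epsilon>" .
  moreover have "v \<in> sobolev k \<infinity> \<Omega>" by (rule bounded_derivatives_sobolev[OF v, where B = B]) (use B in blast)
  ultimately show "\<exists>v\<in>smooth_functions \<Omega> \<inter> sobolev k \<infinity> \<Omega>. hom_sobolev_seminorm k p \<Omega> (\<lambda>x. u x - v x) < ennreal \<epsilon>"
    using v by blast
qed

end

theorem theorem4p1:
  fixes c0 c :: real
  assumes "c0 \<ge> 1" and "c \<ge> 1"
  shows "\<exists>R0\<ge>0. \<forall>(k::nat) (p::ennreal) (\<Omega>::(real^'n) set) (R::real).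
    k \<ge> 1 \<longrightarrow> 1 \<le> p \<longrightarrow> p < \<infinity> \<longrightarrow>
    domain_set \<Omega> \<longrightarrow> bounded \<Omega> \<longrightarrow> ball_separation c0 \<Omega> \<longrightarrow>
    R \<ge> R0 \<longrightarrow> radially_hyperbolic c0 c R \<Omega> \<longrightarrow>
    dense_wrt_seminorm (hom_sobolev_seminorm k p \<Omega>)
      (smooth_functions \<Omega> \<inter> sobolev k \<infinity> \<Omega>) (hom_sobolev k p \<Omega>)"
proof (intro exI[of _ "ln (1 + (4 * (c0 + 1)^2 + 2 * c0))"] conjI allI impI)
  show "0 \<le> ln (1 + (4 * (c0 + 1)^2 + 2 * c0))" using assms by (intro ln_ge_zero) simp
next
  fix k :: nat and p :: ennreal and \<Omega> :: "(real^'n) set" and R :: real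
  assume p: "1 \<le> p" "p < \<infinity>" and \<Omega>: "domain_set \<Omega>" "bounded \<Omega>" "ball_separation c0 \<Omega>"
    and R: "ln (1 + (4 * (c0 + 1)^2 + 2 * c0)) \<le> R" and "radially_hyperbolic c0 c R \<Omega>"
  then obtain x0 where x0: "x0 \<in> \<Omega>" "\<forall>x\<in>\<Omega>. x \<noteq> x0 \<longrightarrow> (\<forall>\<gamma>x. qh_geodesic \<Omega> x0 x \<gamma>x \<longrightarrow>
       diam_GH c R \<Omega> (path_image \<gamma>x) \<and>
       (\<forall>y\<in>\<Omega>. \<forall>\<gamma>y. y \<noteq> x0 \<and> qh_geodesic \<Omega> x0 y \<gamma>y \<and>
            (path_image \<gamma>x \<inter> path_image \<gamma>y) - {x0} \<noteq> {} \<longrightarrow>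
          length_GH c R \<Omega> (path_image \<gamma>x \<union> path_image \<gamma>y) \<or>
          diam_GH c R \<Omega> (path_image \<gamma>x \<union> path_image \<gamma>y)))"
    unfolding radially_hyperbolic_def by (elim conjE bexE)
  interpret radial_domain \<Omega> c0 c R x0
  proof unfold_locales
    fix x y \<gamma>x \<gamma>y
    assume "x \<in> \<Omega>" "x \<noteq> x0" "qh_geodesic \<Omega> x0 x \<gamma>x" "y \<in> \<Omega>" "y \<noteq> x0" "qh_geodesic \<Omega> x0 y \<gamma>y"
      "(path_image \<gamma>x \<inter> path_image \<gamma>y) - {x0} \<noteq> {}"
    then show "length_GH c R \<Omega> (path_image \<gamma>x \<union> path_image \<gamma>y) \<or> diam_GH c R \<Omega> (path_image \<gamma>x \<union> path_image \<gamma>y)"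
      using x0(2) by blast
  qed (use assms \<Omega> R x0(1) in simp_all)
  show "dense_wrt_seminorm (hom_sobolev_seminorm k p \<Omega>) (smooth_functions \<Omega> \<inter> sobolev k \<infinity> \<Omega>) (hom_sobolev k p \<Omega>)"
    using ex_gate_system dense_of_gate_systems[OF p] by blast
qed



end
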